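(* Let $G$ be a finite nilpotent group and $\mathbb{F}$ a finite field of order $q^m$ ($q$ prime, $m\ge 1$) such that $\mathbb{F}G$ is semisimple. For every primitive central idempotent $e_C=e_C(G,H,K)$ of $\mathbb{F}G$, with $(H,K)$ a strong Shoda pair of $G$ and $C\in\mathcal{C}(H/K)$, set $E=E_G(H/K)$ and let $T_{e_C}\subseteq G$ and $\beta_{e_C}\in\mathbb{F}G$ be as constructed in the context. For every $t,t'\in T_{e_C}$, let $$E_{tt'}=t^{-1}\beta_{e_C}t'.$$ Then $\{E_{tt'} : t,t'\in T_{e_C}\}$ is a complete set of matrix units in $\mathbb{F}Ge_C$, i.e. $e_C=\sum_{t\in T_{e_C}}E_{tt}$ and $E_{t_1t_2}E_{t_3t_4}=\delta_{t_2t_3}E_{t_1t_4}$ for every $t_1,t_2,t_3,t_4\in T_{e_C}$. Moreover, $E_{tt}\,\mathbb{F}G\,E_{tt}\simeq\mathbb{F}_{q^{mo/[E:H]}}$ for every $t\in T_{e_C}$, where $o$ is the multiplicative order of $q^m$ modulo $[H:K]$.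
   Context: Conventions. $\mathbb{F}$ is a finite field of characteristic $q$ with $q^m$ elements, $\overline{\mathbb{F}}$ is a fixed algebraic closure, $G$ is a finite group, and $\mathbb{F}G$ semisimple means $q\nmid |G|$. For $g,h\in G$ and $\alpha\in\mathbb{F}G$ (or $\mathbb{Q}G$) put $h^g=g^{-1}hg$, $H^g=g^{-1}Hg$, $\alpha^g=g^{-1}\alpha g$. For a subgroup $M\le G$, $\widetilde{M}=|M|^{-1}\sum_{h\in M}h$, and $\widetilde{g}=\widetilde{\langle g\rangle}$. $N_G(\cdot)$ denotes the normalizer in $G$. $\delta$ is the Kronecker delta. Strong Shoda pairs. For $K\unlhd H\le G$ define $\varepsilon(H,K)\in\mathbb{Q}G$ by $\varepsilon(H,H)=\widetilde{H}$ and, if $H\ne K$, $\varepsilon(H,K)=\prod_{M/K}(\widetilde{K}-\widetilde{M})$, where $M/K$ runs over the minimal non-trivial normal subgroups of $H/K$. A strong Shoda pair of $G$ is a pair $(H,K)$ of subgroups of $G$ such that: (SS1) $K\le H\unlhd N_G(K)$; (SS2) $H/K$ is cyclic and a maximal abelian subgroup of $N_G(K)/K$; (SS3) for every $g\in G\setminus N_G(K)$, $\varepsilon(H,K)\varepsilon(H,K)^g=0$ in $\mathbb{Q}G$. Cyclotomic classes. Let $K\unlhd H\le G$ with $H/K$ cyclic of order $k$. $\mathcal{C}(H/K)$ is the set of $q^m$-cyclotomic classes of faithful linear characters $\chi:H/K\to\overline{\mathbb{F}}^{\times}$, i.e. the orbits of such characters under $\chi\mapsto\chi^{q^m}$. For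 $C\in\mathcal{C}(H/K)$ and any $\chi\in C$ (the choice does not matter), set $$\varepsilon_C(H,K)=|H|^{-1}\sum_{h\in H}\mathrm{tr}(\chi(hK))\,h^{-1}\in\mathbb{F}G,$$ where $\mathrm{tr}$ is the field trace of $\mathbb{F}(\xi_k)/\mathbb{F}$, with $\xi_k\in\overline{\mathbb{F}}$ a primitive $k$-th root of unity. $e_C(G,H,K)$ denotes the sum of the different $G$-conjugates of $\varepsilon_C(H,K)$. The group $E_G(H/K)$. The group $N=N_G(H)\cap N_G(K)$ acts on linear characters of $H/K$ by $\chi^g(h^gK)=\chi(hK)$, and hence acts on $\mathcal{C}(H/K)$. The stabilizer in $N$ of a class in $\mathcal{C}(H/K)$ does not depend on the class; it is denoted $E_G(H/K)$. Construction of $T_{e_C}$ and $\beta_{e_C}$. Let $G$ be nilpotent, $(H,K)$ a strong Shoda pair of $G$, $C\in\mathcal{C}(H/K)$, $\varepsilon_C=\varepsilon_C(H,K)$, $E=E_G(H/K)$. A bar denotes the image in $E/K$ of an element of $E$. Let $E_2/K$ and $H_2/K=\langle\overline{a_2}\rangle$ be the $2$-parts (Sylow $2$-subgroups), and $E_{2'}/K$ and $H_{2'}/K=\langle\overline{a_{2'}}\rangle$ the $2'$-parts (Hall $2'$-subgroups), of the nilpotent groups $E/K$ and $H/K$, where $a_2\in H_2$, $a_{2'}\in H_{2'}$. The group $\langle\overline{a_{2'}}\rangle$ has a cyclic complement $\langle\overline{b_{2'}}\rangle$ in $E_{2'}/K$, with $b_{2'}\in E_{2'}$. Set $$\beta_{e_C}=\widetilde{b_{2'}}\,\beta_2\,\varepsilon_C,\qquad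 T_{e_C}=T_{2'}T_2T_E,$$ where $T_{2'}=\{1,a_{2'},\dots,a_{2'}^{[E_{2'}:H_{2'}]-1}\}$, $T_E$ is a right transversal of $E$ in $G$ (one element from each right coset $Eg$), and $\beta_2,T_2$ are as follows, with $2^n$ the order of $\overline{a_2}$ and $k\ge 0$, $r$ integers. (1) If $H_2/K$ has a complement $M_2/K$ in $E_2/K$, then $\beta_2=\widetilde{M_2}$. If $M_2/K$ is cyclic, there is $b_2\in E_2$ such that $E_2/K$ has the presentation $\langle \overline{a_2},\overline{b_2}\mid \overline{a_2}^{\,2^n}=\overline{b_2}^{\,2^k}=1,\ \overline{a_2}^{\,\overline{b_2}}=\overline{a_2}^{\,r}\rangle$; if $M_2/K$ is not cyclic, there are $b_2,c_2\in E_2$ such that $E_2/K$ has the presentation $\langle \overline{a_2},\overline{b_2},\overline{c_2}\mid \overline{a_2}^{\,2^n}=\overline{b_2}^{\,2^k}=\overline{c_2}^{\,2}=1,\ \overline{a_2}^{\,\overline{b_2}}=\overline{a_2}^{\,r},\ \overline{a_2}^{\,\overline{c_2}}=\overline{a_2}^{\,-1},\ [\overline{b_2},\overline{c_2}]=1\rangle$ with $r\equiv 1\bmod 4$. Then: (i) $T_2=\{1,a_2,\dots,a_2^{2^k-1}\}$ if $M_2/K$ is cyclic and either $n\le 1$ or $\overline{a_2}^{\,2^{n-2}}$ is central in $E_2/K$; (ii) $T_2=\{1,a_2,\dots,a_2^{d/2-1},a_2^{2^{n-2}},a_2^{2^{n-2}+1},\dots,a_2^{2^{n-2}+d/2-1}\}$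 with $d=[E_2:H_2]$, otherwise. (2) If $H_2/K$ has no complement in $E_2/K$, there are $b_2,c_2\in E_2$ such that $E_2/K$ has the presentation $\langle \overline{a_2},\overline{b_2},\overline{c_2}\mid \overline{a_2}^{\,2^n}=\overline{b_2}^{\,2^k}=1,\ \overline{c_2}^{\,2}=\overline{a_2}^{\,2^{n-1}},\ \overline{a_2}^{\,\overline{b_2}}=\overline{a_2}^{\,r},\ \overline{a_2}^{\,\overline{c_2}}=\overline{a_2}^{\,-1},\ [\overline{b_2},\overline{c_2}]=1\rangle$ with $r\equiv 1\bmod 4$. Then $\beta_2=\widetilde{b_2}\,\frac{1+x a_2^{2^{n-2}}+y a_2^{2^{n-2}}c_2}{2}$ and $T_2=\{1,a_2,\dots,a_2^{2^k-1},c_2,c_2a_2,\dots,c_2a_2^{2^k-1}\}$, where $x,y\in\mathbb{F}$ satisfy $x^2+y^2=-1$ and $y\ne 0$. *)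

theory Defs
  imports "HOL-Algebra.Algebra" "HOL-Algebra.Algebraic_Closure_Type" "HOL-Number_Theory.Number_Theory"
    "HOL-Library.Cardinality"
begin

section \<open>Groups\<close>

text \<open>Conventions: \<open>g\<^sup>h = h\<^sup>-\<^sup>1 g h\<close> and \<open>[g, h] = g\<^sup>-\<^sup>1 h\<^sup>-\<^sup>1 g h\<close>.\<close>

definition quot :: "('a, 'b) monoid_scheme \<Rightarrow> 'a set \<Rightarrow> 'a set \<Rightarrow> 'a set monoid" where
  "quot G A K = (G\<lparr>carrier := A\<rparr>) Mod K"

definition index :: "('a, 'b) monoid_scheme \<Rightarrow> 'a set \<Rightarrow> 'a set \<Rightarrow> nat" where
  "index G A B = card (rcosets\<^bsub>G\<lparr>carrier := A\<rparr>\<^esub> B)"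

primrec lower_central_series :: "('a, 'b) monoid_scheme \<Rightarrow> nat \<Rightarrow> 'a set" where
  "lower_central_series G 0 = carrier G"
| "lower_central_series G (Suc i) =
     generate G {inv\<^bsub>G\<^esub> x \<otimes>\<^bsub>G\<^esub> inv\<^bsub>G\<^esub> y \<otimes>\<^bsub>G\<^esub> x \<otimes>\<^bsub>G\<^esub> y | x y.
                   x \<in> lower_central_series G i \<and> y \<in> carrier G}"

definition nilpotent_group :: "('a, 'b) monoid_scheme \<Rightarrow> bool" where
  "nilpotent_group G \<longleftrightarrow> group G \<and> (\<exists>c. lower_central_series G c = {\<one>\<^bsub>G\<^esub>})"

definition group_center :: "('a, 'b) monoid_scheme \<Rightarrow> 'a set" where
  "group_center G = {z \<in> carrier G. \<forall>x \<in> carrier G. z \<otimes>\<^bsub>G\<^esub> x = x \<otimes>\<^bsub>G\<^esub> z}"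

definition minimal_normal :: "('a, 'b) monoid_scheme \<Rightarrow> 'a set \<Rightarrow> bool" where
  "minimal_normal G N \<longleftrightarrow> N \<lhd> G \<and> N \<noteq> {\<one>\<^bsub>G\<^esub>} \<and>
     (\<forall>N'. N' \<lhd> G \<and> N' \<noteq> {\<one>\<^bsub>G\<^esub>} \<and> N' \<subseteq> N \<longrightarrow> N' = N)"

definition maximal_abelian_subgroup :: "('a, 'b) monoid_scheme \<Rightarrow> 'a set \<Rightarrow> bool" where
  "maximal_abelian_subgroup G A \<longleftrightarrow> subgroup A G \<and> comm_group (G\<lparr>carrier := A\<rparr>) \<and>
     (\<forall>B. subgroup B G \<and> comm_group (G\<lparr>carrier := B\<rparr>) \<and> A \<subseteq> B \<longrightarrow> B = A)"

definition is_complement :: "('a, 'b) monoid_scheme \<Rightarrow> 'a set \<Rightarrow> 'a set \<Rightarrow> bool" where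
  "is_complement G A B \<longleftrightarrow> subgroup A G \<and> subgroup B G \<and>
     A \<inter> B = {\<one>\<^bsub>G\<^esub>} \<and> A <#>\<^bsub>G\<^esub> B = carrier G"

definition hall_subgroup :: "nat set \<Rightarrow> ('a, 'b) monoid_scheme \<Rightarrow> 'a set \<Rightarrow> bool" where
  "hall_subgroup \<pi> G S \<longleftrightarrow> subgroup S G \<and>
     (\<forall>p::nat. Factorial_Ring.prime p \<and> p dvd card S \<longrightarrow> p \<in> \<pi>) \<and>
     (\<forall>p::nat. Factorial_Ring.prime p \<and> p dvd index G (carrier G) S \<longrightarrow> p \<notin> \<pi>)"

text \<open>\<open>S\<close> is the full preimage in \<open>A\<close> of a Hall \<open>\<pi>\<close>-subgroup of \<open>A/K\<close>.\<close>

definition hall_preimage ::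
    "nat set \<Rightarrow> ('a, 'b) monoid_scheme \<Rightarrow> 'a set \<Rightarrow> 'a set \<Rightarrow> 'a set \<Rightarrow> bool" where
  "hall_preimage \<pi> G A K S \<longleftrightarrow> subgroup S G \<and> K \<subseteq> S \<and>
     hall_subgroup \<pi> (quot G A K) (carrier (quot G S K))"

definition right_transversal :: "('a, 'b) monoid_scheme \<Rightarrow> 'a set \<Rightarrow> 'a set \<Rightarrow> bool" where
  "right_transversal G E T \<longleftrightarrow> T \<subseteq> carrier G \<and> (\<forall>Y \<in> rcosets\<^bsub>G\<^esub> E. \<exists>!t. t \<in> T \<and> t \<in> Y)"


section \<open>Group presentations\<close>

text \<open>
  The letter \<open>(i, True)\<close> stands for the \<open>i\<close>-th generator and \<open>(i, False)\<close> for its inverse. The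
  congruence \<^term>\<open>presented_eq n R\<close> identifies two words in the first \<open>n\<close> generators
  iff they are equal in the group with these generators and the defining relations \<open>u = v\<close>,
  \<open>(u, v) \<in> R\<close>.
\<close>

type_synonym gword = "(nat \<times> bool) list"

inductive presented_eq :: "nat \<Rightarrow> (gword \<times> gword) set \<Rightarrow> gword \<Rightarrow> gword \<Rightarrow> bool"
  for n :: nat and R :: "(gword \<times> gword) set" where
  refl: "presented_eq n R u u"
| sym: "presented_eq n R u v \<Longrightarrow> presented_eq n R v u"
| trans: "presented_eq n R u v \<Longrightarrow> presented_eq n R v w \<Longrightarrow> presented_eq n R u w"
| app: "presented_eq n R u v \<Longrightarrow> presented_eq n R u' v' \<Longrightarrow> presented_eq n R (u @ u') (v @ v')"
| cancel: "i < n \<Longrightarrow> presented_eq n R [(i, s), (i, \<not> s)] []"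
| rel: "(u, v) \<in> R \<Longrightarrow> presented_eq n R u v"

definition eval_letter :: "('a, 'b) monoid_scheme \<Rightarrow> 'a list \<Rightarrow> nat \<times> bool \<Rightarrow> 'a" where
  "eval_letter G gs l = (if snd l then gs ! fst l else inv\<^bsub>G\<^esub> (gs ! fst l))"

definition eval_word :: "('a, 'b) monoid_scheme \<Rightarrow> 'a list \<Rightarrow> gword \<Rightarrow> 'a" where
  "eval_word G gs w = foldr (\<lambda>l z. eval_letter G gs l \<otimes>\<^bsub>G\<^esub> z) w \<one>\<^bsub>G\<^esub>"

definition has_presentation ::
    "('a, 'b) monoid_scheme \<Rightarrow> 'a list \<Rightarrow> (gword \<times> gword) set \<Rightarrow> bool" where
  "has_presentation G gs R \<longleftrightarrow>
     set gs \<subseteq> carrier G \<and> generate G (set gs) = carrier G \<and>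
     (\<forall>u v. fst ` set u \<subseteq> {..<length gs} \<and> fst ` set v \<subseteq> {..<length gs} \<longrightarrow>
        (eval_word G gs u = eval_word G gs v \<longleftrightarrow> presented_eq (length gs) R u v))"

definition gen :: "nat \<Rightarrow> gword" where
  "gen i = [(i, True)]"

definition winv :: "gword \<Rightarrow> gword" where
  "winv w = map (\<lambda>(i, s). (i, \<not> s)) (rev w)"

definition wpow :: "gword \<Rightarrow> int \<Rightarrow> gword" where
  "wpow w r = (if 0 \<le> r then concat (replicate (nat r) w)
               else concat (replicate (nat (- r)) (winv w)))"

definition wconj :: "gword \<Rightarrow> gword \<Rightarrow> gword" where
  "wconj u v = winv v @ u @ v"

definition wcomm :: "gword \<Rightarrow> gword \<Rightarrow> gword" where
  "wcomm u v = winv u @ winv v @ u @ v"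

abbreviation (input) wa :: gword where "wa \<equiv> gen 0"
abbreviation (input) wb :: gword where "wb \<equiv> gen 1"
abbreviation (input) wc :: gword where "wc \<equiv> gen 2"

definition relations_cyclic :: "nat \<Rightarrow> nat \<Rightarrow> int \<Rightarrow> (gword \<times> gword) set" where
  "relations_cyclic n k r =
     {(wpow wa (2 ^ n), []), (wpow wb (2 ^ k), []), (wconj wa wb, wpow wa r)}"

definition relations_split :: "nat \<Rightarrow> nat \<Rightarrow> int \<Rightarrow> (gword \<times> gword) set" where
  "relations_split n k r =
     {(wpow wa (2 ^ n), []), (wpow wb (2 ^ k), []), (wpow wc 2, []),
      (wconj wa wb, wpow wa r), (wconj wa wc, wpow wa (- 1)), (wcomm wb wc, [])}"

definition relations_nonsplit :: "nat \<Rightarrow> nat \<Rightarrow> int \<Rightarrow> (gword \<times> gword) set" where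
  "relations_nonsplit n k r =
     {(wpow wa (2 ^ n), []), (wpow wb (2 ^ k), []), (wpow wc 2, wpow wa (2 ^ (n - 1))),
      (wconj wa wb, wpow wa r), (wconj wa wc, wpow wa (- 1)), (wcomm wb wc, [])}"


section \<open>Rings\<close>

definition central_idempotent :: "('a, 'b) ring_scheme \<Rightarrow> 'a \<Rightarrow> bool" where
  "central_idempotent R e \<longleftrightarrow> e \<in> carrier R \<and> e \<otimes>\<^bsub>R\<^esub> e = e \<and>
     (\<forall>x \<in> carrier R. e \<otimes>\<^bsub>R\<^esub> x = x \<otimes>\<^bsub>R\<^esub> e)"

definition primitive_central_idempotent :: "('a, 'b) ring_scheme \<Rightarrow> 'a \<Rightarrow> bool" where
  "primitive_central_idempotent R e \<longleftrightarrow> central_idempotent R e \<and> e \<noteq> \<zero>\<^bsub>R\<^esub> \<and>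
     \<not> (\<exists>f g. central_idempotent R f \<and> central_idempotent R g \<and> f \<noteq> \<zero>\<^bsub>R\<^esub> \<and> g \<noteq> \<zero>\<^bsub>R\<^esub> \<and>
            f \<otimes>\<^bsub>R\<^esub> g = \<zero>\<^bsub>R\<^esub> \<and> e = f \<oplus>\<^bsub>R\<^esub> g)"

text \<open>The ring \<open>e R e\<close>, with identity \<open>e\<close>.\<close>

definition corner :: "('a, 'b) ring_scheme \<Rightarrow> 'a \<Rightarrow> ('a, 'b) ring_scheme" where
  "corner R e = R\<lparr>carrier := (\<lambda>x. e \<otimes>\<^bsub>R\<^esub> x \<otimes>\<^bsub>R\<^esub> e) ` carrier R, one := e\<rparr>"


section \<open>Fields\<close>

text \<open>
  For \<open>Q\<close> a positive power of the characteristic of \<open>'f\<close>, the field with \<open>Q\<close> elements, realised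
  as the set of roots of \<open>X\<^sup>Q - X\<close> in the algebraic closure of \<open>'f\<close>.
\<close>

definition GF :: "nat \<Rightarrow> 'f::field alg_closure ring" where
  "GF Q = ring_of_type_algebra\<lparr>carrier := {x. x ^ Q = x}\<rparr>"

definition primitive_root_of_unity :: "nat \<Rightarrow> 'k::field \<Rightarrow> bool" where
  "primitive_root_of_unity k \<xi> \<longleftrightarrow> \<xi> ^ k = 1 \<and> (\<forall>j. 0 < j \<and> j < k \<longrightarrow> \<xi> ^ j \<noteq> 1)"

text \<open>\<open>\<F>(\<xi>\<^sub>k)\<close>; it does not depend on the choice of \<open>\<xi>\<^sub>k\<close>.\<close>

definition cyclotomic_extension :: "nat \<Rightarrow> 'f::field alg_closure set" where
  "cyclotomic_extension k =
     generate_field ring_of_type_algebra (range to_ac \<union> {SOME \<xi>. primitive_root_of_unity k \<xi>})"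

definition galois_group :: "'k::field set \<Rightarrow> 'k set \<Rightarrow> ('k \<Rightarrow> 'k) set" where
  "galois_group L F =
     {\<sigma> \<in> ring_iso (ring_of_type_algebra\<lparr>carrier := L\<rparr>) (ring_of_type_algebra\<lparr>carrier := L\<rparr>)
          \<inter> extensional L. \<forall>x \<in> F. \<sigma> x = x}"

text \<open>The trace of a finite Galois extension \<open>L/F\<close>.\<close>

definition field_trace :: "'k::field set \<Rightarrow> 'k set \<Rightarrow> 'k \<Rightarrow> 'k" where
  "field_trace L F x = (\<Sum>\<sigma> \<in> galois_group L F. \<sigma> x)"

definition cyclotomic_trace :: "nat \<Rightarrow> 'f::field alg_closure \<Rightarrow> 'f" where
  "cyclotomic_trace k x = of_ac (field_trace (cyclotomic_extension k) (range to_ac) x)"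


section \<open>Group algebras of finite groups\<close>

text \<open>The function \<open>\<alpha>\<close> represents the element \<open>\<Sum>\<^sub>x \<alpha>(x) x\<close>.\<close>

definition group_algebra :: "('a, 'b) monoid_scheme \<Rightarrow> ('a \<Rightarrow> 'f::field) ring" where
  "group_algebra G =
     \<lparr>carrier = {\<alpha>. \<forall>x. x \<notin> carrier G \<longrightarrow> \<alpha> x = 0},
      monoid.mult = (\<lambda>\<alpha> \<beta> z. if z \<in> carrier G
                       then \<Sum>x \<in> carrier G. \<alpha> x * \<beta> (inv\<^bsub>G\<^esub> x \<otimes>\<^bsub>G\<^esub> z) else 0),
      monoid.one = (\<lambda>x. if x = \<one>\<^bsub>G\<^esub> then 1 else 0),
      ring.zero = (\<lambda>_. 0),
      ring.add = (\<lambda>\<alpha> \<beta> x. \<alpha> x + \<beta> x)\<rparr>"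

definition single :: "'a \<Rightarrow> ('a \<Rightarrow> 'f::field)" where
  "single g = (\<lambda>x. if x = g then 1 else 0)"

definition scale :: "'f::field \<Rightarrow> ('a \<Rightarrow> 'f) \<Rightarrow> ('a \<Rightarrow> 'f)" where
  "scale c \<alpha> = (\<lambda>x. c * \<alpha> x)"

text \<open>\<open>average M\<close> is \<open>|M|\<^sup>-\<^sup>1 \<Sum>\<^sub>h\<^sub>\<in>\<^sub>M h\<close>.\<close>

definition average :: "'a set \<Rightarrow> ('a \<Rightarrow> 'f::field)" where
  "average M = (\<lambda>x. if x \<in> M then inverse (of_nat (card M)) else 0)"

text \<open>\<open>sandwich G \<alpha> s t\<close> is \<open>s\<^sup>-\<^sup>1 \<alpha> t\<close>; the conjugate \<open>\<alpha>\<^sup>g\<close> is \<open>sandwich G \<alpha> g g\<close>.\<close>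

definition sandwich ::
    "('a, 'b) monoid_scheme \<Rightarrow> ('a \<Rightarrow> 'f::field) \<Rightarrow> 'a \<Rightarrow> 'a \<Rightarrow> ('a \<Rightarrow> 'f)" where
  "sandwich G \<alpha> s t =
     single (inv\<^bsub>G\<^esub> s) \<otimes>\<^bsub>group_algebra G\<^esub> \<alpha> \<otimes>\<^bsub>group_algebra G\<^esub> single t"


section \<open>Strong Shoda pairs\<close>

text \<open>
  The sets \<open>M\<close> below are normal in \<open>H\<close>, so the factors commute pairwise and the product does not
  depend on their order, although the group algebra need not be commutative.
\<close>

definition shoda_eps :: "('a, 'b) monoid_scheme \<Rightarrow> 'a set \<Rightarrow> 'a set \<Rightarrow> ('a \<Rightarrow> rat)" where
  "shoda_eps G H K =
     (if H = K then average H
      else finprod (group_algebra G) (\<lambda>M. average K \<ominus>\<^bsub>group_algebra G\<^esub> average M)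
             {M. subgroup M G \<and> K \<subseteq> M \<and> minimal_normal (quot G H K) (carrier (quot G M K))})"

definition strong_shoda_pair :: "('a, 'b) monoid_scheme \<Rightarrow> 'a set \<Rightarrow> 'a set \<Rightarrow> bool" where
  "strong_shoda_pair G H K \<longleftrightarrow>
     subgroup H G \<and> subgroup K G \<and> K \<subseteq> H \<and>
     H \<lhd> G\<lparr>carrier := normalizer G K\<rparr> \<and>
     cyclic_group (quot G H K) \<and>
     maximal_abelian_subgroup (quot G (normalizer G K) K) (carrier (quot G H K)) \<and>
     (\<forall>g \<in> carrier G - normalizer G K.
        shoda_eps G H K \<otimes>\<^bsub>group_algebra G\<^esub> sandwich G (shoda_eps G H K) g g
          = \<zero>\<^bsub>group_algebra G\<^esub>)"


section \<open>Cyclotomic classes\<close>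

text \<open>
  Linear characters of \<open>H/K\<close> with values in the algebraic closure of \<open>'f\<close>. They take the value
  \<open>undefined\<close> off \<open>H/K\<close>, so that equal characters are equal functions.
\<close>

definition linear_characters ::
    "('a, 'b) monoid_scheme \<Rightarrow> 'a set \<Rightarrow> 'a set \<Rightarrow> ('a set \<Rightarrow> 'f::field alg_closure) set" where
  "linear_characters G H K =
     hom (quot G H K) (units_of ring_of_type_algebra) \<inter> extensional (carrier (quot G H K))"

definition faithful_characters ::
    "('a, 'b) monoid_scheme \<Rightarrow> 'a set \<Rightarrow> 'a set \<Rightarrow> ('a set \<Rightarrow> 'f::field alg_closure) set" where
  "faithful_characters G H K =
     {\<chi> \<in> linear_characters G H K. inj_on \<chi> (carrier (quot G H K))}"

definition cyclotomic_class ::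
    "('a, 'b) monoid_scheme \<Rightarrow> 'a set \<Rightarrow> 'a set \<Rightarrow> ('a set \<Rightarrow> 'f::{field,finite} alg_closure)
       \<Rightarrow> ('a set \<Rightarrow> 'f alg_closure) set" where
  "cyclotomic_class G H K \<chi> =
     range (\<lambda>i::nat. \<lambda>Y \<in> carrier (quot G H K). \<chi> Y ^ (CARD('f) ^ i))"

definition cyclotomic_classes ::
    "('a, 'b) monoid_scheme \<Rightarrow> 'a set \<Rightarrow> 'a set
       \<Rightarrow> ('a set \<Rightarrow> 'f::{field,finite} alg_closure) set set" where
  "cyclotomic_classes G H K = cyclotomic_class G H K ` faithful_characters G H K"

text \<open>
  The coefficient of \<open>x = h\<^sup>-\<^sup>1\<close> in \<open>|H|\<^sup>-\<^sup>1 \<Sum>\<^sub>h tr(\<chi>(hK)) h\<^sup>-\<^sup>1\<close>. The result does not depend on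
  the choice of \<open>\<chi>\<close> in \<open>C\<close>.
\<close>

definition class_eps ::
    "('a, 'b) monoid_scheme \<Rightarrow> 'a set \<Rightarrow> 'a set \<Rightarrow> ('a set \<Rightarrow> 'f::{field,finite} alg_closure) set
       \<Rightarrow> ('a \<Rightarrow> 'f)" where
  "class_eps G H K C =
     (let \<chi> = (SOME \<chi>. \<chi> \<in> C)
      in (\<lambda>x. if x \<in> H
              then inverse (of_nat (card H)) *
                   cyclotomic_trace (Coset.order (quot G H K)) (\<chi> (K #>\<^bsub>G\<^esub> inv\<^bsub>G\<^esub> x))
              else 0))"

definition class_e ::
    "('a, 'b) monoid_scheme \<Rightarrow> 'a set \<Rightarrow> 'a set \<Rightarrow> ('a set \<Rightarrow> 'f::{field,finite} alg_closure) set
       \<Rightarrow> ('a \<Rightarrow> 'f)" where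
  "class_e G H K C =
     finsum (group_algebra G) (\<lambda>\<alpha>. \<alpha>)
       ((\<lambda>g. sandwich G (class_eps G H K C) g g) ` carrier G)"

text \<open>\<open>\<chi>\<^sup>g(Y) = \<chi>(g Y g\<^sup>-\<^sup>1)\<close>, that is, \<open>\<chi>\<^sup>g(h\<^sup>g K) = \<chi>(hK)\<close>.\<close>

definition character_conj ::
    "('a, 'b) monoid_scheme \<Rightarrow> 'a set \<Rightarrow> 'a set \<Rightarrow> 'a \<Rightarrow> ('a set \<Rightarrow> 'k) \<Rightarrow> ('a set \<Rightarrow> 'k)" where
  "character_conj G H K g \<chi> =
     (\<lambda>Y \<in> carrier (quot G H K). \<chi> (g <#\<^bsub>G\<^esub> Y #>\<^bsub>G\<^esub> inv\<^bsub>G\<^esub> g))"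

text \<open>For \<open>C\<close> a cyclotomic class of \<open>H/K\<close>, this is \<open>E\<^sub>G(H/K)\<close>, which does not depend on \<open>C\<close>.\<close>

definition class_stabilizer ::
    "('a, 'b) monoid_scheme \<Rightarrow> 'a set \<Rightarrow> 'a set \<Rightarrow> ('a set \<Rightarrow> 'f::field alg_closure) set
       \<Rightarrow> 'a set" where
  "class_stabilizer G H K C =
     {g \<in> normalizer G H \<inter> normalizer G K. character_conj G H K g ` C = C}"


section \<open>The set \<open>T\<close> and the element \<open>\<beta>\<close>\<close>

text \<open>
  \<open>two_part G K E2 H2 a n T2 \<beta>2\<close>: the pair \<open>(T\<^sub>2, \<beta>\<^sub>2)\<close> arises from \<open>E\<^sub>2\<close>, \<open>H\<^sub>2\<close>, \<open>a = a\<^sub>2\<close> and the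
  exponent \<open>n\<close> for some choice of the complement \<open>M\<^sub>2\<close> and of the remaining generators and
  parameters. The rules \<open>cyclic_central\<close>, \<open>cyclic_noncentral\<close> and \<open>noncyclic\<close> treat the case in which
  \<open>H\<^sub>2/K\<close> has a complement, the last two together forming its second subcase.
\<close>

inductive two_part ::
    "('a, 'b) monoid_scheme \<Rightarrow> 'a set \<Rightarrow> 'a set \<Rightarrow> 'a set \<Rightarrow> 'a \<Rightarrow> nat
       \<Rightarrow> 'a set \<Rightarrow> ('a \<Rightarrow> 'f::field) \<Rightarrow> bool"
  for G :: "('a, 'b) monoid_scheme" and K E2 H2 :: "'a set" and a :: 'a and n :: nat where
  cyclic_central:
    "\<lbrakk> subgroup M2 G; K \<subseteq> M2;
       is_complement (quot G E2 K) (carrier (quot G H2 K)) (carrier (quot G M2 K));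
       cyclic_group (quot G M2 K);
       b \<in> E2;
       has_presentation (quot G E2 K) [K #>\<^bsub>G\<^esub> a, K #>\<^bsub>G\<^esub> b] (relations_cyclic n k r);
       n \<le> 1 \<or> K #>\<^bsub>G\<^esub> (a [^]\<^bsub>G\<^esub> (2 ^ (n - 2) :: nat)) \<in> group_center (quot G E2 K) \<rbrakk>
     \<Longrightarrow> two_part G K E2 H2 a n {a [^]\<^bsub>G\<^esub> i | i::nat. i < 2 ^ k} (average M2)"
| cyclic_noncentral:
    "\<lbrakk> subgroup M2 G; K \<subseteq> M2;
       is_complement (quot G E2 K) (carrier (quot G H2 K)) (carrier (quot G M2 K));
       cyclic_group (quot G M2 K);
       b \<in> E2;
       has_presentation (quot G E2 K) [K #>\<^bsub>G\<^esub> a, K #>\<^bsub>G\<^esub> b] (relations_cyclic n k r);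
       \<not> (n \<le> 1 \<or> K #>\<^bsub>G\<^esub> (a [^]\<^bsub>G\<^esub> (2 ^ (n - 2) :: nat)) \<in> group_center (quot G E2 K));
       d = index G E2 H2 \<rbrakk>
     \<Longrightarrow> two_part G K E2 H2 a n
           ({a [^]\<^bsub>G\<^esub> i | i::nat. i < d div 2} \<union>
            {a [^]\<^bsub>G\<^esub> (2 ^ (n - 2) + i) | i::nat. i < d div 2})
           (average M2)"
| noncyclic:
    "\<lbrakk> subgroup M2 G; K \<subseteq> M2;
       is_complement (quot G E2 K) (carrier (quot G H2 K)) (carrier (quot G M2 K));
       \<not> cyclic_group (quot G M2 K);
       b \<in> E2; c \<in> E2; [r = 1] (mod 4);
       has_presentation (quot G E2 K) [K #>\<^bsub>G\<^esub> a, K #>\<^bsub>G\<^esub> b, K #>\<^bsub>G\<^esub> c] (relations_split n k r);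
       d = index G E2 H2 \<rbrakk>
     \<Longrightarrow> two_part G K E2 H2 a n
           ({a [^]\<^bsub>G\<^esub> i | i::nat. i < d div 2} \<union>
            {a [^]\<^bsub>G\<^esub> (2 ^ (n - 2) + i) | i::nat. i < d div 2})
           (average M2)"
| no_complement:
    "\<lbrakk> \<not> (\<exists>B. is_complement (quot G E2 K) (carrier (quot G H2 K)) B);
       b \<in> E2; c \<in> E2; [r = 1] (mod 4);
       has_presentation (quot G E2 K) [K #>\<^bsub>G\<^esub> a, K #>\<^bsub>G\<^esub> b, K #>\<^bsub>G\<^esub> c] (relations_nonsplit n k r);
       x\<^sup>2 + y\<^sup>2 = - 1; y \<noteq> 0 \<rbrakk>
     \<Longrightarrow> two_part G K E2 H2 a n
           ({a [^]\<^bsub>G\<^esub> i | i::nat. i < 2 ^ k} \<union> {c \<otimes>\<^bsub>G\<^esub> a [^]\<^bsub>G\<^esub> i | i::nat. i < 2 ^ k})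
           (average (generate G {b}) \<otimes>\<^bsub>group_algebra G\<^esub>
              scale (1 / 2)
                (\<one>\<^bsub>group_algebra G\<^esub> \<oplus>\<^bsub>group_algebra G\<^esub>
                 scale x (single (a [^]\<^bsub>G\<^esub> (2 ^ (n - 2) :: nat))) \<oplus>\<^bsub>group_algebra G\<^esub>
                 scale y (single (a [^]\<^bsub>G\<^esub> (2 ^ (n - 2) :: nat) \<otimes>\<^bsub>G\<^esub> c))))"

text \<open>
  \<open>matrix_unit_data G H K C T \<beta>\<close>: \<open>T\<close> and \<open>\<beta>\<close> are a set \<open>T\<^bsub>e\<^sub>C\<^esub>\<close> and an element \<open>\<beta>\<^bsub>e\<^sub>C\<^esub>\<close> for some
  choice of the generators, complements and transversal in their construction. The suffix \<open>o\<close>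
  marks the \<open>2'\<close>-parts.
\<close>

definition matrix_unit_data ::
    "('a, 'b) monoid_scheme \<Rightarrow> 'a set \<Rightarrow> 'a set \<Rightarrow> ('a set \<Rightarrow> 'f::{field,finite} alg_closure) set
       \<Rightarrow> 'a set \<Rightarrow> ('a \<Rightarrow> 'f) \<Rightarrow> bool" where
  "matrix_unit_data G H K C T \<beta> \<longleftrightarrow>
     (\<exists>E E2 Eo H2 Ho a2 ao bo n T2 \<beta>2 TE.
        E = class_stabilizer G H K C \<and>
        hall_preimage {2} G E K E2 \<and> hall_preimage (- {2}) G E K Eo \<and>
        hall_preimage {2} G H K H2 \<and> hall_preimage (- {2}) G H K Ho \<and>
        a2 \<in> H2 \<and> generate (quot G E K) {K #>\<^bsub>G\<^esub> a2} = carrier (quot G H2 K) \<and>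
        group.ord (quot G E K) (K #>\<^bsub>G\<^esub> a2) = 2 ^ n \<and>
        ao \<in> Ho \<and> generate (quot G E K) {K #>\<^bsub>G\<^esub> ao} = carrier (quot G Ho K) \<and>
        bo \<in> Eo \<and>
        is_complement (quot G Eo K) (carrier (quot G Ho K)) (generate (quot G Eo K) {K #>\<^bsub>G\<^esub> bo}) \<and>
        two_part G K E2 H2 a2 n T2 \<beta>2 \<and>
        right_transversal G E TE \<and>
        T = {ao [^]\<^bsub>G\<^esub> i | i::nat. i < index G Eo Ho} <#>\<^bsub>G\<^esub> T2 <#>\<^bsub>G\<^esub> TE \<and>
        \<beta> = average (generate G {bo}) \<otimes>\<^bsub>group_algebra G\<^esub> \<beta>2 \<otimes>\<^bsub>group_algebra G\<^esub> class_eps G H K C)"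

end

theory Submission imports Defs "HOL-Library.Function_Algebras" begin

text \<open>
  A faithful character \<open>\<chi>\<close> of \<open>H/K\<close> turns the field \<open>L = F(\<xi>\<^sub>k)\<close> into a subring
  \<open>w(L)\<close> of the group algebra with identity \<open>w(1) = \<epsilon>\<^sub>C\<close>, and \<open>g \<in> E\<close> acts on \<open>w(L)\<close> by a power
  of the Frobenius map. Hence \<open>E/H\<close> is cyclic, and the corner of \<open>\<epsilon>\<^sub>C\<close> is a crossed product of
  \<open>L\<close> with \<open>E/H\<close>. For a cyclic complement generated by \<open>b\<close>, the average of the powers of \<open>b\<close> is an
  idempotent whose corner is the field fixed by \<open>b\<close>, and powers \<open>t\<close> of \<open>a\<close> give matrix units when the sums
  of \<open>\<chi>(s/t)\<close> over the Frobenius orbit vanish for \<open>s \<noteq> t\<close>; nilpotency of \<open>E/K\<close> controls these sums.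
  Without a complement, cyclicity of \<open>E/H\<close> forces \<open>[E\<^sub>2 : H\<^sub>2] = 2\<close>, and the 2-part is a split
  quaternion algebra. The 2-part and the odd part commute, and the conjugates of
  \<open>\<epsilon>\<^sub>C\<close> over a transversal of \<open>E\<close> are orthogonal by condition (SS3).
\<close>

section \<open>Lifting the exponent and orthogonality of Frobenius orbits\<close>

section \<open>Sums of roots of unity over cyclic groups of exponents\<close>

text \<open>In general the sum of a root of unity over a Frobenius orbit need not vanish. Nilpotency
  enters as follows: if \<open>b\<close> acts on \<open>\<psi> a\<close> as the \<open>R\<close>-th
  power, every prime dividing the order \<open>N\<close> of \<open>\<psi> a\<close> divides
  \<open>R - 1\<close>. Lifting the exponent then shows that the numbers \<open>R ^ j - 1\<close>
  run through all multiples of gcd(N, R - 1) modulo \<open>N\<close>, so orbit sums become complete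
  geometric sums. This breaks down at the prime 2 when 4 divides \<open>N\<close> and
  \<open>R\<close> is 3 modulo 4; there \<open>R ^ 2\<close> is used instead, and a fourth root of
  unity supplies the second half of the transversal, whence the exponent \<open>2 ^ (n - 2)\<close>.
  Condition (SS3) is an identity over the rationals; it reaches the finite field because all
  coefficients involved are \<open>q\<close>-integral. The order of the corner field comes from the
  least positive exponent \<open>s\<close> of a Frobenius power induced by an element of
  \<open>E\<close>: the index of \<open>H\<close> in \<open>E\<close> is \<open>ell div s\<close>,
  and the field fixed by \<open>E\<close> has \<open>q ^ (m * s)\<close> elements. Elements of the
  group algebra are functions with a carrier set, so products are computed with their convolution
  operators, which form a type of class \<open>ring_1\<close>.\<close>

lemma geometric_sum_mod:
  fixes x :: int
  shows "(\<Sum>j<p. (1 + m * x) ^ j) mod m = int p mod m"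
proof -
  have "[(\<Sum>j<p. (1 + m * x) ^ j) = (\<Sum>j<p. 1 ^ j)] (mod m)"
    by (intro cong_sum cong_pow) (simp add: cong_iff_dvd_diff)
  thus ?thesis by (simp add: cong_def)
qed

text \<open>Writing \<open>x = 1 + p * u\<close>, the \<open>j\<close>-th term is
  \<open>1 + j * p * u\<close> modulo the square of \<open>p\<close>, and for odd \<open>p\<close>
  the sum of the \<open>j\<close> contributes another factor \<open>p\<close>. For
  \<open>p = 2\<close> it does not, hence the separate assumption modulo 4.\<close>

lemma geometric_sum_prime:
  fixes x :: int and p :: nat
  assumes p: "Factorial_Ring.prime p" and x: "int p dvd x - 1" and x4: "p = 2 \<Longrightarrow> 4 dvd x - 1"
  shows "[(\<Sum>j<p. x ^ j) = int p] (mod (int p)\<^sup>2)"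
proof (cases "p = 2")
  case True
  have "(\<Sum>j<p. x ^ j) = 1 + x" using True by (simp add: numeral_2_eq_2)
  thus ?thesis using x4[OF True] True by (simp add: cong_iff_dvd_diff)
next
  case False
  obtain u where u: "x = 1 + int p * u" using x by (metis add.commute diff_add_cancel dvdE)
  have pw: "[x ^ j = 1 + int j * (int p * u)] (mod (int p)\<^sup>2)" for j
  proof (induction j)
    case (Suc j)
    have "[x ^ Suc j = (1 + int p * u) * (1 + int j * (int p * u))] (mod (int p)\<^sup>2)"
      using cong_scalar_left[OF Suc, of x] by (simp add: u)
    also have "(1 + int p * u) * (1 + int j * (int p * u)) =
        1 + int (Suc j) * (int p * u) + (int p)\<^sup>2 * (int j * u\<^sup>2)"
      by (simp add: algebra_simps power2_eq_square)
    also have "[\<dots> = 1 + int (Suc j) * (int p * u)] (mod (int p)\<^sup>2)"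
      by (simp add: cong_iff_dvd_diff)
    finally show ?case .
  qed simp
  have "odd p" using p False prime_ge_2_nat[OF p] by (intro prime_odd_nat) auto
  then obtain h where h: "p = 2 * h + 1" by (elim oddE)
  have s: "(\<Sum>j<p. int j) = int p * int h"
  proof -
    have "2 * (\<Sum>j<n. int j) = int n * (int n - 1)" for n
      by (induction n) (simp_all add: algebra_simps)
    from this[of p] show ?thesis by (simp add: h algebra_simps)
  qed
  have "[(\<Sum>j<p. x ^ j) = (\<Sum>j<p. 1 + int j * (int p * u))] (mod (int p)\<^sup>2)"
    by (intro cong_sum pw)
  also have "(\<Sum>j<p. 1 + int j * (int p * u)) = int p + (\<Sum>j<p. int j) * (int p * u)"
    by (simp add: sum.distrib sum_distrib_right)
  also have "\<dots> = int p + (int p)\<^sup>2 * (int h * u)" by (simp add: s power2_eq_square algebra_simps)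
  also have "[\<dots> = int p] (mod (int p)\<^sup>2)" by (simp add: cong_iff_dvd_diff)
  finally show ?thesis .
qed

text \<open>Lifting the exponent, by strong induction on \<open>d\<close> with one factor
  \<open>p\<close> removed at a time. If \<open>p\<close> does not divide \<open>d\<close>, the
  quotient of \<open>r ^ d - 1\<close> by \<open>r - 1\<close> is congruent to \<open>d\<close> and
  hence prime to \<open>p\<close>. If \<open>d = p * e\<close>, the quotient of
  \<open>r ^ d - 1\<close> by \<open>r ^ e - 1\<close> is \<open>p\<close> times a number prime to
  \<open>p\<close>.\<close>

lemma prime_power_dvd_exponent:
  fixes r :: int and p :: nat
  assumes p: "Factorial_Ring.prime p" and x: "int p dvd r - 1" and x4: "p = 2 \<Longrightarrow> 4 dvd r - 1"
  shows "d > 0 \<Longrightarrow> int p ^ l dvd r ^ d - 1 \<Longrightarrow> int p ^ l dvd int d * (r - 1)"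
proof (induction d arbitrary: l rule: less_induct)
  case (less d)
  have pp: "Factorial_Ring.prime (int p)" using p by simp
  show ?case
  proof (cases "p dvd d")
    case False
    have "(\<Sum>j<d. r ^ j) mod int p = int d mod int p"
      using geometric_sum_mod[of "int p" "(r - 1) div int p" d] x by simp
    hence "\<not> int p dvd (\<Sum>j<d. r ^ j)" using False
      by (metis dvd_eq_mod_eq_0 int_dvd_int_iff)
    hence "coprime (int p ^ l) (\<Sum>j<d. r ^ j)" using pp
      by (simp add: prime_imp_coprime)
    moreover have "r ^ d - 1 = (r - 1) * (\<Sum>j<d. r ^ j)"
      by (simp add: power_diff_1_eq)
    ultimately have "int p ^ l dvd r - 1" using less.prems(2)
      by (simp add: coprime_dvd_mult_left_iff)
    thus ?thesis by simp
  next
    case True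
    then obtain e where e: "d = p * e" by auto
    have e0: "e > 0" "e < d" using e less.prems(1) prime_ge_2_nat[OF p] by (cases "e = 0"; simp)+
    have r1: "r - 1 dvd r ^ e - 1" by (simp add: power_diff_1_eq)
    have c: "[(\<Sum>j<p. (r ^ e) ^ j) = int p] (mod (int p)\<^sup>2)"
      by (rule geometric_sum_prime[OF p dvd_trans[OF x r1]]) (use x4 r1 dvd_trans in blast)
    then obtain v where "(\<Sum>j<p. (r ^ e) ^ j) - int p = (int p)\<^sup>2 * v"
      unfolding cong_iff_dvd_diff by (elim dvdE)
    hence v: "(\<Sum>j<p. (r ^ e) ^ j) = int p * (1 + int p * v)"
      by (simp add: power2_eq_square algebra_simps)
    have d: "r ^ d - 1 = (r ^ e - 1) * int p * (1 + int p * v)"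
      using v power_diff_1_eq[of "r ^ e" p] by (simp add: e power_mult[symmetric] mult.commute)
    have cop: "coprime (int p ^ k) (1 + int p * v)" for k
    proof -
      have "\<not> int p dvd 1 + int p * v"
        using pp by (metis dvd_add_left_iff dvd_triv_left not_prime_unit)
      thus ?thesis using pp by (simp add: prime_imp_coprime)
    qed
    show ?thesis
    proof (cases l)
      case (Suc k)
      have "int p ^ l dvd (r ^ e - 1) * int p" using less.prems(2) d cop[of l]
        by (simp add: coprime_dvd_mult_left_iff)
      hence "int p ^ k dvd r ^ e - 1" using p Suc by (simp add: mult.commute prime_gt_0_nat)
      from less.IH[OF e0(2,1) this] show ?thesis by (simp add: Suc e mult.assoc)
    qed simp
  qed
qed

text \<open>Prime by prime, by comparing multiplicities. Lifting the exponent does not apply at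
  \<open>p = 2\<close> when 4 does not divide \<open>r - 1\<close>; but then 4 does not divide
  \<open>N\<close> either, and the single factor 2 comes from \<open>r - 1\<close>.\<close>

lemma dvd_exponent:
  fixes r N d :: nat
  assumes r: "r > 0" and d: "d > 0" and rad: "\<And>p. Factorial_Ring.prime p \<Longrightarrow> p dvd N \<Longrightarrow> p dvd r - 1"
    and four: "4 dvd N \<Longrightarrow> 4 dvd r - 1" and dv: "N dvd r ^ d - 1" and N: "N > 0"
  shows "N dvd d * (r - 1)"
proof (cases "d * (r - 1) = 0")
  case False
  show ?thesis
  proof (rule multiplicity_le_imp_dvd)
    show "N \<noteq> 0" using N by simp
    fix p :: nat assume p: "Factorial_Ring.prime p"
    let ?l = "multiplicity p N"
    have i: "int (x - 1) = int x - 1" if "x > 0" for x using that by simp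
    show "?l \<le> multiplicity p (d * (r - 1))"
    proof (cases "p dvd N")
      case True
      have pr: "p dvd r - 1" by (rule rad[OF p True])
      show ?thesis
      proof (cases "p = 2 \<and> \<not> 4 dvd r - 1")
        case True
        hence "\<not> 2 ^ 2 dvd N" using four by auto
        hence "\<not> 2 \<le> ?l" using True multiplicity_dvd'[of 2 2 N] by blast
        hence "?l \<le> 1" by linarith
        also have "1 \<le> multiplicity p (d * (r - 1))"
          using pr False p by (intro multiplicity_geI) (auto simp: prime_nat_iff)
        finally show ?thesis .
      next
        case f: False
        have "int p ^ ?l dvd int r ^ d - 1"
          using dvd_trans[OF multiplicity_dvd dv, of p] r
          by (metis i of_nat_dvd_iff of_nat_power zero_less_power)
        from prime_power_dvd_exponent[OF p _ _ d this] pr f r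
        have "int p ^ ?l dvd int d * (int r - 1)"
          by (metis i of_nat_dvd_iff of_nat_numeral)
        hence "p ^ ?l dvd d * (r - 1)" using r
          by (metis i of_nat_dvd_iff of_nat_mult of_nat_power)
        thus ?thesis using False p by (intro multiplicity_geI) (auto simp: prime_nat_iff)
      qed
    qed (simp add: not_dvd_imp_multiplicity_0)
  qed
qed auto

text \<open>The minimality of \<open>d\<close> keeps the powers \<open>r ^ j\<close> with
  \<open>j < d\<close> distinct modulo \<open>N\<close>, so \<open>f\<close> is injective with
  values below \<open>N div g\<close> and \<open>d \<le> N div g\<close>. Conversely
  \<open>N\<close> divides \<open>d * (r - 1)\<close>, and \<open>N div g\<close> is coprime to
  \<open>(r - 1) div g\<close>, so \<open>N div g\<close> divides \<open>d\<close>. Equality makes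
  \<open>f\<close> a permutation.\<close>

lemma exponent_order:
  fixes r N d :: nat
  assumes r: "r > 0" and d: "d > 0" and rad: "\<And>p. Factorial_Ring.prime p \<Longrightarrow> p dvd N \<Longrightarrow> p dvd r - 1"
    and four: "4 dvd N \<Longrightarrow> 4 dvd r - 1" and dv: "N dvd r ^ d - 1" and N: "N > 0"
    and min: "\<And>j. 0 < j \<Longrightarrow> j < d \<Longrightarrow> \<not> N dvd r ^ j - 1"
  defines "g \<equiv> gcd N (r - 1)"
  defines "f \<equiv> \<lambda>j. ((r ^ j - 1) mod N) div g"
  shows "d * g = N" and "bij_betw f {..<d} {..<d}" and "[r ^ j - 1 = g * f j] (mod N)"
proof -
  define M where "M = N div g"
  have g0: "g > 0" and gN: "N = M * g" and gr: "g dvd r - 1"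
    using N by (auto simp: g_def M_def)
  have gj: "g dvd r ^ j - 1" for j
  proof -
    have "int (r - 1) dvd int (r ^ j - 1)" using r by (simp add: power_diff_1_eq of_nat_diff)
    hence "r - 1 dvd r ^ j - 1" by (simp only: of_nat_dvd_iff)
    thus ?thesis using gr dvd_trans by blast
  qed
  have f: "g * f j = (r ^ j - 1) mod N" for j
    using gj[of j] gN unfolding f_def by (metis dvd_mod dvd_mult_div_cancel dvd_triv_right)
  show c: "[r ^ j - 1 = g * f j] (mod N)" for j
    by (simp add: f)
  have fM: "f j < M" for j
    using f[of j] N gN g0 by (metis mod_less_divisor mult.commute mult_less_cancel1)
  have inj: "inj_on f {..<d}"
  proof (rule linorder_inj_onI)
    fix i j assume ij: "i < j" "i \<in> {..<d}" "j \<in> {..<d}"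
    have cop: "coprime N (r ^ i)"
    proof -
      have "[r ^ d = 1] (mod N)" using dv r by (metis cong_to_1'_nat cong_def le_add_diff_inverse mod_add_cong
          nat_dvd_not_less cong_altdef_nat Suc_leI zero_less_power One_nat_def)
      hence "coprime (r ^ d) N" using cong_imp_coprime cong_sym coprime_1_left by blast
      thus ?thesis using d by (simp add: coprime_commute)
    qed
    show "f i \<noteq> f j"
    proof
      assume "f i = f j"
      hence "[r ^ i - 1 = r ^ j - 1] (mod N)" using c cong_sym cong_trans by metis
      hence "[r ^ i - 1 + 1 = r ^ j - 1 + 1] (mod N)" by (rule cong_add_rcancel_nat[THEN iffD2])
      hence "[r ^ i = r ^ j] (mod N)" using r by simp
      hence "[r ^ i * r ^ (j - i) = r ^ i * 1] (mod N)"
        using ij by (simp add: power_add[symmetric] cong_sym)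
      hence "[r ^ (j - i) = 1] (mod N)" using cop cong_mult_lcancel_nat[of "r ^ i" N "r ^ (j - i)" 1] coprime_commute by blast
      hence "N dvd r ^ (j - i) - 1" by (rule cong_to_1_nat)
      thus False using min[of "j - i"] ij less_imp_diff_less by auto
    qed
  qed auto
  have "d \<le> M" using card_inj_on_le[OF inj, of "{..<M}"] fM by auto
  moreover have "M dvd d"
  proof -
    have "M * g dvd d * ((r - 1) div g) * g"
      using dvd_exponent[OF r d rad four dv N] gr gN by (simp add: mult.assoc)
    hence "M dvd d * ((r - 1) div g)" using g0 by simp
    moreover have "coprime M ((r - 1) div g)"
      unfolding M_def g_def using N by (intro div_gcd_coprime) auto
    ultimately show ?thesis by (simp add: coprime_dvd_mult_left_iff)
  qed
  ultimately have dM: "d = M" using d by (simp add: dvd_imp_le antisym)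
  thus "d * g = N" by (simp add: gN)
  show "bij_betw f {..<d} {..<d}"
    using inj fM endo_inj_surj[of "{..<d}" f] dM by (auto simp: bij_betw_def)
qed

lemma geometric_sum_eq_zero:
  fixes y :: "'k::field"
  assumes "y ^ d = 1" and "y \<noteq> 1"
  shows "(\<Sum>j<d. y ^ j) = 0"
  using power_diff_1_eq[of y d] assms by simp

lemma power_cong_exponent:
  fixes x :: "'k::field"
  assumes "x ^ N = 1" and "[i = j] (mod N)"
  shows "x ^ i = x ^ j"
  by (metis assms cong_def mod_mult_div_eq mult.right_neutral power_add power_mult power_one)

text \<open>With \<open>g = gcd N (r - 1)\<close>, the terms are \<open>x\<close> times powers of
  \<open>x ^ g\<close>, with exponents permuted by \<open>exponent_order\<close>. As
  \<open>d * g = N\<close>, the element \<open>x ^ g\<close> is a \<open>d\<close>-th root of unity,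
  and it is not 1.\<close>

lemma conjugate_sum_eq_zero:
  fixes x :: "'k::field"
  assumes r: "r > 0" and d: "d > 0" and rad: "\<And>p. Factorial_Ring.prime p \<Longrightarrow> p dvd N \<Longrightarrow> p dvd r - 1"
    and four: "4 dvd N \<Longrightarrow> 4 dvd r - 1" and dv: "N dvd r ^ d - 1" and N: "N > 0"
    and min: "\<And>j. 0 < j \<Longrightarrow> j < d \<Longrightarrow> \<not> N dvd r ^ j - 1"
    and x: "x ^ N = 1" and ne: "x ^ gcd N (r - 1) \<noteq> 1"
  shows "(\<Sum>j<d. x ^ (r ^ j)) = 0"
proof -
  note e = exponent_order[OF r d rad four dv N min]
  let ?f = "\<lambda>j. ((r ^ j - 1) mod N) div gcd N (r - 1)"
  have "x ^ (r ^ j) = x * (x ^ gcd N (r - 1)) ^ ?f j" for j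
  proof -
    have "x ^ (r ^ j) = x ^ (1 + (r ^ j - 1))" using r by simp
    also have "\<dots> = x * x ^ (r ^ j - 1)" by simp
    also have "x ^ (r ^ j - 1) = (x ^ gcd N (r - 1)) ^ ?f j"
      using power_cong_exponent[OF x e(3)] by (simp add: power_mult)
    finally show ?thesis .
  qed
  hence "(\<Sum>j<d. x ^ (r ^ j)) = x * (\<Sum>j<d. (x ^ gcd N (r - 1)) ^ ?f j)"
    by (simp add: sum_distrib_left)
  also have "(\<Sum>j<d. (x ^ gcd N (r - 1)) ^ ?f j) = (\<Sum>j<d. (x ^ gcd N (r - 1)) ^ j)"
    by (rule sum.reindex_bij_betw[OF e(2)])
  also have "\<dots> = 0"
    by (rule geometric_sum_eq_zero) (use ne x e(1) in \<open>simp_all add: power_mult[symmetric] mult.commute\<close>)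
  finally show ?thesis by simp
qed

text \<open>
  The matrix \<open>(z\<^sub>t^(R^j))\<close>, with rows \<open>t \<in> I\<close> and columns \<open>j < d\<close>, is a multiple of a unitary one,
  where inversion plays the role of complex conjugation.
\<close>

definition conjugate_orthogonal :: "'i set \<Rightarrow> ('i \<Rightarrow> 'k::field) \<Rightarrow> nat \<Rightarrow> nat \<Rightarrow> bool" where
  "conjugate_orthogonal I z R d \<longleftrightarrow> finite I \<and> (\<forall>t \<in> I. z t \<noteq> 0) \<and>
     (\<forall>s \<in> I. \<forall>t \<in> I. (\<Sum>j<d. (z s / z t) ^ (R ^ j)) = (if s = t then of_nat d else 0)) \<and>
     (\<forall>j<d. (\<Sum>t \<in> I. z t ^ (R ^ j) / z t) = (if j = 0 then of_nat d else 0))"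

lemma power_primitive_eq_iff:
  fixes z :: "'k::field"
  assumes z: "\<And>i. z ^ i = 1 \<longleftrightarrow> N dvd i" and N: "N > 0"
  shows "z ^ i = z ^ j \<longleftrightarrow> [i = j] (mod N)"
proof -
  have z0: "z \<noteq> 0" using z[of N] N by (auto simp: power_0_left)
  have "z ^ i = z ^ (i + m) \<longleftrightarrow> [i = i + m] (mod N)" for i m
    using z[of m] z0 by (simp add: power_add cong_def) (metis add_cancel_left_right cong_0_iff cong_add_lcancel_0_nat cong_def mod_0 mult_cancel_left1)
  thus ?thesis
    by (metis cong_sym le_Suc_ex linear)
qed

text \<open>Rows: since \<open>N = d * g\<close>, the \<open>g\<close>-th power of the ratio of
  \<open>z ^ s\<close> and \<open>z ^ t\<close> is 1 only if \<open>s\<close> and \<open>t\<close>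
  agree modulo \<open>d\<close>, so the orbit sum of the ratio vanishes otherwise. Columns: the
  terms are the powers of \<open>z ^ (r ^ j) / z\<close>, a nontrivial \<open>d\<close>-th root of
  unity because \<open>N\<close> divides \<open>d * (r ^ j - 1)\<close> but not
  \<open>r ^ j - 1\<close>.\<close>

lemma conjugate_orthogonal_cyclic:
  fixes z :: "'k::field"
  assumes r: "r > 0" and d: "d > 0" and rad: "\<And>p. Factorial_Ring.prime p \<Longrightarrow> p dvd N \<Longrightarrow> p dvd r - 1"
    and four: "4 dvd N \<Longrightarrow> 4 dvd r - 1" and dv: "N dvd r ^ d - 1" and N: "N > 0"
    and min: "\<And>j. 0 < j \<Longrightarrow> j < d \<Longrightarrow> \<not> N dvd r ^ j - 1"
    and z: "\<And>i. z ^ i = 1 \<longleftrightarrow> N dvd i"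
  shows "conjugate_orthogonal {..<d} (\<lambda>i. z ^ i) r d"
proof -
  let ?g = "gcd N (r - 1)"
  note e = exponent_order[OF r d rad four dv N min]
  note eq = power_primitive_eq_iff[OF z N]
  have z0: "z \<noteq> 0" using z[of N] N by (auto simp: power_0_left)
  have zN: "z ^ N = 1" using z[of N] by simp
  have "(\<Sum>j<d. (z ^ s / z ^ t) ^ (r ^ j)) = (if s = t then of_nat d else 0)" if "s < d" "t < d" for s t
  proof (cases "s = t")
    case False
    have "(z ^ s / z ^ t) ^ ?g \<noteq> 1"
    proof
      assume "(z ^ s / z ^ t) ^ ?g = 1"
      hence "z ^ (?g * s) = z ^ (?g * t)"
        using z0 by (simp add: power_divide power_mult[symmetric] mult.commute)
      hence "(?g * s) mod (?g * d) = (?g * t) mod (?g * d)"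
        using e(1) eq by (simp add: cong_def mult.commute)
      hence "?g * s = ?g * t" using that by (simp add: mult_mod_right[symmetric])
      thus False using False N by simp
    qed
    moreover have "(z ^ s / z ^ t) ^ N = 1"
      using zN z0 by (simp add: power_divide power_mult[symmetric] mult.commute[of _ N]) (simp add: power_mult)
    ultimately show ?thesis
      using conjugate_sum_eq_zero[OF r d rad four dv N min] False by simp
  qed (use z0 in simp)
  moreover have "(\<Sum>t<d. (z ^ t) ^ (r ^ j) / z ^ t) = (if j = 0 then of_nat d else 0)" if "j < d" for j
  proof (cases "j = 0")
    case False
    have t: "(z ^ t) ^ (r ^ j) / z ^ t = (z ^ (r ^ j) / z) ^ t" for t
      by (simp add: power_divide power_mult[symmetric] mult.commute)
    have one: "1 \<le> r ^ j" using r by simp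
    have "N dvd d * (r - 1)" by (rule dvd_exponent[OF r d rad four dv N])
    moreover have "int (r - 1) dvd int (r ^ j - 1)" using r by (simp add: power_diff_1_eq of_nat_diff)
    hence "r - 1 dvd r ^ j - 1" by (simp only: of_nat_dvd_iff)
    ultimately have "N dvd d * (r ^ j - 1)" by (meson dvd_refl dvd_trans mult_dvd_mono)
    hence "[d * r ^ j = d] (mod N)"
      using one by (simp add: cong_altdef_nat diff_mult_distrib2)
    hence "(z ^ (r ^ j) / z) ^ d = 1"
      using z0 eq[of "d * r ^ j" d] by (simp add: power_divide power_mult[symmetric] mult.commute)
    moreover have "\<not> [r ^ j = 1] (mod N)" using min[of j] False that cong_to_1_nat[of "r ^ j" N] by auto
    hence "z ^ (r ^ j) / z \<noteq> 1" using z0 eq[of "r ^ j" 1] by auto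
    ultimately show ?thesis using geometric_sum_eq_zero[of "z ^ (r ^ j) / z" d] False unfolding t by simp
  qed (use z0 in simp)
  ultimately show ?thesis using z0 by (auto simp: conjugate_orthogonal_def)
qed

lemma sum_even_odd:
  fixes f :: "nat \<Rightarrow> 'k::comm_monoid_add"
  shows "(\<Sum>j<2 * e. f j) = (\<Sum>j<e. f (2 * j)) + (\<Sum>j<e. f (2 * j + 1))"
  by (induction e) (simp_all add: ac_simps)

text \<open>Here \<open>r\<close> is 3 modulo 4, so lifting the exponent is available for the square
  of \<open>r\<close> only, with orbits of length \<open>d div 2\<close>. It separates two rows
  unless they differ by a factor whose square is -1. Such a factor is fixed by even powers of
  \<open>r\<close> and negated by odd ones, so the two halves of the orbit cancel.\<close>

lemma conjugate_orthogonal_noncentral: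
  fixes z :: "'k::field"
  assumes n: "n \<ge> 2" and r: "r mod 4 = 3" and d: "d > 0" and dv: "2 ^ n dvd r ^ d - 1"
    and min: "\<And>j. 0 < j \<Longrightarrow> j < d \<Longrightarrow> \<not> 2 ^ n dvd r ^ j - 1"
    and z: "\<And>i. z ^ i = 1 \<longleftrightarrow> 2 ^ n dvd i"
  shows "even d" and "conjugate_orthogonal ({..<d div 2} \<times> {..<2}) (\<lambda>(i, b). z ^ (i + b * 2 ^ (n - 2))) r d"
proof -
  define N :: nat where "N = 2 ^ n"
  define A :: nat where "A = 2 ^ (n - 2)"
  have NA: "N = 4 * A"
  proof -
    obtain l where "n = l + 2" using n by (metis add.commute le_Suc_ex)
    thus ?thesis by (simp add: N_def A_def)
  qed
  have N: "N > 0" and A: "A > 0" by (simp_all add: N_def A_def)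
  have r0: "r > 0" using r by (cases r) auto
  have zz: "z ^ i = 1 \<longleftrightarrow> N dvd i" for i using z by (simp add: N_def)
  note eq = power_primitive_eq_iff[OF zz N]
  have z0: "z \<noteq> 0" using zz[of N] N by (auto simp: power_0_left)
  have rm: "[r = 3] (mod 4)" using r by (simp add: cong_def)
  have rj: "r ^ j mod 4 = (if even j then 1 else 3)" for j
  proof (induction j)
    case (Suc j)
    have "r ^ Suc j mod 4 = (r mod 4) * (r ^ j mod 4) mod 4" by (simp add: mod_mult_eq)
    thus ?case using Suc r by simp
  qed simp
  show ev: "even d"
  proof (rule ccontr)
    assume "odd d"
    hence "r ^ d mod 4 = 3" by (simp add: rj)
    moreover have "4 dvd r ^ d - 1" using dvd_trans[OF _ dv, of 4] NA N_def by simp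
    ultimately show False by presburger
  qed
  define e where "e = d div 2"
  have de: "d = 2 * e" and e0: "e > 0" using ev d by (auto simp: e_def)
  have r2: "r\<^sup>2 > 0" using r0 by simp
  have r24: "4 dvd r\<^sup>2 - 1" using rj[of 2] by (simp add: mod_eq_dvd_iff_nat r0) presburger
  have rad: "p dvd r\<^sup>2 - 1" if "Factorial_Ring.prime p" "p dvd N" for p
  proof -
    have "p = 2" using that unfolding N_def by (metis prime_dvd_power primes_dvd_imp_eq two_is_prime_nat)
    thus ?thesis using r24 by (meson dvd_trans even_numeral)
  qed
  have dv2: "N dvd (r\<^sup>2) ^ e - 1" using dv by (simp add: N_def power_mult[symmetric] de)
  have min2: "\<not> N dvd (r\<^sup>2) ^ j - 1" if "0 < j" "j < e" for j
    using min[of "2 * j"] that by (simp add: N_def power_mult[symmetric] de)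
  define g where "g = gcd N (r\<^sup>2 - 1)"
  note ord = exponent_order[OF r2 e0 rad r24 dv2 N min2]
  have eg: "e * g = N" using ord(1) by (simp add: g_def)
  have "4 dvd g" using NA r24 by (simp add: g_def)
  then obtain g' where g': "g = 4 * g'" by auto
  have eA: "A = e * g'" using eg NA g' by simp
  have g0: "g > 0" using eg N by (cases g) auto
  define z' where "z' = (\<lambda>(i, b). z ^ (i + b * A))"
  define \<iota> where "\<iota> = z ^ A"
  have i2: "\<iota>\<^sup>2 = - 1"
  proof -
    have "(\<iota>\<^sup>2)\<^sup>2 = 1" using zz[of N] by (simp add: \<iota>_def power_mult[symmetric] NA mult.commute)
    moreover have "\<iota>\<^sup>2 \<noteq> 1" using zz[of "A * 2"] A NA
      by (auto simp: \<iota>_def power_mult[symmetric] dest!: dvd_imp_le)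
    ultimately show ?thesis by (metis power2_eq_1_iff)
  qed
  have i0: "\<iota> \<noteq> 0" using z0 by (simp add: \<iota>_def)
  \<comment> \<open>Splitting \<open>j\<close> by parity turns the orbit under \<open>r\<close> into
    two orbits under the square of \<open>r\<close>, starting at \<open>x\<close> and at
    \<open>x ^ r\<close>.\<close>
  have tr0: "(\<Sum>j<d. x ^ (r ^ j)) = 0" if xN: "x ^ N = 1" and xg: "x ^ g \<noteq> 1" for x :: 'k
  proof -
    have *: "(\<Sum>j<e. y ^ ((r\<^sup>2) ^ j)) = 0" if "y ^ N = 1" "y ^ g \<noteq> 1" for y :: 'k
      using conjugate_sum_eq_zero[OF r2 e0 rad r24 dv2 N min2 that[unfolded g_def]] .
    have "(x ^ r) ^ N = 1" using xN by (simp add: power_mult[symmetric] mult.commute[of _ N]) (simp add: power_mult)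
    moreover have "(x ^ r) ^ g \<noteq> 1"
    proof
      assume "(x ^ r) ^ g = 1"
      \<comment> \<open>The exponent \<open>r ^ (d - 1)\<close> inverts \<open>r\<close> modulo
        \<open>N\<close>, so it recovers \<open>x\<close> from \<open>x ^ r\<close>.\<close>
      hence "((x ^ r) ^ g) ^ (r ^ (d - 1)) = 1" by simp
      also have "((x ^ r) ^ g) ^ (r ^ (d - 1)) = (x ^ (r ^ d)) ^ g"
        using d by (cases d) (simp_all add: power_mult[symmetric] ac_simps)
      also have "x ^ (r ^ d) = x ^ 1"
        by (rule power_cong_exponent[OF xN]) (use dv r0 in \<open>simp add: cong_altdef_nat N_def\<close>)
      finally show False using xg by simp
    qed
    ultimately have "(\<Sum>j<e. (x ^ r) ^ ((r\<^sup>2) ^ j)) = 0" by (rule *)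
    moreover have "(\<Sum>j<e. x ^ ((r\<^sup>2) ^ j)) = 0" using xN xg by (rule *)
    ultimately show ?thesis
      by (simp add: de sum_even_odd power_mult[symmetric])
  qed
  have zN: "(z ^ s / z ^ t) ^ N = 1" for s t
    using zz[of N] z0 by (simp add: power_divide power_mult[symmetric] mult.commute[of _ N]) (simp add: power_mult)
  have i4: "x ^ (r ^ j) = (if even j then x else - x)" if "x\<^sup>2 = -1" for x :: 'k and j
  proof -
    have x4: "x ^ 4 = 1" using that by (simp add: numeral_eq_Suc power2_eq_square)
    have "x ^ (r ^ j) = x ^ (r ^ j mod 4)"
      by (rule power_cong_exponent[OF x4]) (simp add: cong_def)
    thus ?thesis using that by (simp add: rj power3_eq_cube power2_eq_square)
  qed
  have o1: "(\<Sum>j<d. (z' s / z' t) ^ (r ^ j)) = (if s = t then of_nat d else 0)"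
    if st: "s \<in> {..<e} \<times> {..<2}" "t \<in> {..<e} \<times> {..<2}" for s t
  proof (cases "s = t")
    case False
    obtain i b i' b' where s: "s = (i, b)" and t: "t = (i', b')" by (metis surj_pair)
    show ?thesis
    proof (cases "(z' s / z' t) ^ g = 1")
      case True
      hence "z ^ (g * (i + b * A)) = z ^ (g * (i' + b' * A))"
        using z0 by (simp add: z'_def s t power_divide power_mult[symmetric] mult.commute)
      hence "(g * (i + b * A)) mod (g * e) = (g * (i' + b' * A)) mod (g * e)"
        using eq eg by (simp add: cong_def mult.commute)
      hence "(i + b * A) mod e = (i' + b' * A) mod e" using g0 by (simp add: mult_mod_right[symmetric])
      \<comment> \<open>\<open>A\<close> is a multiple of \<open>e\<close>, so the second
        coordinates disappear modulo \<open>e\<close>.\<close>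
      hence ii: "i = i'" using st by (simp add: s t eA mult.left_commute[of _ e])
      have "(z' s / z' t)\<^sup>2 = -1"
      proof -
        have "b \<noteq> b'" using False ii by (simp add: s t)
        hence "b = 0 \<and> b' = 1 \<or> b = 1 \<and> b' = 0" using st by (auto simp: s t)
        thus ?thesis using i2 i0 z0 ii
          by (auto simp: s t z'_def power_add power_divide divide_simps \<iota>_def[symmetric])
      qed
      from i4[OF this] show ?thesis using False by (simp add: de sum_even_odd)
    qed (use tr0 zN False in \<open>simp add: z'_def split_beta\<close>)
  qed (use z0 in \<open>simp add: z'_def split_beta\<close>)
  \<comment> \<open>The column sum factors into a geometric sum over \<open>i\<close> and the factor
    \<open>1 + \<omega> ^ A\<close>. Odd \<open>j\<close> annihilates the second factor; even
    \<open>j\<close> other than 0 annihilates the first.\<close>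
  have o2: "(\<Sum>t\<in>{..<e} \<times> {..<2}. z' t ^ (r ^ j) / z' t) = (if j = 0 then of_nat d else 0)" if "j < d" for j
  proof -
    define \<omega> where "\<omega> = z ^ (r ^ j) / z"
    have "z' (i, b) ^ (r ^ j) / z' (i, b) = \<omega> ^ i * (\<omega> ^ A) ^ b" for i b
      by (simp add: \<omega>_def z'_def power_divide power_mult[symmetric] power_add[symmetric] algebra_simps)
    hence "(\<Sum>t\<in>{..<e} \<times> {..<2}. z' t ^ (r ^ j) / z' t) = (\<Sum>(i, b)\<in>{..<e} \<times> {..<2}. \<omega> ^ i * (\<omega> ^ A) ^ b)"
      by (intro sum.cong) auto
    also have "\<dots> = (\<Sum>i<e. \<omega> ^ i) * (\<Sum>b<2. (\<omega> ^ A) ^ b)"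
      by (simp add: sum.cartesian_product[symmetric] sum_distrib_left[symmetric] sum_distrib_right[symmetric])
    also have "(\<Sum>b<2. (\<omega> ^ A) ^ b) = 1 + \<omega> ^ A" by (simp add: numeral_2_eq_2)
    finally have *: "(\<Sum>t\<in>{..<e} \<times> {..<2}. z' t ^ (r ^ j) / z' t) = (\<Sum>i<e. \<omega> ^ i) * (1 + \<omega> ^ A)" .
    show ?thesis
    proof (cases "even j")
      case False
      have "\<omega> ^ A = \<iota> ^ (r ^ j) / \<iota>"
        by (simp add: \<omega>_def \<iota>_def power_divide power_mult[symmetric] mult.commute)
      hence "1 + \<omega> ^ A = 0" using i4[OF i2, of j] False i0 by simp
      moreover have "j \<noteq> 0" using False by (cases j) auto
      ultimately show ?thesis unfolding * by simp
    next
      case True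
      then obtain l where l: "j = 2 * l" by auto
      show ?thesis
      proof (cases "j = 0")
        case False
        have one: "1 \<le> r ^ j" using r0 by simp
        have "int (r\<^sup>2 - 1) dvd int ((r\<^sup>2) ^ l - 1)" using r0 by (simp add: power_diff_1_eq of_nat_diff)
        hence "r\<^sup>2 - 1 dvd r ^ j - 1" by (simp only: of_nat_dvd_iff l power_mult)
        moreover have "N dvd e * (r\<^sup>2 - 1)" by (rule dvd_exponent[OF r2 e0 rad r24 dv2 N])
        ultimately have "N dvd e * (r ^ j - 1)" by (meson dvd_refl dvd_trans mult_dvd_mono)
        hence "[e * r ^ j = e] (mod N)"
          using one by (simp add: cong_altdef_nat diff_mult_distrib2)
        hence "\<omega> ^ e = 1"
          using z0 eq[of "e * r ^ j" e] by (simp add: \<omega>_def power_divide power_mult[symmetric] mult.commute)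
        moreover have "\<not> [r ^ j = 1] (mod N)" using min[of j] False that cong_to_1_nat[of "r ^ j" N] by (auto simp: N_def)
        hence "\<omega> \<noteq> 1" using z0 eq[of "r ^ j" 1] by (auto simp: \<omega>_def)
        ultimately show ?thesis using geometric_sum_eq_zero[of \<omega> e] False unfolding * by simp
      next
        case True
        hence "\<omega> = 1" using z0 by (simp add: \<omega>_def)
        thus ?thesis unfolding * using True by (simp add: de)
      qed
    qed
  qed
  show "conjugate_orthogonal ({..<d div 2} \<times> {..<2}) (\<lambda>(i, b). z ^ (i + b * 2 ^ (n - 2))) r d"
    unfolding conjugate_orthogonal_def e_def[symmetric] A_def[symmetric] z'_def[symmetric]
    using o1 o2 z0 by (auto simp: z'_def)
qed

section \<open>Idempotents built from an element that acts semilinearly on a field\<close>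

section \<open>Idempotents in twisted rings\<close>

text \<open>The map is not unital: \<open>w 1\<close> is merely an idempotent, later the idempotent
  of the cyclotomic class. \<open>L\<close> is a subfield of the ambient field type, so all laws are
  relative to it.\<close>

locale field_embedding =
  fixes w :: "'k::field \<Rightarrow> 'r::ring_1" and L :: "'k set"
  assumes one_L: "1 \<in> L"
    and add_L: "x \<in> L \<Longrightarrow> y \<in> L \<Longrightarrow> x + y \<in> L"
    and uminus_L: "x \<in> L \<Longrightarrow> - x \<in> L"
    and mult_L: "x \<in> L \<Longrightarrow> y \<in> L \<Longrightarrow> x * y \<in> L"
    and inverse_L: "x \<in> L \<Longrightarrow> inverse x \<in> L"
    and w_add: "x \<in> L \<Longrightarrow> y \<in> L \<Longrightarrow> w (x + y) = w x + w y"
    and w_mult: "x \<in> L \<Longrightarrow> y \<in> L \<Longrightarrow> w (x * y) = w x * w y"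
begin

lemma zero_L: "0 \<in> L" using add_L[OF one_L uminus_L[OF one_L]] by simp
lemma diff_L: "x \<in> L \<Longrightarrow> y \<in> L \<Longrightarrow> x - y \<in> L" using add_L[OF _ uminus_L] by fastforce
lemma divide_L: "x \<in> L \<Longrightarrow> y \<in> L \<Longrightarrow> x / y \<in> L" using mult_L inverse_L by (metis divide_inverse)
lemma power_L: "x \<in> L \<Longrightarrow> x ^ n \<in> L" by (induction n) (auto intro: one_L mult_L)
lemma of_nat_L: "of_nat n \<in> L" by (induction n) (auto intro: zero_L one_L add_L)
lemma sum_L: "(\<And>i. i \<in> A \<Longrightarrow> f i \<in> L) \<Longrightarrow> sum f A \<in> L"
  by (induction A rule: infinite_finite_induct) (auto intro: zero_L add_L)

lemmas L_intros = one_L add_L uminus_L mult_L inverse_L zero_L diff_L divide_L power_L of_nat_L sum_L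

lemma w_zero: "w 0 = 0" using w_add[OF zero_L zero_L] by simp

lemma w_sum: "(\<And>i. i \<in> A \<Longrightarrow> f i \<in> L) \<Longrightarrow> w (sum f A) = (\<Sum>i\<in>A. w (f i))"
proof (induction A rule: infinite_finite_induct)
  case (insert x F)
  thus ?case using w_add[of "f x" "sum f F"] sum_L[of F f] by simp
qed (simp_all add: w_zero)

lemma w_one_left: "x \<in> L \<Longrightarrow> w 1 * w x = w x" using w_mult[OF one_L, of x] by simp
lemma w_one_right: "x \<in> L \<Longrightarrow> w x * w 1 = w x" using w_mult[OF _ one_L, of x] by simp

end

locale twisted_element = field_embedding w L for w :: "'k::field \<Rightarrow> 'r::ring_1" and L +
  fixes y :: 'r and R :: nat
  assumes twist: "x \<in> L \<Longrightarrow> y * w x = w (x ^ R) * y"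
    and y_one: "y * w 1 = y" "w 1 * y = y"
begin

lemma twist_power: "x \<in> L \<Longrightarrow> y ^ j * w x = w (x ^ (R ^ j)) * y ^ j"
proof (induction j)
  case (Suc j)
  have "y ^ Suc j * w x = y * (w (x ^ (R ^ j)) * y ^ j)" using Suc by (simp add: mult.assoc)
  also have "\<dots> = w (x ^ R ^ Suc j) * y ^ Suc j"
    using twist[OF power_L[OF Suc.prems], of "R ^ j"]
    by (simp add: mult.assoc[symmetric] power_mult[symmetric] mult.commute)
  finally show ?case .
qed simp

end

text \<open>The assumption \<open>of_nat_fix\<close> lets \<open>y\<close> pass the normalizing
  factor of the average. It holds in the application because \<open>R\<close> is a power of the
  order of the base field, which contains this factor.\<close>

locale twisted_cyclic = twisted_element w L y R
  for w :: "'k::field \<Rightarrow> 'r::ring_1" and L y R +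
  fixes d :: nat
  assumes d: "d > 0" and char_d: "(of_nat d :: 'k) \<noteq> 0" and y_power: "y ^ d = w 1"
    and of_nat_fix: "(inverse (of_nat d) :: 'k) ^ R = inverse (of_nat d)"
begin

definition average_power ("\<beta>") where "\<beta> = w (inverse (of_nat d)) * (\<Sum>j<d. y ^ j)"

lemma inv_d_L: "inverse (of_nat d) \<in> L"
  by (intro inverse_L of_nat_L)

text \<open>The shifted sum ends with \<open>y ^ d = w 1\<close>, whereas the original one starts
  with the unit of the whole ring. The factor \<open>w x\<close> in front makes the two
  indistinguishable.\<close>

lemma sum_shift: "w x * (\<Sum>j<d. y ^ Suc j) = w x * (\<Sum>j<d. y ^ j)" if "x \<in> L"
proof -
  obtain e where e: "d = Suc e" using d by (cases d) auto
  have "(\<Sum>j<d. y ^ Suc j) = (\<Sum>j<e. y ^ Suc j) + w 1"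
    using y_power by (simp add: e)
  moreover have "(\<Sum>j<d. y ^ j) = (\<Sum>j<e. y ^ Suc j) + 1"
    unfolding e sum.lessThan_Suc_shift by simp
  ultimately show ?thesis using w_one_right[OF that] by (simp add: distrib_left)
qed

lemma y_average: "y * \<beta> = \<beta>"
proof -
  have "y * \<beta> = w (inverse (of_nat d)) * (y * (\<Sum>j<d. y ^ j))"
    unfolding average_power_def
    using twist[OF inv_d_L] of_nat_fix by (simp add: mult.assoc[symmetric])
  also have "\<dots> = \<beta>" using sum_shift[OF inv_d_L] by (simp add: average_power_def sum_distrib_left)
  finally show ?thesis .
qed

lemma y_power_average: "y ^ j * \<beta> = \<beta>"
  by (induction j) (simp_all add: mult.assoc y_average)

lemma average_y: "\<beta> * y = \<beta>"
  using sum_shift[OF inv_d_L] by (simp add: average_power_def mult.assoc sum_distrib_right power_commutes)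

lemma one_average: "w 1 * \<beta> = \<beta>"
  using w_one_left[OF inv_d_L] by (simp add: average_power_def mult.assoc[symmetric])

lemma average_one: "\<beta> * w 1 = \<beta>"
proof -
  have "\<beta> * w 1 = \<beta> * (y * w 1)" by (simp add: mult.assoc[symmetric] average_y)
  thus ?thesis by (simp add: y_one average_y)
qed

text \<open>Each \<open>y ^ j\<close> passes \<open>w x\<close> at the cost of a power of
  \<open>x\<close> and is then absorbed by \<open>\<beta>\<close>. What remains is the trace of
  \<open>x\<close> along the twist, divided by \<open>d\<close>.\<close>

lemma average_sandwich:
  assumes x: "x \<in> L"
  shows "\<beta> * w x * \<beta> = w (inverse (of_nat d) * (\<Sum>j<d. x ^ (R ^ j))) * \<beta>"
proof -
  have "\<beta> * w x * \<beta> = w (inverse (of_nat d)) * (\<Sum>j<d. y ^ j * w x * \<beta>)"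
    unfolding average_power_def[of ] by (simp add: mult.assoc sum_distrib_right)
  also have "(\<Sum>j<d. y ^ j * w x * \<beta>) = (\<Sum>j<d. w (x ^ (R ^ j)) * \<beta>)"
    by (simp add: twist_power[OF x] mult.assoc y_power_average)
  also have "\<dots> = w (\<Sum>j<d. x ^ (R ^ j)) * \<beta>"
    by (simp add: w_sum power_L x sum_distrib_right)
  also have "w (inverse (of_nat d)) * \<dots> = w (inverse (of_nat d) * (\<Sum>j<d. x ^ (R ^ j))) * \<beta>"
    by (simp add: w_mult L_intros x mult.assoc)
  finally show ?thesis .
qed

lemma average_orthogonal:
  assumes "conjugate_orthogonal I z R d" "s \<in> I" "t \<in> I" "z s \<in> L" "z t \<in> L"
  shows "\<beta> * w (z s / z t) * \<beta> = (if s = t then \<beta> else 0)"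
proof -
  have "(\<Sum>j<d. (z s / z t) ^ (R ^ j)) = (if s = t then of_nat d else 0)"
    using assms unfolding conjugate_orthogonal_def by blast
  thus ?thesis using average_sandwich[OF divide_L[OF assms(4,5)]] char_d
    by (simp add: w_zero one_average)
qed

text \<open>After expansion of \<open>\<beta>\<close>, the coefficient of \<open>y ^ j\<close> is a
  column sum of the orthogonality relations, which vanishes for \<open>j\<close> other than
  0.\<close>

lemma average_complete:
  assumes orth: "conjugate_orthogonal I z R d" and zL: "\<And>t. t \<in> I \<Longrightarrow> z t \<in> L"
  shows "(\<Sum>t\<in>I. w (inverse (z t)) * \<beta> * w (z t)) = w 1"
proof -
  let ?i = "inverse (of_nat d)"
  have "w (inverse (z t)) * \<beta> * w (z t) = w ?i * (\<Sum>j<d. w (z t ^ (R ^ j) / z t) * y ^ j)" if t: "t \<in> I" for t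
  proof -
    have "w (inverse (z t)) * \<beta> * w (z t) = w (inverse (z t)) * w ?i * (\<Sum>j<d. y ^ j * w (z t))"
      by (simp add: average_power_def mult.assoc sum_distrib_right)
    also have "w (inverse (z t)) * w ?i = w ?i * w (inverse (z t))"
      by (simp add: w_mult[symmetric] L_intros zL t mult.commute)
    also have "\<dots> * (\<Sum>j<d. y ^ j * w (z t)) = w ?i * (\<Sum>j<d. w (inverse (z t)) * (y ^ j * w (z t)))"
      by (simp add: mult.assoc sum_distrib_left)
    also have "(\<Sum>j<d. w (inverse (z t)) * (y ^ j * w (z t))) = (\<Sum>j<d. w (z t ^ (R ^ j) / z t) * y ^ j)"
      by (simp add: twist_power zL t mult.assoc[symmetric] w_mult[symmetric] L_intros)
        (simp add: divide_inverse mult.commute)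
    finally show ?thesis .
  qed
  hence "(\<Sum>t\<in>I. w (inverse (z t)) * \<beta> * w (z t)) = w ?i * (\<Sum>t\<in>I. \<Sum>j<d. w (z t ^ (R ^ j) / z t) * y ^ j)"
    by (simp add: sum_distrib_left)
  also have "(\<Sum>t\<in>I. \<Sum>j<d. w (z t ^ (R ^ j) / z t) * y ^ j) = (\<Sum>j<d. w (\<Sum>t\<in>I. z t ^ (R ^ j) / z t) * y ^ j)"
    by (subst sum.swap) (simp add: w_sum L_intros zL sum_distrib_right)
  also have "\<dots> = (\<Sum>j<d. if j = 0 then w (of_nat d) else 0)"
    using orth by (intro sum.cong) (auto simp: conjugate_orthogonal_def w_zero)
  also have "\<dots> = w (of_nat d)" using d by simp
  also have "w ?i * \<dots> = w 1" using char_d by (simp add: w_mult[symmetric] L_intros)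
  finally show ?thesis .
qed

text \<open>The \<open>R\<close>-th power shifts the summands by one place, and the
  \<open>d\<close>-th shift returns to \<open>x\<close>.\<close>

lemma average_fixed:
  fixes x :: 'k
  assumes add_R: "\<And>x y :: 'k. (x + y) ^ R = x ^ R + y ^ R" and x: "x ^ (R ^ d) = x" and R: "R > 0"
  shows "(inverse (of_nat d) * (\<Sum>j<d. x ^ (R ^ j))) ^ R = inverse (of_nat d) * (\<Sum>j<d. x ^ (R ^ j))"
proof -
  have s: "(\<Sum>j<n. x ^ (R ^ j)) ^ R = (\<Sum>j<n. x ^ (R ^ Suc j))" for n
  proof (induction n)
    case (Suc n)
    have "(\<Sum>j<Suc n. x ^ (R ^ j)) ^ R = (\<Sum>j<n. x ^ (R ^ j)) ^ R + (x ^ (R ^ n)) ^ R"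
      using add_R[of "\<Sum>j<n. x ^ (R ^ j)" "x ^ (R ^ n)"] by simp
    thus ?case using Suc by (simp add: power_mult[symmetric] mult.commute)
  qed (use R in simp)
  obtain e where e: "d = Suc e" using d by (cases d) auto
  have "(\<Sum>j<d. x ^ (R ^ Suc j)) = (\<Sum>j<e. x ^ (R ^ Suc j)) + x"
    using x unfolding e by simp
  also have "\<dots> = (\<Sum>j<d. x ^ (R ^ j))"
    unfolding e sum.lessThan_Suc_shift by simp
  finally show ?thesis using s[of d] by (simp add: power_mult_distrib of_nat_fix)
qed

end

section \<open>The split quaternion algebra\<close>

locale twisted_quaternion = twisted_element w L y R
  for w :: "'k::field \<Rightarrow> 'r::ring_1" and L y R +
  fixes \<iota> p q :: 'k
  assumes y_square: "y * y = w (- 1)"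
    and i_L: "\<iota> \<in> L" and i_square: "\<iota> * \<iota> = - 1" and i_twist: "\<iota> ^ R = - \<iota>"
    and pq_L: "p \<in> L" "q \<in> L" and pq_fix: "p ^ R = p" "q ^ R = q"
    and pq: "p\<^sup>2 + q\<^sup>2 = - 1" and q0: "q \<noteq> 0"
    and two: "(2::'k) \<noteq> 0"
    and add_R: "\<And>x y :: 'k. (x + y) ^ R = x ^ R + y ^ R" and R0: "R > 0"
    and R_square: "x \<in> L \<Longrightarrow> (x ^ R) ^ R = x"
begin

text \<open>Coefficients of the idempotent \<open>f\<close>. The elements \<open>\<iota>\<close> and
  \<open>y\<close> behave like anticommuting quaternion units of square -1, so
  \<open>p * \<iota> + q * \<iota> * y\<close> has square \<open>- (p * p + q * q) = 1\<close>, and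
  half of 1 plus this element is idempotent.\<close>

definition A where "A = (1 + p * \<iota>) / 2"
definition B where "B = q * \<iota> / 2"

lemma two_L: "2 \<in> L" using of_nat_L[of 2] by simp
lemma AB_L: "A \<in> L" "B \<in> L" by (simp_all add: A_def B_def L_intros two_L i_L pq_L)

lemma two_R: "(2::'k) ^ R = 2" using add_R[of 1 1] by simp
lemma uminus_R: "(- x) ^ R = - (x ^ R)" for x :: 'k
  using add_R[of x "- x"] R0 by (simp add: eq_neg_iff_add_eq_0 add.commute power_0_left)
lemma A_R: "A ^ R = 1 - A"
  by (simp add: A_def power_divide two_R add_R power_mult_distrib pq_fix i_twist field_simps two)
lemma B_R: "B ^ R = - B"
  by (simp add: B_def power_divide two_R power_mult_distrib pq_fix i_twist)
lemma AA: "A * A + B * B = A"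
proof -
  have four: "(4::'k) \<noteq> 0" using two by (metis mult_2 no_zero_divisors numeral_Bit0)
  have "4 * (A * A + B * B) = 1 + 2 * p * \<iota> + (p\<^sup>2 + q\<^sup>2) * (\<iota> * \<iota>)"
    using two four by (simp add: A_def B_def field_simps power2_eq_square)
  also have "\<dots> = 4 * A" using two by (simp add: i_square pq A_def field_simps)
  finally show ?thesis using four by (metis mult_left_cancel)
qed
lemma BB: "B * B = A * (1 - A)" using AA by (simp add: algebra_simps eq_diff_eq)

definition f where "f = w A + w B * y"

lemma pair_mult:
  assumes "a \<in> L" "b \<in> L" "a' \<in> L" "b' \<in> L"
  shows "(w a + w b * y) * (w a' + w b' * y) = w (a * a' - b * b' ^ R) + w (a * b' + b * a' ^ R) * y"
proof -
  have 1: "w b * (y * w a') = w (b * a' ^ R) * y"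
    using twist assms by (simp add: mult.assoc w_mult L_intros)
  have "w b * (y * (w b' * y)) = w b * (y * w b') * y" by (simp add: mult.assoc)
  also have "\<dots> = w b * w (b' ^ R) * (y * y)" using twist assms by (simp add: mult.assoc)
  also have "\<dots> = w (- (b * b' ^ R))"
    using assms by (simp add: y_square w_mult[symmetric] L_intros)
  finally have 2: "w b * (y * (w b' * y)) = w (- (b * b' ^ R))" .
  have "(w a + w b * y) * (w a' + w b' * y) = w (a * a') + w (- (b * b' ^ R)) + (w (a * b') * y + w (b * a' ^ R) * y)"
    using assms by (simp add: distrib_left distrib_right 1 2 w_mult mult.assoc)
  thus ?thesis using assms by (simp add: w_add[symmetric] L_intros distrib_right[symmetric])
qed

lemma w_pair: "w a = w a + w 0 * y" by (simp add: w_zero)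
lemma y_pair: "y = w 0 + w 1 * y" by (simp add: w_zero y_one)
lemma inv_y_pair: "w (- 1) * y = w 0 + w (- 1) * y" by (simp add: w_zero)

lemma f_one: "w 1 * f = f" "f * w 1 = f"
  by (simp_all add: f_def distrib_left distrib_right mult.assoc[symmetric] w_one_left w_one_right AB_L)
    (simp add: mult.assoc y_one)

lemma f_idem: "f * f = f"
  unfolding f_def using pair_mult[OF AB_L AB_L] AA BB
  by (simp add: A_R B_R) (simp add: algebra_simps)

lemma f_y_f: "f * y * f = 0"
proof -
  have "f * y = w (- B) + w A * y"
    unfolding f_def using pair_mult[OF AB_L zero_L one_L] y_pair R0 by (simp add: power_0_left)
  hence "f * y * f = w (- B * A - A * B ^ R) + w (- B * B + A * A ^ R) * y"
    using pair_mult[OF uminus_L[OF AB_L(2)] AB_L(1) AB_L] by (simp add: f_def)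
  also have "\<dots> = 0" by (simp add: A_R B_R BB w_zero)
  finally show ?thesis .
qed

lemma f_inv_y_f: "f * (w (- 1) * y) * f = 0"
proof -
  have "f * w (- 1) = w (- 1) * f"
    by (simp add: f_def distrib_left distrib_right mult.assoc twist L_intros uminus_R)
      (simp add: mult.assoc[symmetric] w_mult[symmetric] L_intros AB_L)
  hence "f * (w (- 1) * y) * f = w (- 1) * (f * y * f)" by (metis mult.assoc)
  thus ?thesis by (simp add: f_y_f)
qed

text \<open>Since \<open>y\<close> has square \<open>w (- 1)\<close>, the factor
  \<open>w (- 1) * y\<close> is its inverse in the corner. Thus conjugation by \<open>y\<close>
  exchanges \<open>f\<close> with the complementary idempotent.\<close>

lemma f_complete: "f + w (- 1) * y * f * y = w 1"
proof -
  have m1: "(- 1 :: 'k) \<in> L" by (simp add: L_intros)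
  have "w (- 1) * y * f = w (- B) + w (A - 1) * y"
    unfolding f_def using pair_mult[OF zero_L m1 AB_L] inv_y_pair by (simp add: A_R B_R)
  hence "w (- 1) * y * f * y = w (1 - A) + w (- B) * y"
    using pair_mult[OF uminus_L[OF AB_L(2)] diff_L[OF AB_L(1) one_L] zero_L one_L] y_pair R0
    by (simp add: power_0_left)
  hence "f + w (- 1) * y * f * y = (w A + w (1 - A)) + (w B + w (- B)) * y"
    by (simp add: f_def distrib_right add_ac)
  thus ?thesis by (simp add: w_add[symmetric] L_intros AB_L w_zero)
qed

text \<open>The \<open>R\<close>-th power is an involution on \<open>L\<close>, and the scalar is
  the corresponding trace of \<open>A * x\<close>. Hence the corner of \<open>f\<close> is seen to
  be governed by the fixed field.\<close>

lemma f_sandwich: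
  assumes x: "x \<in> L"
  shows "f * w x * f = w (A * x + (A * x) ^ R) * f"
proof -
  have "f * w x = w (A * x) + w (B * x ^ R) * y"
    using pair_mult[OF AB_L x zero_L] w_pair[of x] R0 by (simp add: f_def power_0_left)
  hence "f * w x * f = w (A * x * A + B * B * x ^ R) + w (A * x * B + B * x ^ R * A ^ R) * y"
    using pair_mult[OF mult_L[OF AB_L(1) x] mult_L[OF AB_L(2) power_L[OF x]] AB_L]
    by (simp add: f_def B_R mult_ac)
  also have "\<dots> = w ((A * x + (A * x) ^ R) * A) + w ((A * x + (A * x) ^ R) * B) * y"
    by (simp add: BB A_R power_mult_distrib algebra_simps)
  also have "\<dots> = w (A * x + (A * x) ^ R) * f"
    by (simp add: f_def w_mult L_intros AB_L x distrib_left mult.assoc)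
  finally show ?thesis .
qed

lemma f_fixed: "x \<in> L \<Longrightarrow> (A * x + (A * x) ^ R) ^ R = A * x + (A * x) ^ R"
  using R_square[OF mult_L[OF AB_L(1)], of x] by (simp add: add_R add.commute)

lemma i0: "\<iota> \<noteq> 0" using i_square by auto
lemma B0: "B \<noteq> 0" using q0 i0 two by (simp add: B_def)

text \<open>Solving \<open>f * f = f\<close> for \<open>w B * y * f\<close> and dividing by
  \<open>B\<close>, which is invertible because \<open>q\<close> is nonzero. Left multiplication of
  \<open>f\<close> by \<open>y\<close> is thus a multiplication by an element of the field.\<close>

lemma y_f: "y * f = w ((1 - A) / B) * f"
proof -
  have "(w A + w B * y) * f = f" using f_idem f_def by simp
  hence "w B * y * f = w 1 * f - w A * f" by (simp add: distrib_right f_one eq_diff_eq add.commute)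
  also have "\<dots> = w (1 - A) * f"
    using w_add[OF diff_L[OF one_L AB_L(1)] AB_L(1)] by (simp add: left_diff_distrib[symmetric])
  finally have "w (inverse B) * (w B * y * f) = w (inverse B) * (w (1 - A) * f)" by simp
  thus ?thesis using B0
    by (simp add: mult.assoc[symmetric] w_mult[symmetric] L_intros AB_L y_one) (simp add: divide_inverse mult.commute)
qed

end

text \<open>The two systems behave like the factors of a tensor product: moving
  \<open>\<beta>1\<close> past the \<open>t\<close> and \<open>\<beta>2\<close> past the
  \<open>s\<close> splits a product into one sandwich of each kind. In the sum, the part over
  \<open>I\<close> collapses to \<open>\<epsilon>\<close>, which \<open>\<beta>2\<close>
  absorbs.\<close>

lemma product_matrix_units:
  fixes \<beta>1 \<beta>2 \<epsilon> :: "'r::ring_1" and s s' :: "'i \<Rightarrow> 'r" and t t' :: "'j \<Rightarrow> 'r"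
  assumes ss: "\<And>i i'. i \<in> I \<Longrightarrow> i' \<in> I \<Longrightarrow> \<beta>1 * (s i * s' i') * \<beta>1 = (if i = i' then \<beta>1 else 0)"
    and tt: "\<And>j j'. j \<in> J \<Longrightarrow> j' \<in> J \<Longrightarrow> \<beta>2 * (t j * t' j') * \<beta>2 = (if j = j' then \<beta>2 else 0)"
    and s1: "(\<Sum>i\<in>I. s' i * \<beta>1 * s i) = \<epsilon>" and t1: "(\<Sum>j\<in>J. t' j * \<beta>2 * t j) = \<epsilon>"
    and \<beta>\<beta>: "\<beta>1 * \<beta>2 = \<beta>2 * \<beta>1" and \<epsilon>: "\<epsilon> * \<beta>2 = \<beta>2"
    and \<beta>1t: "\<And>j. j \<in> J \<Longrightarrow> \<beta>1 * t j = t j * \<beta>1" "\<And>j. j \<in> J \<Longrightarrow> \<beta>1 * t' j = t' j * \<beta>1"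
    and \<beta>2s: "\<And>i. i \<in> I \<Longrightarrow> \<beta>2 * s i = s i * \<beta>2" "\<And>i. i \<in> I \<Longrightarrow> \<beta>2 * s' i = s' i * \<beta>2"
    and st: "\<And>i j. i \<in> I \<Longrightarrow> j \<in> J \<Longrightarrow> s' i * t j = t j * s' i" "\<And>i j. i \<in> I \<Longrightarrow> j \<in> J \<Longrightarrow> s' i * t' j = t' j * s' i"
  shows "\<And>i j i' j'. i \<in> I \<Longrightarrow> i' \<in> I \<Longrightarrow> j \<in> J \<Longrightarrow> j' \<in> J \<Longrightarrow>
      (\<beta>1 * \<beta>2) * ((s i * t j) * (t' j' * s' i')) * (\<beta>1 * \<beta>2) = (if i = i' \<and> j = j' then \<beta>1 * \<beta>2 else 0)"
    and "(\<Sum>(i, j)\<in>I \<times> J. (t' j * s' i) * (\<beta>1 * \<beta>2) * (s i * t j)) = \<epsilon>"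
proof -
  fix i j i' j' assume i: "i \<in> I" "i' \<in> I" and j: "j \<in> J" "j' \<in> J"
  have "(\<beta>1 * \<beta>2) * ((s i * t j) * (t' j' * s' i')) * (\<beta>1 * \<beta>2) =
      \<beta>1 * (\<beta>2 * s i) * (t j * (t' j' * s' i')) * \<beta>1 * \<beta>2" by (simp add: mult.assoc)
  also have "\<dots> = \<beta>1 * s i * \<beta>2 * (t j * (s' i' * t' j')) * \<beta>1 * \<beta>2"
    using i j by (simp add: \<beta>2s st mult.assoc)
  also have "\<dots> = \<beta>1 * s i * \<beta>2 * (s' i' * t j) * t' j' * \<beta>1 * \<beta>2"
    using i j by (simp add: st(1) mult.assoc)
  also have "\<dots> = \<beta>1 * s i * (\<beta>2 * s' i') * (t j * t' j') * \<beta>1 * \<beta>2" by (simp add: mult.assoc)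
  also have "\<dots> = \<beta>1 * (s i * s' i') * \<beta>2 * (t j * (\<beta>1 * t' j')) * \<beta>2"
    using i j by (simp add: \<beta>2s \<beta>1t mult.assoc)
  also have "\<dots> = \<beta>1 * (s i * s' i') * \<beta>2 * ((\<beta>1 * t j) * t' j') * \<beta>2"
    using j by (simp add: \<beta>1t mult.assoc)
  also have "\<dots> = \<beta>1 * (s i * s' i') * (\<beta>2 * \<beta>1) * (t j * t' j') * \<beta>2" by (simp add: mult.assoc)
  also have "\<dots> = (\<beta>1 * (s i * s' i') * \<beta>1) * (\<beta>2 * (t j * t' j') * \<beta>2)"
    by (simp add: \<beta>\<beta>[symmetric] mult.assoc)
  also have "\<dots> = (if i = i' \<and> j = j' then \<beta>1 * \<beta>2 else 0)" using i j by (simp add: ss tt)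
  finally show "(\<beta>1 * \<beta>2) * ((s i * t j) * (t' j' * s' i')) * (\<beta>1 * \<beta>2) = (if i = i' \<and> j = j' then \<beta>1 * \<beta>2 else 0)" .
next
  have \<epsilon>': "\<epsilon> * (\<beta>2 * u) = \<beta>2 * u" for u by (simp add: mult.assoc[symmetric] \<epsilon>)
  have "(\<Sum>(i, j)\<in>I \<times> J. (t' j * s' i) * (\<beta>1 * \<beta>2) * (s i * t j)) =
      (\<Sum>j\<in>J. \<Sum>i\<in>I. t' j * ((s' i * \<beta>1 * s i) * (\<beta>2 * t j)))"
    by (subst sum.swap) (simp add: sum.cartesian_product[symmetric] mult.assoc, simp add: mult.assoc[symmetric] \<beta>2s)
  also have "\<dots> = (\<Sum>j\<in>J. t' j * \<beta>2 * t j)"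
    by (simp only: sum_distrib_left[symmetric] sum_distrib_right[symmetric] s1) (simp add: \<epsilon>' mult.assoc)
  finally show "(\<Sum>(i, j)\<in>I \<times> J. (t' j * s' i) * (\<beta>1 * \<beta>2) * (s i * t j)) = \<epsilon>" by (simp add: t1)
qed

section \<open>Coprime orders in nilpotent groups\<close>

section \<open>Nilpotent groups and Hall subgroups\<close>

lemma (in group) lower_central_series_normal: "lower_central_series G i \<lhd> G"
proof (induction i)
  case 0
  show ?case by (simp add: normal_inv_iff subgroup_self)
next
  case (Suc i)
  let ?D = "lower_central_series G i"
  have D: "?D \<subseteq> carrier G" using Suc normal_imp_subgroup subgroup.subset by blast
  show ?case unfolding lower_central_series.simps
  proof (rule normal_generateI, goal_cases)
    case 1
    show ?case using D by auto
  next
    case (2 h g)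
    then obtain x y where h: "h = inv x \<otimes> inv y \<otimes> x \<otimes> y" and x: "x \<in> ?D" and y: "y \<in> carrier G" by auto
    have g: "g \<in> carrier G" by fact
    have xc: "x \<in> carrier G" using x D by auto
    define x' y' where "x' = g \<otimes> x \<otimes> inv g" and "y' = g \<otimes> y \<otimes> inv g"
    have "x' \<in> ?D" using normal.inv_op_closed2[OF Suc g x] by (simp add: x'_def)
    moreover have "y' \<in> carrier G" using y g by (simp add: y'_def)
    moreover have "g \<otimes> h \<otimes> inv g = inv x' \<otimes> inv y' \<otimes> x' \<otimes> y'"
    proof -
      have c: "inv g \<otimes> (g \<otimes> z) = z" if "z \<in> carrier G" for z using g that by (simp add: m_assoc[symmetric])
      show ?thesis using xc y g
        by (simp add: h x'_def y'_def inv_mult_group m_assoc c)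
    qed
    ultimately show ?case by blast
  qed
qed

lemma (in group) conj_nat_pow:
  assumes "x \<in> carrier G" "y \<in> carrier G"
  shows "(inv y \<otimes> x \<otimes> y) [^] (n::nat) = inv y \<otimes> x [^] n \<otimes> y"
proof (induction n)
  case (Suc n)
  have "(inv y \<otimes> x [^] n \<otimes> y) \<otimes> (inv y \<otimes> x \<otimes> y) = inv y \<otimes> x [^] n \<otimes> (y \<otimes> inv y) \<otimes> x \<otimes> y"
    using assms by (simp only: m_assoc inv_closed nat_pow_closed m_closed)
  thus ?case using Suc assms by (simp add: m_assoc)
qed (use assms in simp)

text \<open>Conjugating \<open>x [^] m = \<one>\<close> by \<open>y\<close> gives the
  \<open>m\<close>-th power of \<open>x \<otimes> w\<close>, which splits because the factors
  commute.\<close>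

lemma (in group) central_commutator_power:
  assumes x: "x \<in> carrier G" and y: "y \<in> carrier G" and w: "w \<in> carrier G"
    and c: "x \<otimes> w = w \<otimes> x" and xy: "inv y \<otimes> x \<otimes> y = x \<otimes> w" and m: "x [^] (m::nat) = \<one>"
  shows "w [^] m = \<one>"
proof -
  have "(x \<otimes> w) [^] m = \<one>" using conj_nat_pow[OF x y, of m] y by (simp add: xy[symmetric] m)
  thus ?thesis using pow_mult_distrib[OF c x w, of m] m w by simp
qed

lemma (in group) coprime_pow_eq_one:
  assumes "w \<in> carrier G" "w [^] (m::nat) = \<one>" "w [^] (l::nat) = \<one>" "coprime m l"
  shows "w = \<one>"
proof -
  have "ord w dvd m" "ord w dvd l" using assms pow_eq_id by blast+
  hence "ord w dvd 1" using assms(4) coprime_common_divisor by blast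
  thus ?thesis using assms(1) ord_eq_1 by simp
qed

text \<open>The commutator \<open>w\<close> descends the lower central series step by step: modulo
  the next term it is central, so its order divides both \<open>m\<close> and \<open>l\<close>, and
  it is trivial there.\<close>

lemma (in group) nilpotent_coprime_commute:
  assumes nil: "lower_central_series G c = {\<one>}"
    and x: "x \<in> carrier G" and y: "y \<in> carrier G"
    and m: "x [^] (m::nat) = \<one>" and l: "y [^] (l::nat) = \<one>" and cop: "coprime m l"
  shows "x \<otimes> y = y \<otimes> x"
proof -
  define w where "w = inv x \<otimes> inv y \<otimes> x \<otimes> y"
  have w: "w \<in> carrier G" using x y by (simp add: w_def)
  have "w \<in> lower_central_series G i" for i
  proof (induction i)
    case 0
    show ?case using w by simp
  next
    case (Suc i)
    define D where "D = lower_central_series G (Suc i)"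
    have D: "D \<lhd> G" unfolding D_def by (rule lower_central_series_normal)
    interpret D: normal D G by (rule D)
    define Q where "Q = G Mod D"
    define p where "p = (\<lambda>a. D #> a)"
    interpret Q: group Q unfolding Q_def by (rule D.factorgroup_is_group)
    interpret h: group_hom G Q p
      using D.r_coset_hom_Mod Q.is_group
      by (simp add: group_hom_def group_hom_axioms_def is_group p_def Q_def)
    have ker: "p a = \<one>\<^bsub>Q\<^esub> \<longleftrightarrow> a \<in> D" if "a \<in> carrier G" for a
      using coset_join1[OF _ that D.is_subgroup] coset_join2[OF that D.is_subgroup] D.subset
      by (auto simp: p_def Q_def FactGroup_def)
    have central: "p w \<otimes>\<^bsub>Q\<^esub> p z = p z \<otimes>\<^bsub>Q\<^esub> p w" if z: "z \<in> carrier G" for z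
    proof -
      have "inv w \<otimes> inv z \<otimes> w \<otimes> z \<in> D"
        unfolding D_def using Suc z by (auto intro!: generate.incl)
      moreover have "inv w \<otimes> inv z \<otimes> w \<otimes> z \<in> carrier G" using w z by simp
      ultimately have "p (inv w \<otimes> inv z \<otimes> w \<otimes> z) = \<one>\<^bsub>Q\<^esub>" using ker by blast
      hence "inv\<^bsub>Q\<^esub> (p z \<otimes>\<^bsub>Q\<^esub> p w) \<otimes>\<^bsub>Q\<^esub> (p w \<otimes>\<^bsub>Q\<^esub> p z) = \<one>\<^bsub>Q\<^esub>"
        using w z by (simp add: Q.inv_mult_group Q.m_assoc)
      thus ?thesis using w z
        by (metis Q.inv_closed Q.inv_equality Q.inv_inv Q.m_closed h.hom_closed)
    qed
    have "inv y \<otimes> x \<otimes> y = x \<otimes> w"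
      using x y by (simp add: w_def m_assoc[symmetric])
    hence "p (inv y \<otimes> x \<otimes> y) = p (x \<otimes> w)" by simp
    hence 1: "inv\<^bsub>Q\<^esub> p y \<otimes>\<^bsub>Q\<^esub> p x \<otimes>\<^bsub>Q\<^esub> p y = p x \<otimes>\<^bsub>Q\<^esub> p w"
      using x y w by simp
    \<comment> \<open>The same commutator, read as the effect of \<open>x\<close> on
      \<open>inv y\<close>, so that now \<open>l\<close> bounds its order.\<close>
    have "inv x \<otimes> inv y \<otimes> x = w \<otimes> inv y"
      using x y by (simp add: w_def m_assoc)
    hence "p (inv x \<otimes> inv y \<otimes> x) = p (w \<otimes> inv y)" by simp
    hence 2: "inv\<^bsub>Q\<^esub> p x \<otimes>\<^bsub>Q\<^esub> p (inv y) \<otimes>\<^bsub>Q\<^esub> p x = p (inv y) \<otimes>\<^bsub>Q\<^esub> p w"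
      using x y w central[of "inv y"] by simp
    have "p x [^]\<^bsub>Q\<^esub> m = \<one>\<^bsub>Q\<^esub>" using h.hom_nat_pow[OF x, of m] m by simp
    hence "p w [^]\<^bsub>Q\<^esub> m = \<one>\<^bsub>Q\<^esub>"
      using Q.central_commutator_power[OF _ _ _ _ 1] central[OF x] x y w by simp
    moreover have "inv y [^] l = \<one>" using l y by (simp add: nat_pow_inv)
    hence "p (inv y) [^]\<^bsub>Q\<^esub> l = \<one>\<^bsub>Q\<^esub>" using h.hom_nat_pow[of "inv y" l] y by simp
    hence "p w [^]\<^bsub>Q\<^esub> l = \<one>\<^bsub>Q\<^esub>"
      using Q.central_commutator_power[OF _ _ _ _ 2] central[of "inv y"] x y w by simp
    ultimately have "p w = \<one>\<^bsub>Q\<^esub>"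
      using Q.coprime_pow_eq_one[OF _ _ _ cop] w by simp
    thus ?case using ker[OF w] D_def by simp
  qed
  hence "inv x \<otimes> inv y \<otimes> x \<otimes> y = \<one>" using nil unfolding w_def by blast
  hence "inv (y \<otimes> x) \<otimes> (x \<otimes> y) = \<one>" using x y by (simp add: inv_mult_group m_assoc)
  thus ?thesis using x y by (metis inv_closed inv_equality inv_inv m_closed)
qed

lemma coprime_nat_primeI:
  fixes a b :: nat
  assumes "\<And>p. Factorial_Ring.prime p \<Longrightarrow> p dvd a \<Longrightarrow> p dvd b \<Longrightarrow> False"
  shows "coprime a b"
proof (rule ccontr)
  assume "\<not> coprime a b"
  hence "gcd a b \<noteq> 1" using coprime_iff_gcd_eq_1 by blast
  then obtain p where "Factorial_Ring.prime p" "p dvd gcd a b" using prime_factor_nat by blast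
  thus False using assms by auto
qed

text \<open>The coprime indices show that the order of \<open>G\<close> divides the product of the
  orders of \<open>A\<close> and \<open>B\<close>. The coprime orders show that this product divides
  the order of the subgroup \<open>A <#> B\<close>.\<close>

lemma (in group) hall_product:
  assumes fin: "finite (carrier G)" and A: "hall_subgroup (- {2}) G A" and B: "hall_subgroup {2} G B"
    and comm: "\<And>a b. a \<in> A \<Longrightarrow> b \<in> B \<Longrightarrow> a \<otimes> b = b \<otimes> a"
  shows "A <#> B = carrier G"
proof -
  have sA: "subgroup A G" and sB: "subgroup B G" using A B by (auto simp: hall_subgroup_def)
  have Ac: "A \<subseteq> carrier G" and Bc: "B \<subseteq> carrier G" using sA sB subgroup.subset by blast+
  define P where "P = A <#> B"
  have memP: "p \<in> P \<longleftrightarrow> (\<exists>a\<in>A. \<exists>b\<in>B. p = a \<otimes> b)" for p by (auto simp: P_def set_mult_def)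
  have Pc: "P \<subseteq> carrier G" using Ac Bc by (fastforce simp: memP)
  have sP: "subgroup P G"
  proof (rule subgroupI[OF Pc])
    show "P \<noteq> {}" using memP subgroup.one_closed[OF sA] subgroup.one_closed[OF sB] by blast
  next
    fix p assume "p \<in> P"
    then obtain a b where ab: "a \<in> A" "b \<in> B" "p = a \<otimes> b" using memP by auto
    hence "inv p = inv (b \<otimes> a)" using ab comm[OF ab(1,2)] by simp
    hence "inv p = inv a \<otimes> inv b" using ab Ac Bc by (simp add: inv_mult_group subset_iff)
    thus "inv p \<in> P" using ab sA sB subgroup.m_inv_closed memP by metis
  next
    fix p p' assume "p \<in> P" "p' \<in> P"
    then obtain a b a' b' where ab: "a \<in> A" "b \<in> B" "p = a \<otimes> b" "a' \<in> A" "b' \<in> B" "p' = a' \<otimes> b'"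
      using memP by metis
    hence c: "a \<in> carrier G" "b \<in> carrier G" "a' \<in> carrier G" "b' \<in> carrier G" using Ac Bc by auto
    have "p \<otimes> p' = a \<otimes> (b \<otimes> a') \<otimes> b'" using ab c by (simp add: m_assoc)
    also have "b \<otimes> a' = a' \<otimes> b" using comm[OF ab(4,2)] by simp
    also have "a \<otimes> (a' \<otimes> b) \<otimes> b' = (a \<otimes> a') \<otimes> (b \<otimes> b')" using c by (simp add: m_assoc)
    finally show "p \<otimes> p' \<in> P" using ab sA sB subgroup.m_closed memP by metis
  qed
  have AP: "A \<subseteq> P"
  proof
    fix a assume a: "a \<in> A"
    thus "a \<in> P" using memP[of a] subgroup.one_closed[OF sB] Ac by (metis r_one subsetD)
  qed
  have BP: "B \<subseteq> P"
  proof
    fix b assume b: "b \<in> B"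
    thus "b \<in> P" using memP[of b] subgroup.one_closed[OF sA] Bc by (metis l_one subsetD)
  qed
  have dvdP: "card S dvd card P" if "subgroup S G" "S \<subseteq> P" for S
  proof -
    have "subgroup S (G\<lparr>carrier := P\<rparr>)" using subgroup_incl[OF that(1) sP that(2)] .
    from group.lagrange[OF subgroup_imp_group[OF sP] this] show ?thesis
      by (simp add: Coset.order_def) (metis dvd_triv_right)
  qed
  have lA: "index G (carrier G) A * card A = card (carrier G)"
    using lagrange[OF sA] by (simp add: index_def Coset.order_def)
  have lB: "index G (carrier G) B * card B = card (carrier G)"
    using lagrange[OF sB] by (simp add: index_def Coset.order_def)
  have finP: "finite P" using Pc fin finite_subset by blast
  have c1: "coprime (card A) (card B)"
    using A B unfolding hall_subgroup_def by (intro coprime_nat_primeI) auto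
  have c2: "coprime (index G (carrier G) A) (index G (carrier G) B)"
    using A B unfolding hall_subgroup_def by (intro coprime_nat_primeI) auto
  have "index G (carrier G) A dvd index G (carrier G) B * card B"
    using lA lB by (metis dvd_triv_left)
  hence "index G (carrier G) A dvd card B" using c2 by (simp add: coprime_dvd_mult_right_iff)
  hence "card (carrier G) dvd card B * card A" using lA by (metis mult_dvd_mono dvd_refl)
  also have "card B * card A dvd card P"
    using dvdP[OF sA AP] dvdP[OF sB BP] c1 by (simp add: divides_mult coprime_commute)
  finally have "card (carrier G) dvd card P" .
  hence "card (carrier G) \<le> card P" using finP subgroup.finite_imp_card_positive[OF sP fin] by (simp add: dvd_imp_le)
  hence "P = carrier G" using Pc fin card_seteq by blast
  thus ?thesis by (simp add: P_def)
qed

section \<open>Sections \<open>A/K\<close> handled through representatives in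
  \<open>G\<close>\<close>

section \<open>Sections of a group\<close>

lemma carrier_quot: "carrier (quot G A K) = (\<lambda>x. K #>\<^bsub>G\<^esub> x) ` A"
  by (auto simp: quot_def FactGroup_def RCOSETS_def r_coset_def)

lemma quot_restrict: "quot G B K = (quot G A K)\<lparr>carrier := (\<lambda>x. K #>\<^bsub>G\<^esub> x) ` B\<rparr>"
proof -
  have m: "set_mult (G\<lparr>carrier := C\<rparr>) = set_mult G" for C by (intro ext) (simp add: set_mult_def)
  show ?thesis unfolding quot_def FactGroup_def m by (auto simp: RCOSETS_def r_coset_def)
qed

lemma (in group) mem_normalizer:
  assumes "K \<subseteq> carrier G"
  shows "g \<in> normalizer G K \<longleftrightarrow> g \<in> carrier G \<and> g <# K #> inv g = K"
  using assms by (auto simp: normalizer_def stabilizer_def)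

lemma (in group) index_cyclic_transversal:
  assumes A: "subgroup A G" and S: "subgroup S G" and AS: "A \<subseteq> S" and b: "b \<in> S"
    and cover: "\<And>g. g \<in> S \<Longrightarrow> \<exists>h\<in>A. \<exists>j<d. g = h \<otimes> b [^] (j::nat)"
    and mem: "\<And>j. b [^] (j::nat) \<in> A \<longleftrightarrow> d dvd j"
  shows "index G S A = d"
proof -
  have Sc: "S \<subseteq> carrier G" and Ac: "A \<subseteq> carrier G" using S A subgroup.subset by blast+
  have bS: "b [^] (j::nat) \<in> S" for j
    using S b by (induction j) (auto simp: subgroup.one_closed subgroup.m_closed)
  have bc: "b [^] (j::nat) \<in> carrier G" for j using bS Sc by blast
  have "rcosets\<^bsub>G\<lparr>carrier := S\<rparr>\<^esub> A = (\<lambda>j. A #> b [^] j) ` {..<d}"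
  proof -
    have "A #> g \<in> (\<lambda>j. A #> b [^] j) ` {..<d}" if g: "g \<in> S" for g
    proof -
      obtain h j where hj: "h \<in> A" "j < d" "g = h \<otimes> b [^] j" using cover[OF g] by auto
      hence "A #> g = (A #> h) #> b [^] j" using Ac bc by (simp add: coset_mult_assoc subset_iff)
      also have "A #> h = A" using hj(1) A Ac by (intro coset_join2) auto
      finally show ?thesis using hj by auto
    qed
    moreover have "rcosets\<^bsub>G\<lparr>carrier := S\<rparr>\<^esub> A = (\<lambda>g. A #> g) ` S"
      by (auto simp: RCOSETS_def r_coset_def)
    ultimately show ?thesis using bS by auto
  qed
  moreover have "inj_on (\<lambda>j. A #> b [^] j) {..<d}"
  proof (rule linorder_inj_onI)
    fix i j assume ij: "i < j" "i \<in> {..<d}" "j \<in> {..<d}"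
    show "A #> b [^] i \<noteq> A #> b [^] j"
    proof
      assume eq: "A #> b [^] i = A #> b [^] j"
      have "b [^] j \<in> A #> b [^] i" using rcos_self[OF bc A] eq by simp
      then obtain h where h: "h \<in> A" "b [^] j = h \<otimes> b [^] i" by (auto simp: r_coset_def)
      have "b [^] j = b [^] (j - i) \<otimes> b [^] i" using ij b Sc by (simp add: nat_pow_mult subset_iff)
      hence "b [^] (j - i) \<otimes> b [^] i = h \<otimes> b [^] i" using h by simp
      moreover have "h \<in> carrier G" using h Ac by blast
      ultimately have "b [^] (j - i) = h" using bc by simp
      hence "d dvd j - i" using h mem[of "j - i"] by simp
      thus False using ij by (auto dest: dvd_imp_le)
    qed
  qed auto
  ultimately show ?thesis by (simp add: index_def card_image)
qed

locale subquotient = group G for G (structure) +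
  fixes A K
  assumes sub_A: "subgroup A G" and norm_K: "K \<lhd> G\<lparr>carrier := A\<rparr>"
begin

lemma A_carrier: "A \<subseteq> carrier G" by (rule subgroup.subset[OF sub_A])
lemma A_mem: "x \<in> A \<Longrightarrow> x \<in> carrier G" using A_carrier by blast
lemma A_closed: "\<one> \<in> A" "x \<in> A \<Longrightarrow> y \<in> A \<Longrightarrow> x \<otimes> y \<in> A" "x \<in> A \<Longrightarrow> inv x \<in> A"
  using subgroup.one_closed[OF sub_A] subgroup.m_closed[OF sub_A] subgroup.m_inv_closed[OF sub_A]
  by simp_all
lemma A_pow: "x \<in> A \<Longrightarrow> x [^] (n::nat) \<in> A"
  by (induction n) (simp_all add: A_closed)

lemma sub_K: "subgroup K G"
  using incl_subgroup[OF sub_A normal_imp_subgroup[OF norm_K]] .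

lemma K_A: "K \<subseteq> A" using subgroup.subset[OF normal_imp_subgroup[OF norm_K]] by simp
lemma K_carrier: "K \<subseteq> carrier G" using K_A A_carrier by blast

abbreviation Q where "Q \<equiv> quot G A K"

lemma group_quot: "group Q"
  unfolding quot_def by (rule normal.factorgroup_is_group[OF norm_K])

lemma coset_one_iff: "x \<in> carrier G \<Longrightarrow> K #> x = K \<longleftrightarrow> x \<in> K"
  using coset_join1[OF _ _ sub_K] coset_join2[OF _ sub_K] by blast

lemma coset_eq_iff:
  assumes "x \<in> carrier G" "y \<in> carrier G"
  shows "K #> x = K #> y \<longleftrightarrow> x \<otimes> inv y \<in> K"
proof -
  have "K #> x = K #> y \<longleftrightarrow> K #> (x \<otimes> inv y) = K"
    using coset_mult_inv1[OF _ assms K_carrier] coset_mult_inv2[OF _ assms K_carrier] by blast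
  thus ?thesis using assms coset_one_iff by simp
qed

lemma one_quot: "\<one>\<^bsub>Q\<^esub> = K" by (simp add: quot_def FactGroup_def)

lemma mult_quot: "x \<in> A \<Longrightarrow> y \<in> A \<Longrightarrow> (K #> x) \<otimes>\<^bsub>Q\<^esub> (K #> y) = K #> (x \<otimes> y)"
  using normal.rcos_sum[OF norm_K, of x y]
  by (simp add: quot_def FactGroup_def r_coset_def set_mult_def)

lemma hom_quot: "group_hom (G\<lparr>carrier := A\<rparr>) Q (\<lambda>x. K #> x)"
  unfolding group_hom_def group_hom_axioms_def
  using subgroup_imp_group[OF sub_A] group_quot
  by (simp add: hom_def carrier_quot mult_quot)

lemma inv_quot:
  assumes "x \<in> A" shows "inv\<^bsub>Q\<^esub> (K #> x) = K #> inv x"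
proof -
  interpret Q: group Q by (rule group_quot)
  have "(K #> inv x) \<otimes>\<^bsub>Q\<^esub> (K #> x) = K #> (inv x \<otimes> x)"
    by (intro mult_quot A_closed assms)
  also have "inv x \<otimes> x = \<one>" using A_mem[OF assms] by (rule l_inv)
  also have "K #> \<one> = \<one>\<^bsub>Q\<^esub>" using K_carrier by (simp only: coset_mult_one one_quot)
  finally have "(K #> inv x) \<otimes>\<^bsub>Q\<^esub> (K #> x) = \<one>\<^bsub>Q\<^esub>" .
  moreover have "K #> x \<in> carrier Q" unfolding carrier_quot using assms by (rule imageI)
  moreover have "K #> inv x \<in> carrier Q" unfolding carrier_quot using A_closed(3)[OF assms] by (rule imageI)
  ultimately show ?thesis by (rule Q.inv_equality)
qed

lemma pow_quot: "x \<in> A \<Longrightarrow> (K #> x) [^]\<^bsub>Q\<^esub> (n::nat) = K #> (x [^] n)"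
proof (induction n)
  case 0
  have "K #> \<one> = K" using K_carrier by (rule coset_mult_one)
  thus ?case by (simp add: one_quot)
next
  case (Suc n)
  thus ?case by (simp add: mult_quot A_pow)
qed

lemma subgroup_image:
  assumes "subgroup B G" "B \<subseteq> A"
  shows "subgroup ((\<lambda>x. K #> x) ` B) Q"
  using group_hom.subgroup_img_is_subgroup[OF hom_quot subgroup_incl[OF assms(1) sub_A assms(2)]] .

lemma mem_image_iff:
  assumes B: "subgroup B G" "K \<subseteq> B" and x: "x \<in> carrier G"
  shows "K #> x \<in> (\<lambda>x. K #> x) ` B \<longleftrightarrow> x \<in> B"
proof
  assume "K #> x \<in> (\<lambda>x. K #> x) ` B"
  then obtain y where y: "y \<in> B" "K #> x = K #> y" by auto
  have yc: "y \<in> carrier G" using y(1) subgroup.subset[OF B(1)] by blast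
  have "x \<otimes> inv y \<in> B" using y(2) coset_eq_iff[OF x yc] B(2) by blast
  hence "x \<otimes> inv y \<otimes> y \<in> B" using y(1) subgroup.m_closed[OF B(1)] by blast
  thus "x \<in> B" using x yc by (simp add: m_assoc)
qed auto

lemma finite_quot: "finite (carrier G) \<Longrightarrow> finite (carrier Q)"
  unfolding carrier_quot by (intro finite_imageI finite_subset[OF A_carrier])

text \<open>Commutators of cosets lift to commutators of representatives, so nilpotency of
  \<open>G\<close> passes to every section.\<close>

lemma lower_central_series_quot:
  "lower_central_series Q i \<subseteq> (\<lambda>x. K #> x) ` (lower_central_series G i \<inter> A)"
proof (induction i)
  case 0
  show ?case using A_carrier by (auto simp: carrier_quot)
next
  case (Suc i)
  interpret Q: group Q by (rule group_quot)
  let ?D = "lower_central_series G (Suc i) \<inter> A"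
  have D: "subgroup ?D G"
    using subgroups_Inter_pair[OF normal_imp_subgroup[OF lower_central_series_normal] sub_A] .
  have "subgroup ((\<lambda>x. K #> x) ` ?D) Q" using D by (intro subgroup_image) auto
  moreover have "{inv\<^bsub>Q\<^esub> x \<otimes>\<^bsub>Q\<^esub> inv\<^bsub>Q\<^esub> y \<otimes>\<^bsub>Q\<^esub> x \<otimes>\<^bsub>Q\<^esub> y | x y.
      x \<in> lower_central_series Q i \<and> y \<in> carrier Q} \<subseteq> (\<lambda>x. K #> x) ` ?D"
  proof (clarify)
    fix U V assume "U \<in> lower_central_series Q i" "V \<in> carrier Q"
    then obtain x y where x: "x \<in> lower_central_series G i" "x \<in> A" "U = K #> x"
      and y: "y \<in> A" "V = K #> y" using Suc by (auto simp: carrier_quot)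
    have "inv x \<otimes> inv y \<otimes> x \<otimes> y \<in> lower_central_series G (Suc i)"
      using x y A_mem by (auto intro!: generate.incl)
    hence "inv x \<otimes> inv y \<otimes> x \<otimes> y \<in> ?D" using x y by (simp add: A_closed)
    moreover have "inv\<^bsub>Q\<^esub> U \<otimes>\<^bsub>Q\<^esub> inv\<^bsub>Q\<^esub> V \<otimes>\<^bsub>Q\<^esub> U \<otimes>\<^bsub>Q\<^esub> V = K #> (inv x \<otimes> inv y \<otimes> x \<otimes> y)"
      using x y by (simp add: mult_quot inv_quot A_closed)
    ultimately show "inv\<^bsub>Q\<^esub> U \<otimes>\<^bsub>Q\<^esub> inv\<^bsub>Q\<^esub> V \<otimes>\<^bsub>Q\<^esub> U \<otimes>\<^bsub>Q\<^esub> V \<in> (\<lambda>x. K #> x) ` ?D" by blast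
  qed
  ultimately show ?case unfolding lower_central_series.simps(2)[of Q] by (intro Q.generate_subgroup_incl)
qed

text \<open>Translates a complement in the quotient into statements on elements: the powers of
  \<open>b\<close> below \<open>d\<close> represent the cosets of \<open>HS\<close>. The number
  \<open>d\<close> is the order of \<open>b\<close> modulo \<open>K\<close>; the order of
  \<open>b\<close> itself may be larger.\<close>

lemma cyclic_complement:
  assumes fin: "finite (carrier G)" and HS: "subgroup HS G" "K \<subseteq> HS" and b: "b \<in> A"
    and compl: "is_complement Q (carrier (quot G HS K)) (generate Q {K #> b})"
  defines "d \<equiv> group.ord Q (K #> b)"
  shows "HS \<subseteq> A" and "d > 0" and "\<And>j. b [^] (j::nat) \<in> HS \<longleftrightarrow> d dvd j" and "b [^] d \<in> K"
    and "\<And>g. g \<in> A \<Longrightarrow> \<exists>h\<in>HS. \<exists>j<d. g = h \<otimes> b [^] (j::nat)" and "index G A HS = d"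
proof -
  interpret Q: group Q by (rule group_quot)
  have Kb: "K #> b \<in> carrier Q" using b by (auto simp: carrier_quot)
  have HSc: "HS \<subseteq> carrier G" using HS subgroup.subset by blast
  have "(\<lambda>x. K #> x) ` HS \<subseteq> carrier Q"
    using compl subgroup.subset[of "carrier (quot G HS K)" Q] by (simp add: is_complement_def carrier_quot)
  hence "K #> x \<in> (\<lambda>x. K #> x) ` A" if "x \<in> HS" for x using that by (auto simp: carrier_quot)
  thus HA: "HS \<subseteq> A" using mem_image_iff[OF sub_A K_A] HSc by blast
  show d0: "d > 0" unfolding d_def using Q.ord_ge_1[OF finite_quot[OF fin] Kb] by simp
  have gen: "K #> (b [^] (j::nat)) \<in> generate Q {K #> b}" for j
    using pow_quot[OF b, of j] by (auto simp: Q.generate_pow_on_finite_carrier[OF finite_quot[OF fin] Kb])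
  show mem: "b [^] (j::nat) \<in> HS \<longleftrightarrow> d dvd j" for j
  proof -
    have "b [^] j \<in> HS \<longleftrightarrow> K #> (b [^] j) = K"
    proof
      assume "b [^] j \<in> HS"
      hence "K #> (b [^] j) \<in> carrier (quot G HS K) \<inter> generate Q {K #> b}"
        using gen by (auto simp: carrier_quot)
      thus "K #> (b [^] j) = K" using compl unfolding is_complement_def one_quot by blast
    qed (use HS b A_mem coset_one_iff in auto)
    also have "\<dots> \<longleftrightarrow> d dvd j"
      using Q.pow_eq_id[OF Kb, of j] b by (simp add: pow_quot one_quot d_def)
    finally show ?thesis .
  qed
  have "(K #> b) [^]\<^bsub>Q\<^esub> d = \<one>\<^bsub>Q\<^esub>" using Kb by (simp add: d_def)
  thus "b [^] d \<in> K" using b by (simp add: pow_quot one_quot coset_one_iff A_mem)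
  show cov: "\<exists>h\<in>HS. \<exists>j<d. g = h \<otimes> b [^] (j::nat)" if g: "g \<in> A" for g
  proof -
    have "K #> g \<in> carrier (quot G HS K) <#>\<^bsub>Q\<^esub> generate Q {K #> b}"
      using g compl by (auto simp: is_complement_def carrier_quot)
    then obtain h U where h: "h \<in> HS" and U: "U \<in> generate Q {K #> b}" and gX: "K #> g = (K #> h) \<otimes>\<^bsub>Q\<^esub> U"
      by (auto simp: set_mult_def carrier_quot)
    obtain i :: nat where i: "U = (K #> b) [^]\<^bsub>Q\<^esub> i"
      using U by (auto simp: Q.generate_pow_on_finite_carrier[OF finite_quot[OF fin] Kb])
    define j where "j = i mod d"
    have j: "j < d" using d0 by (simp add: j_def)
    have U: "U = K #> (b [^] j)"
    proof -
      have "i = d * (i div d) + j" by (simp add: j_def)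
      hence "U = ((K #> b) [^]\<^bsub>Q\<^esub> d) [^]\<^bsub>Q\<^esub> (i div d) \<otimes>\<^bsub>Q\<^esub> (K #> b) [^]\<^bsub>Q\<^esub> j"
        using Kb i by (metis Q.nat_pow_mult Q.nat_pow_pow)
      moreover have "K #> (b [^] j) \<in> carrier Q" using A_pow[OF b] by (auto simp: carrier_quot)
      ultimately show ?thesis using Kb b by (simp add: d_def pow_quot)
    qed
    have bj: "b [^] j \<in> A" using b by (rule A_pow)
    have "K #> g = K #> (h \<otimes> b [^] j)" using gX U h HA bj by (simp add: mult_quot subset_iff)
    hence "g \<otimes> inv (h \<otimes> b [^] j) \<in> K" using coset_eq_iff g h HA bj by (simp add: A_mem subset_iff)
    then obtain k where k: "k \<in> K" "g \<otimes> inv (h \<otimes> b [^] j) = k" by simp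
    have c: "g \<in> carrier G" "h \<in> carrier G" "b [^] j \<in> carrier G" "k \<in> carrier G"
      using g h(1) HSc bj k(1) K_carrier A_mem by auto
    have "g = k \<otimes> h \<otimes> b [^] j"
      using inv_solve_right[of k g "h \<otimes> b [^] j"] k(2) c by (simp add: m_assoc)
    moreover have "k \<otimes> h \<in> HS" using k(1) h HS(2) subgroup.m_closed[OF HS(1)] by blast
    ultimately show ?thesis using j by blast
  qed
  show "index G A HS = d"
    by (rule index_cyclic_transversal[OF HS(1) sub_A HA b cov mem])
qed

end

section \<open>Frobenius powers and the Galois group of the cyclotomic extension\<close>

section \<open>Finite fields and the trace of a cyclotomic extension\<close>

lemma ring_of_type_algebra_simps [simp]:
  "carrier (ring_of_type_algebra :: 'k::field ring) = UNIV"
  "x \<oplus>\<^bsub>ring_of_type_algebra\<^esub> y = x + (y::'k)"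
  "x \<otimes>\<^bsub>ring_of_type_algebra\<^esub> y = x * (y::'k)"
  "\<zero>\<^bsub>ring_of_type_algebra\<^esub> = (0::'k)"
  "\<one>\<^bsub>ring_of_type_algebra\<^esub> = (1::'k)"
  by (simp_all add: ring_of_type_algebra_def)

lemma ring_of_type_algebra_uminus [simp]: "\<ominus>\<^bsub>ring_of_type_algebra\<^esub> x = - (x::'k::field)"
proof -
  interpret R: field "ring_of_type_algebra :: 'k ring" by (rule field_from_type_algebra)
  show ?thesis using R.minus_equality[of "- x" x] by simp
qed

lemma ring_of_type_algebra_inv [simp]:
  fixes x :: "'k::field"
  assumes "x \<noteq> 0"
  shows "inv\<^bsub>ring_of_type_algebra\<^esub> x = inverse x"
proof -
  interpret R: field "ring_of_type_algebra :: 'k ring" by (rule field_from_type_algebra)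
  show ?thesis using R.comm_inv_char[of x "inverse x"] assms by simp
qed

lemma power_CARD_eq:
  fixes x :: "'f::{field,finite}"
  shows "x ^ CARD('f) = x"
proof (cases "x = 0")
  case False
  have "(\<Prod>y \<in> UNIV - {0}. y) = (\<Prod>y \<in> UNIV - {0}. x * y)"
    by (rule prod.reindex_bij_betw[symmetric], rule bij_betw_byWitness[where f' = "\<lambda>y. y / x"])
      (use False in auto)
  also have "\<dots> = x ^ (CARD('f) - 1) * (\<Prod>y \<in> UNIV - {0}. y)"
    by (simp add: prod.distrib card_Diff_singleton)
  finally have "x ^ (CARD('f) - 1) = 1" by simp
  hence "x * x ^ (CARD('f) - 1) = x" by simp
  thus ?thesis by (metis power_Suc Suc_diff_1 zero_less_card_finite)
qed (simp add: zero_power)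

lemma CARD_field_gt_1: "CARD('f::{field,finite}) > 1"
proof -
  have "card {0, 1 :: 'f} \<le> CARD('f)" by (intro card_mono) auto
  thus ?thesis by simp
qed

text \<open>By counting: the elements of the base field are roots of the polynomial, whose degree
  already equals their number.\<close>

lemma range_to_ac:
  "range (to_ac :: 'f::{field,finite} \<Rightarrow> _) = {x. x ^ CARD('f) = x}"
proof (rule card_seteq)
  let ?p = "monom 1 (CARD('f)) - monom 1 1 :: 'f alg_closure poly"
  have c: "Polynomial.coeff ?p (CARD('f)) = 1" using CARD_field_gt_1[where 'f = 'f] by simp
  hence p: "?p \<noteq> 0" by (metis coeff_0 zero_neq_one)
  have r: "{x. poly ?p x = 0} = {x::'f alg_closure. x ^ CARD('f) = x}" by (simp add: poly_monom)
  show "finite {x::'f alg_closure. x ^ CARD('f) = x}" using poly_roots_finite[OF p] r by simp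
  have "Polynomial.degree ?p \<le> CARD('f)"
    using zero_less_card_finite[where 'a = 'f]
    by (intro degree_diff_le order.trans[OF degree_monom_le]) (auto simp: Suc_le_eq)
  thus "card {x::'f alg_closure. x ^ CARD('f) = x} \<le> card (range (to_ac :: 'f \<Rightarrow> _))"
    using card_poly_roots_bound[OF p] r by (simp add: card_image inj_to_ac)
  show "range (to_ac :: 'f \<Rightarrow> _) \<subseteq> {x. x ^ CARD('f) = x}"
    by (auto simp: power_CARD_eq simp flip: to_ac_power)
qed

text \<open>\<open>C\<close> stands for \<open>CARD('f)\<close>, and the locale fixes the Frobenius structure of \<open>'f\<close>.\<close>

locale frobenius =
  fixes C q m :: nat and f_type :: "'f::{field,finite} itself"
  assumes prime_q: "Factorial_Ring.prime q" and m1: "m \<ge> 1" and C: "CARD('f) = q ^ m" and C_def: "C = CARD('f)"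
begin

lemma C_gt_1: "C > 1" using CARD_field_gt_1 by (simp add: C_def)

lemma CHAR_eq: "CHAR('f) = q"
proof -
  have "Factorial_Ring.prime CHAR('f)"
    by (rule prime_CHAR_semidom) (rule finite_imp_CHAR_pos, simp)
  moreover have "CHAR('f) dvd q ^ m" using CHAR_dvd_CARD[where 'a = 'f] C by simp
  ultimately show ?thesis using prime_q prime_dvd_power primes_dvd_imp_eq by blast
qed

lemma frobenius_add: "(x + y :: 'f alg_closure) ^ (C ^ i) = x ^ (C ^ i) + y ^ (C ^ i)"
proof (rule freshmans_dream'[where n = "m * i"])
  show "Factorial_Ring.prime CHAR('f alg_closure)" using CHAR_eq prime_q by simp
qed (simp add: C_def C CHAR_eq power_mult)

lemma frobenius_sum: "(\<Sum>i\<in>A. f i :: 'f alg_closure) ^ (C ^ i) = (\<Sum>j\<in>A. f j ^ (C ^ i))"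
  using C_gt_1 by (induction A rule: infinite_finite_induct) (auto simp: frobenius_add power_0_left)

lemma frobenius_uminus: "(- x :: 'f alg_closure) ^ (C ^ i) = - (x ^ (C ^ i))"
  using frobenius_add[of x "- x" i] C_gt_1 by (simp add: eq_neg_iff_add_eq_0 add.commute power_0_left)

lemma frobenius_inj: "(x :: 'f alg_closure) ^ (C ^ i) = y ^ (C ^ i) \<longleftrightarrow> x = y"
proof
  assume "x ^ (C ^ i) = y ^ (C ^ i)"
  hence "(x + - y) ^ (C ^ i) = 0" by (simp only: frobenius_add frobenius_uminus) simp
  thus "x = y" by simp
qed simp

lemma frobenius_base: "(to_ac x :: 'f alg_closure) ^ (C ^ i) = to_ac x"
proof -
  have "x ^ (C ^ i) = x" by (induction i) (simp_all add: power_mult power_CARD_eq C_def)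
  thus ?thesis by (simp flip: to_ac_power)
qed

text \<open>For positive \<open>n\<close> this is the field with \<open>C ^ n\<close> elements. With
  \<open>n = ell\<close> it contains the cyclotomic extension and takes its place in the later
  computations, because membership is a single equation.\<close>

definition fixed_field :: "nat \<Rightarrow> 'f alg_closure set" where
  "fixed_field n = {x. x ^ (C ^ n) = x}"

lemma fixed_field_closed:
  "1 \<in> fixed_field n" "0 \<in> fixed_field n"
  "x \<in> fixed_field n \<Longrightarrow> y \<in> fixed_field n \<Longrightarrow> x + y \<in> fixed_field n"
  "x \<in> fixed_field n \<Longrightarrow> - x \<in> fixed_field n"
  "x \<in> fixed_field n \<Longrightarrow> y \<in> fixed_field n \<Longrightarrow> x * y \<in> fixed_field n"
  "x \<in> fixed_field n \<Longrightarrow> inverse x \<in> fixed_field n"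
  "to_ac a \<in> fixed_field n"
  using C_gt_1
  by (auto simp: fixed_field_def frobenius_add frobenius_uminus frobenius_base power_mult_distrib power_inverse power_0_left)

lemma fixed_field_power: "x \<in> fixed_field n \<Longrightarrow> x ^ (C ^ (n * i)) = x"
  by (induction i) (simp_all add: fixed_field_def power_add power_mult)

lemma fixed_field_dvd: "n dvd n' \<Longrightarrow> fixed_field n \<subseteq> fixed_field n'"
  by (auto elim!: dvdE dest: fixed_field_power simp: fixed_field_def[of "_ * _"])

lemma frobenius_mod: "x \<in> fixed_field n \<Longrightarrow> x ^ (C ^ (i mod n)) = x ^ (C ^ i)"
proof -
  assume x: "x \<in> fixed_field n"
  have "C ^ i = C ^ (n * (i div n)) * C ^ (i mod n)" by (simp flip: power_add)
  thus ?thesis using fixed_field_power[OF x, of "i div n"] by (simp add: power_mult)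
qed

end

locale cyclotomic = frobenius C q m f_type for C q m and f_type :: "'f::{field,finite} itself" +
  fixes k ell :: nat and \<zeta> :: "'f alg_closure"
  assumes k0: "k > 0" and coprime_k: "coprime k C" and ell_def: "ell = ord k C"
    and \<zeta>: "primitive_root_of_unity k \<zeta>"
begin

lemma ell_pos: "ell > 0" using coprime_k by (simp add: ell_def ord_eq_0 zero_less_iff_neq_zero)

lemma C_power_ell: "[C ^ ell = 1] (mod k)" using coprime_ord[OF coprime_k] by (simp add: ell_def)

lemma root_fixed: "x ^ k = 1 \<Longrightarrow> x \<in> fixed_field ell"
  unfolding fixed_field_def using power_cong_exponent[OF _ C_power_ell, of x] by simp

lemma primitive_root_iff:
  assumes "primitive_root_of_unity k \<xi>"
  shows "(\<xi> :: 'f alg_closure) ^ i = 1 \<longleftrightarrow> k dvd i"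
proof -
  have k1: "\<xi> ^ k = 1" using assms by (simp add: primitive_root_of_unity_def)
  have "\<xi> ^ i = \<xi> ^ (i mod k)" by (rule power_cong_exponent[OF k1]) (simp add: cong_def)
  moreover have "i mod k < k" using k0 by simp
  ultimately show ?thesis using assms
    by (metis primitive_root_of_unity_def mod_greater_zero_iff_not_dvd mod_0_imp_dvd power_0 dvd_imp_mod_0)
qed

lemma root_is_power:
  assumes "primitive_root_of_unity k \<xi>" "(x :: 'f alg_closure) ^ k = 1"
  shows "\<exists>j. x = \<xi> ^ j"
proof -
  let ?p = "monom 1 k - 1 :: 'f alg_closure poly"
  have p: "?p \<noteq> 0"
  proof
    assume "?p = 0"
    hence "Polynomial.coeff ?p k = 0" by simp
    thus False using k0 by simp
  qed
  have r: "{x. poly ?p x = 0} = {x::'f alg_closure. x ^ k = 1}" by (simp add: poly_monom)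
  note eq = power_primitive_eq_iff[OF primitive_root_iff[OF assms(1)] k0]
  have inj: "inj_on (\<lambda>j. \<xi> ^ j) {..<k}"
    using eq by (auto simp: inj_on_def cong_def)
  have "(\<lambda>j. \<xi> ^ j) ` {..<k} = {x::'f alg_closure. x ^ k = 1}"
  proof (rule card_seteq)
    show "finite {x::'f alg_closure. x ^ k = 1}" using poly_roots_finite[OF p] r by simp
    show "(\<lambda>j. \<xi> ^ j) ` {..<k} \<subseteq> {x. x ^ k = 1}"
      using primitive_root_iff[OF assms(1), of "_ * k"] by (auto simp flip: power_mult)
    have "Polynomial.degree ?p \<le> k" by (intro degree_diff_le) (auto simp: degree_monom_le)
    thus "card {x::'f alg_closure. x ^ k = 1} \<le> card ((\<lambda>j. \<xi> ^ j) ` {..<k})"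
      using card_poly_roots_bound[OF p] r inj by (simp add: card_image)
  qed
  thus ?thesis using assms(2) by blast
qed

text \<open>The choice hidden inside \<open>cyclotomic_extension\<close>. It need not be
  \<open>\<zeta>\<close>, whose role is to guarantee that the choice yields a primitive
  root.\<close>

definition root :: "'f alg_closure" where "root = (SOME \<xi>. primitive_root_of_unity k \<xi>)"
lemma root: "primitive_root_of_unity k root" unfolding root_def using \<zeta> by (rule someI)

definition L where "L = (cyclotomic_extension k :: 'f alg_closure set)"

lemma L_eq: "L = generate_field ring_of_type_algebra (range to_ac \<union> {root})"
  by (simp add: L_def cyclotomic_extension_def root_def)

lemma L_closed:
  "to_ac a \<in> L" "root \<in> L" "1 \<in> L" "0 \<in> L"
  "x \<in> L \<Longrightarrow> y \<in> L \<Longrightarrow> x + y \<in> L" "x \<in> L \<Longrightarrow> y \<in> L \<Longrightarrow> x * y \<in> L"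
proof -
  let ?R = "ring_of_type_algebra :: 'f alg_closure ring"
  show "to_ac a \<in> L" "root \<in> L" by (auto simp: L_eq intro: generate_field.incl)
  show "1 \<in> L" using generate_field.one[of ?R "range to_ac \<union> {root}"] by (simp add: L_eq)
  show "0 \<in> L" using generate_field.incl[of "to_ac 0" "range to_ac \<union> {root}" ?R] by (simp add: L_eq)
  show "x \<in> L \<Longrightarrow> y \<in> L \<Longrightarrow> x + y \<in> L" "x \<in> L \<Longrightarrow> y \<in> L \<Longrightarrow> x * y \<in> L"
    using generate_field.eng_add[of x ?R "range to_ac \<union> {root}" y]
      generate_field.eng_mult[of x ?R "range to_ac \<union> {root}" y] by (simp_all add: L_eq)
qed

lemma L_power: "x \<in> L \<Longrightarrow> x ^ i \<in> L" by (induction i) (auto intro: L_closed)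

lemma root_L: "x ^ k = 1 \<Longrightarrow> x \<in> L"
  using root_is_power[OF root] L_power[OF L_closed(2)] by metis

lemma L_induct [consumes 1, case_names base root uminus inverse add mult]:
  assumes "x \<in> L" and "\<And>a. P (to_ac a)" and "P root"
    and "\<And>x. x \<in> L \<Longrightarrow> P x \<Longrightarrow> P (- x)" and "\<And>x. x \<in> L \<Longrightarrow> x \<noteq> 0 \<Longrightarrow> inverse x \<in> L \<Longrightarrow> P x \<Longrightarrow> P (inverse x)"
    and "\<And>x y. x \<in> L \<Longrightarrow> y \<in> L \<Longrightarrow> P x \<Longrightarrow> P y \<Longrightarrow> P (x + y)"
    and "\<And>x y. x \<in> L \<Longrightarrow> y \<in> L \<Longrightarrow> P x \<Longrightarrow> P y \<Longrightarrow> P (x * y)"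
  shows "P x"
  using assms(1) unfolding L_eq
proof (induction rule: generate_field.induct)
  case one
  show ?case using assms(2)[of 1] by simp
next
  case (incl h)
  thus ?case using assms(2,3) by auto
next
  case (a_inv h)
  thus ?case using assms(4) by (simp add: L_eq)
next
  case (m_inv h)
  have "inverse h \<in> L" using generate_field.m_inv[OF m_inv(1,2)] m_inv by (simp add: L_eq)
  thus ?case using assms(5)[of h] m_inv by (simp add: L_eq)
next
  case (eng_add x y)
  thus ?case using assms(6)[of x y] by (simp add: L_eq)
next
  case (eng_mult x y)
  thus ?case using assms(7)[of x y] by (simp add: L_eq)
qed

lemma L_fixed: "x \<in> L \<Longrightarrow> x \<in> fixed_field ell"
proof (induction rule: L_induct)
  show "root \<in> fixed_field ell" using root by (intro root_fixed) (simp add: primitive_root_of_unity_def)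
qed (auto intro: fixed_field_closed)

definition frob :: "nat \<Rightarrow> 'f alg_closure \<Rightarrow> 'f alg_closure" where
  "frob i = restrict (\<lambda>x. x ^ (C ^ i)) L"

lemma frob_galois: "frob i \<in> galois_group L (range to_ac)"
proof -
  have "bij_betw (\<lambda>x. x ^ (C ^ i)) L L"
  proof (rule bij_betw_imageI)
    show "inj_on (\<lambda>x. x ^ (C ^ i)) L" by (auto simp: inj_on_def frobenius_inj)
    show "(\<lambda>x. x ^ (C ^ i)) ` L = L"
    proof (intro equalityI subsetI)
      fix y assume y: "y \<in> L"
      \<comment> \<open>On \<open>L\<close>, applying Frobenius \<open>ell * i\<close> times is the
        identity, so \<open>(ell - 1) * i\<close> applications produce a preimage.\<close>
      have "(y ^ (C ^ ((ell - 1) * i))) ^ (C ^ i) = y ^ (C ^ ((ell - 1) * i + i))"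
        by (simp add: power_add power_mult)
      also have "(ell - 1) * i + i = ell * i" using ell_pos by (cases ell) auto
      also have "y ^ (C ^ (ell * i)) = y" by (rule fixed_field_power[OF L_fixed[OF y]])
      finally show "y \<in> (\<lambda>x. x ^ (C ^ i)) ` L" using L_power[OF y] by (metis imageI)
    qed (auto intro: L_power)
  qed
  hence "bij_betw (frob i) L L" by (simp add: frob_def bij_betw_restrict_eq)
  thus ?thesis
    by (auto simp: galois_group_def ring_iso_def ring_hom_def frob_def L_closed L_power frobenius_add
        power_mult_distrib frobenius_base)
qed

lemma map_poly_frobenius_mult:
  "map_poly (\<lambda>x. x ^ C) (f * g :: 'f alg_closure poly) = map_poly (\<lambda>x. x ^ C) f * map_poly (\<lambda>x. x ^ C) g"
proof (rule poly_eqI)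
  fix n
  have 0: "(0 :: 'f alg_closure) ^ C = 0" using C_gt_1 by (simp add: power_0_left)
  show "Polynomial.coeff (map_poly (\<lambda>x. x ^ C) (f * g)) n =
      Polynomial.coeff (map_poly (\<lambda>x. x ^ C) f * map_poly (\<lambda>x. x ^ C) g) n"
    by (simp add: coeff_map_poly 0 coeff_mult power_mult_distrib frobenius_sum[of _ _ 1, unfolded power_one_right])
qed

definition orbit_poly :: "'f alg_closure poly" where
  "orbit_poly = (\<Prod>i<ell. [:- (root ^ (C ^ i)), 1:])"

text \<open>Raising the coefficients to the \<open>C\<close>-th power is multiplicative on
  polynomials and permutes the linear factors cyclically. Each coefficient is therefore fixed by
  Frobenius and lies in the base field.\<close>

lemma orbit_poly_coeff: "Polynomial.coeff orbit_poly j \<in> range to_ac"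
proof -
  have 0: "(0 :: 'f alg_closure) ^ C = 0" using C_gt_1 by (simp add: power_0_left)
  have 1: "map_poly (\<lambda>x. x ^ C) [:- (root ^ (C ^ i)), 1:] = [:- (root ^ (C ^ Suc i)), 1:]" for i
    using frobenius_uminus[of _ 1] C_gt_1 by (simp add: map_poly_pCons 0 power_mult[symmetric] mult.commute)
  have "map_poly (\<lambda>x. x ^ C) (\<Prod>i<n. [:- (root ^ (C ^ i)), 1:]) = (\<Prod>i<n. [:- (root ^ (C ^ Suc i)), 1:])" for n
  proof (induction n)
    case (Suc n)
    thus ?case by (simp only: prod.lessThan_Suc map_poly_frobenius_mult 1)
  qed (simp add: map_poly_1')
  hence "map_poly (\<lambda>x. x ^ C) orbit_poly = (\<Prod>i<ell. [:- (root ^ (C ^ Suc i)), 1:])"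
    by (simp add: orbit_poly_def)
  also have "\<dots> = orbit_poly"
  proof -
    obtain n where n: "ell = Suc n" using ell_pos by (cases ell) auto
    have "root ^ (C ^ Suc n) = root ^ (C ^ 0)"
      using L_fixed[OF L_closed(2)] by (simp add: fixed_field_def n)
    hence "(\<Prod>i<Suc n. [:- (root ^ (C ^ Suc i)), 1:]) = (\<Prod>i<Suc n. [:- (root ^ (C ^ i)), 1:])"
      unfolding prod.lessThan_Suc_shift[of "\<lambda>i. [:- (root ^ (C ^ i)), 1:]"]
      by (simp only: prod.lessThan_Suc mult.commute)
    thus ?thesis unfolding n[symmetric] by (simp only: orbit_poly_def)
  qed
  finally have "Polynomial.coeff orbit_poly j ^ C = Polynomial.coeff orbit_poly j"
    by (metis coeff_map_poly 0)
  thus ?thesis by (simp add: range_to_ac C_def)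
qed

text \<open>An automorphism over the base field sends \<open>root\<close> to a root of
  \<open>orbit_poly\<close>, that is, to a Frobenius power of \<open>root\<close>, and it is
  determined by this value because \<open>root\<close> generates the extension.\<close>

lemma galois_frob:
  assumes \<sigma>: "\<sigma> \<in> galois_group L (range to_ac)"
  shows "\<exists>i<ell. \<sigma> = frob i"
proof -
  have add: "\<sigma> (x + y) = \<sigma> x + \<sigma> y" and mult: "\<sigma> (x * y) = \<sigma> x * \<sigma> y" if "x \<in> L" "y \<in> L" for x y
    using \<sigma> that by (auto simp: galois_group_def ring_iso_def ring_hom_def)
  have ext: "\<sigma> \<in> extensional L" using \<sigma> by (simp add: galois_group_def)
  have base: "\<sigma> (to_ac a) = to_ac a" for a using \<sigma> by (simp add: galois_group_def)
  have zero: "\<sigma> 0 = 0" and one: "\<sigma> 1 = 1" using base[of 0] base[of 1] by simp_all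
  have sum: "\<sigma> (\<Sum>i\<in>A. f i) = (\<Sum>i\<in>A. \<sigma> (f i)) \<and> (\<Sum>i\<in>A. f i) \<in> L" if "\<And>i. f i \<in> L" for f :: "nat \<Rightarrow> _" and A
    by (induction A rule: infinite_finite_induct) (auto simp: zero add that L_closed)
  have pow: "\<sigma> (x ^ i) = \<sigma> x ^ i" if "x \<in> L" for x i
    by (induction i) (auto simp: one mult that L_power)
  have "poly orbit_poly (\<sigma> root) = (\<Sum>i\<le>Polynomial.degree orbit_poly. Polynomial.coeff orbit_poly i * \<sigma> root ^ i)"
    by (rule poly_altdef)
  also have "\<dots> = (\<Sum>i\<le>Polynomial.degree orbit_poly. \<sigma> (Polynomial.coeff orbit_poly i * root ^ i))"
  proof -
    have "Polynomial.coeff orbit_poly i * \<sigma> root ^ i = \<sigma> (Polynomial.coeff orbit_poly i * root ^ i)" for i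
    proof -
      obtain a where a: "Polynomial.coeff orbit_poly i = to_ac a" using orbit_poly_coeff by blast
      show ?thesis by (simp add: a mult L_closed L_power base pow)
    qed
    thus ?thesis by simp
  qed
  also have "\<dots> = \<sigma> (poly orbit_poly root)"
  proof -
    have "Polynomial.coeff orbit_poly i * root ^ i \<in> L" for i
      using orbit_poly_coeff[of i] by (auto intro!: L_closed L_power)
    thus ?thesis unfolding poly_altdef
      using sum[of "\<lambda>i. Polynomial.coeff orbit_poly i * root ^ i" "{..Polynomial.degree orbit_poly}"] by simp
  qed
  also have "poly orbit_poly root = 0"
    using ell_pos by (force simp: orbit_poly_def poly_prod)
  finally have "poly orbit_poly (\<sigma> root) = 0" by (simp add: zero)
  then obtain i where i: "i < ell" "\<sigma> root = root ^ (C ^ i)"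
    by (auto simp: orbit_poly_def poly_prod)
  have "\<sigma> x = x ^ (C ^ i)" if "x \<in> L" for x
    using that
  proof (induction rule: L_induct)
    case (uminus x)
    have "\<sigma> (- 1) = - 1" using base[of "- 1"] by simp
    moreover have "- 1 \<in> L" using L_closed(1)[of "- 1"] by simp
    ultimately show ?case using mult[of "- 1" x] uminus by (simp add: frobenius_uminus)
  next
    case (inverse x)
    have "\<sigma> x * \<sigma> (inverse x) = 1" using mult[of x "inverse x"] inverse by (simp add: one)
    thus ?case using inverse(4) by (simp add: power_inverse inverse_unique[symmetric])
  qed (auto simp: base frobenius_base i add mult frobenius_add power_mult_distrib)
  hence "\<sigma> = frob i" using ext by (auto simp: frob_def extensional_def)
  thus ?thesis using i by blast
qed

text \<open>The Frobenius powers below \<open>ell\<close> exhaust the Galois group and are distinct,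
  already on \<open>root\<close>, because \<open>ell\<close> is the order of \<open>C\<close> modulo
  \<open>k\<close>. The abstract trace thereby becomes an explicit sum.\<close>

lemma field_trace_eq:
  assumes "x \<in> L"
  shows "field_trace L (range to_ac) x = (\<Sum>i<ell. x ^ (C ^ i))"
proof -
  have "galois_group L (range to_ac) = frob ` {..<ell}"
    using frob_galois galois_frob by blast
  moreover have inj: "inj_on frob {..<ell}"
  proof (rule linorder_inj_onI)
    fix i j assume ij: "i < j" "i \<in> {..<ell}" "j \<in> {..<ell}"
    show "frob i \<noteq> frob j"
    proof
      assume "frob i = frob j"
      hence "frob i root = frob j root" by simp
      hence "root ^ (C ^ i) = (root ^ (C ^ (j - i))) ^ (C ^ i)"
        using ij by (simp add: frob_def L_closed power_mult[symmetric] power_add[symmetric])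
      hence "root ^ 1 = root ^ (C ^ (j - i))" using frobenius_inj by (metis power_one_right)
      hence "[C ^ (j - i) = 1] (mod k)"
        using power_primitive_eq_iff[OF primitive_root_iff[OF root] k0] cong_sym by blast
      hence "ell dvd j - i" unfolding ell_def by (rule ord_divides[THEN iffD1])
      thus False using ij by (auto dest: dvd_imp_le)
    qed
  qed auto
  ultimately have "field_trace L (range to_ac) x = (\<Sum>i<ell. frob i x)"
    using sum.reindex[OF inj, of "\<lambda>\<sigma>. \<sigma> x"] by (simp add: field_trace_def o_def)
  thus ?thesis using assms by (simp add: frob_def)
qed

lemma cyclotomic_trace_eq:
  "(x :: 'f alg_closure) ^ k = 1 \<Longrightarrow> cyclotomic_trace k x = of_ac (\<Sum>i<ell. x ^ (C ^ i))"
  unfolding cyclotomic_trace_def L_def[symmetric] using field_trace_eq root_L by simp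

end

section \<open>The left regular representation\<close>

section \<open>Group algebras acting by convolution\<close>

text \<open>Additive endomorphisms form a ring on a whole type, so the lemmas proved for class
  \<open>ring_1\<close> become applicable to the group algebra. The sort \<open>zero_neq_one\<close>
  provides two distinct elements, which makes the zero map different from the identity.\<close>

typedef (overloaded) 'v endo =
  "{f :: 'v::{ab_group_add,zero_neq_one} \<Rightarrow> 'v. \<forall>x y. f (x + y) = f x + f y}"
  by (rule exI[of _ "\<lambda>x. x"]) simp

setup_lifting type_definition_endo

instantiation endo :: ("{ab_group_add,zero_neq_one}") ring_1
begin

lift_definition zero_endo :: "'a endo" is "\<lambda>_. 0" by simp
lift_definition one_endo :: "'a endo" is "\<lambda>x. x" by simp
lift_definition plus_endo :: "'a endo \<Rightarrow> 'a endo \<Rightarrow> 'a endo" is "\<lambda>f g x. f x + g x"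
  by (simp add: algebra_simps)
lift_definition uminus_endo :: "'a endo \<Rightarrow> 'a endo" is "\<lambda>f x. - f x" by simp
lift_definition minus_endo :: "'a endo \<Rightarrow> 'a endo \<Rightarrow> 'a endo" is "\<lambda>f g x. f x - g x"
  by (simp add: algebra_simps)
lift_definition times_endo :: "'a endo \<Rightarrow> 'a endo \<Rightarrow> 'a endo" is "\<lambda>f g x. f (g x)" by simp

instance
proof
  show "(0 :: 'a endo) \<noteq> 1"
    by transfer (metis zero_neq_one)
qed (transfer; simp add: fun_eq_iff algebra_simps)+

end

lemma group_algebra_simps:
  "carrier (group_algebra G) = {\<alpha>. \<forall>x. x \<notin> carrier G \<longrightarrow> \<alpha> x = 0}"
  "\<one>\<^bsub>group_algebra G\<^esub> = (\<lambda>x. if x = \<one>\<^bsub>G\<^esub> then 1 else 0)"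
  "\<zero>\<^bsub>group_algebra G\<^esub> = 0"
  "\<alpha> \<oplus>\<^bsub>group_algebra G\<^esub> \<beta> = \<alpha> + \<beta>"
  "\<alpha> \<otimes>\<^bsub>group_algebra G\<^esub> \<beta> = (\<lambda>z. if z \<in> carrier G then \<Sum>x\<in>carrier G. \<alpha> x * \<beta> (inv\<^bsub>G\<^esub> x \<otimes>\<^bsub>G\<^esub> z) else 0)"
  by (simp_all add: group_algebra_def fun_eq_iff)

abbreviation convolve ("(_ \<star>\<index> _)" [71, 70] 70) where
  "\<alpha> \<star>\<^bsub>G\<^esub> \<beta> \<equiv> \<alpha> \<otimes>\<^bsub>group_algebra G\<^esub> \<beta>"

locale finite_group = group G for G (structure) +
  assumes finite_G: "finite (carrier G)"
begin

lemma sum_translate: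
  assumes "g \<in> carrier G"
  shows "(\<Sum>x\<in>carrier G. f (g \<otimes> x)) = (\<Sum>x\<in>carrier G. f x)"
  by (rule sum.reindex_bij_witness[of _ "\<lambda>x. inv g \<otimes> x" "\<lambda>x. g \<otimes> x"])
    (use assms in \<open>auto simp: m_assoc[symmetric]\<close>)

lemma convolve_apply:
  "z \<in> carrier G \<Longrightarrow> (\<alpha> \<star> \<beta>) z = (\<Sum>x\<in>carrier G. \<alpha> x * \<beta> (inv x \<otimes> z))"
  by (simp add: group_algebra_simps)

lemma convolve_outside: "z \<notin> carrier G \<Longrightarrow> (\<alpha> \<star> \<beta>) z = 0"
  by (simp add: group_algebra_simps)

lemma convolve_closed: "\<alpha> \<star> \<beta> \<in> carrier (group_algebra G)"
  by (simp add: group_algebra_simps)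

lemma convolve_assoc: "(\<alpha> \<star> \<beta>) \<star> \<gamma> = \<alpha> \<star> (\<beta> \<star> \<gamma>)"
proof
  fix z
  show "((\<alpha> \<star> \<beta>) \<star> \<gamma>) z = (\<alpha> \<star> (\<beta> \<star> \<gamma>)) z"
  proof (cases "z \<in> carrier G")
    case z: True
    have "((\<alpha> \<star> \<beta>) \<star> \<gamma>) z = (\<Sum>x\<in>carrier G. \<Sum>y\<in>carrier G. \<alpha> y * \<beta> (inv y \<otimes> x) * \<gamma> (inv x \<otimes> z))"
      by (simp add: convolve_apply z sum_distrib_right)
    also have "\<dots> = (\<Sum>y\<in>carrier G. \<Sum>x\<in>carrier G. \<alpha> y * \<beta> (inv y \<otimes> x) * \<gamma> (inv x \<otimes> z))"
      by (rule sum.swap)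
    also have "\<dots> = (\<Sum>y\<in>carrier G. \<alpha> y * (\<beta> \<star> \<gamma>) (inv y \<otimes> z))"
    proof (intro sum.cong HOL.refl)
      fix y assume y: "y \<in> carrier G"
      have "(\<Sum>x\<in>carrier G. \<alpha> y * \<beta> (inv y \<otimes> x) * \<gamma> (inv x \<otimes> z)) =
          (\<Sum>x\<in>carrier G. \<alpha> y * \<beta> (inv y \<otimes> (y \<otimes> x)) * \<gamma> (inv (y \<otimes> x) \<otimes> z))"
        by (rule sum_translate[OF y, symmetric])
      also have "\<dots> = \<alpha> y * (\<beta> \<star> \<gamma>) (inv y \<otimes> z)"
        using y z by (simp add: convolve_apply sum_distrib_left mult.assoc inv_mult_group m_assoc)
          (simp add: m_assoc[symmetric])
      finally show "(\<Sum>x\<in>carrier G. \<alpha> y * \<beta> (inv y \<otimes> x) * \<gamma> (inv x \<otimes> z)) = \<alpha> y * (\<beta> \<star> \<gamma>) (inv y \<otimes> z)" .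
    qed
    finally show ?thesis using z by (simp add: convolve_apply)
  qed (simp add: convolve_outside)
qed

lemma single_convolve:
  assumes g: "g \<in> carrier G" and z: "z \<in> carrier G"
  shows "(single g \<star> \<alpha>) z = \<alpha> (inv g \<otimes> z)"
proof -
  have "(single g \<star> \<alpha>) z = (\<Sum>x\<in>carrier G. if x = g then \<alpha> (inv g \<otimes> z) else 0)"
    using z by (simp add: convolve_apply single_def) (intro sum.cong, auto)
  thus ?thesis using g finite_G by simp
qed

lemma convolve_single:
  assumes g: "g \<in> carrier G" and z: "z \<in> carrier G"
  shows "(\<alpha> \<star> single g) z = \<alpha> (z \<otimes> inv g)"
proof -
  have "inv x \<otimes> z = g \<longleftrightarrow> x = z \<otimes> inv g" if "x \<in> carrier G" for x
    using that g z by (metis inv_closed inv_solve_left inv_solve_right m_closed)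
  hence "(\<alpha> \<star> single g) z = (\<Sum>x\<in>carrier G. if x = z \<otimes> inv g then \<alpha> (z \<otimes> inv g) else 0)"
    using z by (simp add: convolve_apply single_def) (intro sum.cong, auto)
  thus ?thesis using g z finite_G by simp
qed

lemma one_single: "\<one>\<^bsub>group_algebra G\<^esub> = single \<one>"
  by (simp add: group_algebra_simps single_def)

lemma group_algebra_ring: "ring (group_algebra G :: ('a \<Rightarrow> 'f::field) ring)"
proof (rule ringI)
  show "abelian_group (group_algebra G :: ('a \<Rightarrow> 'f) ring)"
  proof (rule abelian_groupI)
    fix \<alpha> :: "'a \<Rightarrow> 'f" assume "\<alpha> \<in> carrier (group_algebra G)"
    thus "\<exists>\<beta>\<in>carrier (group_algebra G). \<beta> \<oplus>\<^bsub>group_algebra G\<^esub> \<alpha> = \<zero>\<^bsub>group_algebra G\<^esub>"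
      by (intro bexI[of _ "- \<alpha>"]) (auto simp: group_algebra_simps)
  qed (auto simp: group_algebra_simps add_ac)
  show "Group.monoid (group_algebra G :: ('a \<Rightarrow> 'f) ring)"
  proof (rule monoidI)
    fix \<alpha> :: "'a \<Rightarrow> 'f" assume a: "\<alpha> \<in> carrier (group_algebra G)"
    show "\<one>\<^bsub>group_algebra G\<^esub> \<star> \<alpha> = \<alpha>"
    proof
      fix z show "(\<one>\<^bsub>group_algebra G\<^esub> \<star> \<alpha>) z = \<alpha> z" unfolding one_single
        using a by (cases "z \<in> carrier G") (auto simp: single_convolve convolve_outside group_algebra_simps(1))
    qed
    show "\<alpha> \<star> \<one>\<^bsub>group_algebra G\<^esub> = \<alpha>"
    proof
      fix z show "(\<alpha> \<star> \<one>\<^bsub>group_algebra G\<^esub>) z = \<alpha> z" unfolding one_single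
        using a by (cases "z \<in> carrier G") (auto simp: convolve_single convolve_outside group_algebra_simps(1))
    qed
  qed (auto simp: convolve_assoc convolve_closed, simp add: group_algebra_simps)
qed (simp_all add: group_algebra_simps fun_eq_iff algebra_simps sum.distrib)

text \<open>The operator acts on all functions, including those not supported on \<open>G\<close>.
  Therefore \<open>grp \<one>\<close> is the restriction to functions supported on \<open>G\<close>
  and need not be 1; later products keep it as an explicit factor until it is absorbed.\<close>

definition conv :: "('a \<Rightarrow> 'f::field) \<Rightarrow> ('a \<Rightarrow> 'f) endo" where
  "conv \<alpha> = Abs_endo (\<lambda>\<beta>. \<alpha> \<star> \<beta>)"

lemma Rep_conv:
  fixes \<alpha> \<beta> :: "'a \<Rightarrow> 'f::field"
  shows "Rep_endo (conv \<alpha>) \<beta> = \<alpha> \<star> \<beta>"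
proof -
  have "\<alpha> \<star> (x + y) = \<alpha> \<star> x + \<alpha> \<star> y" for x y :: "'a \<Rightarrow> 'f"
    by (simp add: group_algebra_simps fun_eq_iff algebra_simps sum.distrib)
  thus ?thesis by (simp add: conv_def Abs_endo_inverse)
qed

lemma conv_mult: "conv (\<alpha> \<star> \<beta>) = conv \<alpha> * conv \<beta>"
  by (rule Rep_endo_inject[THEN iffD1]) (simp add: fun_eq_iff times_endo.rep_eq Rep_conv convolve_assoc)

lemma conv_add: "conv (\<alpha> + \<beta>) = conv \<alpha> + conv \<beta>"
  by (rule Rep_endo_inject[THEN iffD1], rule ext)
    (simp add: plus_endo.rep_eq Rep_conv group_algebra_simps fun_eq_iff algebra_simps sum.distrib)

lemma conv_zero: "conv 0 = 0"
  by (rule Rep_endo_inject[THEN iffD1], rule ext)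
    (simp add: zero_endo.rep_eq Rep_conv group_algebra_simps fun_eq_iff)

text \<open>Applying both operators to the unit recovers the elements. Identities between operators
  return to the group algebra in this way.\<close>

lemma conv_inject:
  assumes "\<alpha> \<in> carrier (group_algebra G)" "\<beta> \<in> carrier (group_algebra G)"
  shows "conv \<alpha> = conv \<beta> \<longleftrightarrow> \<alpha> = \<beta>"
proof
  assume "conv \<alpha> = conv \<beta>"
  hence "\<alpha> \<star> \<one>\<^bsub>group_algebra G\<^esub> = \<beta> \<star> \<one>\<^bsub>group_algebra G\<^esub>" using Rep_conv by metis
  thus "\<alpha> = \<beta>" using assms ring.ring_simprules(11)[OF group_algebra_ring]
    by (metis Group.monoid.r_one group_algebra_ring ring.is_monoid)
qed simp

lemma conv_sum: "conv (sum f A) = (\<Sum>i\<in>A. conv (f i))"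
proof (induction A rule: infinite_finite_induct)
  case (insert x F)
  thus ?case by (simp only: sum.insert[OF insert(1,2)] conv_add)
next
  case (infinite A)
  show ?case unfolding sum.infinite[OF infinite] by (rule conv_zero)
next
  case empty
  show ?case unfolding sum.empty by (rule conv_zero)
qed

lemma finsum_eq_sum:
  fixes f :: "'i \<Rightarrow> 'a \<Rightarrow> 'f::field"
  assumes "f \<in> A \<rightarrow> carrier (group_algebra G)"
  shows "finsum (group_algebra G) f A = sum f A"
proof -
  interpret R: ring "group_algebra G :: ('a \<Rightarrow> 'f) ring" by (rule group_algebra_ring)
  show ?thesis using assms
  proof (induction A rule: infinite_finite_induct)
    case (insert x F)
    thus ?case by (simp add: R.finsum_insert Pi_iff group_algebra_simps(4))
  qed (simp_all add: group_algebra_simps)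
qed

definition grp :: "'a \<Rightarrow> ('a \<Rightarrow> 'f::field) endo" where "grp g = conv (single g)"
definition scalar :: "'f::field \<Rightarrow> ('a \<Rightarrow> 'f) endo" where "scalar c = conv (scale c (single \<one>))"

lemma single_closed: "g \<in> carrier G \<Longrightarrow> single g \<in> carrier (group_algebra G)"
  by (auto simp: group_algebra_simps single_def)

lemma grp_mult:
  assumes gh: "g \<in> carrier G" "h \<in> carrier G"
  shows "grp g * grp h = (grp (g \<otimes> h) :: ('a \<Rightarrow> 'f::field) endo)"
proof -
  have "single g \<star> single h = (single (g \<otimes> h) :: 'a \<Rightarrow> 'f)"
  proof
    fix z
    show "(single g \<star> single h) z = (single (g \<otimes> h) :: 'a \<Rightarrow> 'f) z"
    proof (cases "z \<in> carrier G")
      case z: True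
      have "inv g \<otimes> z = h \<longleftrightarrow> z = g \<otimes> h" using gh z inv_solve_left[of h g z] by auto
      thus ?thesis using single_convolve[OF gh(1) z, of "single h :: 'a \<Rightarrow> 'f"] by (simp add: single_def)
    next
      case False
      hence "z \<noteq> g \<otimes> h" using gh by auto
      thus ?thesis using convolve_outside[OF False] by (simp add: single_def)
    qed
  qed
  thus ?thesis by (simp add: grp_def flip: conv_mult)
qed

lemma grp_one_left: "\<alpha> \<in> carrier (group_algebra G) \<Longrightarrow> grp \<one> * conv \<alpha> = conv \<alpha>"
  using ring.is_monoid[OF group_algebra_ring] Group.monoid.l_one
  by (fastforce simp: grp_def one_single simp flip: conv_mult)

lemma grp_one_right: "\<alpha> \<in> carrier (group_algebra G) \<Longrightarrow> conv \<alpha> * grp \<one> = conv \<alpha>"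
  using ring.is_monoid[OF group_algebra_ring] Group.monoid.r_one
  by (fastforce simp: grp_def one_single simp flip: conv_mult)

lemma scale_convolve: "scale c \<alpha> \<star> \<beta> = scale c (\<alpha> \<star> \<beta>)" "\<alpha> \<star> scale c \<beta> = scale c (\<alpha> \<star> \<beta>)"
  by (simp_all add: group_algebra_simps scale_def fun_eq_iff sum_distrib_left mult_ac)

lemma scale_closed: "\<alpha> \<in> carrier (group_algebra G) \<Longrightarrow> scale c \<alpha> \<in> carrier (group_algebra G)"
  by (simp add: group_algebra_simps scale_def)

lemma scalar_left: "\<alpha> \<in> carrier (group_algebra G) \<Longrightarrow> scalar c * conv \<alpha> = conv (scale c \<alpha>)"
proof -
  assume a: "\<alpha> \<in> carrier (group_algebra G)"
  have "single \<one> \<star> \<alpha> = \<alpha>"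
    using Group.monoid.l_one[OF ring.is_monoid[OF group_algebra_ring] a] by (simp add: one_single)
  thus ?thesis by (simp add: scalar_def scale_convolve flip: conv_mult)
qed

lemma scalar_right: "\<alpha> \<in> carrier (group_algebra G) \<Longrightarrow> conv \<alpha> * scalar c = conv (scale c \<alpha>)"
proof -
  assume a: "\<alpha> \<in> carrier (group_algebra G)"
  have "\<alpha> \<star> single \<one> = \<alpha>"
    using Group.monoid.r_one[OF ring.is_monoid[OF group_algebra_ring] a] by (simp add: one_single)
  thus ?thesis by (simp add: scalar_def scale_convolve flip: conv_mult)
qed

lemma conv_expand:
  fixes \<alpha> :: "'a \<Rightarrow> 'f::field"
  assumes "\<alpha> \<in> carrier (group_algebra G)"
  shows "conv \<alpha> = (\<Sum>g\<in>carrier G. scalar (\<alpha> g) * grp g)"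
proof -
  have app: "sum f A x = (\<Sum>a\<in>A. f a x)" for f :: "'a \<Rightarrow> 'a \<Rightarrow> 'f" and A x
    by (induction A rule: infinite_finite_induct) auto
  have "\<alpha> = (\<Sum>g\<in>carrier G. scale (\<alpha> g) (single g))"
  proof
    fix x
    have "(\<Sum>g\<in>carrier G. scale (\<alpha> g) (single g)) x = (\<Sum>g\<in>carrier G. if g = x then \<alpha> g else 0)"
      unfolding app by (intro sum.cong) (auto simp: scale_def single_def)
    thus "\<alpha> x = (\<Sum>g\<in>carrier G. scale (\<alpha> g) (single g)) x"
      using assms finite_G by (simp add: group_algebra_simps(1))
  qed
  hence "conv \<alpha> = conv (\<Sum>g\<in>carrier G. scale (\<alpha> g) (single g))" by simp
  also have "\<dots> = (\<Sum>g\<in>carrier G. scalar (\<alpha> g) * grp g)"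
    unfolding conv_sum by (intro sum.cong HOL.refl) (simp add: grp_def scalar_left single_closed)
  finally show ?thesis .
qed

lemma average_closed: "M \<subseteq> carrier G \<Longrightarrow> average M \<in> carrier (group_algebra G)"
  by (auto simp: average_def group_algebra_simps)

lemma conv_average:
  assumes "M \<subseteq> carrier G"
  shows "conv (average M :: 'a \<Rightarrow> 'f::field) = scalar (inverse (of_nat (card M))) * (\<Sum>h\<in>M. grp h)"
proof -
  have "conv (average M :: 'a \<Rightarrow> 'f) = (\<Sum>g\<in>carrier G. scalar (average M g) * grp g)"
    by (rule conv_expand[OF average_closed[OF assms]])
  also have "\<dots> = (\<Sum>g\<in>M. scalar (average M g) * grp g)"
  proof (rule sum.mono_neutral_right[OF finite_G assms], rule ballI)
    fix g assume "g \<in> carrier G - M"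
    hence "scalar (average M g) = (0 :: ('a \<Rightarrow> 'f) endo)"
      by (simp add: average_def scalar_def scale_def conv_zero[unfolded zero_fun_def])
    thus "scalar (average M g) * grp g = (0 :: ('a \<Rightarrow> 'f) endo)" by simp
  qed
  also have "\<dots> = scalar (inverse (of_nat (card M))) * (\<Sum>h\<in>M. grp h)"
    by (simp add: average_def sum_distrib_left)
  finally show ?thesis .
qed

end

section \<open>Transport of condition (SS3) to the finite field\<close>

section \<open>Strong Shoda pairs\<close>

lemma (in group) generate_commuting:
  assumes S: "S \<subseteq> carrier G" and comm: "\<And>x y. x \<in> S \<Longrightarrow> y \<in> S \<Longrightarrow> x \<otimes> y = y \<otimes> x"
  shows "comm_group (G\<lparr>carrier := generate G S\<rparr>)"
proof -
  have cent: "subgroup {x \<in> carrier G. x \<otimes> s = s \<otimes> x} G" if s: "s \<in> carrier G" for s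
  proof (rule subgroupI)
    fix x assume "x \<in> {x \<in> carrier G. x \<otimes> s = s \<otimes> x}"
    hence x: "x \<in> carrier G" "x \<otimes> s = s \<otimes> x" by auto
    have "inv x \<otimes> s = inv x \<otimes> (s \<otimes> x) \<otimes> inv x" using x s by (simp add: m_assoc)
    also have "\<dots> = inv x \<otimes> (x \<otimes> s) \<otimes> inv x" using x by simp
    also have "\<dots> = s \<otimes> inv x" using x(1) s by (simp add: m_assoc[symmetric])
    finally show "inv x \<in> {x \<in> carrier G. x \<otimes> s = s \<otimes> x}" using x by simp
  next
    fix x y assume "x \<in> {x \<in> carrier G. x \<otimes> s = s \<otimes> x}" "y \<in> {x \<in> carrier G. x \<otimes> s = s \<otimes> x}"
    hence xy: "x \<in> carrier G" "x \<otimes> s = s \<otimes> x" "y \<in> carrier G" "y \<otimes> s = s \<otimes> y" by auto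
    have "x \<otimes> y \<otimes> s = x \<otimes> (s \<otimes> y)" using xy s by (simp add: m_assoc)
    also have "\<dots> = (s \<otimes> x) \<otimes> y" using xy s by (simp add: m_assoc[symmetric])
    finally show "x \<otimes> y \<in> {x \<in> carrier G. x \<otimes> s = s \<otimes> x}" using xy s by (simp add: m_assoc)
  qed (use s in auto)
  have gc: "generate G S \<subseteq> carrier G" using S by (rule generate_incl)
  have 1: "x \<otimes> s = s \<otimes> x" if x: "x \<in> generate G S" and s: "s \<in> S" for x s
  proof -
    have "s \<in> carrier G" using s S by blast
    moreover have "S \<subseteq> {x \<in> carrier G. x \<otimes> s = s \<otimes> x}" using S comm s by blast
    ultimately show ?thesis using generate_subgroup_incl[OF _ cent] x by blast
  qed
  have 2: "x \<otimes> y = y \<otimes> x" if x: "x \<in> generate G S" and y: "y \<in> generate G S" for x y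
  proof -
    have yc: "y \<in> carrier G" using y gc by blast
    moreover have "S \<subseteq> {x \<in> carrier G. x \<otimes> y = y \<otimes> x}"
    proof
      fix s assume s: "s \<in> S"
      thus "s \<in> {x \<in> carrier G. x \<otimes> y = y \<otimes> x}" using 1[OF y s] S by auto
    qed
    ultimately show ?thesis using generate_subgroup_incl[OF _ cent] x by blast
  qed
  show ?thesis
    using group.group_comm_groupI[OF subgroup_imp_group[OF generate_is_subgroup[OF S]]] 2 by simp
qed

text \<open>\<open>finprod\<close> is designed for commutative monoids, but its underlying fold
  obeys the usual recursion as soon as the factors commute with one another.\<close>

lemma finprod_commuting_insert:
  fixes R (structure)
  assumes R: "Group.monoid R" and a: "\<And>M. M \<in> B \<Longrightarrow> a M \<in> carrier R"
    and comm: "\<And>M M'. M \<in> B \<Longrightarrow> M' \<in> B \<Longrightarrow> a M \<otimes> a M' = a M' \<otimes> a M"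
    and F: "finite F" "M \<notin> F" "insert M F \<subseteq> B"
  shows "finprod R a (insert M F) = a M \<otimes> finprod R a F" and "finprod R a F \<in> carrier R"
proof -
  interpret R: Group.monoid R by (rule R)
  interpret LCD B "carrier R" "(\<otimes>) \<circ> a"
  proof
    fix x y z assume xyz: "x \<in> B" "y \<in> B" "z \<in> carrier R"
    have "a x \<otimes> (a y \<otimes> z) = (a x \<otimes> a y) \<otimes> z" using xyz a by (simp add: R.m_assoc)
    also have "\<dots> = (a y \<otimes> a x) \<otimes> z" using comm xyz by simp
    also have "\<dots> = a y \<otimes> (a x \<otimes> z)" using xyz a by (simp add: R.m_assoc)
    finally show "((\<otimes>) \<circ> a) x (((\<otimes>) \<circ> a) y z) = ((\<otimes>) \<circ> a) y (((\<otimes>) \<circ> a) x z)" by simp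
  qed (use a in simp)
  show "finprod R a (insert M F) = a M \<otimes> finprod R a F"
    using foldD_insert[OF F(1,2), of "\<one>"] F by (simp add: finprod_def)
  show "finprod R a F \<in> carrier R"
    using foldD_closed[OF F(1), of "\<one>"] F by (simp add: finprod_def)
qed

context finite_group
begin

lemma group_algebra_minus:
  fixes \<alpha> \<beta> :: "'a \<Rightarrow> 'f::field"
  assumes "\<beta> \<in> carrier (group_algebra G)"
  shows "\<alpha> \<ominus>\<^bsub>group_algebra G\<^esub> \<beta> = \<alpha> - \<beta>"
proof -
  interpret R: ring "group_algebra G :: ('a \<Rightarrow> 'f) ring" by (rule group_algebra_ring)
  have m1: "- \<beta> \<in> carrier (group_algebra G)" using assms by (simp add: group_algebra_simps(1))
  have m2: "- \<beta> \<oplus>\<^bsub>group_algebra G\<^esub> \<beta> = \<zero>\<^bsub>group_algebra G\<^esub>"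
    unfolding group_algebra_simps(3,4) by (rule left_minus)
  have "\<ominus>\<^bsub>group_algebra G\<^esub> \<beta> = - \<beta>" by (rule R.minus_equality[OF m2 assms m1])
  thus ?thesis unfolding a_minus_def group_algebra_simps(4) by (simp only: add_uminus_conv_diff)
qed

lemma grp_sum_normalized:
  assumes x: "x \<in> carrier G" and M: "M \<subseteq> carrier G" and n: "\<And>y. y \<in> M \<Longrightarrow> x \<otimes> y \<otimes> inv x \<in> M"
    and n': "\<And>y. y \<in> M \<Longrightarrow> inv x \<otimes> y \<otimes> x \<in> M"
  shows "grp x * (\<Sum>y\<in>M. grp y) = (\<Sum>y\<in>M. grp y) * (grp x :: ('a \<Rightarrow> 'f::field) endo)"
proof -
  let ?u = "grp :: 'a \<Rightarrow> ('a \<Rightarrow> 'f) endo"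
  have Mc: "y \<in> carrier G" if "y \<in> M" for y using M that by blast
  have c1: "inv x \<otimes> (x \<otimes> y \<otimes> inv x) \<otimes> x = y" "x \<otimes> (inv x \<otimes> y \<otimes> x) \<otimes> inv x = y" if "y \<in> M" for y
    using x Mc[OF that] inv_solve_right[of y] by (simp_all add: m_assoc) (simp_all add: m_assoc[symmetric])
  have "(\<Sum>y\<in>M. ?u y * ?u x) = (\<Sum>y\<in>M. ?u (x \<otimes> y \<otimes> inv x) * ?u x)"
    by (rule sum.reindex_bij_witness[of _ "\<lambda>y. x \<otimes> y \<otimes> inv x" "\<lambda>y. inv x \<otimes> y \<otimes> x"])
      (simp_all add: c1 n n')
  also have "\<dots> = (\<Sum>y\<in>M. ?u x * ?u y)"
  proof (intro sum.cong HOL.refl)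
    fix y assume y: "y \<in> M"
    show "?u (x \<otimes> y \<otimes> inv x) * ?u x = ?u x * ?u y"
      using x Mc[OF y] by (simp add: grp_mult m_assoc)
  qed
  finally show ?thesis by (simp only: sum_distrib_left sum_distrib_right)
qed

text \<open>Conjugation by an element of \<open>M\<close> permutes \<open>M'\<close>, so every
  element of \<open>M\<close> commutes with the sum over \<open>M'\<close>.\<close>

lemma average_commute:
  fixes f_type :: "'f::field itself"
  assumes M: "M \<subseteq> carrier G" "M' \<subseteq> carrier G"
    and n: "\<And>x y. x \<in> M \<Longrightarrow> y \<in> M' \<Longrightarrow> x \<otimes> y \<otimes> inv x \<in> M'" "\<And>x y. x \<in> M \<Longrightarrow> y \<in> M' \<Longrightarrow> inv x \<otimes> y \<otimes> x \<in> M'"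
  shows "(average M :: 'a \<Rightarrow> 'f) \<star> average M' = average M' \<star> average M"
proof -
  let ?S = "\<lambda>M. \<Sum>h\<in>M. grp h :: ('a \<Rightarrow> 'f) endo" and ?c = "\<lambda>M :: 'a set. scalar (inverse (of_nat (card M))) :: ('a \<Rightarrow> 'f) endo"
  have "grp x * ?S M' = ?S M' * grp x" if "x \<in> M" for x
    using that M n by (intro grp_sum_normalized) auto
  hence "(\<Sum>x\<in>M. grp x * ?S M') = (\<Sum>x\<in>M. ?S M' * grp x)" by (intro sum.cong HOL.refl)
  hence SS: "?S M * ?S M' = ?S M' * ?S M"
    unfolding sum_distrib_right[of grp M, symmetric] sum_distrib_left[of _ grp M, symmetric] .
  have cg: "?c N * conv \<alpha> = conv \<alpha> * ?c N" if "\<alpha> \<in> carrier (group_algebra G)" for N and \<alpha> :: "'a \<Rightarrow> 'f"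
    using that by (simp add: scalar_left scalar_right)
  have cS: "?c N * ?S M = ?S M * ?c N" if "M \<subseteq> carrier G" for N M
    using that single_closed unfolding sum_distrib_left sum_distrib_right grp_def
    by (intro sum.cong HOL.refl cg) auto
  have cc: "?c M * ?c M' = ?c M' * ?c M" unfolding scalar_def[of "inverse (of_nat (card M'))"]
    by (rule cg) (simp add: scale_closed single_closed)
  have "conv (average M \<star> average M' :: 'a \<Rightarrow> 'f) = ?c M * (?S M * ?c M') * ?S M'"
    by (simp add: conv_mult conv_average M mult.assoc)
  also have "\<dots> = ?c M * ?c M' * (?S M * ?S M')" by (simp add: cS[symmetric] M mult.assoc)
  also have "\<dots> = ?c M' * (?c M * ?S M') * ?S M" by (simp add: SS cc mult.assoc)
  also have "?c M * ?S M' = ?S M' * ?c M" by (rule cS[OF M(2)])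
  also have "?c M' * (?S M' * ?c M) * ?S M = conv (average M' \<star> average M)"
    by (simp add: M conv_mult conv_average mult.assoc)
  finally show ?thesis by (simp add: conv_inject convolve_closed)
qed

definition shoda_sets where
  "shoda_sets H K = {M. subgroup M G \<and> K \<subseteq> M \<and> minimal_normal (quot G H K) (carrier (quot G M K))}"

definition shoda_factor :: "'a set \<Rightarrow> 'a set \<Rightarrow> 'a \<Rightarrow> 'f::field" where
  "shoda_factor K M = average K \<ominus>\<^bsub>group_algebra G\<^esub> average M"

text \<open>The construction of \<open>shoda_eps\<close> over an arbitrary field, so that its
  rational instance can be compared with its instance over the finite field.\<close>

definition shoda_idempotent :: "'a set \<Rightarrow> 'a set \<Rightarrow> 'a \<Rightarrow> 'f::field" where
  "shoda_idempotent H K =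
     (if H = K then average H else finprod (group_algebra G) (shoda_factor K) (shoda_sets H K))"

lemma shoda_eps_eq: "shoda_eps G H K = shoda_idempotent H K"
  by (simp add: shoda_eps_def shoda_idempotent_def shoda_sets_def shoda_factor_def[abs_def])

end

text \<open>
  \<^term>\<open>reduces q x y\<close>: the rational number \<open>x\<close> is \<open>q\<close>-integral and \<open>y\<close> is its residue in a field of
  characteristic \<open>q\<close>. Through this relation, identities in the rational group algebra
  pass to the modular one.
\<close>

definition reduces :: "nat \<Rightarrow> rat \<Rightarrow> 'f::field \<Rightarrow> bool" where
  "reduces q x y \<longleftrightarrow> (\<exists>a b::int. \<not> int q dvd b \<and> x = of_int a / of_int b \<and> y = of_int a / of_int b)"

locale reduction =
  fixes q :: nat and f_type :: "'f::field itself"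
  assumes prime_q: "Factorial_Ring.prime q" and char_q: "CHAR('f) = q"
begin

lemma of_int_nonzero: "\<not> int q dvd b \<Longrightarrow> (of_int b :: 'f) \<noteq> 0"
  using char_q by (simp add: of_int_eq_0_iff_char_dvd)

lemma dvd_mult_int: "int q dvd a * b \<longleftrightarrow> int q dvd a \<or> int q dvd b"
  using prime_q by (simp add: prime_dvd_mult_iff)

lemma nonzero_int: "\<not> int q dvd b \<Longrightarrow> b \<noteq> 0" by auto

lemma reduces_add: "reduces q x (y::'f) \<Longrightarrow> reduces q x' y' \<Longrightarrow> reduces q (x + x') (y + y')"
  unfolding reduces_def
proof (elim exE conjE)
  fix a b a' b' :: int
  assume *: "\<not> int q dvd b" "x = of_int a / of_int b" "y = of_int a / of_int b"
    "\<not> int q dvd b'" "x' = of_int a' / of_int b'" "y' = of_int a' / of_int b'"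
  hence "x + x' = of_int (a * b' + a' * b) / of_int (b * b')" "y + y' = of_int (a * b' + a' * b) / of_int (b * b')"
    using of_int_nonzero nonzero_int by (simp_all add: add_frac_eq)
  thus "\<exists>a b. \<not> int q dvd b \<and> x + x' = of_int a / of_int b \<and> y + y' = of_int a / of_int b"
    using * dvd_mult_int by metis
qed

lemma reduces_mult: "reduces q x (y::'f) \<Longrightarrow> reduces q x' y' \<Longrightarrow> reduces q (x * x') (y * y')"
  unfolding reduces_def
proof (elim exE conjE)
  fix a b a' b' :: int
  assume *: "\<not> int q dvd b" "x = of_int a / of_int b" "y = of_int a / of_int b"
    "\<not> int q dvd b'" "x' = of_int a' / of_int b'" "y' = of_int a' / of_int b'"
  hence "x * x' = of_int (a * a') / of_int (b * b')" "y * y' = of_int (a * a') / of_int (b * b')" by simp_all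
  thus "\<exists>a b. \<not> int q dvd b \<and> x * x' = of_int a / of_int b \<and> y * y' = of_int a / of_int b"
    using * dvd_mult_int by metis
qed

lemma reduces_uminus: "reduces q x (y::'f) \<Longrightarrow> reduces q (- x) (- y)"
  unfolding reduces_def by (metis minus_divide_left of_int_minus)

lemma reduces_of_int: "reduces q (of_int a) (of_int a :: 'f)"
  unfolding reduces_def using prime_q by (intro exI[of _ a] exI[of _ 1]) (auto simp: prime_nat_iff)

lemma reduces_0: "reduces q 0 (0 :: 'f)" and reduces_1: "reduces q 1 (1 :: 'f)"
  using reduces_of_int[of 0] reduces_of_int[of 1] by simp_all

lemma reduces_zero_unique: "reduces q 0 (y :: 'f) \<Longrightarrow> y = 0"
  unfolding reduces_def using of_int_nonzero nonzero_int by auto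

lemma reduces_inverse_nat: "\<not> q dvd n \<Longrightarrow> reduces q (inverse (of_nat n)) (inverse (of_nat n) :: 'f)"
  unfolding reduces_def by (intro exI[of _ 1] exI[of _ "int n"]) (simp add: divide_inverse)

lemma reduces_sum:
  "(\<And>i. i \<in> A \<Longrightarrow> reduces q (f i) (g i :: 'f)) \<Longrightarrow> reduces q (sum f A) (sum g A)"
  by (induction A rule: infinite_finite_induct) (auto intro: reduces_0 reduces_add)

end

locale modular_group = finite_group G + reduction q f_type
  for G (structure) and q and f_type :: "'f::field itself" +
  assumes coprime_order: "\<not> q dvd Coset.order G"
begin

definition reduces_fun :: "('a \<Rightarrow> rat) \<Rightarrow> ('a \<Rightarrow> 'f) \<Rightarrow> bool" where
  "reduces_fun \<alpha> \<beta> \<longleftrightarrow> (\<forall>x. reduces q (\<alpha> x) (\<beta> x))"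

lemma reduces_convolve: "reduces_fun \<alpha> \<beta> \<Longrightarrow> reduces_fun \<alpha>' \<beta>' \<Longrightarrow> reduces_fun (\<alpha> \<star> \<alpha>') (\<beta> \<star> \<beta>')"
  by (auto simp: reduces_fun_def group_algebra_simps intro!: reduces_sum reduces_mult reduces_0)

lemma reduces_single: "reduces_fun (single g) (single g)"
  by (auto simp: reduces_fun_def single_def reduces_0 reduces_1)

lemma reduces_diff: "reduces_fun \<alpha> \<beta> \<Longrightarrow> reduces_fun \<alpha>' \<beta>' \<Longrightarrow> reduces_fun (\<alpha> - \<alpha>') (\<beta> - \<beta>')"
  using reduces_add[OF _ reduces_uminus] by (fastforce simp: reduces_fun_def)

lemma card_not_dvd: "subgroup M G \<Longrightarrow> \<not> q dvd card M"
  using coprime_order lagrange by (metis dvd_mult)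

lemma card_nonzero: "subgroup M G \<Longrightarrow> (of_nat (card M) :: 'f) \<noteq> 0"
  using card_not_dvd char_q by (simp add: of_nat_eq_0_iff_char_dvd)

lemma reduces_average: "subgroup M G \<Longrightarrow> reduces_fun (average M) (average M)"
  using card_not_dvd reduces_inverse_nat by (auto simp: reduces_fun_def average_def reduces_0)

text \<open>Both claims are checked factor by factor. Coefficients reduce because the orders of the
  subgroups are prime to \<open>q\<close>; and \<open>\<epsilon>\<close> is unchanged by a factor
  because it absorbs the average of \<open>K\<close> and is annihilated by that of
  \<open>M\<close>.\<close>

lemma shoda_idempotent_facts:
  assumes K: "subgroup K G" and H: "subgroup H G"
    and norm: "\<And>M x y. M \<in> shoda_sets H K \<Longrightarrow> x \<in> H \<Longrightarrow> y \<in> M \<Longrightarrow> x \<otimes> y \<otimes> inv x \<in> M"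
    and MH: "\<And>M. M \<in> shoda_sets H K \<Longrightarrow> M \<subseteq> H"
    and KH: "\<And>x y. x \<in> H \<Longrightarrow> y \<in> K \<Longrightarrow> x \<otimes> y \<otimes> inv x \<in> K" and KsH: "K \<subseteq> H"
  shows "reduces_fun (shoda_idempotent H K) (shoda_idempotent H K)"
    and "\<And>\<epsilon> :: 'a \<Rightarrow> 'f. \<epsilon> \<in> carrier (group_algebra G) \<Longrightarrow> \<epsilon> \<star> average K = \<epsilon> \<Longrightarrow> average K \<star> \<epsilon> = \<epsilon> \<Longrightarrow>
      (\<And>M. M \<in> shoda_sets H K \<Longrightarrow> H \<noteq> K \<Longrightarrow> \<epsilon> \<star> average M = 0 \<and> average M \<star> \<epsilon> = 0) \<Longrightarrow>
      \<epsilon> \<star> shoda_idempotent H K = \<epsilon> \<and> shoda_idempotent H K \<star> \<epsilon> = \<epsilon>"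
proof -
  have sub: "subgroup M G" if "M \<in> shoda_sets H K" for M using that by (simp add: shoda_sets_def)
  have Hc: "H \<subseteq> carrier G" using H subgroup.subset by blast
  have Mc: "M \<subseteq> carrier G" if "M \<in> shoda_sets H K" for M using sub[OF that] subgroup.subset by blast
  have Kc: "K \<subseteq> carrier G" using K subgroup.subset by blast
  have norm': "inv x \<otimes> y \<otimes> x \<in> M" if "M \<in> shoda_sets H K" "x \<in> H" "y \<in> M" for M x y
    using norm[OF that(1) subgroup.m_inv_closed[OF H that(2)] that(3)] that(2) Hc by (simp add: subset_iff)
  have KH': "inv x \<otimes> y \<otimes> x \<in> K" if "x \<in> H" "y \<in> K" for x y
    using KH[OF subgroup.m_inv_closed[OF H that(1)] that(2)] that(1) Hc by (simp add: subset_iff)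
  have "shoda_sets H K \<subseteq> Pow (carrier G)" using Mc by blast
  hence fin: "finite (shoda_sets H K)" by (rule finite_subset) (simp add: finite_G)
  have fac: "shoda_factor K M = average K - (average M :: 'a \<Rightarrow> 'k::field)" if "M \<in> shoda_sets H K" for M
    unfolding shoda_factor_def by (rule group_algebra_minus[OF average_closed[OF Mc[OF that]]])
  have fac_closed: "shoda_factor K M \<in> carrier (group_algebra G :: ('a \<Rightarrow> 'k::field) ring)" if "M \<in> shoda_sets H K" for M
    using Kc Mc[OF that] unfolding fac[OF that] by (auto simp: average_def group_algebra_simps)
  have distr: "(\<alpha> - \<alpha>') \<star> (\<beta> - \<beta>') = \<alpha> \<star> \<beta> - \<alpha> \<star> \<beta>' - \<alpha>' \<star> \<beta> + \<alpha>' \<star> \<beta>'" for \<alpha> \<alpha>' \<beta> \<beta>' :: "'a \<Rightarrow> 'k::field"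
    by (simp add: group_algebra_simps fun_eq_iff algebra_simps sum.distrib sum_subtractf)
  have comm: "shoda_factor K M \<star> shoda_factor K M' = (shoda_factor K M' \<star> shoda_factor K M :: 'a \<Rightarrow> 'k::field)"
    if M: "M \<in> shoda_sets H K" "M' \<in> shoda_sets H K" for M M'
  proof -
    have "average K \<star> average M = (average M \<star> average K :: 'a \<Rightarrow> 'k)" if "M \<in> shoda_sets H K" for M
      using that norm norm' KsH by (intro average_commute[OF Kc Mc[OF that]]) auto
    moreover have "average M \<star> average M' = (average M' \<star> average M :: 'a \<Rightarrow> 'k)"
      using M norm norm' MH by (intro average_commute[OF Mc Mc]) (auto simp: subset_iff)
    ultimately show ?thesis using M unfolding fac[OF M(1)] fac[OF M(2)] distr by (simp add: algebra_simps)
  qed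
  have mon: "Group.monoid (group_algebra G :: ('a \<Rightarrow> 'k::field) ring)"
    using ring.is_monoid[OF group_algebra_ring] .
  have ins: "finprod (group_algebra G) (shoda_factor K) (insert M F) =
      (shoda_factor K M \<star> finprod (group_algebra G) (shoda_factor K) F :: 'a \<Rightarrow> 'k::field)"
    if "finite F" "M \<notin> F" "insert M F \<subseteq> shoda_sets H K" for M F
    by (rule finprod_commuting_insert(1)[where B = "shoda_sets H K", OF mon fac_closed comm that])
  have one: "finprod (group_algebra G) (shoda_factor K) {} = (single \<one> :: 'a \<Rightarrow> 'k::field)"
  proof -
    have "finprod (group_algebra G :: ('a \<Rightarrow> 'k) ring) (shoda_factor K) {} = \<one>\<^bsub>group_algebra G\<^esub>"
      by (simp add: finprod_def foldD_empty single_closed one_single)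
    thus ?thesis by (simp add: one_single)
  qed
  have 1: "reduces_fun (finprod (group_algebra G) (shoda_factor K) F) (finprod (group_algebra G) (shoda_factor K) F)"
    if "F \<subseteq> shoda_sets H K" for F
    using finite_subset[OF that fin] that
  proof (induction F rule: finite_induct)
    case empty
    show ?case unfolding one by (rule reduces_single)
  next
    case (insert M F)
    have M: "M \<in> shoda_sets H K" using insert by blast
    show ?case unfolding ins[OF insert(1,2,4)]
      using insert K sub[OF M] unfolding fac[OF M] by (intro reduces_convolve reduces_diff reduces_average) auto
  qed
  thus "reduces_fun (shoda_idempotent H K) (shoda_idempotent H K)"
    using reduces_average[OF K] by (cases "H = K") (simp_all add: shoda_idempotent_def)
  fix \<epsilon> :: "'a \<Rightarrow> 'f"
  assume e: "\<epsilon> \<in> carrier (group_algebra G)" and eK: "\<epsilon> \<star> average K = \<epsilon>" "average K \<star> \<epsilon> = \<epsilon>"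
    and eM: "\<And>M. M \<in> shoda_sets H K \<Longrightarrow> H \<noteq> K \<Longrightarrow> \<epsilon> \<star> average M = 0 \<and> average M \<star> \<epsilon> = 0"
  show "\<epsilon> \<star> shoda_idempotent H K = \<epsilon> \<and> shoda_idempotent H K \<star> \<epsilon> = \<epsilon>"
  proof (cases "H = K")
    case False
    have dist: "\<epsilon> \<star> (\<alpha> - \<beta>) = \<epsilon> \<star> \<alpha> - \<epsilon> \<star> \<beta>" "(\<alpha> - \<beta>) \<star> \<epsilon> = \<alpha> \<star> \<epsilon> - \<beta> \<star> \<epsilon>" for \<alpha> \<beta> :: "'a \<Rightarrow> 'f"
      by (simp_all add: group_algebra_simps fun_eq_iff algebra_simps sum_subtractf)
    have f1: "\<epsilon> \<star> shoda_factor K M = \<epsilon> \<and> shoda_factor K M \<star> \<epsilon> = \<epsilon>" if M: "M \<in> shoda_sets H K" for M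
      unfolding fac[OF M] dist using eK eM[OF M False] by simp
    have "\<epsilon> \<star> finprod (group_algebra G) (shoda_factor K) F = \<epsilon> \<and> finprod (group_algebra G) (shoda_factor K) F \<star> \<epsilon> = \<epsilon>"
      if "F \<subseteq> shoda_sets H K" for F
      using finite_subset[OF that fin] that
    proof (induction F rule: finite_induct)
      case empty
      show ?case unfolding one using Group.monoid.r_one[OF mon e] Group.monoid.l_one[OF mon e]
        by (simp add: one_single)
    next
      case (insert M F)
      have M: "M \<in> shoda_sets H K" using insert by blast
      show ?case unfolding ins[OF insert(1,2,4)]
        using f1[OF M] insert by (simp add: convolve_assoc) (simp add: convolve_assoc[symmetric])
    qed
    thus ?thesis using False by (simp add: shoda_idempotent_def)
  qed (use eK in \<open>simp add: shoda_idempotent_def\<close>)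
qed

end

locale shoda = modular_group G q f_type
  for G (structure) and q and f_type :: "'f::field itself" +
  fixes H K
  assumes shoda_pair: "strong_shoda_pair G H K"
begin

definition N where "N = normalizer G K"

lemma sub_H: "subgroup H G" and sub_K: "subgroup K G" and K_H: "K \<subseteq> H"
  and H_norm: "H \<lhd> G\<lparr>carrier := N\<rparr>" and cyclic_HK: "cyclic_group (quot G H K)"
  and max_abelian: "maximal_abelian_subgroup (quot G N K) (carrier (quot G H K))"
  and shoda_orth: "g \<in> carrier G \<Longrightarrow> g \<notin> N \<Longrightarrow>
     shoda_eps G H K \<star> sandwich G (shoda_eps G H K) g g = \<zero>\<^bsub>group_algebra G\<^esub>"
  using shoda_pair by (auto simp: strong_shoda_pair_def N_def)

lemma H_carrier: "H \<subseteq> carrier G" and K_carrier: "K \<subseteq> carrier G"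
  using subgroup.subset[OF sub_H] subgroup.subset[OF sub_K] .

lemma H_mem: "h \<in> H \<Longrightarrow> h \<in> carrier G" using H_carrier by blast

lemma sub_N: "subgroup N G" unfolding N_def by (rule normalizer_imp_subgroup[OF K_carrier])
lemma K_norm: "K \<lhd> G\<lparr>carrier := N\<rparr>" unfolding N_def by (rule subgroup_in_normalizer[OF sub_K])
lemma N_carrier: "N \<subseteq> carrier G" by (rule subgroup.subset[OF sub_N])
lemma H_N: "H \<subseteq> N" using subgroup.subset[OF normal_imp_subgroup[OF H_norm]] by simp

lemma conj_closed:
  assumes g: "g \<in> N"
  shows "h \<in> H \<Longrightarrow> g \<otimes> h \<otimes> inv g \<in> H" "h \<in> K \<Longrightarrow> g \<otimes> h \<otimes> inv g \<in> K"
proof -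
  have i: "inv\<^bsub>G\<lparr>carrier := N\<rparr>\<^esub> g = inv g" using m_inv_consistent[OF sub_N g] .
  show "h \<in> H \<Longrightarrow> g \<otimes> h \<otimes> inv g \<in> H"
    using normal.inv_op_closed2[OF H_norm, of g h] g by (simp add: i)
  show "h \<in> K \<Longrightarrow> g \<otimes> h \<otimes> inv g \<in> K"
    using normal.inv_op_closed2[OF K_norm, of g h] g by (simp add: i)
qed

sublocale NK: subquotient G N K
  by (intro subquotient.intro subquotient_axioms.intro is_group sub_N K_norm)

lemma K_normal_sub:
  assumes "subgroup A G" "K \<subseteq> A" "A \<subseteq> N"
  shows "K \<lhd> G\<lparr>carrier := A\<rparr>"
proof -
  have "subgroup A (G\<lparr>carrier := N\<rparr>)" using subgroup_incl[OF assms(1) sub_N assms(3)] .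
  moreover have "group (G\<lparr>carrier := A\<rparr>)" using subgroup_imp_group[OF assms(1)] .
  ultimately show ?thesis
  proof (intro group.normalI)
    show "group (G\<lparr>carrier := A\<rparr>)" by fact
    show "subgroup K (G\<lparr>carrier := A\<rparr>)" using subgroup_incl[OF sub_K assms(1,2)] .
    show "\<forall>x\<in>carrier (G\<lparr>carrier := A\<rparr>). K #>\<^bsub>G\<lparr>carrier := A\<rparr>\<^esub> x = x <#\<^bsub>G\<lparr>carrier := A\<rparr>\<^esub> K"
    proof
      fix x assume "x \<in> carrier (G\<lparr>carrier := A\<rparr>)"
      hence "x \<in> N" using assms(3) by auto
      thus "K #>\<^bsub>G\<lparr>carrier := A\<rparr>\<^esub> x = x <#\<^bsub>G\<lparr>carrier := A\<rparr>\<^esub> K"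
        using normal.coset_eq[OF K_norm] by (simp add: r_coset_def l_coset_def)
    qed
  qed
qed

lemma subquotient_sub: "subgroup A G \<Longrightarrow> K \<subseteq> A \<Longrightarrow> A \<subseteq> N \<Longrightarrow> subquotient G A K"
  by (intro subquotient.intro subquotient_axioms.intro is_group K_normal_sub)

sublocale HK: subquotient G H K
  by (rule subquotient_sub[OF sub_H K_H H_N])

text \<open>Adjoining the coset of \<open>g\<close> to the image of \<open>H\<close> still generates
  an abelian group, so maximality in (SS2) puts the coset into that image.\<close>

lemma self_centralizing:
  assumes g: "g \<in> N" and c: "\<And>h. h \<in> H \<Longrightarrow> g \<otimes> h \<otimes> inv g \<otimes> inv h \<in> K"
  shows "g \<in> H"
proof -
  interpret Q: group "quot G N K" by (rule NK.group_quot)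
  let ?A = "carrier (quot G H K)" and ?Q = "quot G N K"
  define S where "S = insert (K #> g) ?A"
  have A: "subgroup ?A ?Q" "comm_group (?Q\<lparr>carrier := ?A\<rparr>)"
    using max_abelian by (auto simp: maximal_abelian_subgroup_def)
  have Sc: "S \<subseteq> carrier ?Q" using g subgroup.subset[OF A(1)] by (auto simp: S_def carrier_quot)
  have gA: "(K #> g) \<otimes>\<^bsub>?Q\<^esub> a = a \<otimes>\<^bsub>?Q\<^esub> (K #> g)" if a: "a \<in> ?A" for a
  proof -
    obtain h where h: "h \<in> H" "a = K #> h" using a by (auto simp: carrier_quot)
    have hN: "h \<in> N" using h H_N by blast
    have gc: "g \<in> carrier G" "h \<in> carrier G" using g N_carrier h H_mem by auto
    have "g \<otimes> h \<otimes> inv (h \<otimes> g) \<in> K" using c[OF h(1)] gc by (simp add: inv_mult_group m_assoc)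
    hence "K #> (g \<otimes> h) = K #> (h \<otimes> g)" using NK.coset_eq_iff gc by simp
    thus ?thesis using g hN by (simp add: h NK.mult_quot)
  qed
  have AA: "a \<otimes>\<^bsub>?Q\<^esub> b = b \<otimes>\<^bsub>?Q\<^esub> a" if "a \<in> ?A" "b \<in> ?A" for a b
    using comm_groupE(4)[OF A(2), of a b] that by simp
  have "x \<otimes>\<^bsub>?Q\<^esub> y = y \<otimes>\<^bsub>?Q\<^esub> x" if "x \<in> S" "y \<in> S" for x y
    using that gA AA unfolding S_def by (metis insert_iff)
  hence "comm_group (?Q\<lparr>carrier := generate ?Q S\<rparr>)" using Q.generate_commuting[OF Sc] by blast
  moreover have "subgroup (generate ?Q S) ?Q" by (rule Q.generate_is_subgroup[OF Sc])
  moreover have "?A \<subseteq> generate ?Q S" using generate.incl[of _ S ?Q] by (auto simp: S_def)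
  ultimately have "generate ?Q S = ?A" using max_abelian unfolding maximal_abelian_subgroup_def by blast
  moreover have "K #> g \<in> generate ?Q S" by (rule generate.incl) (simp add: S_def)
  ultimately have "K #> g \<in> (\<lambda>x. K #> x) ` H" by (simp add: carrier_quot)
  thus ?thesis using NK.mem_image_iff[OF sub_H K_H] g N_carrier by blast
qed

lemma shoda_sets_facts:
  assumes M: "M \<in> shoda_sets H K"
  shows "M \<subseteq> H" "\<And>x y. x \<in> H \<Longrightarrow> y \<in> M \<Longrightarrow> x \<otimes> y \<otimes> inv x \<in> M" "\<exists>y\<in>M. y \<notin> K"
proof -
  have sM: "subgroup M G" and KM: "K \<subseteq> M" and mn: "minimal_normal (quot G H K) (carrier (quot G M K))"
    using M by (auto simp: shoda_sets_def)
  have Mc: "M \<subseteq> carrier G" by (rule subgroup.subset[OF sM])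
  have norm: "carrier (quot G M K) \<lhd> quot G H K" and ne: "carrier (quot G M K) \<noteq> {K}"
    using mn by (simp_all add: minimal_normal_def HK.one_quot)
  show MH: "M \<subseteq> H"
  proof
    fix y assume y: "y \<in> M"
    hence "K #> y \<in> carrier (quot G M K)" by (simp add: carrier_quot)
    hence "K #> y \<in> carrier (quot G H K)" using subgroup.subset[OF normal_imp_subgroup[OF norm]] by blast
    thus "y \<in> H" using HK.mem_image_iff[OF sub_H K_H] y Mc by (auto simp: carrier_quot)
  qed
  show "x \<otimes> y \<otimes> inv x \<in> M" if x: "x \<in> H" and y: "y \<in> M" for x y
  proof -
    have yH: "y \<in> H" using y MH by blast
    have "(K #> x) \<otimes>\<^bsub>quot G H K\<^esub> (K #> y) \<otimes>\<^bsub>quot G H K\<^esub> inv\<^bsub>quot G H K\<^esub> (K #> x) \<in> carrier (quot G M K)"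
      using x y by (intro normal.inv_op_closed2[OF norm]) (auto simp: carrier_quot)
    hence "K #> (x \<otimes> y \<otimes> inv x) \<in> carrier (quot G M K)"
      using x yH by (simp add: HK.mult_quot HK.inv_quot HK.A_closed)
    thus ?thesis using HK.mem_image_iff[OF sM KM] x yH H_mem by (simp add: carrier_quot)
  qed
  show "\<exists>y\<in>M. y \<notin> K"
  proof (rule ccontr)
    assume "\<not> (\<exists>y\<in>M. y \<notin> K)"
    hence MK: "M = K" using KM by blast
    have "K #> y = K" if "y \<in> K" for y using that K_carrier HK.coset_one_iff by blast
    moreover have "\<one> \<in> K" by (rule subgroup.one_closed[OF sub_K])
    ultimately have "carrier (quot G M K) = {K}" unfolding MK carrier_quot by blast
    thus False using ne by simp
  qed
qed

text \<open>Reducing (SS3) modulo \<open>q\<close> gives the orthogonality for the counterpart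
  \<open>\<eta>\<close> over the finite field. It passes to \<open>\<epsilon>\<close> because
  \<open>\<eta>\<close> acts on \<open>\<epsilon>\<close> as an identity from both sides.\<close>

lemma shoda_orthogonal:
  fixes \<epsilon> :: "'a \<Rightarrow> 'f"
  assumes e: "\<epsilon> \<in> carrier (group_algebra G)" and eK: "\<epsilon> \<star> average K = \<epsilon>" "average K \<star> \<epsilon> = \<epsilon>"
    and eM: "\<And>M. M \<in> shoda_sets H K \<Longrightarrow> \<epsilon> \<star> average M = 0 \<and> average M \<star> \<epsilon> = 0"
    and g: "g \<in> carrier G" "g \<notin> N"
  shows "conv \<epsilon> * grp g * conv \<epsilon> = 0"
proof -
  have KH: "x \<otimes> y \<otimes> inv x \<in> K" if "x \<in> H" "y \<in> K" for x y using conj_closed(2) that H_N by blast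
  note sf = shoda_idempotent_facts[OF sub_K sub_H shoda_sets_facts(2) shoda_sets_facts(1) KH K_H]
  define \<eta> :: "'a \<Rightarrow> 'f" where "\<eta> = shoda_idempotent H K"
  have \<eta>: "\<epsilon> \<star> \<eta> = \<epsilon>" "\<eta> \<star> \<epsilon> = \<epsilon>" unfolding \<eta>_def using sf(2)[OF _ _ _ _ _ _ e eK] eM by blast+
  \<comment> \<open>Conjugation in (SS3) puts the inverse on the left, whereas the goal has
    \<open>g\<close> between the two idempotents; hence the inverse of \<open>g\<close> is
    used.\<close>
  define g' where "g' = inv g"
  have g'N: "g' \<in> carrier G" "g' \<notin> N"
  proof -
    show "g' \<in> carrier G" using g by (simp add: g'_def)
    show "g' \<notin> N" using g subgroup.m_inv_closed[OF sub_N, of g'] by (auto simp: g'_def)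
  qed
  have ig: "inv g' = g" using g by (simp add: g'_def)
  have "reduces_fun (shoda_eps G H K \<star> sandwich G (shoda_eps G H K) g' g') (\<eta> \<star> sandwich G \<eta> g' g')"
    unfolding sandwich_def shoda_eps_eq \<eta>_def
    by (intro reduces_convolve reduces_single sf(1))
  hence "reduces_fun 0 (\<eta> \<star> sandwich G \<eta> g' g')" using shoda_orth[OF g'N] by (simp add: group_algebra_simps)
  hence "\<eta> \<star> sandwich G \<eta> g' g' = 0"
    by (auto simp: reduces_fun_def fun_eq_iff intro: reduces_zero_unique)
  hence "conv \<eta> * (grp g * conv \<eta> * grp g') = 0"
    unfolding sandwich_def grp_def conv_mult[symmetric] ig by (simp only: conv_zero)
  hence "conv \<eta> * (grp g * conv \<eta> * grp g') * grp g = 0" by simp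
  hence "conv \<eta> * grp g * conv \<eta> * (grp g' * grp g) = 0" by (simp add: mult.assoc)
  hence 0: "conv \<eta> * grp g * conv \<eta> * grp \<one> = 0" using g by (simp add: grp_mult g'_def)
  have "conv \<epsilon> * grp g * conv \<epsilon> = conv \<epsilon> * conv \<eta> * grp g * (conv \<eta> * (grp \<one> * conv \<epsilon>))"
    using \<eta> e by (simp add: conv_mult[symmetric] grp_one_left)
  also have "\<dots> = conv \<epsilon> * (conv \<eta> * grp g * conv \<eta> * grp \<one>) * conv \<epsilon>" by (simp add: mult.assoc)
  finally show ?thesis by (simp add: 0)
qed

end

section \<open>Fourier analysis on \<open>H/K\<close> and the action of its normalizer\<close>

section \<open>The field generated by a cyclotomic class\<close>

locale shoda_class = shoda G q f_type H K
  for G (structure) and q and f_type :: "'f::{field,finite} itself" and H K +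
  fixes m C :: nat and \<chi> :: "'a set \<Rightarrow> 'f alg_closure" and Cl :: "('a set \<Rightarrow> 'f alg_closure) set"
  assumes m_pos: "m \<ge> 1" and CARD_f: "CARD('f) = q ^ m" and C_CARD: "C = CARD('f)"
    and \<chi>: "\<chi> \<in> faithful_characters G H K" and Cl: "Cl = cyclotomic_class G H K \<chi>"
begin

sublocale frobenius C q m f_type
  by (intro frobenius.intro prime_q m_pos CARD_f C_CARD)

definition k where "k = Coset.order (quot G H K)"

definition \<psi> :: "'a \<Rightarrow> 'f alg_closure" where "\<psi> h = \<chi> (K #> h)"

lemma \<psi>_mult: "h \<in> H \<Longrightarrow> h' \<in> H \<Longrightarrow> \<psi> (h \<otimes> h') = \<psi> h * \<psi> h'"
proof -
  assume h: "h \<in> H" "h' \<in> H"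
  have "\<chi> \<in> hom (quot G H K) (units_of ring_of_type_algebra)"
    using \<chi> by (simp add: faithful_characters_def linear_characters_def)
  hence "\<chi> ((K #> h) \<otimes>\<^bsub>quot G H K\<^esub> (K #> h')) = \<chi> (K #> h) * \<chi> (K #> h')"
    using h by (simp add: hom_def carrier_quot units_of_def)
  thus ?thesis using h by (simp add: HK.mult_quot \<psi>_def)
qed

lemma \<psi>_nonzero: "h \<in> H \<Longrightarrow> \<psi> h \<noteq> 0"
proof -
  assume h: "h \<in> H"
  have "\<chi> \<in> hom (quot G H K) (units_of ring_of_type_algebra)"
    using \<chi> by (simp add: faithful_characters_def linear_characters_def)
  hence "\<psi> h \<in> Units ring_of_type_algebra"
    using h by (auto simp: hom_def carrier_quot units_of_def \<psi>_def)
  thus ?thesis by (auto simp: Units_def)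
qed

lemma \<psi>_one: "\<psi> \<one> = 1"
  using \<psi>_mult[of \<one> \<one>] \<psi>_nonzero[of \<one>] subgroup.one_closed[OF sub_H] by simp

lemma \<psi>_one_iff: "h \<in> H \<Longrightarrow> \<psi> h = 1 \<longleftrightarrow> h \<in> K"
proof -
  assume h: "h \<in> H"
  have inj: "inj_on \<chi> (carrier (quot G H K))" using \<chi> by (simp add: faithful_characters_def)
  have "\<psi> h = 1 \<longleftrightarrow> \<chi> (K #> h) = \<chi> (K #> \<one>)" using \<psi>_one by (simp add: \<psi>_def)
  also have "\<dots> \<longleftrightarrow> K #> h = K #> \<one>"
    using h subgroup.one_closed[OF sub_H] by (intro inj_on_eq_iff[OF inj]) (auto simp: carrier_quot)
  also have "\<dots> \<longleftrightarrow> h \<in> K" using HK.coset_eq_iff[of h \<one>] H_mem[OF h] by simp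
  finally show ?thesis .
qed

lemma \<psi>_inv: "h \<in> H \<Longrightarrow> \<psi> (inv h) = inverse (\<psi> h)"
  using \<psi>_mult[of h "inv h"] \<psi>_one HK.A_closed(3)[of h] H_mem[of h] inverse_unique[of "\<psi> h" "\<psi> (inv h)"]
  by simp

lemma \<psi>_pow: "h \<in> H \<Longrightarrow> \<psi> (h [^] (n::nat)) = \<psi> h ^ n"
  by (induction n) (simp_all add: \<psi>_one \<psi>_mult HK.A_pow mult.commute)

lemma finite_HK: "finite (carrier (quot G H K))" by (rule HK.finite_quot[OF finite_G])

lemma k_pos: "k > 0"
  unfolding k_def Coset.order_def
  using finite_HK subgroup.one_closed[OF sub_H] by (auto simp: card_gt_0_iff carrier_quot)

lemma \<psi>_k: "h \<in> H \<Longrightarrow> \<psi> h ^ k = 1"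
proof -
  assume h: "h \<in> H"
  have "(K #> h) [^]\<^bsub>quot G H K\<^esub> k = \<one>\<^bsub>quot G H K\<^esub>"
    unfolding k_def using h by (intro group.pow_order_eq_1[OF HK.group_quot]) (auto simp: carrier_quot)
  hence "h [^] k \<in> K" using h by (simp add: HK.pow_quot HK.one_quot HK.coset_one_iff H_mem)
  thus ?thesis using h \<psi>_pow[OF h, of k] \<psi>_one_iff[of "h [^] k"] HK.A_pow by simp
qed

lemma generator_exists: "\<exists>a\<in>H. primitive_root_of_unity k (\<psi> a)"
proof -
  interpret Q: group "quot G H K" by (rule HK.group_quot)
  obtain c where c: "c \<in> carrier (quot G H K)" "subgroup_generated (quot G H K) {c} = quot G H K"
    using cyclic_HK unfolding cyclic_group_def by blast
  then obtain a where a: "a \<in> H" "c = K #> a" by (auto simp: carrier_quot)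
  have "generate (quot G H K) (carrier (quot G H K) \<inter> {c}) = carrier (quot G H K)"
    using c(2) carrier_subgroup_generated by metis
  hence gen: "generate (quot G H K) {c} = carrier (quot G H K)" using c(1) by (simp add: Int_absorb1)
  hence ord: "Q.ord c = k" using Q.generate_pow_card[OF c(1)] by (simp add: k_def Coset.order_def)
  have "primitive_root_of_unity k (\<psi> a)"
    unfolding primitive_root_of_unity_def
  proof (intro conjI allI impI)
    fix j assume j: "0 < j \<and> j < k"
    show "\<psi> a ^ j \<noteq> 1"
    proof
      assume "\<psi> a ^ j = 1"
      hence "a [^] j \<in> K" using \<psi>_one_iff[OF HK.A_pow[OF a(1)], of j] \<psi>_pow[OF a(1), of j] by simp
      hence "c [^]\<^bsub>quot G H K\<^esub> j = \<one>\<^bsub>quot G H K\<^esub>"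
        using a HK.A_pow[OF a(1)] by (simp add: HK.pow_quot HK.one_quot HK.coset_one_iff H_mem)
      hence "k dvd j" using Q.pow_eq_id[OF c(1)] ord by simp
      thus False using j by (auto dest: dvd_imp_le)
    qed
  qed (use \<psi>_k a in auto)
  thus ?thesis using a by blast
qed

definition gen where "gen = (SOME a. a \<in> H \<and> primitive_root_of_unity k (\<psi> a))"

lemma gen: "gen \<in> H" "primitive_root_of_unity k (\<psi> gen)"
  using someI_ex[OF generator_exists[unfolded Bex_def]] by (simp_all add: gen_def)

lemma coprime_k: "coprime k C"
proof -
  have "\<not> q dvd k"
  proof
    assume "q dvd k"
    have "card (rcosets\<^bsub>G\<lparr>carrier := H\<rparr>\<^esub> K) * card K = Coset.order (G\<lparr>carrier := H\<rparr>)"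
      by (rule group.lagrange[OF subgroup_imp_group[OF sub_H] subgroup_incl[OF sub_K sub_H K_H]])
    moreover have "k = card (rcosets\<^bsub>G\<lparr>carrier := H\<rparr>\<^esub> K)"
      by (simp add: k_def Coset.order_def quot_def FactGroup_def)
    ultimately have "card H = k * card K" by (simp add: Coset.order_def)
    hence "k dvd card H" by simp
    thus False using \<open>q dvd k\<close> card_not_dvd[OF sub_H] dvd_trans by blast
  qed
  thus ?thesis using prime_q prime_imp_coprime[of q k] unfolding C_CARD CARD_f
    by (simp add: coprime_commute)
qed

definition ell where ell_eq: "ell = Pocklington.ord k C"

sublocale cyclotomic C q m f_type k ell "\<psi> gen"
  by (intro cyclotomic.intro cyclotomic_axioms.intro frobenius_axioms k_pos coprime_k gen ell_eq)

abbreviation FF where "FF \<equiv> fixed_field ell"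

lemma \<psi>_FF: "h \<in> H \<Longrightarrow> \<psi> h \<in> FF"
  using \<psi>_k by (rule root_fixed)

lemma frobenius_eq_iff: "\<psi> gen ^ (C ^ i) = \<psi> gen ^ (C ^ j) \<longleftrightarrow> [i = j] (mod ell)"
proof -
  have "\<psi> gen ^ (C ^ i) = \<psi> gen ^ (C ^ j) \<longleftrightarrow> [C ^ i = C ^ j] (mod k)"
    by (rule power_primitive_eq_iff[OF primitive_root_iff[OF gen(2)] k_pos])
  also have "\<dots> \<longleftrightarrow> [i = j] (mod ell)"
    unfolding ell_eq by (rule order_divides_expdiff[OF coprime_k])
  finally show ?thesis .
qed

subsection \<open>The trace form\<close>

definition tr :: "'f alg_closure \<Rightarrow> 'f" where "tr x = of_ac (\<Sum>i<ell. x ^ (C ^ i))"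

lemma trace_shift: "x \<in> FF \<Longrightarrow> (\<Sum>i<ell. (x ^ C) ^ (C ^ i)) = (\<Sum>i<ell. x ^ (C ^ i))"
proof -
  assume x: "x \<in> FF"
  obtain e where e: "ell = Suc e" using ell_pos by (cases ell) auto
  have "(\<Sum>i<Suc e. x ^ (C ^ Suc i)) = (\<Sum>i<e. x ^ (C ^ Suc i)) + x"
    using x by (simp add: fixed_field_def e)
  also have "\<dots> = (\<Sum>i<Suc e. x ^ (C ^ i))" unfolding sum.lessThan_Suc_shift by simp
  finally show ?thesis by (simp add: e power_mult)
qed

text \<open>The sum is fixed by Frobenius and so lies in the base field, where \<open>of_ac\<close>
  really inverts \<open>to_ac\<close>.\<close>

lemma to_ac_tr: "x \<in> FF \<Longrightarrow> to_ac (tr x) = (\<Sum>i<ell. x ^ (C ^ i))"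
proof -
  assume x: "x \<in> FF"
  have "(\<Sum>i<ell. x ^ (C ^ i)) ^ C = (\<Sum>i<ell. x ^ (C ^ i))"
    using trace_shift[OF x] frobenius_sum[of "\<lambda>i. x ^ (C ^ i)" "{..<ell}" 1]
    by (simp add: power_mult[symmetric] mult.commute)
  hence "(\<Sum>i<ell. x ^ (C ^ i)) \<in> range (to_ac :: 'f \<Rightarrow> _)" by (simp add: range_to_ac C_CARD)
  thus ?thesis by (simp add: tr_def to_ac_of_ac)
qed

lemma tr_add: "x \<in> FF \<Longrightarrow> y \<in> FF \<Longrightarrow> tr (x + y) = tr x + tr y"
  by (rule injD[OF inj_to_ac]) (simp add: to_ac_tr fixed_field_closed frobenius_add sum.distrib)

lemma tr_scale: "x \<in> FF \<Longrightarrow> tr (to_ac c * x) = c * tr x"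
  by (rule injD[OF inj_to_ac])
    (simp add: to_ac_tr fixed_field_closed power_mult_distrib frobenius_base sum_distrib_left)

lemma tr_frobenius: "x \<in> FF \<Longrightarrow> tr (x ^ (C ^ j)) = tr x"
proof (induction j)
  case (Suc j)
  have FFp: "y ^ n \<in> FF" if "y \<in> FF" for y and n :: nat
    using that by (induction n) (simp_all add: fixed_field_closed)
  have "tr ((x ^ (C ^ j)) ^ C) = tr (x ^ (C ^ j))"
    unfolding tr_def trace_shift[OF FFp[OF Suc.prems]] by (rule HOL.refl)
  thus ?case using Suc by (simp add: power_mult[symmetric] mult.commute)
qed simp

end

context shoda_class
begin

subsection \<open>The idempotent of a cyclotomic class\<close>

lemma FF_power: "x \<in> FF \<Longrightarrow> x ^ n \<in> FF"
  by (induction n) (simp_all add: fixed_field_closed)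

lemma FF_of_nat: "of_nat n \<in> FF"
  by (induction n) (simp_all add: fixed_field_closed)

lemma FF_sum: "(\<And>i. i \<in> A \<Longrightarrow> f i \<in> FF) \<Longrightarrow> sum f A \<in> FF"
  by (induction A rule: infinite_finite_induct) (simp_all add: fixed_field_closed)

lemma character_sum_zero:
  fixes \<phi> :: "'a \<Rightarrow> 'f alg_closure"
  assumes M: "subgroup M G" and mult: "\<And>x y. x \<in> M \<Longrightarrow> y \<in> M \<Longrightarrow> \<phi> (x \<otimes> y) = \<phi> x * \<phi> y"
    and y: "y \<in> M" "\<phi> y \<noteq> 1"
  shows "(\<Sum>x\<in>M. \<phi> x) = 0"
proof -
  have Mc: "x \<in> carrier G" if "x \<in> M" for x using that subgroup.subset[OF M] by blast
  have "(\<Sum>x\<in>M. \<phi> x) = (\<Sum>x\<in>M. \<phi> (y \<otimes> x))"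
    by (rule sum.reindex_bij_witness[of _ "\<lambda>x. y \<otimes> x" "\<lambda>x. inv y \<otimes> x"])
      (simp_all add: subgroup.m_closed[OF M] subgroup.m_inv_closed[OF M] y(1) Mc m_assoc[symmetric])
  also have "\<dots> = \<phi> y * (\<Sum>x\<in>M. \<phi> x)" using y(1) by (simp add: mult sum_distrib_left)
  finally have "(1 - \<phi> y) * (\<Sum>x\<in>M. \<phi> x) = 0" by (simp add: algebra_simps)
  thus ?thesis using y(2) by simp
qed

text \<open>An inverse Fourier transform: after extension of scalars, \<open>W \<phi> l\<close> is
  the sum over \<open>i < ell\<close> of \<open>l ^ (C ^ i)\<close> times the idempotent of the
  \<open>i\<close>-th Frobenius conjugate of the character \<open>\<phi>\<close>. The idempotent of
  the cyclotomic class is the case \<open>\<phi> = \<psi>\<close>, \<open>l = 1\<close>; other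
  characters arise from conjugation in \<open>G\<close>.\<close>

definition W :: "('a \<Rightarrow> 'f alg_closure) \<Rightarrow> 'f alg_closure \<Rightarrow> 'a \<Rightarrow> 'f" where
  "W \<phi> l x = (if x \<in> H then inverse (of_nat (card H)) * tr (l * \<phi> (inv x)) else 0)"

definition is_character :: "('a \<Rightarrow> 'f alg_closure) \<Rightarrow> bool" where
  "is_character \<phi> \<longleftrightarrow> (\<forall>x\<in>H. \<phi> x \<in> FF \<and> \<phi> x \<noteq> 0) \<and> (\<forall>x\<in>H. \<forall>y\<in>H. \<phi> (x \<otimes> y) = \<phi> x * \<phi> y)"

lemma W_closed: "W \<phi> l \<in> carrier (group_algebra G)"
  using H_carrier by (auto simp: W_def group_algebra_simps(1))

lemma is_character_\<psi>: "is_character \<psi>"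
  by (simp add: is_character_def \<psi>_mult \<psi>_nonzero \<psi>_FF)

lemma H_inv: "x \<in> H \<Longrightarrow> inv x \<in> H" and H_mult: "x \<in> H \<Longrightarrow> y \<in> H \<Longrightarrow> x \<otimes> y \<in> H"
  by (simp_all add: HK.A_closed)

lemma is_character_inv: "is_character \<phi> \<Longrightarrow> x \<in> H \<Longrightarrow> \<phi> (inv x) = inverse (\<phi> x)"
proof -
  assume p: "is_character \<phi>" and x: "x \<in> H"
  have o: "\<one> \<in> H" by (rule HK.A_closed)
  have "\<phi> \<one> * \<phi> \<one> = \<phi> \<one>" "\<phi> \<one> \<noteq> 0" using p o unfolding is_character_def by (metis r_one one_closed)+
  hence "\<phi> \<one> = 1" by simp
  moreover have "\<phi> (x \<otimes> inv x) = \<phi> x * \<phi> (inv x)" using p x H_inv[OF x] unfolding is_character_def by blast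
  ultimately have "\<phi> x * \<phi> (inv x) = 1" using H_mem[OF x] by simp
  thus ?thesis by (rule inverse_unique[symmetric])
qed

lemma card_H_nonzero: "(of_nat (card H) :: 'f) \<noteq> 0" by (rule card_nonzero[OF sub_H])

text \<open>Expanding both traces isolates the inner products of Frobenius conjugates of the two
  characters, to which orthogonality applies.\<close>

lemma W_convolve:
  assumes \<phi>: "is_character \<phi>" and \<theta>: "is_character \<theta>" and l: "l \<in> FF" and \<mu>: "\<mu> \<in> FF" and z: "z \<in> H"
  shows "to_ac ((W \<phi> l \<star> W \<theta> \<mu>) z) = to_ac (inverse (of_nat (card H))) ^ 2 *
    (\<Sum>i<ell. \<Sum>j<ell. l ^ (C ^ i) * \<mu> ^ (C ^ j) * \<theta> (inv z) ^ (C ^ j) *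
       (\<Sum>x\<in>H. inverse (\<phi> x ^ (C ^ i)) * \<theta> x ^ (C ^ j)))"
proof -
  let ?n = "inverse (of_nat (card H)) :: 'f"
  have "(W \<phi> l \<star> W \<theta> \<mu>) z = (\<Sum>x\<in>carrier G. W \<phi> l x * W \<theta> \<mu> (inv x \<otimes> z))"
    using H_mem[OF z] by (rule convolve_apply)
  also have "\<dots> = (\<Sum>x\<in>H. W \<phi> l x * W \<theta> \<mu> (inv x \<otimes> z))"
    by (rule sum.mono_neutral_right[OF finite_G H_carrier]) (simp add: W_def)
  also have "\<dots> = (\<Sum>x\<in>H. ?n\<^sup>2 * (tr (l * inverse (\<phi> x)) * tr (\<mu> * (\<theta> (inv z) * \<theta> x))))"
  proof (intro sum.cong HOL.refl)
    fix x assume x: "x \<in> H"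
    have "inv (inv x \<otimes> z) = inv z \<otimes> x" using H_mem[OF x] H_mem[OF z] by (simp add: inv_mult_group)
    moreover have "\<theta> (inv z \<otimes> x) = \<theta> (inv z) * \<theta> x"
      using \<theta> x H_inv[OF z] unfolding is_character_def by blast
    ultimately show "W \<phi> l x * W \<theta> \<mu> (inv x \<otimes> z) = ?n\<^sup>2 * (tr (l * inverse (\<phi> x)) * tr (\<mu> * (\<theta> (inv z) * \<theta> x)))"
      using x z H_inv[OF x] H_mult[OF H_inv[OF x] z]
      by (simp add: W_def is_character_inv[OF \<phi> x] power2_eq_square)
  qed
  finally have "to_ac ((W \<phi> l \<star> W \<theta> \<mu>) z) =
      (\<Sum>x\<in>H. to_ac ?n ^ 2 * (to_ac (tr (l * inverse (\<phi> x))) * to_ac (tr (\<mu> * (\<theta> (inv z) * \<theta> x)))))"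
    by (simp add: to_ac_sum)
  also have "\<dots> = (\<Sum>x\<in>H. \<Sum>i<ell. \<Sum>j<ell. to_ac ?n ^ 2 * (l ^ (C ^ i) * \<mu> ^ (C ^ j) * \<theta> (inv z) ^ (C ^ j) *
       (inverse (\<phi> x ^ (C ^ i)) * \<theta> x ^ (C ^ j))))"
  proof (intro sum.cong HOL.refl)
    fix x assume x: "x \<in> H"
    have "l * inverse (\<phi> x) \<in> FF" "\<mu> * (\<theta> (inv z) * \<theta> x) \<in> FF"
      using \<phi> \<theta> l \<mu> x H_inv[OF z] by (simp_all add: is_character_def fixed_field_closed)
    hence *: "to_ac (tr (l * inverse (\<phi> x))) * to_ac (tr (\<mu> * (\<theta> (inv z) * \<theta> x))) =
        (\<Sum>i<ell. \<Sum>j<ell. (l * inverse (\<phi> x)) ^ (C ^ i) * (\<mu> * (\<theta> (inv z) * \<theta> x)) ^ (C ^ j))"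
      by (simp only: to_ac_tr sum_product)
    show "to_ac ?n ^ 2 * (to_ac (tr (l * inverse (\<phi> x))) * to_ac (tr (\<mu> * (\<theta> (inv z) * \<theta> x)))) =
      (\<Sum>i<ell. \<Sum>j<ell. to_ac ?n ^ 2 * (l ^ (C ^ i) * \<mu> ^ (C ^ j) * \<theta> (inv z) ^ (C ^ j) *
       (inverse (\<phi> x ^ (C ^ i)) * \<theta> x ^ (C ^ j))))"
      unfolding * sum_distrib_left
      by (intro sum.cong HOL.refl) (simp add: power_mult_distrib power_inverse mult_ac)
  qed
  also have "\<dots> = (\<Sum>i<ell. \<Sum>j<ell. \<Sum>x\<in>H. to_ac ?n ^ 2 * (l ^ (C ^ i) * \<mu> ^ (C ^ j) * \<theta> (inv z) ^ (C ^ j) *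
       (inverse (\<phi> x ^ (C ^ i)) * \<theta> x ^ (C ^ j))))"
    by (subst sum.swap) (intro sum.cong HOL.refl sum.swap)
  finally show ?thesis by (simp only: sum_distrib_left)
qed

lemma W_convolve_outside:
  assumes z: "z \<notin> H"
  shows "(W \<phi> l \<star> W \<theta> \<mu>) z = 0"
proof (cases "z \<in> carrier G")
  case True
  have "W \<phi> l x * W \<theta> \<mu> (inv x \<otimes> z) = 0" if x: "x \<in> carrier G" for x
  proof (cases "x \<in> H")
    case xH: True
    have "inv x \<otimes> z \<notin> H"
    proof
      assume "inv x \<otimes> z \<in> H"
      hence "x \<otimes> (inv x \<otimes> z) \<in> H" using xH H_mult by blast
      thus False using z x True by (simp add: m_assoc[symmetric])
    qed
    thus ?thesis by (simp add: W_def)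
  qed (simp add: W_def)
  thus ?thesis unfolding convolve_apply[OF True] by (intro sum.neutral ballI)
qed (rule convolve_outside)

lemma character_orthogonality:
  assumes \<phi>: "is_character \<phi>" and \<theta>: "is_character \<theta>" and x: "x \<in> H" "\<phi> x ^ (C ^ i) \<noteq> \<theta> x ^ (C ^ j)"
  shows "(\<Sum>x\<in>H. inverse (\<phi> x ^ (C ^ i)) * \<theta> x ^ (C ^ j)) = 0"
proof (rule character_sum_zero[OF sub_H _ x(1)])
  show "inverse (\<phi> (y \<otimes> y') ^ (C ^ i)) * \<theta> (y \<otimes> y') ^ (C ^ j) =
      (inverse (\<phi> y ^ (C ^ i)) * \<theta> y ^ (C ^ j)) * (inverse (\<phi> y' ^ (C ^ i)) * \<theta> y' ^ (C ^ j))"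
    if "y \<in> H" "y' \<in> H" for y y'
    using that \<phi> \<theta> by (simp add: is_character_def power_mult_distrib)
  have "\<phi> x \<noteq> 0" using \<phi> x by (simp add: is_character_def)
  thus "inverse (\<phi> x ^ (C ^ i)) * \<theta> x ^ (C ^ j) \<noteq> 1" using x(2) by (simp add: field_simps)
qed

lemma W_orthogonal:
  assumes \<phi>: "is_character \<phi>" and \<theta>: "is_character \<theta>" and l: "l \<in> FF" and \<mu>: "\<mu> \<in> FF"
    and ne: "\<And>i j. \<exists>x\<in>H. \<phi> x ^ (C ^ i) \<noteq> \<theta> x ^ (C ^ j)"
  shows "W \<phi> l \<star> W \<theta> \<mu> = 0"
proof
  fix z
  show "(W \<phi> l \<star> W \<theta> \<mu>) z = 0 z"
  proof (cases "z \<in> H")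
    case True
    have "(\<Sum>x\<in>H. inverse (\<phi> x ^ (C ^ i)) * \<theta> x ^ (C ^ j)) = 0" for i j
      using ne[of i j] character_orthogonality[OF \<phi> \<theta>] by blast
    hence "to_ac ((W \<phi> l \<star> W \<theta> \<mu>) z) = 0" using W_convolve[OF \<phi> \<theta> l \<mu> True] by simp
    thus ?thesis by simp
  qed (simp add: W_convolve_outside)
qed

lemma \<psi>_power_sum:
  assumes "i < ell" "j < ell"
  shows "(\<Sum>x\<in>H. inverse (\<psi> x ^ (C ^ i)) * \<psi> x ^ (C ^ j)) = (if i = j then of_nat (card H) else 0)"
proof (cases "i = j")
  case True
  have "inverse (\<psi> x ^ (C ^ i)) * \<psi> x ^ (C ^ j) = 1" if "x \<in> H" for x
    using that \<psi>_nonzero True by simp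
  thus ?thesis using True by simp
next
  case False
  hence "\<psi> gen ^ (C ^ i) \<noteq> \<psi> gen ^ (C ^ j)" using assms by (simp add: frobenius_eq_iff cong_def)
  thus ?thesis using False character_orthogonality[OF is_character_\<psi> is_character_\<psi> gen(1)] by simp
qed

text \<open>The conjugates of \<open>\<psi>\<close> below \<open>ell\<close> are distinct, hence
  orthogonal; only the terms with \<open>i = j\<close> survive, and one factor \<open>card H\<close>
  cancels.\<close>

lemma W_mult:
  assumes l: "l \<in> FF" and \<mu>: "\<mu> \<in> FF"
  shows "W \<psi> l \<star> W \<psi> \<mu> = W \<psi> (l * \<mu>)"
proof
  fix z
  show "(W \<psi> l \<star> W \<psi> \<mu>) z = W \<psi> (l * \<mu>) z"
  proof (cases "z \<in> H")
    case z: True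
    let ?n = "to_ac (inverse (of_nat (card H))) :: 'f alg_closure"
    have n: "?n * of_nat (card H) = 1" using card_H_nonzero
      by (metis left_inverse to_ac_1 to_ac_mult to_ac_of_nat)
    have "to_ac ((W \<psi> l \<star> W \<psi> \<mu>) z) = ?n\<^sup>2 *
      (\<Sum>i<ell. \<Sum>j<ell. l ^ (C ^ i) * \<mu> ^ (C ^ j) * \<psi> (inv z) ^ (C ^ j) * (if i = j then of_nat (card H) else 0))"
      unfolding W_convolve[OF is_character_\<psi> is_character_\<psi> l \<mu> z]
      by (intro arg_cong2[of _ _ _ _ times] HOL.refl sum.cong) (simp add: \<psi>_power_sum)
    also have "\<dots> = ?n\<^sup>2 * (\<Sum>i<ell. (l * \<mu> * \<psi> (inv z)) ^ (C ^ i) * of_nat (card H))"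
    proof -
      have "(\<Sum>j<ell. l ^ (C ^ i) * \<mu> ^ (C ^ j) * \<psi> (inv z) ^ (C ^ j) * (if i = j then of_nat (card H) else 0)) =
          (l * \<mu> * \<psi> (inv z)) ^ (C ^ i) * of_nat (card H)" if "i < ell" for i
      proof -
        have "(\<Sum>j<ell. l ^ (C ^ i) * \<mu> ^ (C ^ j) * \<psi> (inv z) ^ (C ^ j) * (if i = j then of_nat (card H) else 0)) =
          (\<Sum>j<ell. if j = i then (l * \<mu> * \<psi> (inv z)) ^ (C ^ i) * of_nat (card H) else 0)"
          by (intro sum.cong HOL.refl) (auto simp: power_mult_distrib)
        thus ?thesis using that by simp
      qed
      thus ?thesis by simp
    qed
    also have "\<dots> = (?n * of_nat (card H)) * ?n * (\<Sum>i<ell. (l * \<mu> * \<psi> (inv z)) ^ (C ^ i))"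
      unfolding sum_distrib_right[symmetric] power2_eq_square by (simp only: mult_ac)
    also have "\<dots> = to_ac (W \<psi> (l * \<mu>) z)"
      using to_ac_tr[of "l * \<mu> * \<psi> (inv z)"] l \<mu> \<psi>_FF[OF H_inv[OF z]] z unfolding n
      by (simp add: W_def fixed_field_closed)
    finally show ?thesis by simp
  qed (simp add: W_convolve_outside W_def)
qed

lemma W_add: "l \<in> FF \<Longrightarrow> \<mu> \<in> FF \<Longrightarrow> W \<psi> (l + \<mu>) = W \<psi> l + W \<psi> \<mu>"
proof
  fix x assume l: "l \<in> FF" and \<mu>: "\<mu> \<in> FF"
  show "W \<psi> (l + \<mu>) x = (W \<psi> l + W \<psi> \<mu>) x"
  proof (cases "x \<in> H")
    case True
    have "tr ((l + \<mu>) * \<psi> (inv x)) = tr (l * \<psi> (inv x)) + tr (\<mu> * \<psi> (inv x))"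
      unfolding distrib_right using l \<mu> \<psi>_FF[OF H_inv[OF True]] by (intro tr_add fixed_field_closed)
    thus ?thesis by (simp add: W_def distrib_left)
  qed (simp add: W_def)
qed

lemma W_scale: "l \<in> FF \<Longrightarrow> W \<psi> (to_ac c * l) = scale c (W \<psi> l)"
proof
  fix x assume l: "l \<in> FF"
  show "W \<psi> (to_ac c * l) x = scale c (W \<psi> l) x"
  proof (cases "x \<in> H")
    case True
    have "tr (to_ac c * (l * \<psi> (inv x))) = c * tr (l * \<psi> (inv x))"
      using l \<psi>_FF[OF H_inv[OF True]] by (intro tr_scale fixed_field_closed)
    thus ?thesis by (simp add: W_def scale_def mult_ac)
  qed (simp add: W_def scale_def)
qed

text \<open>Otherwise every \<open>\<psi> x\<close> would have trace 0. Summing these traces against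
  the inverse of \<open>\<psi>\<close> over \<open>H\<close> leaves \<open>card H\<close> by
  orthogonality, which is nonzero in the base field.\<close>

lemma W_one_nonzero: "W \<psi> 1 \<noteq> 0"
proof
  assume 0: "W \<psi> 1 = 0"
  have "tr (\<psi> x) = 0" if x: "x \<in> H" for x
  proof -
    have "W \<psi> 1 (inv x) = 0" using 0 by simp
    thus ?thesis using x H_inv[OF x] H_mem[OF x] card_H_nonzero by (simp add: W_def)
  qed
  hence "(\<Sum>i<ell. \<psi> x ^ (C ^ i)) = 0" if "x \<in> H" for x using to_ac_tr[OF \<psi>_FF[OF that]] that by simp
  hence "0 = (\<Sum>x\<in>H. inverse (\<psi> x ^ (C ^ 0)) * (\<Sum>i<ell. \<psi> x ^ (C ^ i)))" by simp
  also have "\<dots> = (\<Sum>i<ell. \<Sum>x\<in>H. inverse (\<psi> x ^ (C ^ 0)) * \<psi> x ^ (C ^ i))"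
    unfolding sum_distrib_left by (rule sum.swap)
  also have "\<dots> = (\<Sum>i<ell. if i = 0 then of_nat (card H) else 0)"
  proof (intro sum.cong HOL.refl)
    fix i assume "i \<in> {..<ell}"
    thus "(\<Sum>x\<in>H. inverse (\<psi> x ^ (C ^ 0)) * \<psi> x ^ (C ^ i)) = (if i = 0 then of_nat (card H) else 0)"
      using \<psi>_power_sum[of 0 i] ell_pos by auto
  qed
  also have "\<dots> = to_ac (of_nat (card H))" using ell_pos by simp
  finally show False using card_H_nonzero by (metis to_ac_0 to_ac_eq_iff)
qed

definition w :: "'f alg_closure \<Rightarrow> ('a \<Rightarrow> 'f) endo" where "w l = conv (W \<psi> l)"

sublocale field_embedding w FF
  by unfold_locales
    (simp_all add: fixed_field_closed w_def W_add conv_add W_mult conv_mult[symmetric])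

lemma w_one_nonzero: "w 1 \<noteq> 0"
  using conv_inject[OF W_closed, of 0 \<psi> 1] W_one_nonzero
  by (simp add: w_def conv_zero group_algebra_simps(1))

lemma scalar_w: "l \<in> FF \<Longrightarrow> scalar c * w l = w (to_ac c * l)"
  by (simp add: w_def scalar_left W_closed W_scale)

text \<open>\<open>class_eps\<close> works with a representative picked by choice; the assumption
  says that \<open>\<chi>\<close> is this representative.\<close>

lemma class_eps_W:
  assumes "\<chi> = (SOME \<chi>. \<chi> \<in> Cl)"
  shows "class_eps G H K Cl = W \<psi> 1"
proof
  fix x
  have c: "cyclotomic_trace k y = tr y" if "y ^ k = 1" for y using cyclotomic_trace_eq[OF that] by (simp add: tr_def)
  show "class_eps G H K Cl x = W \<psi> 1 x"
  proof (cases "x \<in> H")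
    case True
    have "\<chi> (K #> inv x) ^ k = 1" using \<psi>_k[OF H_inv[OF True]] by (simp add: \<psi>_def)
    from c[OF this] show ?thesis using True unfolding class_eps_def Let_def assms[symmetric]
      by (simp add: W_def \<psi>_def k_def)
  qed (simp add: class_eps_def W_def)
qed

lemma grp_w: "h \<in> H \<Longrightarrow> l \<in> FF \<Longrightarrow> grp h * w l = w (\<psi> h * l)"
proof -
  assume h: "h \<in> H" and l: "l \<in> FF"
  have "single h \<star> W \<psi> l = W \<psi> (\<psi> h * l)"
  proof
    fix z
    show "(single h \<star> W \<psi> l) z = W \<psi> (\<psi> h * l) z"
    proof (cases "z \<in> carrier G")
      case z: True
      have eq: "(single h \<star> W \<psi> l) z = W \<psi> l (inv h \<otimes> z)" by (rule single_convolve[OF H_mem[OF h] z])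
      show ?thesis
      proof (cases "z \<in> H")
        case True
        have "\<psi> (inv (inv h \<otimes> z)) = \<psi> (inv z) * \<psi> h"
          using H_mem[OF h] z \<psi>_mult[OF H_inv[OF True] h] by (simp add: inv_mult_group)
        thus ?thesis using True H_mult[OF H_inv[OF h] True] by (simp add: eq W_def mult_ac)
      next
        case False
        have "inv h \<otimes> z \<notin> H"
        proof
          assume "inv h \<otimes> z \<in> H"
          hence "h \<otimes> (inv h \<otimes> z) \<in> H" using h H_mult by blast
          thus False using False z H_mem[OF h] by (simp add: m_assoc[symmetric])
        qed
        thus ?thesis using False by (simp add: eq W_def)
      qed
    next
      case False
      hence "z \<notin> H" using H_mem by blast
      thus ?thesis using False by (simp add: convolve_outside W_def)
    qed
  qed
  thus ?thesis by (simp add: w_def grp_def conv_mult[symmetric])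
qed

text \<open>Traces are compared rather than characters because conjugation by \<open>g\<close> may
  introduce a Frobenius power, which the trace does not see.\<close>

lemma grp_W_conj:
  assumes g: "g \<in> N" and \<theta>: "\<And>x. x \<in> H \<Longrightarrow> tr (\<mu> * \<theta> (g \<otimes> x \<otimes> inv g)) = tr (l * \<phi> x)"
  shows "grp g * conv (W \<phi> l) = conv (W \<theta> \<mu>) * grp g"
proof -
  have gc: "g \<in> carrier G" using g N_carrier by blast
  have gN': "inv g \<in> N" by (rule subgroup.m_inv_closed[OF sub_N g])
  have "single g \<star> W \<phi> l = W \<theta> \<mu> \<star> single g"
  proof
    fix z
    show "(single g \<star> W \<phi> l) z = (W \<theta> \<mu> \<star> single g) z"
    proof (cases "z \<in> carrier G")
      case z: True
      define x where "x = inv g \<otimes> z"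
      have x: "x \<in> carrier G" using gc z by (simp add: x_def)
      have zx: "z \<otimes> inv g = g \<otimes> x \<otimes> inv g" using gc z by (simp add: x_def m_assoc[symmetric])
      have xg: "x = inv g \<otimes> (g \<otimes> x \<otimes> inv g) \<otimes> g" using gc x by (simp add: m_assoc) (simp add: m_assoc[symmetric])
      have l: "(single g \<star> W \<phi> l) z = W \<phi> l x" unfolding x_def by (rule single_convolve[OF gc z])
      have r: "(W \<theta> \<mu> \<star> single g) z = W \<theta> \<mu> (g \<otimes> x \<otimes> inv g)" using convolve_single[OF gc z] zx by simp
      show ?thesis
      proof (cases "x \<in> H")
        case True
        have "inv (g \<otimes> x \<otimes> inv g) = g \<otimes> inv x \<otimes> inv g" using gc x by (simp add: inv_mult_group m_assoc)
        thus ?thesis using True \<theta>[OF H_inv[OF True]] conj_closed(1)[OF g True] unfolding l r by (simp add: W_def)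
      next
        case False
        have "g \<otimes> x \<otimes> inv g \<notin> H"
        proof
          assume "g \<otimes> x \<otimes> inv g \<in> H"
          from conj_closed(1)[OF gN' this] show False using False xg gc by simp
        qed
        thus ?thesis using False unfolding l r by (simp add: W_def)
      qed
    qed (simp add: convolve_outside)
  qed
  thus ?thesis by (simp add: grp_def conv_mult[symmetric])
qed

text \<open>A relation rather than a function, since the exponent is determined only modulo
  \<open>ell\<close>. Membership in the stabilizer is expressed by it in
  \<open>mem_E\<close>.\<close>

definition acts :: "'a \<Rightarrow> nat \<Rightarrow> bool" where
  "acts g i \<longleftrightarrow> g \<in> N \<and> (\<forall>h\<in>H. \<psi> (g \<otimes> h \<otimes> inv g) = \<psi> h ^ (C ^ i))"

lemma acts_w:
  assumes g: "acts g i" and l: "l \<in> FF"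
  shows "grp g * w l = w (l ^ (C ^ i)) * grp g"
  unfolding w_def
proof (rule grp_W_conj)
  show "g \<in> N" using g by (simp add: acts_def)
  fix x assume x: "x \<in> H"
  have "tr (l ^ (C ^ i) * \<psi> (g \<otimes> x \<otimes> inv g)) = tr ((l * \<psi> x) ^ (C ^ i))"
    using g x by (simp add: acts_def power_mult_distrib)
  also have "\<dots> = tr (l * \<psi> x)" using l \<psi>_FF[OF x] by (intro tr_frobenius fixed_field_closed)
  finally show "tr (l ^ (C ^ i) * \<psi> (g \<otimes> x \<otimes> inv g)) = tr (l * \<psi> x)" .
qed

end

context shoda_class
begin

subsection \<open>The stabilizer of a cyclotomic class\<close>

lemma acts_N: "acts g i \<Longrightarrow> g \<in> N" and acts_carrier: "acts g i \<Longrightarrow> g \<in> carrier G"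
  using N_carrier by (auto simp: acts_def)

lemma acts_\<psi>: "acts g i \<Longrightarrow> h \<in> H \<Longrightarrow> \<psi> (g \<otimes> h \<otimes> inv g) = \<psi> h ^ (C ^ i)"
  by (simp add: acts_def)

lemma FF_frobenius_cong: "x \<in> FF \<Longrightarrow> [i = j] (mod ell) \<Longrightarrow> x ^ (C ^ i) = x ^ (C ^ j)"
  by (metis cong_def frobenius_mod)

lemma acts_unique: "acts g i \<Longrightarrow> acts g j \<Longrightarrow> [i = j] (mod ell)"
  using gen(1) by (simp add: acts_def frobenius_eq_iff[symmetric])

lemma acts_cong: "acts g i \<Longrightarrow> [i = j] (mod ell) \<Longrightarrow> acts g j"
  using \<psi>_FF FF_frobenius_cong by (auto simp: acts_def)

lemma acts_H: "h \<in> H \<Longrightarrow> acts h 0"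
proof -
  assume h: "h \<in> H"
  have "\<psi> (h \<otimes> h' \<otimes> inv h) = \<psi> h'" if h': "h' \<in> H" for h'
    using h h' \<psi>_nonzero[OF h] by (simp add: \<psi>_mult H_mult H_inv \<psi>_inv)
  thus ?thesis using h H_N by (auto simp: acts_def)
qed

lemma acts_mult: "acts g i \<Longrightarrow> acts g' j \<Longrightarrow> acts (g \<otimes> g') (i + j)"
proof -
  assume g: "acts g i" and g': "acts g' j"
  have c: "g \<in> carrier G" "g' \<in> carrier G" using g g' acts_carrier by blast+
  have "\<psi> (g \<otimes> g' \<otimes> h \<otimes> inv (g \<otimes> g')) = \<psi> h ^ (C ^ (i + j))" if h: "h \<in> H" for h
  proof -
    have "g \<otimes> g' \<otimes> h \<otimes> inv (g \<otimes> g') = g \<otimes> (g' \<otimes> h \<otimes> inv g') \<otimes> inv g"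
      using c H_mem[OF h] by (simp add: inv_mult_group m_assoc)
    hence "\<psi> (g \<otimes> g' \<otimes> h \<otimes> inv (g \<otimes> g')) = \<psi> (g' \<otimes> h \<otimes> inv g') ^ (C ^ i)"
      using acts_\<psi>[OF g conj_closed(1)[OF acts_N[OF g'] h]] by simp
    thus ?thesis using acts_\<psi>[OF g' h] by (simp add: power_add power_mult[symmetric] mult.commute)
  qed
  thus ?thesis using NK.A_closed(2)[OF acts_N[OF g] acts_N[OF g']] by (simp add: acts_def)
qed

lemma acts_pow: "acts g i \<Longrightarrow> acts (g [^] (n::nat)) (n * i)"
proof (induction n)
  case 0
  show ?case using acts_H[OF HK.A_closed(1)] by simp
next
  case (Suc n)
  thus ?case using acts_mult[of "g [^] n" "n * i" g i] by (simp add: add.commute)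
qed

text \<open>The exponent stands for \<open>- i\<close> within the natural numbers: together with
  \<open>i\<close> it makes the multiple \<open>ell * i\<close>.\<close>

lemma acts_inv: "acts g i \<Longrightarrow> acts (inv g) (i * (ell - 1))"
proof -
  assume g: "acts g i"
  have gc: "g \<in> carrier G" and gN: "inv g \<in> N"
    using acts_carrier[OF g] NK.A_closed(3)[OF acts_N[OF g]] by auto
  have "\<psi> (inv g \<otimes> h \<otimes> inv (inv g)) = \<psi> h ^ (C ^ (i * (ell - 1)))" if h: "h \<in> H" for h
  proof -
    let ?h = "inv g \<otimes> h \<otimes> inv (inv g)"
    have h': "?h \<in> H" by (rule conj_closed(1)[OF gN h])
    have "g \<otimes> ?h \<otimes> inv g = h" using gc H_mem[OF h] by (simp add: m_assoc) (simp add: m_assoc[symmetric])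
    hence "\<psi> h = \<psi> ?h ^ (C ^ i)" using acts_\<psi>[OF g h'] by simp
    hence "\<psi> h ^ (C ^ (i * (ell - 1))) = \<psi> ?h ^ (C ^ (i + i * (ell - 1)))"
      by (simp add: power_add power_mult)
    also have "i + i * (ell - 1) = ell * i" using ell_pos by (cases ell) auto
    also have "\<psi> ?h ^ (C ^ (ell * i)) = \<psi> ?h" by (rule fixed_field_power[OF \<psi>_FF[OF h']])
    finally show ?thesis by simp
  qed
  thus ?thesis using gN by (simp add: acts_def)
qed

text \<open>As \<open>\<psi>\<close> is faithful modulo \<open>K\<close>, a trivial action means
  that \<open>g\<close> centralizes \<open>H\<close> modulo \<open>K\<close>, and \<open>H/K\<close>
  is its own centralizer. Hence an element of \<open>E\<close> is determined modulo \<open>H\<close>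
  by its exponent.\<close>

lemma acts_trivial: "acts g i \<Longrightarrow> ell dvd i \<Longrightarrow> g \<in> H"
proof (rule self_centralizing)
  assume g: "acts g i" and i: "ell dvd i"
  show "g \<in> N" by (rule acts_N[OF g])
  fix h assume h: "h \<in> H"
  have gh: "g \<otimes> h \<otimes> inv g \<in> H" by (rule conj_closed(1)[OF acts_N[OF g] h])
  obtain n where n: "i = ell * n" using i by auto
  have "\<psi> (g \<otimes> h \<otimes> inv g) = \<psi> h" using acts_\<psi>[OF g h] fixed_field_power[OF \<psi>_FF[OF h], of n] by (simp add: n)
  hence "\<psi> (g \<otimes> h \<otimes> inv g \<otimes> inv h) = 1"
    using \<psi>_mult[OF gh H_inv[OF h]] \<psi>_inv[OF h] \<psi>_nonzero[OF h] by simp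
  thus "g \<otimes> h \<otimes> inv g \<otimes> inv h \<in> K" using \<psi>_one_iff[OF H_mult[OF gh H_inv[OF h]]] by simp
qed

lemma acts_H_iff: "acts g i \<Longrightarrow> g \<in> H \<longleftrightarrow> ell dvd i"
proof
  assume "acts g i" "g \<in> H"
  from acts_unique[OF this(1) acts_H[OF this(2)]] show "ell dvd i" by (simp add: cong_0_iff)
qed (rule acts_trivial)

definition E where "E = class_stabilizer G H K Cl"

lemma coset_conj:
  assumes g: "g \<in> N" and h: "h \<in> H"
  shows "g <# (K #> h) #> inv g = K #> (g \<otimes> h \<otimes> inv g)"
proof -
  have gc: "g \<in> carrier G" "inv g \<in> N" using g N_carrier NK.A_closed(3) by auto
  have Kc: "x \<in> carrier G" if "x \<in> K" for x using that K_carrier by blast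
  show ?thesis
  proof (intro equalityI subsetI)
    fix y assume "y \<in> g <# (K #> h) #> inv g"
    then obtain x where x: "x \<in> K" "y = g \<otimes> (x \<otimes> h) \<otimes> inv g" by (auto simp: l_coset_def r_coset_def)
    have "y = (g \<otimes> x \<otimes> inv g) \<otimes> (g \<otimes> h \<otimes> inv g)"
      using x(2) Kc[OF x(1)] gc(1) H_mem[OF h] by (simp add: m_assoc) (simp add: m_assoc[symmetric])
    thus "y \<in> K #> (g \<otimes> h \<otimes> inv g)" using conj_closed(2)[OF g x(1)] by (auto simp: r_coset_def)
  next
    fix y assume "y \<in> K #> (g \<otimes> h \<otimes> inv g)"
    then obtain x where x: "x \<in> K" "y = x \<otimes> (g \<otimes> h \<otimes> inv g)" by (auto simp: r_coset_def)
    have "y = g \<otimes> ((inv g \<otimes> x \<otimes> inv (inv g)) \<otimes> h) \<otimes> inv g"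
      using x(2) Kc[OF x(1)] gc(1) H_mem[OF h] by (simp add: m_assoc) (simp add: m_assoc[symmetric])
    thus "y \<in> g <# (K #> h) #> inv g" using conj_closed(2)[OF gc(2) x(1)] unfolding l_coset_def r_coset_def by blast
  qed
qed

lemma N_normalizes_H: "g \<in> N \<Longrightarrow> g \<in> normalizer G H"
proof -
  assume g: "g \<in> N"
  have gc: "g \<in> carrier G" "inv g \<in> N" using g N_carrier NK.A_closed(3) by auto
  have "g <# H #> inv g = H"
  proof (intro equalityI subsetI)
    fix y assume "y \<in> g <# H #> inv g"
    thus "y \<in> H" using conj_closed(1)[OF g] by (auto simp: l_coset_def r_coset_def)
  next
    fix y assume y: "y \<in> H"
    have "y = g \<otimes> (inv g \<otimes> y \<otimes> inv (inv g)) \<otimes> inv g"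
      using H_mem[OF y] gc(1) by (simp add: m_assoc) (simp add: m_assoc[symmetric])
    thus "y \<in> g <# H #> inv g" using conj_closed(1)[OF gc(2) y] unfolding l_coset_def r_coset_def by blast
  qed
  thus ?thesis using gc(1) by (simp add: mem_normalizer[OF H_carrier])
qed

definition \<chi>_power :: "nat \<Rightarrow> 'a set \<Rightarrow> 'f alg_closure" where
  "\<chi>_power i = (\<lambda>Y \<in> carrier (quot G H K). \<chi> Y ^ (C ^ i))"

lemma Cl_eq: "Cl = range \<chi>_power"
  by (simp add: Cl cyclotomic_class_def \<chi>_power_def[abs_def] C_CARD[symmetric])

lemma \<chi>_power_apply: "h \<in> H \<Longrightarrow> \<chi>_power i (K #> h) = \<psi> h ^ (C ^ i)"
  by (simp add: \<chi>_power_def \<psi>_def carrier_quot)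

lemma \<chi>_power_eqI:
  assumes "f \<in> extensional (carrier (quot G H K))" "\<And>h. h \<in> H \<Longrightarrow> f (K #> h) = \<psi> h ^ (C ^ i)"
  shows "f = \<chi>_power i"
proof (rule extensionalityI[OF assms(1)])
  show "\<chi>_power i \<in> extensional (carrier (quot G H K))" by (simp add: \<chi>_power_def)
  fix y assume "y \<in> carrier (quot G H K)"
  then obtain h where "h \<in> H" "y = K #> h" by (auto simp: carrier_quot)
  thus "f y = \<chi>_power i y" using assms(2) \<chi>_power_apply by simp
qed

lemma character_conj_apply:
  assumes "g \<in> N" "h \<in> H"
  shows "character_conj G H K g (\<chi>_power i) (K #> h) = \<psi> (g \<otimes> h \<otimes> inv g) ^ (C ^ i)"
  using assms \<chi>_power_apply[OF conj_closed(1)[OF assms]]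
  by (simp add: character_conj_def carrier_quot coset_conj)

text \<open>A stabilizing element sends \<open>\<chi>\<close> to one of its Frobenius powers, and
  this exponent is the one required. Conversely the action shifts all exponents by \<open>i\<close>,
  which is onto the class because exponents are periodic modulo \<open>ell\<close>.\<close>

lemma mem_E: "g \<in> E \<longleftrightarrow> (\<exists>i. acts g i)"
proof
  assume "g \<in> E"
  hence g: "g \<in> N" and c: "character_conj G H K g ` Cl = Cl"
    by (auto simp: E_def class_stabilizer_def N_def)
  have "\<chi>_power 0 \<in> Cl" by (simp add: Cl_eq)
  hence "character_conj G H K g (\<chi>_power 0) \<in> Cl" using c by blast
  then obtain i where i: "character_conj G H K g (\<chi>_power 0) = \<chi>_power i" by (auto simp: Cl_eq)
  have "\<psi> (g \<otimes> h \<otimes> inv g) = \<psi> h ^ (C ^ i)" if h: "h \<in> H" for h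
    using character_conj_apply[OF g h, of 0] \<chi>_power_apply[OF h, of i] i by simp
  thus "\<exists>i. acts g i" using g by (auto simp: acts_def)
next
  assume "\<exists>i. acts g i"
  then obtain i where i: "acts g i" by blast
  have g: "g \<in> N" by (rule acts_N[OF i])
  have cp: "character_conj G H K g (\<chi>_power j) = \<chi>_power (i + j)" for j
  proof (rule \<chi>_power_eqI)
    fix h assume h: "h \<in> H"
    show "character_conj G H K g (\<chi>_power j) (K #> h) = \<psi> h ^ (C ^ (i + j))"
      unfolding character_conj_apply[OF g h] acts_\<psi>[OF i h] by (simp add: power_add power_mult)
  qed (simp add: character_conj_def)
  have "\<chi>_power j \<in> character_conj G H K g ` Cl" for j
  proof -
    have "\<chi>_power (i + (j + i * (ell - 1))) = \<chi>_power j"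
    proof (rule \<chi>_power_eqI)
      fix h assume h: "h \<in> H"
      have eq: "i + (j + i * (ell - 1)) = j + ell * i" using ell_pos by (cases ell) auto
      have "[i + (j + i * (ell - 1)) = j] (mod ell)" unfolding eq by (simp add: cong_def)
      thus "\<chi>_power (i + (j + i * (ell - 1))) (K #> h) = \<psi> h ^ (C ^ j)"
        unfolding \<chi>_power_apply[OF h] by (rule FF_frobenius_cong[OF \<psi>_FF[OF h]])
    qed (simp add: \<chi>_power_def)
    thus ?thesis using cp[of "j + i * (ell - 1)"] unfolding Cl_eq by (metis imageI rangeI)
  qed
  hence "character_conj G H K g ` Cl = Cl" using cp by (auto simp: Cl_eq)
  thus "g \<in> E" using g N_normalizes_H[OF g] by (simp add: E_def class_stabilizer_def N_def)
qed

lemma sub_E: "subgroup E G"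
proof (rule subgroupI)
  show "E \<subseteq> carrier G" using mem_E acts_carrier by blast
  show "E \<noteq> {}" using acts_H[OF HK.A_closed(1)] mem_E by blast
next
  fix g g' assume "g \<in> E" "g' \<in> E"
  thus "g \<otimes> g' \<in> E" unfolding mem_E using acts_mult by blast
next
  fix g assume "g \<in> E"
  thus "inv g \<in> E" unfolding mem_E using acts_inv by blast
qed

lemma H_E: "H \<subseteq> E" using acts_H mem_E by blast
lemma E_N: "E \<subseteq> N" using acts_N mem_E by blast
lemma K_E: "K \<subseteq> E" using K_H H_E by blast
lemma E_mem: "g \<in> E \<Longrightarrow> g \<in> carrier G" using E_N N_carrier by blast

sublocale EK: subquotient G E K
  by (rule subquotient_sub[OF sub_E K_E E_N])

text \<open>Every subgroup of \<open>E\<close> is cyclic modulo \<open>H\<close>, since \<open>E/H\<close> embeds in the Galois group.\<close>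

lemma cyclic_mod_H:
  assumes V: "subgroup V G" and VE: "V \<subseteq> E"
  obtains v s where "v \<in> V" "acts v s" "s > 0" "s dvd ell"
    "\<And>g. g \<in> V \<Longrightarrow> \<exists>h\<in>V \<inter> H. \<exists>j<ell div s. g = h \<otimes> v [^] (j::nat)"
    "\<And>j. v [^] (j::nat) \<in> H \<longleftrightarrow> ell div s dvd j"
    "\<And>g i. g \<in> V \<Longrightarrow> acts g i \<Longrightarrow> s dvd i"
proof -
  \<comment> \<open>Division with remainder makes every exponent occurring in \<open>V\<close> a
    multiple of the least positive one, so an element realizing it generates \<open>V\<close> modulo
    \<open>H\<close>, with order \<open>ell div s\<close>.\<close>
  define s where "s = (LEAST i. i > 0 \<and> (\<exists>g\<in>V. acts g i))"
  have "acts \<one> ell" using acts_cong[OF acts_H[OF HK.A_closed(1)], of ell] by (simp add: cong_def)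
  hence ex: "ell > 0 \<and> (\<exists>g\<in>V. acts g ell)" using ell_pos subgroup.one_closed[OF V] by blast
  have s: "s > 0 \<and> (\<exists>g\<in>V. acts g s)" unfolding s_def by (rule LeastI, rule ex)
  have least: "s \<le> i" if "i > 0" "\<exists>g\<in>V. acts g i" for i
    unfolding s_def using that by (intro Least_le) simp
  obtain v where v: "v \<in> V" "acts v s" using s by blast
  have vc: "v \<in> carrier G" using acts_carrier[OF v(2)] .
  have vV: "v [^] (n::nat) \<in> V" for n
    by (induction n) (simp_all add: subgroup.one_closed[OF V] subgroup.m_closed[OF V] v(1))
  have red: "\<exists>h\<in>V. acts h (i mod s) \<and> g = h \<otimes> v [^] (i div s)" if g: "g \<in> V" "acts g i" for g i
  proof -
    define h where "h = g \<otimes> inv (v [^] (i div s))"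
    have "acts h (i + (i div s * s) * (ell - 1))" unfolding h_def
      by (rule acts_mult[OF g(2) acts_inv[OF acts_pow[OF v(2)]]])
    moreover have "[i + (i div s * s) * (ell - 1) = i mod s] (mod ell)"
    proof -
      have "i + (i div s * s) * (ell - 1) = i mod s + i div s * s + (i div s * s) * (ell - 1)" by simp
      also have "\<dots> = i mod s + ell * (i div s * s)" using ell_pos by (cases ell) (auto simp: algebra_simps)
      finally show ?thesis by (simp add: cong_def)
    qed
    ultimately have "acts h (i mod s)" by (rule acts_cong)
    moreover have "h \<in> V" unfolding h_def
      by (intro subgroup.m_closed[OF V] subgroup.m_inv_closed[OF V] g vV)
    moreover have "g = h \<otimes> v [^] (i div s)" using acts_carrier[OF g(2)] vc by (simp add: h_def m_assoc)
    ultimately show ?thesis by blast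
  qed
  have dv: "s dvd i" if g: "g \<in> V" "acts g i" for g i
  proof -
    have "\<exists>h\<in>V. acts h (i mod s)" using red[OF g] by blast
    hence "\<not> i mod s > 0" using least[of "i mod s"] mod_less_divisor[of s i] s by linarith
    thus ?thesis by (simp add: dvd_eq_mod_eq_0)
  qed
  have sl: "s dvd ell" using ex dv by blast
  have vH: "v [^] (j::nat) \<in> H \<longleftrightarrow> ell div s dvd j" for j
  proof -
    have "v [^] j \<in> H \<longleftrightarrow> ell dvd j * s" by (rule acts_H_iff[OF acts_pow[OF v(2)]])
    also have "\<dots> \<longleftrightarrow> (ell div s) * s dvd j * s" using sl by simp
    also have "\<dots> \<longleftrightarrow> ell div s dvd j" using s by simp
    finally show ?thesis .
  qed
  have cov: "\<exists>h\<in>V \<inter> H. \<exists>j<ell div s. g = h \<otimes> v [^] (j::nat)" if g: "g \<in> V" for g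
  proof -
    obtain i where i0: "acts g i" using g VE mem_E by blast
    have i: "acts g (i mod ell)" by (rule acts_cong[OF i0]) (simp add: cong_def)
    obtain h where h: "h \<in> V" "acts h (i mod ell mod s)" "g = h \<otimes> v [^] (i mod ell div s)"
      using red[OF g i] by blast
    have "i mod ell mod s = 0" using dv[OF g i] by simp
    hence "h \<in> H" using acts_trivial[OF h(2)] by simp
    moreover have "i mod ell div s < ell div s"
      using ell_pos s sl by (metis dvd_mult_div_cancel mod_less_divisor div_less_iff_less_mult mult.commute)
    ultimately show ?thesis using h by blast
  qed
  show thesis by (rule that[OF v _ sl cov vH dv]) (use s in simp)
qed

subsection \<open>Orthogonality of conjugates\<close>

lemma w_grp: "h \<in> H \<Longrightarrow> l \<in> FF \<Longrightarrow> w l * grp h = w (l * \<psi> h)"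
  using acts_w[OF acts_H, of h l] grp_w[of h l] by (simp add: mult.commute)

lemma w_average:
  assumes M: "subgroup M G" "M \<subseteq> H"
  shows "w 1 * conv (average M) = w (to_ac (inverse (of_nat (card M))) * (\<Sum>y\<in>M. \<psi> y))"
    and "conv (average M) * w 1 = w (to_ac (inverse (of_nat (card M))) * (\<Sum>y\<in>M. \<psi> y))"
proof -
  let ?c = "inverse (of_nat (card M)) :: 'f"
  have Mc: "M \<subseteq> carrier G" using M(1) by (rule subgroup.subset)
  have \<psi>M: "\<psi> y \<in> FF" if "y \<in> M" for y using that M(2) \<psi>_FF by blast
  have sF: "(\<Sum>y\<in>M. \<psi> y) \<in> FF" by (rule FF_sum[OF \<psi>M])
  have "w 1 * conv (average M) = w 1 * scalar ?c * (\<Sum>y\<in>M. grp y)"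
    by (simp add: conv_average[OF Mc] mult.assoc)
  also have "w 1 * scalar ?c = scalar ?c * w 1"
    unfolding w_def by (simp add: scalar_left scalar_right W_closed)
  also have "scalar ?c * w 1 * (\<Sum>y\<in>M. grp y) = scalar ?c * (\<Sum>y\<in>M. w 1 * grp y)"
    by (simp add: mult.assoc sum_distrib_left)
  also have "(\<Sum>y\<in>M. w 1 * grp y) = (\<Sum>y\<in>M. w (\<psi> y))"
    using M(2) by (intro sum.cong HOL.refl) (auto simp: w_grp one_L)
  also have "\<dots> = w (\<Sum>y\<in>M. \<psi> y)" by (rule w_sum[symmetric, OF \<psi>M])
  finally show "w 1 * conv (average M) = w (to_ac ?c * (\<Sum>y\<in>M. \<psi> y))" by (simp add: scalar_w[OF sF])
  have "conv (average M) * w 1 = scalar ?c * (\<Sum>y\<in>M. grp y * w 1)"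
    by (simp add: conv_average[OF Mc] mult.assoc sum_distrib_right)
  also have "(\<Sum>y\<in>M. grp y * w 1) = (\<Sum>y\<in>M. w (\<psi> y))"
    using M(2) by (intro sum.cong HOL.refl) (auto simp: grp_w one_L)
  also have "\<dots> = w (\<Sum>y\<in>M. \<psi> y)" by (rule w_sum[symmetric, OF \<psi>M])
  finally show "conv (average M) * w 1 = w (to_ac ?c * (\<Sum>y\<in>M. \<psi> y))" by (simp add: scalar_w[OF sF])
qed

text \<open>Two different reasons. Outside \<open>N\<close>, condition (SS3) applies, since
  \<open>W \<psi> 1\<close> absorbs the average of \<open>K\<close> and is annihilated by those of
  the minimal larger subgroups. Inside \<open>N\<close> but outside \<open>E\<close>, conjugation
  leads to a character with no Frobenius conjugate in common with \<open>\<psi>\<close>.\<close>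

lemma orthogonal_conjugates:
  assumes g: "g \<in> carrier G" "g \<notin> E"
  shows "w 1 * grp g * w 1 = 0"
proof (cases "g \<in> N")
  case False
  have inj: "\<alpha> = \<beta>" if "conv \<alpha> = conv \<beta>" "\<alpha> \<in> carrier (group_algebra G)" "\<beta> \<in> carrier (group_algebra G)"
    for \<alpha> \<beta> :: "'a \<Rightarrow> 'f" using conv_inject that by blast
  have z: "0 \<in> carrier (group_algebra G :: ('a \<Rightarrow> 'f) ring)" by (simp add: group_algebra_simps(1))
  have "\<psi> y = 1" if "y \<in> K" for y using that \<psi>_one_iff K_H by blast
  hence "(\<Sum>y\<in>K. \<psi> y) = of_nat (card K)" by simp
  hence "to_ac (inverse (of_nat (card K))) * (\<Sum>y\<in>K. \<psi> y) = to_ac (inverse (of_nat (card K)) * of_nat (card K))"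
    by simp
  also have "\<dots> = 1" using card_nonzero[OF sub_K] by simp
  finally have K1: "to_ac (inverse (of_nat (card K))) * (\<Sum>y\<in>K. \<psi> y) = 1" .
  have M0: "(\<Sum>y\<in>M. \<psi> y) = 0" if M: "M \<in> shoda_sets H K" for M
  proof -
    obtain y where y: "y \<in> M" "y \<notin> K" using shoda_sets_facts(3)[OF M] by blast
    have MH: "M \<subseteq> H" by (rule shoda_sets_facts(1)[OF M])
    have "subgroup M G" using M by (simp add: shoda_sets_def)
    thus ?thesis
    proof (rule character_sum_zero[OF _ _ y(1)])
      show "\<psi> y \<noteq> 1" using y MH \<psi>_one_iff by blast
    qed (use MH in \<open>simp add: \<psi>_mult subset_iff\<close>)
  qed
  have "conv (W \<psi> 1) * grp g * conv (W \<psi> 1) = 0"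
  proof (rule shoda_orthogonal[OF W_closed _ _ _ g(1) False])
    have "conv (W \<psi> 1 \<star> average K) = conv (W \<psi> 1)" "conv (average K \<star> W \<psi> 1) = conv (W \<psi> 1)"
      unfolding conv_mult w_def[symmetric] w_average[OF sub_K K_H] K1 by (rule HOL.refl)+
    thus "W \<psi> 1 \<star> average K = W \<psi> 1" "average K \<star> W \<psi> 1 = W \<psi> 1"
      using inj[OF _ convolve_closed W_closed] by blast+
    fix M assume M: "M \<in> shoda_sets H K"
    have sM: "subgroup M G" using M by (simp add: shoda_sets_def)
    have "conv (W \<psi> 1 \<star> average M) = conv 0" "conv (average M \<star> W \<psi> 1) = conv 0"
      unfolding conv_mult w_def[symmetric] w_average[OF sM shoda_sets_facts(1)[OF M]] M0[OF M] conv_zero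
      by (simp_all add: w_zero)
    thus "W \<psi> 1 \<star> average M = 0 \<and> average M \<star> W \<psi> 1 = 0"
      using inj[OF _ convolve_closed z] by blast
  qed
  thus ?thesis by (simp add: w_def)
next
  case True
  define \<theta> where "\<theta> x = \<psi> (inv g \<otimes> x \<otimes> inv (inv g))" for x
  have gN': "inv g \<in> N" by (rule NK.A_closed(3)[OF True])
  have \<theta>: "is_character \<theta>" unfolding is_character_def
  proof (intro conjI ballI)
    fix x assume x: "x \<in> H"
    show "\<theta> x \<in> FF" "\<theta> x \<noteq> 0" using \<psi>_FF \<psi>_nonzero conj_closed(1)[OF gN' x] by (simp_all add: \<theta>_def)
    fix y assume y: "y \<in> H"
    have "inv g \<otimes> (x \<otimes> y) \<otimes> inv (inv g) = (inv g \<otimes> x \<otimes> inv (inv g)) \<otimes> (inv g \<otimes> y \<otimes> inv (inv g))"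
      using g(1) H_mem[OF x] H_mem[OF y] by (simp add: m_assoc) (simp add: m_assoc[symmetric])
    thus "\<theta> (x \<otimes> y) = \<theta> x * \<theta> y"
      using \<psi>_mult[OF conj_closed(1)[OF gN' x] conj_closed(1)[OF gN' y]] by (simp add: \<theta>_def)
  qed
  have \<theta>g: "\<theta> (g \<otimes> x \<otimes> inv g) = \<psi> x" if x: "x \<in> H" for x
  proof -
    have "inv g \<otimes> (g \<otimes> x \<otimes> inv g) \<otimes> inv (inv g) = x"
      using g(1) H_mem[OF x] by (simp add: m_assoc) (simp add: m_assoc[symmetric])
    thus ?thesis by (simp add: \<theta>_def)
  qed
  have "grp g * w 1 = conv (W \<theta> 1) * grp g"
    unfolding w_def by (rule grp_W_conj[OF True]) (simp add: \<theta>g)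
  hence "w 1 * grp g * w 1 = conv (W \<psi> 1 \<star> W \<theta> 1) * grp g"
    by (simp add: mult.assoc conv_mult w_def)
  also have "W \<psi> 1 \<star> W \<theta> 1 = 0"
  proof (rule W_orthogonal[OF is_character_\<psi> \<theta> one_L one_L], rule ccontr)
    fix i j
    assume "\<not> (\<exists>x\<in>H. \<psi> x ^ (C ^ i) \<noteq> \<theta> x ^ (C ^ j))"
    hence eq: "\<psi> x ^ (C ^ i) = \<theta> x ^ (C ^ j)" if "x \<in> H" for x using that by blast
    \<comment> \<open>A coincidence of conjugates would let \<open>g\<close> act with exponent
      \<open>j - i\<close>, written within the natural numbers.\<close>
    have "acts g (j + i * (ell - 1))" unfolding acts_def
    proof (intro conjI ballI True)
      fix h assume h: "h \<in> H"
      let ?h = "g \<otimes> h \<otimes> inv g"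
      have h': "?h \<in> H" by (rule conj_closed(1)[OF True h])
      have "i + i * (ell - 1) = ell * i" using ell_pos by (cases ell) auto
      hence "\<psi> ?h = \<psi> ?h ^ (C ^ (i + i * (ell - 1)))" using fixed_field_power[OF \<psi>_FF[OF h']] by simp
      also have "\<dots> = (\<psi> ?h ^ (C ^ i)) ^ (C ^ (i * (ell - 1)))" by (simp add: power_add power_mult)
      also have "\<psi> ?h ^ (C ^ i) = \<psi> h ^ (C ^ j)" using eq[OF h'] \<theta>g[OF h] by simp
      finally show "\<psi> ?h = \<psi> h ^ (C ^ (j + i * (ell - 1)))" by (simp add: power_add power_mult)
    qed
    thus False using g(2) mem_E by blast
  qed
  finally show ?thesis unfolding conv_zero by simp
qed

end

context shoda_class
begin

subsection \<open>The crossed product over the stabilizer\<close>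

text \<open>For \<open>g\<close> in \<open>E\<close>, \<open>w 1\<close> commutes with
  \<open>grp g\<close>. There \<open>u\<close> is a homomorphism into the units of the corner of
  \<open>w 1\<close>, trivial on \<open>K\<close> and equal to the composition of \<open>w\<close>
  and \<open>\<psi>\<close> on \<open>H\<close>.\<close>

definition u :: "'a \<Rightarrow> ('a \<Rightarrow> 'f) endo" where "u g = grp g * w 1"

lemma one_FF: "1 \<in> FF" by (rule one_L)

lemma grp_w_one: "g \<in> E \<Longrightarrow> grp g * w 1 = w 1 * grp g"
proof -
  assume "g \<in> E"
  then obtain i where "acts g i" using mem_E by blast
  from acts_w[OF this one_FF] show ?thesis by simp
qed

lemma w_one_idem: "w 1 * w 1 = w 1" using w_one_left[OF one_FF] .

lemma u_one:
  assumes "g \<in> E"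
  shows "u g * w 1 = u g" "w 1 * u g = u g"
proof -
  show 1: "u g * w 1 = u g" by (simp add: u_def mult.assoc w_one_idem)
  have "w 1 * u g = (w 1 * grp g) * w 1" by (simp add: u_def mult.assoc)
  also have "w 1 * grp g = grp g * w 1" by (rule grp_w_one[OF assms, symmetric])
  finally show "w 1 * u g = u g" by (simp add: u_def mult.assoc w_one_idem)
qed

lemma u_mult: "g \<in> E \<Longrightarrow> g' \<in> E \<Longrightarrow> u g * u g' = u (g \<otimes> g')"
proof -
  assume g: "g \<in> E" "g' \<in> E"
  have "u g * u g' = grp g * (w 1 * grp g') * w 1" by (simp add: u_def mult.assoc)
  also have "\<dots> = (grp g * grp g') * (w 1 * w 1)"
    unfolding grp_w_one[OF g(2), symmetric] by (simp add: mult.assoc)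
  finally show ?thesis using g E_mem by (simp add: u_def grp_mult w_one_idem)
qed

lemma u_H: "h \<in> H \<Longrightarrow> u h = w (\<psi> h)"
  using grp_w[OF _ one_FF] by (simp add: u_def)

lemma u_w: "acts g i \<Longrightarrow> l \<in> FF \<Longrightarrow> u g * w l = w (l ^ (C ^ i)) * u g"
proof -
  assume g: "acts g i" and l: "l \<in> FF"
  have gE: "g \<in> E" using g mem_E by blast
  have "u g * w l = grp g * w l" using w_one_left[OF l] by (simp add: u_def mult.assoc)
  also have "\<dots> = w (l ^ (C ^ i)) * grp g" by (rule acts_w[OF g l])
  also have "\<dots> = w (l ^ (C ^ i)) * (w 1 * grp g)"
    using w_one_right[OF FF_power[OF l]] by (simp add: mult.assoc[symmetric])
  finally show ?thesis using grp_w_one[OF gE] by (simp add: u_def)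
qed

lemma u_K_eq:
  assumes "g \<in> E" "g' \<in> E" "g \<otimes> inv g' \<in> K"
  shows "u g = u g'"
proof -
  define x where "x = g \<otimes> inv g'"
  have x: "x \<in> K" "x \<in> H" "x \<in> E" using assms(3) K_H H_E by (auto simp: x_def)
  have "g = x \<otimes> g'" using E_mem[OF assms(1)] E_mem[OF assms(2)] by (simp add: x_def m_assoc)
  hence "u g = u x * u g'" using u_mult x assms(2) by simp
  also have "u x = w 1" using u_H[OF x(2)] \<psi>_one_iff[OF x(2)] x(1) by simp
  finally show ?thesis using u_one(2)[OF assms(2)] by simp
qed

lemma E_closed: "\<one> \<in> E" "g \<in> E \<Longrightarrow> g' \<in> E \<Longrightarrow> g \<otimes> g' \<in> E" "g \<in> E \<Longrightarrow> inv g \<in> E"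
  by (simp_all add: EK.A_closed)

lemma u_unit: "u \<one> = w 1" using u_H[OF HK.A_closed(1)] \<psi>_one by simp

lemma u_inv: "g \<in> E \<Longrightarrow> u g * u (inv g) = w 1" "g \<in> E \<Longrightarrow> u (inv g) * u g = w 1"
  using u_mult E_closed(3) E_mem u_unit by simp_all

lemma u_pow: "g \<in> E \<Longrightarrow> u (g [^] (n::nat)) = u g ^ n * w 1"
proof (induction n)
  case (Suc n)
  have "u (g [^] Suc n) = u (g [^] n) * u g" using u_mult[OF EK.A_pow[OF Suc.prems] Suc.prems] by simp
  also have "\<dots> = u g ^ n * (w 1 * u g)" using Suc by (simp add: mult.assoc)
  finally have "u (g [^] Suc n) = u g ^ n * (w 1 * u g)" .
  thus ?case using u_one[OF Suc.prems] by (simp add: power_Suc2 mult.assoc del: power_Suc)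
qed (simp add: u_unit)

lemma u_base: "g \<in> E \<Longrightarrow> u g * w (to_ac c) = w (to_ac c) * u g"
proof -
  assume "g \<in> E"
  then obtain i where "acts g i" using mem_E by blast
  from u_w[OF this fixed_field_closed(7)] show ?thesis by (simp add: frobenius_base)
qed

text \<open>Each element of \<open>V\<close> is an element of \<open>V \<inter> K\<close>, which
  \<open>u\<close> does not see, times a power of \<open>v\<close>; the average collapses to
  \<open>d\<close> powers. The equation \<open>card V = card (V \<inter> K) * d\<close> also shows
  that \<open>d\<close> is invertible in the base field.\<close>

lemma average_cyclic_section:
  assumes V: "subgroup V G" and v: "v \<in> V" "v \<in> E"
    and cov: "\<And>g. g \<in> V \<Longrightarrow> \<exists>h\<in>V \<inter> K. \<exists>j<d. g = h \<otimes> v [^] (j::nat)"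
    and mem: "\<And>j. v [^] (j::nat) \<in> K \<longleftrightarrow> d dvd j" and d: "d > 0"
  shows "conv (average V) * w 1 = w (inverse (of_nat d)) * (\<Sum>j<d. u v ^ j)" and "(of_nat d :: 'f) \<noteq> 0"
proof -
  let ?U = "V \<inter> K"
  have Vc: "V \<subseteq> carrier G" by (rule subgroup.subset[OF V])
  have vc: "v [^] (j::nat) \<in> carrier G" for j using v(2) E_mem by simp
  have vV: "v [^] (n::nat) \<in> V" for n
    by (induction n) (simp_all add: subgroup.one_closed[OF V] subgroup.m_closed[OF V] v(1))
  have bij: "bij_betw (\<lambda>(h, j). h \<otimes> v [^] j) (?U \<times> {..<d}) V"
  proof (rule bij_betw_imageI)
    show "inj_on (\<lambda>(h, j). h \<otimes> v [^] j) (?U \<times> {..<d})"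
    proof (rule inj_onI)
      fix p p' :: "'a \<times> nat" assume p: "p \<in> ?U \<times> {..<d}" "p' \<in> ?U \<times> {..<d}"
        and pp: "(\<lambda>(h, j). h \<otimes> v [^] j) p = (\<lambda>(h, j). h \<otimes> v [^] j) p'"
      obtain h j where hj1: "p = (h, j)" by (cases p)
      obtain h' j' where hj2: "p' = (h', j')" by (cases p')
      note hj = hj1 hj2
      have h: "h \<in> V" "h \<in> K" "h' \<in> V" "h' \<in> K" and j: "j \<in> {..<d}" "j' \<in> {..<d}"
        and eq: "h \<otimes> v [^] j = h' \<otimes> v [^] j'" using p pp by (simp_all add: hj)
      have hc: "h \<in> carrier G" "h' \<in> carrier G" using h Vc by auto
      have *: "j = j'" if "i \<le> i'" "{i, i'} = {j, j'}" "k' \<otimes> v [^] i = k'' \<otimes> v [^] i'" "k' \<in> K" "k'' \<in> K" for i i' k' k''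
      proof -
        have kc: "k' \<in> carrier G" "k'' \<in> carrier G" using that K_carrier by auto
        have "k' \<otimes> v [^] i = k'' \<otimes> v [^] (i' - i) \<otimes> v [^] i"
          using that(1,3) v(2) E_mem kc vc by (simp add: m_assoc nat_pow_mult)
        hence "k' = k'' \<otimes> v [^] (i' - i)" using kc vc by simp
        hence "v [^] (i' - i) = inv k'' \<otimes> k'" using kc vc by (simp add: m_assoc[symmetric])
        hence "v [^] (i' - i) \<in> K" using that(4,5) subgroup.m_closed[OF sub_K subgroup.m_inv_closed[OF sub_K]] by simp
        hence "d dvd i' - i" using mem by simp
        moreover have "i' \<in> {j, j'}" using that(2) by blast
        hence "i' - i < d" using j by auto
        ultimately have "i = i'" using that(1) by (auto dest: dvd_imp_le)
        thus ?thesis using that(2) by auto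
      qed
      have "j = j'"
      proof (cases "j \<le> j'")
        case True
        show ?thesis using *[OF True _ eq h(2,4)] by simp
      next
        case False
        hence "j' \<le> j" by simp
        from *[OF this _ eq[symmetric] h(4,2)] show ?thesis by auto
      qed
      thus "p = p'" using eq hc vc by (simp add: hj)
    qed
    show "(\<lambda>(h, j). h \<otimes> v [^] j) ` (?U \<times> {..<d}) = V"
    proof (intro equalityI subsetI)
      fix g assume "g \<in> (\<lambda>(h, j). h \<otimes> v [^] j) ` (?U \<times> {..<d})"
      thus "g \<in> V" using subgroup.m_closed[OF V] vV by auto
    next
      fix g assume "g \<in> V"
      from cov[OF this] show "g \<in> (\<lambda>(h, j). h \<otimes> v [^] j) ` (?U \<times> {..<d})" by force
    qed
  qed
  have card: "card V = card ?U * d" using bij_betw_same_card[OF bij] by (simp add: card_cartesian_product)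
  have nz: "(of_nat (card V) :: 'f) \<noteq> 0" by (rule card_nonzero[OF V])
  thus d0: "(of_nat d :: 'f) \<noteq> 0" using card by auto
  have U0: "(of_nat (card ?U) :: 'f) \<noteq> 0" using card nz by auto
  have "(\<Sum>g\<in>V. u g) = (\<Sum>(h, j)\<in>?U \<times> {..<d}. u (h \<otimes> v [^] j))"
    using sum.reindex_bij_betw[OF bij, of u] by (simp add: split_beta)
  also have "\<dots> = (\<Sum>(h, j)\<in>?U \<times> {..<d}. u v ^ j * w 1)"
  proof (intro sum.cong HOL.refl, clarify)
    fix h and j :: nat assume h: "h \<in> K"
    have hE: "h \<in> E" using h K_E by blast
    have "u (h \<otimes> v [^] j) = u (v [^] j)"
      using h hE E_mem EK.A_pow[OF v(2), of j] by (intro u_K_eq E_closed) (simp_all add: m_assoc)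
    thus "u (h \<otimes> v [^] j) = u v ^ j * w 1" using u_pow[OF v(2)] by simp
  qed
  also have "\<dots> = of_nat (card ?U) * ((\<Sum>j<d. u v ^ j) * w 1)"
    by (simp add: sum.cartesian_product[symmetric] sum_distrib_right)
  finally have s: "(\<Sum>g\<in>V. u g) = of_nat (card ?U) * ((\<Sum>j<d. u v ^ j) * w 1)" .
  have wn: "of_nat n * w 1 = w (of_nat n)" for n
    by (induction n) (simp_all add: w_zero w_add one_FF FF_of_nat distrib_right)
  have "conv (average V) * w 1 = scalar (inverse (of_nat (card V))) * (\<Sum>g\<in>V. u g)"
    by (simp add: conv_average[OF Vc] mult.assoc sum_distrib_right u_def)
  also have "(\<Sum>g\<in>V. u g) = w 1 * (\<Sum>g\<in>V. u g)"
  proof -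
    have "w 1 * u g = u g" if g: "g \<in> V" for g
    proof -
      obtain h and j :: nat where "h \<in> K" "g = h \<otimes> v [^] j" using cov[OF g] by blast
      hence "g \<in> E" using K_E E_closed(2) EK.A_pow[OF v(2)] by blast
      thus ?thesis by (rule u_one)
    qed
    thus ?thesis by (simp add: sum_distrib_left)
  qed
  also have "scalar (inverse (of_nat (card V))) * (w 1 * (\<Sum>g\<in>V. u g)) =
      w (to_ac (inverse (of_nat (card V)))) * (\<Sum>g\<in>V. u g)"
    using scalar_w[OF one_FF] by (simp add: mult.assoc[symmetric])
  also have "\<dots> = (w (to_ac (inverse (of_nat (card V)))) * of_nat (card ?U)) * ((\<Sum>j<d. u v ^ j) * w 1)"
    by (simp add: s mult.assoc)
  also have "w (to_ac (inverse (of_nat (card V)))) * of_nat (card ?U) =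
      w (to_ac (inverse (of_nat (card V)))) * w 1 * of_nat (card ?U)"
    unfolding w_one_right[OF fixed_field_closed(7)] by (rule HOL.refl)
  also have "\<dots> = w (to_ac (inverse (of_nat (card V)))) * (of_nat (card ?U) * w 1)"
    by (simp only: mult.assoc mult_of_nat_commute)
  also have "\<dots> = w (to_ac (inverse (of_nat (card V))) * of_nat (card ?U))"
    unfolding wn by (rule w_mult[symmetric, OF fixed_field_closed(7) FF_of_nat])
  also have "to_ac (inverse (of_nat (card V))) * of_nat (card ?U) = to_ac (inverse (of_nat (card V)) * of_nat (card ?U) :: 'f)"
    by simp
  also have "inverse (of_nat (card V)) * of_nat (card ?U) = (inverse (of_nat d) :: 'f)"
    using U0 d0 by (simp add: card field_simps)
  also have "to_ac (inverse (of_nat d)) = inverse (of_nat d)" by simp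
  also have "w (inverse (of_nat d)) * ((\<Sum>j<d. u v ^ j) * w 1) = w (inverse (of_nat d)) * (\<Sum>j<d. u v ^ j)"
  proof -
    have iF: "inverse (of_nat d) \<in> FF" by (intro inverse_L FF_of_nat)
    have c: "w 1 * u v ^ j = u v ^ j * w 1" for j
      by (induction j) (simp_all add: mult.assoc u_one[OF v(2)], metis mult.assoc u_one[OF v(2)])
    have "(\<Sum>j<d. u v ^ j) * w 1 = w 1 * (\<Sum>j<d. u v ^ j)" by (simp add: sum_distrib_left sum_distrib_right c)
    thus ?thesis using w_one_right[OF iF] by (simp add: mult.assoc[symmetric])
  qed
  finally show "conv (average V) * w 1 = w (inverse (of_nat d)) * (\<Sum>j<d. u v ^ j)" .
qed

text \<open>
  A set of matrix units for the part \<open>S\<close> of the stabilizer, up to the identification of the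
  corner ring: \<open>B\<close> is the idempotent and the \<open>t\<^sub>j\<close> conjugate it to the other diagonal units.
\<close>

definition unit_system :: "'a set \<Rightarrow> 'j set \<Rightarrow> ('j \<Rightarrow> 'a) \<Rightarrow> ('a \<Rightarrow> 'f) endo \<Rightarrow> bool" where
  "unit_system S J t B \<longleftrightarrow> finite J \<and> t ` J \<subseteq> S \<and> B * w 1 = B \<and> w 1 * B = B \<and>
     (\<forall>i\<in>J. \<forall>j\<in>J. B * (u (t i) * u (inv (t j))) * B = (if i = j then B else 0)) \<and>
     (\<Sum>j\<in>J. u (inv (t j)) * B * u (t j)) = w 1 \<and>
     (\<forall>l\<in>FF. \<exists>\<tau>\<in>FF. B * w l * B = w \<tau> * B \<and> (\<forall>g\<in>S. \<forall>i. acts g i \<longrightarrow> \<tau> ^ (C ^ i) = \<tau>)) \<and>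
     (\<forall>g\<in>S. \<exists>l\<in>FF. u g * B = w l * B) \<and>
     (\<forall>Z. (\<forall>g\<in>S. Z * u g = u g * Z) \<longrightarrow> (\<forall>c. Z * w (to_ac c) = w (to_ac c) * Z) \<longrightarrow> Z * B = B * Z)"

text \<open>Everything follows from writing the idempotent in powers of \<open>u b\<close>. The
  clauses beyond the matrix unit relations prepare the product of two parts: the sandwich clause
  describes the corner by a fixed field, and the final one, of double centralizer type, transfers
  commutation from group elements to idempotents.\<close>

lemma unit_system_cyclic:
  assumes S: "S \<subseteq> E" and HS: "HS \<subseteq> H" "HS \<subseteq> S" and b: "b \<in> S" "acts b s"
    and cov: "\<And>g. g \<in> S \<Longrightarrow> \<exists>h\<in>HS. \<exists>j. g = h \<otimes> b [^] (j::nat)" and d: "d > 0" "b [^] d \<in> K" "(of_nat d :: 'f) \<noteq> 0"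
    and t: "t ` J \<subseteq> HS" and orth: "conjugate_orthogonal J (\<lambda>j. \<psi> (t j)) (C ^ s) d"
  shows "unit_system S J t (w (inverse (of_nat d)) * (\<Sum>j<d. u b ^ j))"
proof -
  have bE: "b \<in> E" using b S by blast
  have dF: "(of_nat d :: 'f alg_closure) \<noteq> 0" using d(3) by (metis to_ac_eq_0_iff to_ac_of_nat)
  have inv_d: "inverse (of_nat d) = (to_ac (inverse (of_nat d)) :: 'f alg_closure)" by simp
  interpret Y: twisted_cyclic w FF "u b" "C ^ s" d
  proof (unfold_locales)
    show "u b * w x = w (x ^ C ^ s) * u b" if "x \<in> FF" for x using u_w[OF b(2) that] .
    show "u b * w 1 = u b" "w 1 * u b = u b" using u_one[OF bE] .
    have "u b ^ d * w 1 = w 1"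
      using u_pow[OF bE, of d] u_K_eq[of "b [^] d" \<one>] EK.A_pow[OF bE] d(2) E_mem[OF bE] E_closed(1) u_unit by simp
    moreover have "u b ^ d * w 1 = u b ^ d"
      using d(1) u_one(1)[OF bE] by (cases d) (simp_all add: power_Suc2 mult.assoc del: power_Suc)
    ultimately show "u b ^ d = w 1" by simp
    show "inverse (of_nat d) ^ C ^ s = inverse (of_nat d :: 'f alg_closure)"
      unfolding inv_d by (rule frobenius_base)
  qed (use d dF in simp_all)
  let ?B = "Y.average_power"
  have B: "w (inverse (of_nat d)) * (\<Sum>j<d. u b ^ j) = ?B" by (simp add: Y.average_power_def)
  have tH: "t j \<in> H" if "j \<in> J" for j using that t HS by blast
  have tE: "t j \<in> E" if "j \<in> J" for j using tH[OF that] H_E by blast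
  have ut: "u (t j) = w (\<psi> (t j))" "u (inv (t j)) = w (inverse (\<psi> (t j)))" if "j \<in> J" for j
    using u_H[OF tH[OF that]] u_H[OF H_inv[OF tH[OF that]]] \<psi>_inv[OF tH[OF that]] by simp_all
  have gd: "\<exists>h\<in>H. \<exists>n. g = h \<otimes> b [^] (n::nat)" if "g \<in> S" for g using cov[OF that] HS by blast
  have C0: "C ^ s > 0" using C_gt_1 by simp
  show ?thesis unfolding unit_system_def B
  proof (intro conjI ballI allI impI)
    show "finite J" using orth by (simp add: conjugate_orthogonal_def)
    show "t ` J \<subseteq> S" using t HS by blast
    show "?B * w 1 = ?B" "w 1 * ?B = ?B" by (rule Y.average_one Y.one_average)+
    show "?B * (u (t i) * u (inv (t j))) * ?B = (if i = j then ?B else 0)" if ij: "i \<in> J" "j \<in> J" for i j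
    proof -
      have "u (t i) * u (inv (t j)) = w (\<psi> (t i) / \<psi> (t j))"
        using ut[OF ij(1)] ut[OF ij(2)] \<psi>_FF tH ij
        by (simp add: w_mult[symmetric] inverse_L divide_inverse)
      thus ?thesis using Y.average_orthogonal[OF orth ij \<psi>_FF[OF tH[OF ij(1)]] \<psi>_FF[OF tH[OF ij(2)]]]
        by (simp add: mult.assoc)
    qed
    have "(\<Sum>j\<in>J. u (inv (t j)) * ?B * u (t j)) = (\<Sum>j\<in>J. w (inverse (\<psi> (t j))) * ?B * w (\<psi> (t j)))"
      by (intro sum.cong HOL.refl) (simp add: ut)
    also have "\<dots> = w 1" by (rule Y.average_complete[OF orth \<psi>_FF[OF tH]])
    finally show "(\<Sum>j\<in>J. u (inv (t j)) * ?B * u (t j)) = w 1" .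
    show "\<exists>\<tau>\<in>FF. ?B * w l * ?B = w \<tau> * ?B \<and> (\<forall>g\<in>S. \<forall>i. acts g i \<longrightarrow> \<tau> ^ (C ^ i) = \<tau>)" if l: "l \<in> FF" for l
    proof -
      define \<tau> where "\<tau> = inverse (of_nat d) * (\<Sum>j<d. l ^ ((C ^ s) ^ j))"
      have \<tau>F: "\<tau> \<in> FF" unfolding \<tau>_def by (intro mult_L inverse_L FF_of_nat FF_sum FF_power l)
      have "acts (b [^] d) (d * s)" by (rule acts_pow[OF b(2)])
      hence "ell dvd d * s" using acts_H_iff d(2) K_H by blast
      hence "l ^ (C ^ (d * s)) = l" using fixed_field_power[OF l] by (auto elim!: dvdE)
      hence ld: "l ^ ((C ^ s) ^ d) = l" by (simp add: power_mult[symmetric] mult.commute)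
      have \<tau>s: "\<tau> ^ (C ^ s) = \<tau>" unfolding \<tau>_def
        by (rule Y.average_fixed[OF frobenius_add ld C0])
      have \<tau>n: "\<tau> ^ (C ^ (n * s)) = \<tau>" for n
        by (induction n) (simp_all add: power_add power_mult \<tau>s)
      have "\<tau> ^ (C ^ i) = \<tau>" if g: "g \<in> S" "acts g i" for g i
      proof -
        obtain h n where h: "h \<in> H" "g = h \<otimes> b [^] (n::nat)" using gd[OF g(1)] by blast
        have "acts g (0 + n * s)" unfolding h(2) by (rule acts_mult[OF acts_H[OF h(1)] acts_pow[OF b(2)]])
        from FF_frobenius_cong[OF \<tau>F acts_unique[OF g(2) this]] show ?thesis using \<tau>n by simp
      qed
      moreover have "?B * w l * ?B = w \<tau> * ?B" unfolding \<tau>_def by (rule Y.average_sandwich[OF l])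
      ultimately show ?thesis using \<tau>F by blast
    qed
    show "\<exists>l\<in>FF. u g * ?B = w l * ?B" if g: "g \<in> S" for g
    proof -
      obtain h n where h: "h \<in> H" "g = h \<otimes> b [^] (n::nat)" using gd[OF g] by blast
      have "u g = w (\<psi> h) * (u b ^ n * w 1)"
        using u_mult[of h "b [^] n"] h H_E EK.A_pow[OF bE] u_H[OF h(1)] u_pow[OF bE] by auto
      hence "u g * ?B = w (\<psi> h) * ?B"
        by (simp add: mult.assoc Y.one_average Y.y_power_average)
      thus ?thesis using \<psi>_FF[OF h(1)] by blast
    qed
    fix Z assume Z: "\<forall>g\<in>S. Z * u g = u g * Z" and Zc: "\<forall>c. Z * w (to_ac c) = w (to_ac c) * Z"
    have "Z * u b ^ j = u b ^ j * Z" for j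
    proof (induction j)
      case (Suc j)
      have "Z * u b ^ Suc j = (Z * u b) * u b ^ j" by (simp add: mult.assoc)
      also have "\<dots> = u b * (Z * u b ^ j)" using Z b(1) by (simp add: mult.assoc)
      finally show ?case using Suc by (simp add: mult.assoc)
    qed simp
    hence "Z * (\<Sum>j<d. u b ^ j) = (\<Sum>j<d. u b ^ j) * Z" by (simp add: sum_distrib_left sum_distrib_right)
    moreover have "Z * w (inverse (of_nat d)) = w (inverse (of_nat d)) * Z" unfolding inv_d using Zc by blast
    ultimately have "Z * w (inverse (of_nat d)) * (\<Sum>j<d. u b ^ j) = w (inverse (of_nat d)) * (\<Sum>j<d. u b ^ j) * Z"
      by (simp only: mult.assoc)
    thus "Z * ?B = ?B * Z" unfolding Y.average_power_def by (simp only: mult.assoc)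
  qed
qed

end

context shoda_class
begin

lemma unit_system_nonzero: "unit_system S J t B \<Longrightarrow> B \<noteq> 0"
  using w_one_nonzero by (auto simp: unit_system_def)

lemma unit_system_inj:
  assumes U: "unit_system S J t B" and S: "S \<subseteq> E"
  shows "inj_on t J"
proof (rule inj_onI, rule ccontr)
  fix i j assume ij: "i \<in> J" "j \<in> J" "t i = t j" "i \<noteq> j"
  have ort: "B * (u (t x) * u (inv (t y))) * B = (if x = y then B else 0)" if "x \<in> J" "y \<in> J" for x y
    using U that unfolding unit_system_def by blast
  have "B = 0" using ort[OF ij(1,1)] ort[OF ij(1,2)] ij(3,4) by simp
  thus False using unit_system_nonzero[OF U] by simp
qed

text \<open>Indexing by the group elements themselves matches the set \<open>T\<close> of the
  theorem. This is legitimate because equal elements at different indices would force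
  \<open>B = 0\<close>.\<close>

lemma unit_system_image:
  assumes U: "unit_system S J t B" and S: "S \<subseteq> E"
  shows "unit_system S (t ` J) (\<lambda>x. x) B"
proof -
  have inj: "inj_on t J" by (rule unit_system_inj[OF U S])
  have "(\<Sum>x\<in>t ` J. u (inv x) * B * u x) = (\<Sum>j\<in>J. u (inv (t j)) * B * u (t j))"
    by (simp add: sum.reindex[OF inj])
  thus ?thesis using U inj_on_eq_iff[OF inj] unfolding unit_system_def by auto
qed

end

section \<open>Nilpotency of \<open>E/K\<close> and its Hall parts\<close>

locale nilpotent_shoda = shoda_class G q f_type H K m C \<chi> Cl
  for G (structure) and q and f_type :: "'f::{field,finite} itself" and H K m C \<chi> Cl +
  assumes nil: "nilpotent_group G"
begin

lemma nilpotent_quot: "\<exists>c. lower_central_series EK.Q c = {\<one>\<^bsub>EK.Q\<^esub>}"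
proof -
  interpret Q: group "EK.Q" by (rule EK.group_quot)
  obtain c where c: "lower_central_series G c = {\<one>}" using nil by (auto simp: nilpotent_group_def)
  have "lower_central_series EK.Q c \<subseteq> {K #> \<one>}"
    using EK.lower_central_series_quot[of c] unfolding c by blast
  moreover have "K #> \<one> = \<one>\<^bsub>EK.Q\<^esub>" using coset_mult_one[OF K_carrier] by (simp add: EK.one_quot)
  moreover have "\<one>\<^bsub>EK.Q\<^esub> \<in> lower_central_series EK.Q c"
    using subgroup.one_closed[OF normal_imp_subgroup[OF Q.lower_central_series_normal]] .
  ultimately show ?thesis by auto
qed

text \<open>A commutator with the inverse of \<open>b\<close> raises the value of
  \<open>\<psi>\<close> to the power \<open>C ^ s - 1\<close>, and iterated commutators become
  trivial with the lower central series of \<open>E/K\<close>.\<close>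

lemma nilpotent_exponent:
  assumes a: "a \<in> H" and b: "acts b s"
  shows "\<exists>c. \<psi> a ^ ((C ^ s - 1) ^ c) = 1"
proof -
  interpret Q: group "EK.Q" by (rule EK.group_quot)
  let ?e = "C ^ s - 1"
  have aE: "a \<in> E" using a H_E by blast
  have bE: "b \<in> E" using b mem_E by blast
  have C1: "C ^ s \<ge> 1" using C_gt_1 by simp
  have mem: "K #> (a [^] (?e ^ i)) \<in> lower_central_series EK.Q i" for i
  proof (induction i)
    case 0
    show ?case unfolding lower_central_series.simps carrier_quot by (intro imageI EK.A_pow aE)
  next
    case (Suc i)
    define x where "x = a [^] (?e ^ i)"
    have xH: "x \<in> H" using HK.A_pow[OF a] by (simp add: x_def)
    have xE: "x \<in> E" using xH H_E by blast
    define y where "y = inv x \<otimes> inv (inv b) \<otimes> x \<otimes> inv b"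
    have "inv\<^bsub>EK.Q\<^esub> (K #> x) \<otimes>\<^bsub>EK.Q\<^esub> inv\<^bsub>EK.Q\<^esub> (K #> inv b) \<otimes>\<^bsub>EK.Q\<^esub> (K #> x) \<otimes>\<^bsub>EK.Q\<^esub> (K #> inv b)
        \<in> lower_central_series EK.Q (Suc i)"
      unfolding lower_central_series.simps
      using Suc E_closed(3)[OF bE] unfolding x_def[symmetric]
      by (intro generate.incl) (auto simp: carrier_quot)
    moreover have "inv\<^bsub>EK.Q\<^esub> (K #> x) \<otimes>\<^bsub>EK.Q\<^esub> inv\<^bsub>EK.Q\<^esub> (K #> inv b) \<otimes>\<^bsub>EK.Q\<^esub> (K #> x) \<otimes>\<^bsub>EK.Q\<^esub> (K #> inv b) = K #> y"
      using xE bE by (simp add: EK.inv_quot EK.mult_quot E_closed y_def)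
    ultimately have y: "K #> y \<in> lower_central_series EK.Q (Suc i)" by simp
    have bx: "b \<otimes> x \<otimes> inv b \<in> H" by (rule conj_closed(1)[OF acts_N[OF b] xH])
    have y': "y = inv x \<otimes> (b \<otimes> x \<otimes> inv b)" using E_mem[OF xE] E_mem[OF bE] by (simp add: y_def m_assoc)
    have yH: "y \<in> H" unfolding y' by (rule H_mult[OF H_inv[OF xH] bx])
    have "\<psi> y = inverse (\<psi> x) * \<psi> x ^ (C ^ s)"
      unfolding y' \<psi>_mult[OF H_inv[OF xH] bx] \<psi>_inv[OF xH] acts_\<psi>[OF b xH] ..
    also have "\<psi> x ^ (C ^ s) = \<psi> x ^ ?e * \<psi> x" using C1 by (metis le_add_diff_inverse2 power_add power_one_right)
    also have "inverse (\<psi> x) * (\<psi> x ^ ?e * \<psi> x) = \<psi> x ^ ?e" using \<psi>_nonzero[OF xH] by simp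
    also have "\<dots> = \<psi> (a [^] (?e ^ Suc i))"
      by (simp add: x_def \<psi>_pow[OF a] power_mult[symmetric] mult.commute)
    finally have eq: "\<psi> y = \<psi> (a [^] (?e ^ Suc i))" .
    have aH: "a [^] (?e ^ Suc i) \<in> H" by (rule HK.A_pow[OF a])
    have "\<psi> (y \<otimes> inv (a [^] (?e ^ Suc i))) = 1"
      unfolding \<psi>_mult[OF yH H_inv[OF aH]] \<psi>_inv[OF aH] eq using \<psi>_nonzero[OF aH] by simp
    hence "y \<otimes> inv (a [^] (?e ^ Suc i)) \<in> K" using \<psi>_one_iff[OF H_mult[OF yH H_inv[OF aH]]] by simp
    hence "K #> y = K #> (a [^] (?e ^ Suc i))" using EK.coset_eq_iff[OF H_mem[OF yH] H_mem[OF aH]] by simp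
    thus ?case using y by simp
  qed
  obtain c where "lower_central_series EK.Q c = {\<one>\<^bsub>EK.Q\<^esub>}" using nilpotent_quot by blast
  hence "K #> (a [^] (?e ^ c)) = K" using mem[of c] by (simp add: EK.one_quot)
  hence "a [^] (?e ^ c) \<in> K" using EK.coset_one_iff[OF H_mem[OF HK.A_pow[OF a]]] by simp
  thus ?thesis using \<psi>_one_iff[OF HK.A_pow[OF a]] \<psi>_pow[OF a] by auto
qed

lemma hall_preimage_facts:
  assumes "hall_preimage \<pi> G E K S"
  shows "subgroup S G" "K \<subseteq> S" "S \<subseteq> E" "hall_subgroup \<pi> EK.Q ((\<lambda>x. K #> x) ` S)"
proof -
  show S: "subgroup S G" "K \<subseteq> S" and h: "hall_subgroup \<pi> EK.Q ((\<lambda>x. K #> x) ` S)"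
    using assms by (auto simp: hall_preimage_def carrier_quot)
  have "(\<lambda>x. K #> x) ` S \<subseteq> carrier EK.Q"
    using h subgroup.subset unfolding hall_subgroup_def by blast
  thus "S \<subseteq> E" using EK.mem_image_iff[OF sub_E K_E] subgroup.subset[OF S(1)] by (auto simp: carrier_quot)
qed

lemma coset_power_card:
  assumes S: "subgroup S G" "S \<subseteq> E" and x: "x \<in> S"
  shows "(K #> x) [^]\<^bsub>EK.Q\<^esub> card ((\<lambda>x. K #> x) ` S) = \<one>\<^bsub>EK.Q\<^esub>"
proof -
  interpret Q: group "EK.Q" by (rule EK.group_quot)
  have sub: "subgroup ((\<lambda>x. K #> x) ` S) EK.Q" by (rule EK.subgroup_image[OF S])
  have "(K #> x) [^]\<^bsub>EK.Q\<lparr>carrier := (\<lambda>x. K #> x) ` S\<rparr>\<^esub> Coset.order (EK.Q\<lparr>carrier := (\<lambda>x. K #> x) ` S\<rparr>) =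
      \<one>\<^bsub>EK.Q\<lparr>carrier := (\<lambda>x. K #> x) ` S\<rparr>\<^esub>"
    using x by (intro group.pow_order_eq_1[OF Q.subgroup_imp_group[OF sub]]) simp
  thus ?thesis by (simp add: Coset.order_def nat_pow_def)
qed

lemma hall_commute:
  assumes S: "hall_preimage (- {2}) G E K S" and S': "hall_preimage {2} G E K S'"
    and x: "x \<in> S" and y: "y \<in> S'"
  shows "(K #> x) \<otimes>\<^bsub>EK.Q\<^esub> (K #> y) = (K #> y) \<otimes>\<^bsub>EK.Q\<^esub> (K #> x)" and "x \<otimes> y \<otimes> inv (y \<otimes> x) \<in> K"
proof -
  interpret Q: group "EK.Q" by (rule EK.group_quot)
  note S = hall_preimage_facts[OF S] and S' = hall_preimage_facts[OF S']
  obtain c where c: "lower_central_series EK.Q c = {\<one>\<^bsub>EK.Q\<^esub>}" using nilpotent_quot by blast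
  have xE: "x \<in> E" and yE: "y \<in> E" using x y S(3) S'(3) by auto
  have cop: "coprime (card ((\<lambda>x. K #> x) ` S)) (card ((\<lambda>x. K #> x) ` S'))"
    using S(4) S'(4) unfolding hall_subgroup_def by (intro coprime_nat_primeI) auto
  show 1: "(K #> x) \<otimes>\<^bsub>EK.Q\<^esub> (K #> y) = (K #> y) \<otimes>\<^bsub>EK.Q\<^esub> (K #> x)"
  proof (rule Q.nilpotent_coprime_commute[OF c _ _ coset_power_card[OF S(1,3) x] coset_power_card[OF S'(1,3) y] cop])
    show "K #> x \<in> carrier EK.Q" "K #> y \<in> carrier EK.Q" unfolding carrier_quot using xE yE by (auto intro: imageI)
  qed
  hence "K #> (x \<otimes> y) = K #> (y \<otimes> x)" using xE yE by (simp add: EK.mult_quot)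
  thus "x \<otimes> y \<otimes> inv (y \<otimes> x) \<in> K" using xE yE E_mem EK.coset_eq_iff[of "x \<otimes> y" "y \<otimes> x"] by simp
qed

lemma hall_disjoint:
  assumes S: "hall_preimage (- {2}) G E K S" and S': "hall_preimage {2} G E K S'"
  shows "S \<inter> S' \<subseteq> K"
proof
  interpret Q: group "EK.Q" by (rule EK.group_quot)
  note S = hall_preimage_facts[OF S] and S' = hall_preimage_facts[OF S']
  fix x assume "x \<in> S \<inter> S'"
  hence x: "x \<in> S" "x \<in> S'" by auto
  have cop: "coprime (card ((\<lambda>x. K #> x) ` S)) (card ((\<lambda>x. K #> x) ` S'))"
    using S(4) S'(4) unfolding hall_subgroup_def by (intro coprime_nat_primeI) auto
  have xE: "x \<in> E" using x S(3) by blast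
  have "K #> x \<in> carrier EK.Q" unfolding carrier_quot using xE by (rule imageI)
  hence "K #> x = \<one>\<^bsub>EK.Q\<^esub>"
    by (rule Q.coprime_pow_eq_one[OF _ coset_power_card[OF S(1,3) x(1)] coset_power_card[OF S'(1,3) x(2)] cop])
  thus "x \<in> K" using EK.coset_one_iff[OF E_mem[OF xE]] by (simp add: EK.one_quot)
qed

text \<open>The discrepancy between \<open>g\<close> and a product of representatives lies in
  \<open>K\<close> and is absorbed by the factor from \<open>S\<close>, which contains
  \<open>K\<close>.\<close>

lemma product_lift:
  assumes A: "subquotient G A K" and S: "subgroup S G" "K \<subseteq> S" "S \<subseteq> A" and S': "S' \<subseteq> A"
    and prod: "(\<lambda>x. K #> x) ` S <#>\<^bsub>quot G A K\<^esub> (\<lambda>x. K #> x) ` S' = carrier (quot G A K)" and g: "g \<in> A"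
  shows "\<exists>x\<in>S. \<exists>y\<in>S'. g = x \<otimes> y"
proof -
  interpret A: subquotient G A K by (rule A)
  have "K #> g \<in> (\<lambda>x. K #> x) ` S <#>\<^bsub>quot G A K\<^esub> (\<lambda>x. K #> x) ` S'"
    unfolding prod carrier_quot using g by blast
  then obtain x y where xy: "x \<in> S" "y \<in> S'" "K #> g = (K #> x) \<otimes>\<^bsub>quot G A K\<^esub> (K #> y)"
    by (auto simp: set_mult_def)
  have xA: "x \<in> A" and yA: "y \<in> A" using xy S(3) S' by auto
  have c: "g \<in> carrier G" "x \<in> carrier G" "y \<in> carrier G" using g xA yA A.A_mem by auto
  have "K #> g = K #> (x \<otimes> y)" using xy(3) xA yA by (simp add: A.mult_quot)
  hence "g \<otimes> inv (x \<otimes> y) \<in> K" using A.coset_eq_iff[of g "x \<otimes> y"] c by simp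
  hence "g \<otimes> inv (x \<otimes> y) \<in> S" using S(2) by blast
  hence "g \<otimes> inv (x \<otimes> y) \<otimes> x \<in> S" using subgroup.m_closed[OF S(1)] xy(1) by blast
  moreover have "g = g \<otimes> inv (x \<otimes> y) \<otimes> x \<otimes> y"
  proof -
    have "g \<otimes> inv (x \<otimes> y) \<otimes> x \<otimes> y = g \<otimes> (inv (x \<otimes> y) \<otimes> (x \<otimes> y))" using c by (simp add: m_assoc)
    thus ?thesis using c by simp
  qed
  ultimately show ?thesis using xy(2) by blast
qed

lemma hall_cover:
  assumes S: "hall_preimage (- {2}) G E K S" and S': "hall_preimage {2} G E K S'" and g: "g \<in> E"
  shows "\<exists>x\<in>S. \<exists>y\<in>S'. g = x \<otimes> y"
proof -
  note F = hall_preimage_facts[OF S] and F' = hall_preimage_facts[OF S']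
  have "(\<lambda>x. K #> x) ` S <#>\<^bsub>EK.Q\<^esub> (\<lambda>x. K #> x) ` S' = carrier EK.Q"
    by (rule group.hall_product[OF EK.group_quot EK.finite_quot[OF finite_G] F(4) F'(4)])
      (use hall_commute(1)[OF S S'] in blast)
  from product_lift[OF EK.subquotient_axioms F(1-3) F'(3) this g] show ?thesis .
qed

lemma hall_cover_H:
  assumes S: "hall_preimage (- {2}) G H K S" and S': "hall_preimage {2} G H K S'" and g: "g \<in> H"
  shows "S \<subseteq> H" "S' \<subseteq> H" "subgroup S G" "subgroup S' G" "K \<subseteq> S" "K \<subseteq> S'" "\<exists>x\<in>S. \<exists>y\<in>S'. g = x \<otimes> y"
proof -
  show F: "subgroup S G" "K \<subseteq> S" and F': "subgroup S' G" "K \<subseteq> S'"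
    using S S' by (auto simp: hall_preimage_def)
  have h: "hall_subgroup (- {2}) HK.Q ((\<lambda>x. K #> x) ` S)" "hall_subgroup {2} HK.Q ((\<lambda>x. K #> x) ` S')"
    using S S' by (auto simp: hall_preimage_def carrier_quot)
  have *: "T \<subseteq> H" if T: "hall_subgroup \<pi> HK.Q ((\<lambda>x. K #> x) ` T)" and Tc: "subgroup T G" for T \<pi>
  proof -
    have "(\<lambda>x. K #> x) ` T \<subseteq> carrier HK.Q" using T subgroup.subset unfolding hall_subgroup_def by blast
    thus ?thesis using HK.mem_image_iff[OF sub_H K_H] subgroup.subset[OF Tc] by (auto simp: carrier_quot)
  qed
  show SH: "S \<subseteq> H" and SH': "S' \<subseteq> H" using *[OF h(1) F(1)] *[OF h(2) F'(1)] .
  have comm: "(K #> x) \<otimes>\<^bsub>HK.Q\<^esub> (K #> y) = (K #> y) \<otimes>\<^bsub>HK.Q\<^esub> (K #> x)" if xy: "x \<in> H" "y \<in> H" for x y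
  proof -
    have "\<psi> (x \<otimes> y \<otimes> inv (y \<otimes> x)) = 1"
      using xy \<psi>_nonzero[OF xy(1)] \<psi>_nonzero[OF xy(2)] by (simp add: \<psi>_mult \<psi>_inv H_mult H_inv field_simps)
    hence "x \<otimes> y \<otimes> inv (y \<otimes> x) \<in> K" using xy \<psi>_one_iff by (simp add: H_mult H_inv)
    thus ?thesis using xy HK.coset_eq_iff[of "x \<otimes> y" "y \<otimes> x"] by (simp add: HK.mult_quot H_mem)
  qed
  have "(\<lambda>x. K #> x) ` S <#>\<^bsub>HK.Q\<^esub> (\<lambda>x. K #> x) ` S' = carrier HK.Q"
    by (rule group.hall_product[OF HK.group_quot finite_HK h]) (use comm SH SH' in blast)
  from product_lift[OF HK.subquotient_axioms F(1,2) SH SH' this g]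
  show "\<exists>x\<in>S. \<exists>y\<in>S'. g = x \<otimes> y" .
qed

end

text \<open>
  A Hall part \<open>S\<close> of the stabilizer in which the Hall part \<open>HS\<close> of \<open>H\<close>, generated by \<open>a\<close> modulo
  \<open>K\<close>, has a cyclic complement generated by \<open>b\<close>.
\<close>

locale complemented_part = nilpotent_shoda G q f_type H K m C \<chi> Cl
  for G (structure) and q and f_type :: "'f::{field,finite} itself" and H K m C \<chi> Cl +
  fixes S HS :: "'a set" and a b :: 'a
  assumes S: "subgroup S G" "K \<subseteq> S" "S \<subseteq> E" and HS: "subgroup HS G" "K \<subseteq> HS" "HS \<subseteq> H"
    and a: "a \<in> HS" and faithful: "\<And>g. g \<in> S \<Longrightarrow> \<psi> (g \<otimes> a \<otimes> inv g) = \<psi> a \<Longrightarrow> g \<in> HS"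
    and b: "b \<in> S" and compl: "is_complement (quot G S K) (carrier (quot G HS K)) (generate (quot G S K) {K #> b})"
begin

sublocale SK: subquotient G S K
  by (rule subquotient_sub[OF S(1,2)]) (use S(3) E_N in blast)

definition s where "s = (SOME i. acts b i)"
definition d where "d = group.ord SK.Q (K #> b)"
definition r where "r = C ^ s"
definition ord_a where "ord_a = group.ord HK.Q (K #> a)"

lemma acts_b: "acts b s" unfolding s_def by (rule someI_ex) (use b S(3) mem_E in blast)

lemma a_H: "a \<in> H" using a HS(3) by blast
lemma b_E: "b \<in> E" using b S(3) by blast

lemmas complement_facts = SK.cyclic_complement[OF finite_G HS(1,2) b compl, folded d_def]

lemma b_power_K: "b [^] (j::nat) \<in> K \<longleftrightarrow> d dvd j"
proof
  assume "b [^] j \<in> K"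
  thus "d dvd j" using HS(2) complement_facts(3) by blast
next
  assume "d dvd j"
  then obtain i where i: "j = d * i" by auto
  have "b [^] j = (b [^] d) [^] i" using E_mem[OF b_E] by (simp add: i nat_pow_pow)
  also have "(b [^] d) [^] i \<in> K"
    by (induction i) (simp_all add: subgroup.one_closed[OF sub_K] subgroup.m_closed[OF sub_K] complement_facts(4))
  finally show "b [^] j \<in> K" .
qed

lemma ord_a: "\<psi> a ^ i = 1 \<longleftrightarrow> ord_a dvd i" "ord_a > 0"
proof -
  have Ka: "K #> a \<in> carrier HK.Q" using a_H by (auto simp: carrier_quot)
  have "\<psi> a ^ i = 1 \<longleftrightarrow> a [^] i \<in> K" using \<psi>_one_iff[OF HK.A_pow[OF a_H, of i]] \<psi>_pow[OF a_H] by simp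
  also have "\<dots> \<longleftrightarrow> (K #> a) [^]\<^bsub>HK.Q\<^esub> i = \<one>\<^bsub>HK.Q\<^esub>"
    using HK.coset_one_iff[OF H_mem[OF HK.A_pow[OF a_H]]] by (simp add: HK.pow_quot[OF a_H] HK.one_quot)
  also have "\<dots> \<longleftrightarrow> ord_a dvd i" unfolding ord_a_def by (rule group.pow_eq_id[OF HK.group_quot Ka])
  finally show "\<psi> a ^ i = 1 \<longleftrightarrow> ord_a dvd i" .
  show "ord_a > 0" unfolding ord_a_def using group.ord_ge_1[OF HK.group_quot finite_HK Ka] by simp
qed

lemma r_pos: "r > 0" using C_gt_1 by (simp add: r_def)

lemma conj_a: "\<psi> (b [^] (j::nat) \<otimes> a \<otimes> inv (b [^] j)) = \<psi> a ^ (r ^ j)"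
  using acts_\<psi>[OF acts_pow[OF acts_b, of j] a_H] by (simp add: r_def power_mult[symmetric] mult.commute)

lemma power_r_iff: "ord_a dvd r ^ j - 1 \<longleftrightarrow> \<psi> a ^ (r ^ j) = \<psi> a"
proof -
  have "\<psi> a ^ (r ^ j) = \<psi> a ^ (r ^ j - 1) * \<psi> a"
    using r_pos by (metis Suc_diff_1 power_Suc2 zero_less_power)
  thus ?thesis using ord_a(1) \<psi>_nonzero[OF a_H] by auto
qed

lemma ord_a_dvd: "ord_a dvd r ^ d - 1"
proof -
  have "b [^] d \<in> H" using complement_facts(4) K_H by blast
  hence "ell dvd d * s" using acts_H_iff[OF acts_pow[OF acts_b]] by blast
  hence "\<psi> a ^ (C ^ (d * s)) = \<psi> a" using fixed_field_power[OF \<psi>_FF[OF a_H]] by (auto elim!: dvdE)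
  thus ?thesis unfolding power_r_iff by (simp add: r_def power_mult[symmetric] mult.commute)
qed

text \<open>If \<open>b [^] j\<close> fixed the value at \<open>a\<close>, faithfulness would put it
  into \<open>HS\<close>, against the complement. Together with \<open>ord_a_dvd\<close>, this makes
  \<open>d\<close> the multiplicative order of \<open>r\<close> modulo \<open>ord_a\<close>.\<close>

lemma ord_a_min:
  assumes "0 < j" "j < d"
  shows "\<not> ord_a dvd r ^ j - 1"
proof
  assume "ord_a dvd r ^ j - 1"
  hence "\<psi> (b [^] j \<otimes> a \<otimes> inv (b [^] j)) = \<psi> a" unfolding power_r_iff conj_a .
  hence "b [^] j \<in> HS" by (rule faithful[OF SK.A_pow[OF b]])
  thus False using complement_facts(3) assms by (auto dest: dvd_imp_le)
qed

text \<open>The point where nilpotency becomes arithmetic: some power of \<open>r - 1\<close> is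
  divisible by \<open>ord_a\<close>.\<close>

lemma ord_a_rad:
  assumes "Factorial_Ring.prime p" "p dvd ord_a"
  shows "p dvd r - 1"
proof -
  obtain c where "\<psi> a ^ ((r - 1) ^ c) = 1" using nilpotent_exponent[OF a_H acts_b] by (auto simp: r_def)
  hence "p dvd (r - 1) ^ c" using ord_a(1) assms(2) dvd_trans by blast
  thus ?thesis using assms(1) prime_dvd_power by blast
qed

text \<open>\<open>V\<close> is kept general because the construction averages over the group
  generated by \<open>b\<close> in the odd part, but over the full preimage of the complement in the
  2-part. Both give the same element of the corner.\<close>

lemma average_complement:
  assumes V: "subgroup V G" "V \<subseteq> S" "b \<in> V" and gen: "(\<lambda>x. K #> x) ` V \<subseteq> generate SK.Q {K #> b}"
  shows "conv (average V) * w 1 = w (inverse (of_nat d)) * (\<Sum>j<d. u b ^ j)"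
    and "(of_nat d :: 'f) \<noteq> 0"
proof -
  have Kb: "K #> b \<in> carrier SK.Q" using b by (auto simp: carrier_quot)
  have cov: "\<exists>h\<in>V \<inter> K. \<exists>j<d. g = h \<otimes> b [^] (j::nat)" if g: "g \<in> V" for g
  proof -
    have "K #> g \<in> generate SK.Q {K #> b}" using gen g by blast
    then obtain i :: nat where "K #> g = (K #> b) [^]\<^bsub>SK.Q\<^esub> i"
      by (auto simp: group.generate_pow_on_finite_carrier[OF SK.group_quot SK.finite_quot[OF finite_G] Kb])
    hence gi: "K #> g = K #> (b [^] i)" by (simp add: SK.pow_quot[OF b])
    have c: "g \<in> carrier G" "b \<in> carrier G" using g V(2) SK.A_mem b by auto
    define h where "h = g \<otimes> inv (b [^] (i mod d))"
    have "b [^] i \<otimes> inv (b [^] (i mod d)) = b [^] (d * (i div d))"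
    proof -
      have "b [^] i = b [^] (d * (i div d)) \<otimes> b [^] (i mod d)" using c by (simp add: nat_pow_mult)
      thus ?thesis using c by (simp add: m_assoc)
    qed
    hence 1: "b [^] i \<otimes> inv (b [^] (i mod d)) \<in> K" using b_power_K by simp
    have "g \<otimes> inv (b [^] i) \<in> K" using gi SK.coset_eq_iff[of g "b [^] i"] c by simp
    hence "(g \<otimes> inv (b [^] i)) \<otimes> (b [^] i \<otimes> inv (b [^] (i mod d))) \<in> K" using 1 subgroup.m_closed[OF sub_K] by blast
    moreover have "(g \<otimes> inv (b [^] i)) \<otimes> (b [^] i \<otimes> inv (b [^] (i mod d))) = h"
      using c unfolding h_def by (simp add: m_assoc) (simp add: m_assoc[symmetric])
    ultimately have hK: "h \<in> K" by simp
    have bV: "b [^] (j::nat) \<in> V" for j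
      by (induction j) (simp_all add: subgroup.one_closed[OF V(1)] subgroup.m_closed[OF V(1)] V(3))
    have hV: "h \<in> V" unfolding h_def by (intro subgroup.m_closed[OF V(1)] subgroup.m_inv_closed[OF V(1)] g bV)
    have "g = h \<otimes> b [^] (i mod d)" using c by (simp add: h_def m_assoc)
    thus ?thesis using hK hV mod_less_divisor[OF complement_facts(2), of i] by blast
  qed
  show "conv (average V) * w 1 = w (inverse (of_nat d)) * (\<Sum>j<d. u b ^ j)"
    by (rule average_cyclic_section(1)[OF V(1,3) b_E cov b_power_K complement_facts(2)])
  show "(of_nat d :: 'f) \<noteq> 0"
    by (rule average_cyclic_section(2)[OF V(1,3) b_E cov b_power_K complement_facts(2)])
qed

lemma unit_system_complement:
  assumes V: "subgroup V G" "V \<subseteq> S" "b \<in> V" "(\<lambda>x. K #> x) ` V \<subseteq> generate SK.Q {K #> b}"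
    and orth: "conjugate_orthogonal J (\<lambda>j. \<psi> a ^ e j) r d"
  shows "unit_system S ((\<lambda>j. a [^] (e j :: nat)) ` J) (\<lambda>x. x) (conv (average V) * w 1)"
proof (rule unit_system_image[OF _ S(3)])
  have aHS: "a [^] (n::nat) \<in> HS" for n
    by (induction n) (simp_all add: subgroup.one_closed[OF HS(1)] subgroup.m_closed[OF HS(1)] a)
  have cov: "\<exists>h\<in>HS. \<exists>j. g = h \<otimes> b [^] (j::nat)" if "g \<in> S" for g using complement_facts(5)[OF that] by blast
  have dK: "b [^] d \<in> K" by (rule complement_facts(4))
  show "unit_system S J (\<lambda>j. a [^] e j) (conv (average V) * w 1)"
    unfolding average_complement(1)[OF V]
    by (rule unit_system_cyclic[OF S(3) HS(3) complement_facts(1) b acts_b cov complement_facts(2) dK average_complement(2)[OF V]])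
      (use aHS orth in \<open>auto simp: \<psi>_pow[OF a_H] r_def\<close>)
qed

lemma orthogonal_central:
  assumes "4 dvd ord_a \<Longrightarrow> 4 dvd r - 1"
  shows "conjugate_orthogonal {..<d} (\<lambda>j. \<psi> a ^ j) r d"
  by (rule conjugate_orthogonal_cyclic[OF r_pos complement_facts(2) ord_a_rad assms ord_a_dvd ord_a(2) ord_a_min ord_a(1)])

end

section \<open>Words, relations and what a presentation forbids\<close>

section \<open>Presentations\<close>

text \<open>
  The exponent sum of the second generator. It vanishes on the relations modulo \<open>2^k\<close>, so it
  bounds the order of that generator modulo the subgroup generated by the first one from below.
\<close>

definition exponent_sum :: "gword \<Rightarrow> int" where
  "exponent_sum v = sum_list (map (\<lambda>(i, s). if i = 1 then (if s then 1 else -1) else 0) v)"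

lemma exponent_sum_append [simp]: "exponent_sum (u @ v) = exponent_sum u + exponent_sum v"
  by (simp add: exponent_sum_def)

lemma exponent_sum_concat_replicate: "exponent_sum (concat (replicate j v)) = int j * exponent_sum v"
  by (induction j) (simp_all add: algebra_simps, simp add: exponent_sum_def)

lemma exponent_sum_winv: "exponent_sum (winv v) = - exponent_sum v"
  by (induction v) (auto simp: winv_def exponent_sum_def)

lemma exponent_sum_wpow: "exponent_sum (wpow v i) = i * exponent_sum v"
  by (simp add: wpow_def exponent_sum_concat_replicate exponent_sum_winv)

lemma exponent_sum_gen: "exponent_sum (gen i) = (if i = 1 then 1 else 0)"
  by (simp add: gen_def exponent_sum_def)

lemma presented_eq_exponent_sum:
  assumes "presented_eq N R u v" and R: "\<And>u v. (u, v) \<in> R \<Longrightarrow> [exponent_sum u = exponent_sum v] (mod M)"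
  shows "[exponent_sum u = exponent_sum v] (mod M)"
  using assms(1)
proof (induction rule: presented_eq.induct)
  case (cancel i s)
  show ?case by (simp add: exponent_sum_def)
qed (auto intro: R cong_sym cong_trans cong_add)

lemma relations_exponent_sum:
  "(u, v) \<in> relations_cyclic n k r \<Longrightarrow> [exponent_sum u = exponent_sum v] (mod 2 ^ k)"
  "(u, v) \<in> relations_nonsplit n k r \<Longrightarrow> [exponent_sum u = exponent_sum v] (mod 2 ^ k)"
  by (auto simp: relations_cyclic_def relations_nonsplit_def exponent_sum_wpow exponent_sum_gen wconj_def
      wcomm_def exponent_sum_winv cong_def) (simp_all add: exponent_sum_def)

context group
begin

lemma eval_word_append:
  assumes "set gs \<subseteq> carrier G" "fst ` set u \<subseteq> {..<length gs}" "fst ` set v \<subseteq> {..<length gs}"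
  shows "eval_word G gs (u @ v) = eval_word G gs u \<otimes> eval_word G gs v" and "eval_word G gs u \<in> carrier G"
proof -
  have letter: "eval_letter G gs l \<in> carrier G" if "fst l < length gs" for l
    using that assms(1) by (auto simp: eval_letter_def subset_iff)
  have cl: "eval_word G gs x \<in> carrier G" if "fst ` set x \<subseteq> {..<length gs}" for x
    using that by (induction x) (auto simp: eval_word_def letter)
  show "eval_word G gs u \<in> carrier G" by (rule cl[OF assms(2)])
  show "eval_word G gs (u @ v) = eval_word G gs u \<otimes> eval_word G gs v"
    using assms(2) cl[OF assms(3)]
  proof (induction u)
    case (Cons l u)
    thus ?case using letter cl[of u] by (simp add: eval_word_def m_assoc)
  qed (simp add: eval_word_def)
qed

lemma eval_word_replicate:
  assumes gs: "set gs \<subseteq> carrier G" and v: "fst ` set v \<subseteq> {..<length gs}"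
  shows "eval_word G gs (concat (replicate j v)) = eval_word G gs v [^] j"
proof (induction j)
  case (Suc j)
  have c: "fst ` set (concat (replicate j v)) \<subseteq> {..<length gs}" using v by (fastforce simp: subset_iff)
  have "eval_word G gs (concat (replicate (Suc j) v)) = eval_word G gs v \<otimes> eval_word G gs v [^] j"
    using eval_word_append(1)[OF gs v c] Suc by simp
  thus ?case using eval_word_append(2)[OF gs v v] nat_pow_Suc2 by simp
qed (simp add: eval_word_def)

lemma eval_word_gen:
  assumes "set gs \<subseteq> carrier G" "i < length gs"
  shows "eval_word G gs (gen i) = gs ! i" "eval_word G gs (winv (gen i)) = inv (gs ! i)"
proof -
  have "gs ! i \<in> carrier G" using assms by auto
  thus "eval_word G gs (gen i) = gs ! i" "eval_word G gs (winv (gen i)) = inv (gs ! i)"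
    by (simp_all add: eval_word_def eval_letter_def gen_def winv_def)
qed

lemma letters_gen: "fst ` set (gen i) = {i}" "fst ` set (winv (gen i)) = {i}"
  by (simp_all add: gen_def winv_def)

lemma letters_wpow: "fst ` set (wpow (gen i) j) \<subseteq> {i}"
  by (auto simp: wpow_def gen_def winv_def split: if_splits)

lemma eval_word_wpow:
  assumes "set gs \<subseteq> carrier G" "i < length gs"
  shows "eval_word G gs (wpow (gen i) j) = (if 0 \<le> j then (gs ! i) [^] nat j else inv (gs ! i) [^] nat (- j))"
  using assms eval_word_replicate[OF assms(1), of "gen i"] eval_word_replicate[OF assms(1), of "winv (gen i)"]
  by (simp add: wpow_def eval_word_gen letters_gen)

lemma presentation_relation:
  assumes P: "has_presentation G gs R" and R: "(u, v) \<in> R"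
    and l: "fst ` set u \<subseteq> {..<length gs}" "fst ` set v \<subseteq> {..<length gs}"
  shows "eval_word G gs u = eval_word G gs v"
  using P R l presented_eq.rel[OF R] unfolding has_presentation_def by blast

text \<open>This uses the completeness of a presentation: words with equal values are connected by
  the relations, along which the exponent sum is constant modulo \<open>2 ^ k\<close>.\<close>

lemma presentation_second_generator:
  assumes P: "has_presentation G gs R" and len: "1 < length gs"
    and R: "\<And>u v. (u, v) \<in> R \<Longrightarrow> [exponent_sum u = exponent_sum v] (mod 2 ^ k)"
    and eq: "(gs ! 1) [^] (j::nat) = (gs ! 0) [^] (i::nat)"
  shows "2 ^ k dvd j"
proof -
  have gs: "set gs \<subseteq> carrier G" using P by (simp add: has_presentation_def)
  let ?b = "concat (replicate j (gen 1))" and ?a = "concat (replicate i (gen 0))"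
  have g: "fst ` set (gen 1) \<subseteq> {..<length gs}" "fst ` set (gen 0) \<subseteq> {..<length gs}"
    using len by (simp_all add: gen_def) auto
  have l0: "0 < length gs" using len by linarith
  have ne: "gs \<noteq> []" using len by (cases gs) simp_all
  have l: "fst ` set ?b \<subseteq> {..<length gs}" "fst ` set ?a \<subseteq> {..<length gs}"
    using len ne by (auto simp: gen_def)
  have "eval_word G gs ?b = eval_word G gs ?a"
    unfolding eval_word_replicate[OF gs g(1)] eval_word_replicate[OF gs g(2)]
      eval_word_gen(1)[OF gs len] eval_word_gen(1)[OF gs l0] by (rule eq)
  hence "presented_eq (length gs) R ?b ?a" using P l unfolding has_presentation_def by blast
  from presented_eq_exponent_sum[OF this R] have "[int j = 0] (mod 2 ^ k)"
    by (simp add: exponent_sum_concat_replicate exponent_sum_gen)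
  hence "(2::int) ^ k dvd int j" by (simp add: cong_0_iff)
  thus ?thesis by (metis of_nat_dvd_iff of_nat_numeral of_nat_power)
qed

end

section \<open>The odd part and the complemented 2-parts\<close>

text \<open>The inclusions \<open>H2_E2\<close> and \<open>Ho_Eo\<close> are not listed among the
  data of the construction; they are recovered from the presentation and from the
  complement.\<close>

locale hall_parts = nilpotent_shoda G q f_type H K m C \<chi> Cl
  for G (structure) and q and f_type :: "'f::{field,finite} itself" and H K m C \<chi> Cl +
  fixes E2 Eo H2 Ho :: "'a set" and a2 ao :: 'a and n :: nat
  assumes hE2: "hall_preimage {2} G E K E2" and hEo: "hall_preimage (- {2}) G E K Eo"
    and hH2: "hall_preimage {2} G H K H2" and hHo: "hall_preimage (- {2}) G H K Ho"
    and a2: "a2 \<in> H2" and gen2: "generate (quot G E K) {K #> a2} = carrier (quot G H2 K)"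
    and ord2: "group.ord (quot G E K) (K #> a2) = 2 ^ n"
    and ao: "ao \<in> Ho" and geno: "generate (quot G E K) {K #> ao} = carrier (quot G Ho K)"
    and H2_E2: "H2 \<subseteq> E2" and Ho_Eo: "Ho \<subseteq> Eo"
begin

lemmas E2_facts = hall_preimage_facts[OF hE2] and Eo_facts = hall_preimage_facts[OF hEo]

lemma H2_facts: "subgroup H2 G" "K \<subseteq> H2" "H2 \<subseteq> H" and Ho_facts: "subgroup Ho G" "K \<subseteq> Ho" "Ho \<subseteq> H"
  using hall_cover_H[OF hHo hH2 HK.A_closed(1)] by blast+

lemma a2_H: "a2 \<in> H" and ao_H: "ao \<in> H" using a2 ao H2_facts Ho_facts by auto

lemma power_of_generator:
  assumes a: "a \<in> H" and g: "generate (quot G E K) {K #> a} = carrier (quot G S K)" and h: "h \<in> S" "h \<in> H"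
  shows "\<exists>i. h \<otimes> inv (a [^] (i::nat)) \<in> K \<and> \<psi> h = \<psi> a ^ i"
proof -
  have aE: "a \<in> E" using a H_E by blast
  have Ka: "K #> a \<in> carrier EK.Q" using aE by (auto simp: carrier_quot)
  have "K #> h \<in> generate EK.Q {K #> a}" unfolding g carrier_quot using h(1) by (rule imageI)
  then obtain i :: nat where i: "K #> h = (K #> a) [^]\<^bsub>EK.Q\<^esub> i"
    by (auto simp: group.generate_pow_on_finite_carrier[OF EK.group_quot EK.finite_quot[OF finite_G] Ka])
  hence "h \<otimes> inv (a [^] i) \<in> K"
    using EK.coset_eq_iff[OF H_mem[OF h(2)] H_mem[OF HK.A_pow[OF a]]] by (simp add: EK.pow_quot[OF aE])
  moreover from this have "\<psi> h * inverse (\<psi> a ^ i) = 1"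
    using \<psi>_mult[OF h(2) H_inv[OF HK.A_pow[OF a]]] \<psi>_inv[OF HK.A_pow[OF a]] \<psi>_pow[OF a]
      \<psi>_one_iff[OF H_mult[OF h(2) H_inv[OF HK.A_pow[OF a]]]] by simp
  hence "\<psi> h = \<psi> a ^ i" using \<psi>_nonzero[OF a] by (simp add: field_simps)
  ultimately show ?thesis by blast
qed

text \<open>Modulo \<open>K\<close> the two generators generate \<open>H\<close>, so fixing the
  values of \<open>\<psi>\<close> at both fixes \<open>\<psi>\<close> on all of
  \<open>H\<close>.\<close>

lemma trivial_action:
  assumes g: "g \<in> E" and "\<psi> (g \<otimes> a2 \<otimes> inv g) = \<psi> a2" "\<psi> (g \<otimes> ao \<otimes> inv g) = \<psi> ao"
  shows "g \<in> H"
proof -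
  obtain i where i: "acts g i" using g mem_E by blast
  have f: "\<psi> a2 ^ (C ^ i) = \<psi> a2" "\<psi> ao ^ (C ^ i) = \<psi> ao"
    using assms(2,3) acts_\<psi>[OF i a2_H] acts_\<psi>[OF i ao_H] by simp_all
  have p: "(\<psi> x ^ e) ^ (C ^ i) = \<psi> x ^ e" if "\<psi> x ^ (C ^ i) = \<psi> x" for x e
    using that by (metis mult.commute power_mult)
  have "\<psi> (g \<otimes> h \<otimes> inv g) = \<psi> h ^ (C ^ 0)" if h: "h \<in> H" for h
  proof -
    obtain x y where xy: "x \<in> Ho" "y \<in> H2" "h = x \<otimes> y" using hall_cover_H(7)[OF hHo hH2 h] by blast
    have xH: "x \<in> H" and yH: "y \<in> H" using xy Ho_facts H2_facts by auto
    obtain e e' where e: "\<psi> x = \<psi> ao ^ e" "\<psi> y = \<psi> a2 ^ e'"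
      using power_of_generator[OF ao_H geno xy(1) xH] power_of_generator[OF a2_H gen2 xy(2) yH] by blast
    have "\<psi> h = \<psi> x * \<psi> y" unfolding xy(3) by (rule \<psi>_mult[OF xH yH])
    moreover have "(\<psi> x * \<psi> y) ^ (C ^ i) = \<psi> x * \<psi> y"
      using p[OF f(1), of e'] p[OF f(2), of e] by (simp add: e power_mult_distrib)
    ultimately show ?thesis using acts_\<psi>[OF i h] by simp
  qed
  hence "acts g 0" using acts_N[OF i] by (simp add: acts_def)
  thus ?thesis by (rule acts_trivial) simp
qed

lemma commute_conj:
  assumes x: "x \<in> Eo" and y: "y \<in> E2"
  shows "x \<in> H \<Longrightarrow> \<psi> (y \<otimes> x \<otimes> inv y) = \<psi> x" and "y \<in> H \<Longrightarrow> \<psi> (x \<otimes> y \<otimes> inv x) = \<psi> y"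
proof -
  have c: "x \<in> carrier G" "y \<in> carrier G" and xyE: "x \<in> E" "y \<in> E" using x y Eo_facts(3) E2_facts(3) E_mem by auto
  have N: "x \<in> N" "y \<in> N" using xyE E_N by auto
  have k: "x \<otimes> y \<otimes> inv (y \<otimes> x) \<in> K" by (rule hall_commute(2)[OF hEo hE2 x y])
  show "\<psi> (y \<otimes> x \<otimes> inv y) = \<psi> x" if xH: "x \<in> H"
  proof -
    have yx: "y \<otimes> x \<otimes> inv y \<in> H" by (rule conj_closed(1)[OF N(2) xH])
    have "x \<otimes> y \<otimes> inv (y \<otimes> x) = x \<otimes> inv (y \<otimes> x \<otimes> inv y)" using c by (simp add: inv_mult_group m_assoc)
    hence "\<psi> (x \<otimes> inv (y \<otimes> x \<otimes> inv y)) = 1" using k \<psi>_one_iff[OF H_mult[OF xH H_inv[OF yx]]] by simp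
    hence "\<psi> x * inverse (\<psi> (y \<otimes> x \<otimes> inv y)) = 1" by (simp only: \<psi>_mult[OF xH H_inv[OF yx]] \<psi>_inv[OF yx])
    thus ?thesis using \<psi>_nonzero[OF yx] by (simp add: field_simps)
  qed
  show "\<psi> (x \<otimes> y \<otimes> inv x) = \<psi> y" if yH: "y \<in> H"
  proof -
    have xy: "x \<otimes> y \<otimes> inv x \<in> H" by (rule conj_closed(1)[OF N(1) yH])
    have "x \<otimes> y \<otimes> inv (y \<otimes> x) = x \<otimes> y \<otimes> inv x \<otimes> inv y" using c by (simp add: inv_mult_group m_assoc)
    hence "\<psi> (x \<otimes> y \<otimes> inv x \<otimes> inv y) = 1" using k \<psi>_one_iff[OF H_mult[OF xy H_inv[OF yH]]] by simp
    hence "\<psi> (x \<otimes> y \<otimes> inv x) * inverse (\<psi> y) = 1" by (simp only: \<psi>_mult[OF xy H_inv[OF yH]] \<psi>_inv[OF yH])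
    thus ?thesis using \<psi>_nonzero[OF yH] by (simp add: field_simps)
  qed
qed

text \<open>In the decomposition of an element of \<open>H\<close> into its two Hall components, the
  unwanted component lies in both Hall parts of \<open>E\<close>, hence in \<open>K\<close>.\<close>

lemma intersect_H: "Eo \<inter> H \<subseteq> Ho" "E2 \<inter> H \<subseteq> H2"
proof -
  have "h \<in> Ho" if h: "h \<in> Eo" "h \<in> H" for h
  proof -
    obtain x y where xy: "x \<in> Ho" "y \<in> H2" "h = x \<otimes> y" using hall_cover_H(7)[OF hHo hH2 h(2)] by blast
    have c: "x \<in> carrier G" "y \<in> carrier G" using xy Ho_facts H2_facts H_mem by auto
    have "y = inv x \<otimes> h" using c by (simp add: xy(3) m_assoc[symmetric])
    hence "y \<in> Eo" using subgroup.m_closed[OF Eo_facts(1) subgroup.m_inv_closed[OF Eo_facts(1)]] xy(1) h(1) Ho_Eo by blast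
    hence "y \<in> Ho" using hall_disjoint[OF hEo hE2] xy(2) H2_E2 Ho_facts(2) by blast
    thus ?thesis unfolding xy(3) using subgroup.m_closed[OF Ho_facts(1) xy(1)] by blast
  qed
  moreover have "h \<in> H2" if h: "h \<in> E2" "h \<in> H" for h
  proof -
    obtain x y where xy: "x \<in> Ho" "y \<in> H2" "h = x \<otimes> y" using hall_cover_H(7)[OF hHo hH2 h(2)] by blast
    have c: "x \<in> carrier G" "y \<in> carrier G" using xy Ho_facts H2_facts H_mem by auto
    have "x = h \<otimes> inv y" using c by (simp add: xy(3) m_assoc)
    hence "x \<in> E2" using subgroup.m_closed[OF E2_facts(1) _ subgroup.m_inv_closed[OF E2_facts(1)]] xy(2) h(1) H2_E2 by blast
    hence "x \<in> H2" using hall_disjoint[OF hEo hE2] xy(1) Ho_Eo H2_facts(2) by blast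
    thus ?thesis unfolding xy(3) using subgroup.m_closed[OF H2_facts(1) _ xy(2)] by blast
  qed
  ultimately show "Eo \<inter> H \<subseteq> Ho" "E2 \<inter> H \<subseteq> H2" by blast+
qed

text \<open>Elements of \<open>Eo\<close> commute with \<open>a2\<close> modulo \<open>K\<close>
  anyway, so acting trivially on \<open>ao\<close> already means acting trivially on
  \<open>H\<close>.\<close>

lemma faithful_o: "g \<in> Eo \<Longrightarrow> \<psi> (g \<otimes> ao \<otimes> inv g) = \<psi> ao \<Longrightarrow> g \<in> Ho"
  using trivial_action[of g] commute_conj(2)[of g a2] a2 a2_H H2_E2 Eo_facts(3) intersect_H(1) by blast

lemma faithful_2: "g \<in> E2 \<Longrightarrow> \<psi> (g \<otimes> a2 \<otimes> inv g) = \<psi> a2 \<Longrightarrow> g \<in> H2"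
  using trivial_action[of g] commute_conj(1)[of ao g] ao ao_H Ho_Eo E2_facts(3) intersect_H(2) by blast

lemma \<psi>_a2: "\<psi> a2 ^ i = 1 \<longleftrightarrow> 2 ^ n dvd i"
proof -
  have aE: "a2 \<in> E" using a2_H H_E by blast
  have Ka: "K #> a2 \<in> carrier EK.Q" using aE by (auto simp: carrier_quot)
  have "\<psi> a2 ^ i = 1 \<longleftrightarrow> a2 [^] i \<in> K" using \<psi>_one_iff[OF HK.A_pow[OF a2_H, of i]] \<psi>_pow[OF a2_H] by simp
  also have "\<dots> \<longleftrightarrow> (K #> a2) [^]\<^bsub>EK.Q\<^esub> i = \<one>\<^bsub>EK.Q\<^esub>"
    using EK.coset_one_iff[OF H_mem[OF HK.A_pow[OF a2_H]]] by (simp add: EK.pow_quot[OF aE] EK.one_quot)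
  finally show ?thesis using group.pow_eq_id[OF EK.group_quot Ka, of i] ord2 by simp
qed

lemma unit_system_odd:
  assumes b: "b \<in> Eo"
    and compl: "is_complement (quot G Eo K) (carrier (quot G Ho K)) (generate (quot G Eo K) {K #> b})"
  shows "unit_system Eo {ao [^] i | i::nat. i < index G Eo Ho} (\<lambda>x. x) (conv (average (generate G {b})) * w 1)"
proof -
  interpret P: complemented_part G q f_type H K m C \<chi> Cl Eo Ho ao b
    by (intro complemented_part.intro nilpotent_shoda_axioms complemented_part_axioms.intro)
      (use Eo_facts Ho_facts Ho_Eo ao faithful_o b compl in auto)
  have bc: "b \<in> carrier G" using P.b_E E_mem by blast
  have Kb: "K #> b \<in> carrier P.SK.Q" using b by (auto simp: carrier_quot)
  have V: "subgroup (generate G {b}) G" "generate G {b} \<subseteq> Eo" "b \<in> generate G {b}"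
    using bc b generate_subgroup_incl[OF _ Eo_facts(1), of "{b}"] generate.incl[of b "{b}" G]
    by (simp_all add: generate_is_subgroup)
  have gen: "(\<lambda>x. K #> x) ` generate G {b} \<subseteq> generate P.SK.Q {K #> b}"
  proof
    fix x assume "x \<in> (\<lambda>x. K #> x) ` generate G {b}"
    then obtain i :: nat where "x = K #> (b [^] i)" by (auto simp: generate_pow_on_finite_carrier[OF finite_G bc])
    thus "x \<in> generate P.SK.Q {K #> b}" using P.SK.pow_quot[OF b, of i]
      by (auto simp: group.generate_pow_on_finite_carrier[OF P.SK.group_quot P.SK.finite_quot[OF finite_G] Kb])
  qed
  \<comment> \<open>The order of an element of the odd part is odd, which makes the condition modulo
    4 vacuous.\<close>
  have "\<not> 4 dvd P.ord_a"
  proof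
    assume 4: "4 dvd P.ord_a"
    have aoE: "ao \<in> E" using ao_H H_E by blast
    let ?c = "card ((\<lambda>x. K #> x) ` Ho)"
    have "(K #> ao) [^]\<^bsub>EK.Q\<^esub> ?c = \<one>\<^bsub>EK.Q\<^esub>"
      by (rule coset_power_card[OF Ho_facts(1) _ ao]) (use Ho_facts(3) H_E in blast)
    hence "ao [^] ?c \<in> K" using EK.coset_one_iff[OF H_mem[OF HK.A_pow[OF ao_H]]]
      by (simp add: EK.pow_quot[OF aoE] EK.one_quot)
    hence "\<psi> ao ^ ?c = 1" using \<psi>_one_iff[OF HK.A_pow[OF ao_H]] \<psi>_pow[OF ao_H] by simp
    hence "P.ord_a dvd ?c" using P.ord_a(1) by blast
    hence "2 dvd ?c" using 4 dvd_trans[of 2 4] dvd_trans by (metis even_numeral)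
    thus False using hHo two_is_prime_nat unfolding hall_preimage_def hall_subgroup_def carrier_quot by blast
  qed
  hence orth: "conjugate_orthogonal {..<P.d} (\<lambda>j. \<psi> ao ^ j) P.r P.d" by (intro P.orthogonal_central) blast
  have "{ao [^] i | i::nat. i < index G Eo Ho} = (\<lambda>j. ao [^] j) ` {..<P.d}"
    unfolding P.complement_facts(6) by auto
  thus ?thesis using P.unit_system_complement[OF V gen orth] by simp
qed

text \<open>The second generator of the given presentation need not lie in \<open>M2\<close>, so a
  generator of \<open>M2/K\<close> is chosen afresh. The presentation serves to identify
  \<open>[E2 : H2]\<close> with \<open>2 ^ k\<close>.\<close>

lemma unit_system_complemented:
  assumes M: "subgroup M2 G" "K \<subseteq> M2"
    and compl: "is_complement (quot G E2 K) (carrier (quot G H2 K)) (carrier (quot G M2 K))"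
    and cyc: "cyclic_group (quot G M2 K)"
  obtains b where "complemented_part G q H K m C \<chi> Cl E2 H2 a2 b" "M2 \<subseteq> E2" "b \<in> M2"
    "(\<lambda>x. K #> x) ` M2 \<subseteq> generate (quot G E2 K) {K #> b}"
proof -
  interpret SK: subquotient G E2 K
    by (rule subquotient_sub[OF E2_facts(1,2)]) (use E2_facts(3) E_N in blast)
  have sM: "subgroup ((\<lambda>x. K #> x) ` M2) SK.Q" using compl by (simp add: is_complement_def carrier_quot)
  have ME: "M2 \<subseteq> E2"
    using subgroup.subset[OF sM] SK.mem_image_iff[OF E2_facts(1,2)] subgroup.subset[OF M(1)]
    by (auto simp: carrier_quot)
  obtain c where c: "c \<in> carrier (quot G M2 K)" "subgroup_generated (quot G M2 K) {c} = quot G M2 K"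
    using cyc unfolding cyclic_group_def by blast
  then obtain b where b: "b \<in> M2" "c = K #> b" by (auto simp: carrier_quot)
  have "generate (quot G M2 K) (carrier (quot G M2 K) \<inter> {c}) = carrier (quot G M2 K)"
    using c(2) carrier_subgroup_generated by metis
  hence "generate (quot G M2 K) {c} = carrier (quot G M2 K)" using c(1) by (simp add: Int_absorb1)
  moreover have "generate (quot G M2 K) {c} = generate SK.Q {c}"
    unfolding quot_restrict[of G M2 K E2]
    by (rule group.generate_consistent[OF SK.group_quot _ sM]) (use b in auto)
  ultimately have gen: "generate SK.Q {K #> b} = carrier (quot G M2 K)" using b by simp
  have "complemented_part G q H K m C \<chi> Cl E2 H2 a2 b"
    using E2_facts H2_facts a2 faithful_2 b ME compl unfolding gen[symmetric]
    by (intro complemented_part.intro nilpotent_shoda_axioms complemented_part_axioms.intro) (use H2_E2 in auto)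
  thus thesis by (rule that[OF _ ME b(1)]) (simp add: gen carrier_quot)
qed

text \<open>The relations show that the powers of \<open>b\<close> below \<open>2 ^ k\<close> meet
  all cosets of \<open>H2\<close>. That they lie in different cosets is a statement about the
  absence of further relations and comes from the exponent sum.\<close>

lemma index_presentation:
  fixes k :: nat
  assumes P: "has_presentation (quot G E2 K) [K #> a2, K #> b] (relations_cyclic n k r)" and b: "b \<in> E2"
  shows "index G E2 H2 = 2 ^ k"
proof -
  interpret SK: subquotient G E2 K
    by (rule subquotient_sub[OF E2_facts(1,2)]) (use E2_facts(3) E_N in blast)
  interpret Q: group SK.Q by (rule SK.group_quot)
  let ?gs = "[K #> a2, K #> b]"
  have gs: "set ?gs \<subseteq> carrier SK.Q" and gen: "generate SK.Q {K #> a2, K #> b} = carrier SK.Q"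
    using P by (simp_all add: has_presentation_def)
  have a2E: "a2 \<in> E2" using a2 H2_E2 by blast
  have bc: "b \<in> carrier G" using b E2_facts(3) E_mem by blast
  have "eval_word SK.Q ?gs (wpow wb (2 ^ k)) = eval_word SK.Q ?gs []"
    by (rule Q.presentation_relation[OF P])
      (use Q.letters_wpow[of 1 "2 ^ k"] in \<open>auto simp: relations_cyclic_def\<close>)
  hence "(K #> b) [^]\<^bsub>SK.Q\<^esub> (2 ^ k :: nat) = \<one>\<^bsub>SK.Q\<^esub>"
    using Q.eval_word_wpow[OF gs, of 1 "2 ^ k"] by (simp add: eval_word_def nat_power_eq)
  hence bk: "b [^] (2 ^ k :: nat) \<in> K"
    using SK.coset_one_iff[of "b [^] (2 ^ k :: nat)"] bc by (simp add: SK.pow_quot[OF b] SK.one_quot)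
  have bkK: "b [^] (2 ^ k * j :: nat) \<in> K" for j
  proof -
    have "(b [^] (2 ^ k :: nat)) [^] j \<in> K"
      by (induction j) (simp_all add: subgroup.one_closed[OF sub_K] subgroup.m_closed[OF sub_K] bk)
    thus ?thesis using bc by (simp add: nat_pow_pow)
  qed
  have H2c: "h \<in> carrier G" if "h \<in> H2" for h using that H2_facts(3) H_mem by blast
  have mem: "b [^] (j::nat) \<in> H2 \<longleftrightarrow> 2 ^ k dvd j" for j
  proof
    assume bj: "b [^] j \<in> H2"
    hence bjH: "b [^] j \<in> H" using H2_facts(3) by blast
    obtain i :: nat where i: "b [^] j \<otimes> inv (a2 [^] i) \<in> K" using power_of_generator[OF a2_H gen2 bj bjH] by blast
    hence "K #> (b [^] j) = K #> (a2 [^] i)" using SK.coset_eq_iff[of "b [^] j" "a2 [^] i"] bc H_mem[OF a2_H] by simp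
    hence "(?gs ! 1) [^]\<^bsub>SK.Q\<^esub> j = (?gs ! 0) [^]\<^bsub>SK.Q\<^esub> i" by (simp add: SK.pow_quot b a2E)
    from Q.presentation_second_generator[OF P _ relations_exponent_sum(1) this] show "2 ^ k dvd j" by simp
  next
    assume "2 ^ k dvd j"
    thus "b [^] j \<in> H2" using bkK H2_facts(2) by (auto elim!: dvdE)
  qed
  have H2conj: "b [^] (j::nat) \<otimes> h \<otimes> inv (b [^] j) \<in> H2" if h: "h \<in> H2" for h j
  proof -
    have "b [^] j \<in> E2" by (rule SK.A_pow[OF b])
    hence "b [^] j \<otimes> h \<otimes> inv (b [^] j) \<in> E2" using h H2_E2 by (intro SK.A_closed) auto
    moreover have "b [^] j \<in> N" using \<open>b [^] j \<in> E2\<close> E2_facts(3) E_N by blast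
    hence "b [^] j \<otimes> h \<otimes> inv (b [^] j) \<in> H" using h H2_facts(3) by (intro conj_closed(1)) auto
    ultimately show ?thesis using intersect_H(2) by blast
  qed
  have cov: "\<exists>h\<in>H2. \<exists>j. x = K #> (h \<otimes> b [^] (j::nat))" if "x \<in> generate SK.Q {K #> a2, K #> b}" for x
    using that
  proof (induction rule: generate.induct)
    case one
    show ?case by (intro bexI[of _ \<one>] exI[of _ 0])
      (simp_all add: subgroup.one_closed[OF H2_facts(1)] SK.one_quot coset_mult_one[OF K_carrier])
  next
    case (incl h)
    show ?case
    proof (cases "h = K #> a2")
      case True
      show ?thesis using a2 H2c by (intro bexI[of _ a2] exI[of _ 0]) (simp_all add: True)
    next
      case False
      hence "h = K #> b" using incl by simp
      thus ?thesis using bc by (intro bexI[of _ \<one>] exI[of _ 1]) (simp_all add: subgroup.one_closed[OF H2_facts(1)])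
    qed
  next
    case (inv h)
    show ?case
    proof (cases "h = K #> a2")
      case True
      have "inv a2 \<in> H2" by (rule subgroup.m_inv_closed[OF H2_facts(1) a2])
      thus ?thesis using H2c by (intro bexI[of _ "inv a2"] exI[of _ 0]) (simp_all add: True SK.inv_quot[OF a2E])
    next
      case False
      hence h: "h = K #> b" using inv by simp
      let ?e = "2 ^ k - 1 :: nat"
      have "b [^] ?e \<otimes> b = b [^] (2 ^ k :: nat)" using bc by (metis Suc_diff_1 nat_pow_Suc pos2 zero_less_power)
      hence "b [^] ?e \<otimes> inv (inv b) \<in> K" using bk bc by simp
      hence "K #> (b [^] ?e) = K #> inv b" using SK.coset_eq_iff[of "b [^] ?e" "inv b"] bc by simp
      thus ?thesis using bc
        by (intro bexI[of _ \<one>] exI[of _ ?e]) (simp_all add: h SK.inv_quot[OF b] subgroup.one_closed[OF H2_facts(1)])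
    qed
  next
    case (eng x y)
    then obtain h j h' j' where x: "h \<in> H2" "x = K #> (h \<otimes> b [^] (j::nat))"
      and y: "h' \<in> H2" "y = K #> (h' \<otimes> b [^] (j'::nat))" by blast
    have e: "h \<otimes> b [^] j \<in> E2" "h' \<otimes> b [^] j' \<in> E2" using x y H2_E2 SK.A_pow[OF b] by (auto intro!: SK.A_closed(2))
    have "x \<otimes>\<^bsub>SK.Q\<^esub> y = K #> ((h \<otimes> b [^] j) \<otimes> (h' \<otimes> b [^] j'))" unfolding x y by (rule SK.mult_quot[OF e])
    also have "(h \<otimes> b [^] j) \<otimes> (h' \<otimes> b [^] j') = h \<otimes> (b [^] j \<otimes> h' \<otimes> inv (b [^] j)) \<otimes> b [^] (j + j')"
    proof -
      have "h \<otimes> (b [^] j \<otimes> h' \<otimes> inv (b [^] j)) \<otimes> b [^] (j + j') =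
          h \<otimes> b [^] j \<otimes> h' \<otimes> (inv (b [^] j) \<otimes> (b [^] j \<otimes> b [^] j'))"
        using H2c[OF x(1)] H2c[OF y(1)] bc by (simp add: m_assoc nat_pow_mult)
      also have "inv (b [^] j) \<otimes> (b [^] j \<otimes> b [^] j') = b [^] j'" using bc by (simp add: m_assoc[symmetric])
      finally show ?thesis using H2c[OF x(1)] H2c[OF y(1)] bc by (simp add: m_assoc)
    qed
    finally show ?case using subgroup.m_closed[OF H2_facts(1) x(1) H2conj[OF y(1), of j]] by blast
  qed
  show ?thesis
  proof (rule index_cyclic_transversal[OF H2_facts(1) E2_facts(1) H2_E2 b _ mem])
    fix g assume g: "g \<in> E2"
    hence "K #> g \<in> generate SK.Q {K #> a2, K #> b}" unfolding gen carrier_quot by (rule imageI)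
    then obtain h and j :: nat where h: "h \<in> H2" "K #> g = K #> (h \<otimes> b [^] j)" using cov by blast
    have gc: "g \<in> carrier G" using g SK.A_mem by blast
    have k1: "g \<otimes> inv (h \<otimes> b [^] j) \<in> K" using h(2) SK.coset_eq_iff[of g "h \<otimes> b [^] j"] gc H2c[OF h(1)] bc by simp
    have k2: "g \<otimes> inv (h \<otimes> b [^] j) \<in> H2" using k1 H2_facts(2) by blast
    define j' where "j' = j mod 2 ^ k"
    define x where "x = b [^] (2 ^ k * (j div 2 ^ k) :: nat)"
    have xK: "x \<in> H2" using bkK H2_facts(2) by (auto simp: x_def)
    have bj: "b [^] j = x \<otimes> b [^] j'" using bc by (simp add: x_def j'_def nat_pow_mult)
    have "g = (g \<otimes> inv (h \<otimes> b [^] j)) \<otimes> (h \<otimes> b [^] j)" using gc H2c[OF h(1)] bc by (simp add: m_assoc del: inv_mult_group)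
    also have "\<dots> = (g \<otimes> inv (h \<otimes> b [^] j)) \<otimes> h \<otimes> x \<otimes> b [^] j'"
      using gc H2c[OF h(1)] bc H2c[OF xK] unfolding bj by (simp add: m_assoc)
    finally have "g = (g \<otimes> inv (h \<otimes> b [^] j)) \<otimes> h \<otimes> x \<otimes> b [^] j'" .
    moreover have "(g \<otimes> inv (h \<otimes> b [^] j)) \<otimes> h \<otimes> x \<in> H2"
      by (rule subgroup.m_closed[OF H2_facts(1) subgroup.m_closed[OF H2_facts(1) k2 h(1)] xK])
    moreover have "j' < 2 ^ k" by (simp add: j'_def)
    ultimately show "\<exists>h\<in>H2. \<exists>j<2 ^ k. g = h \<otimes> b [^] (j::nat)" by blast
  qed
qed

end

context hall_parts
begin

lemma E2_subquotient: "subquotient G E2 K"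
  by (rule subquotient_sub[OF E2_facts(1,2)]) (use E2_facts(3) E_N in blast)

lemma central_iff:
  assumes x: "x \<in> H2"
  shows "K #> x \<in> group_center (quot G E2 K) \<longleftrightarrow> (\<forall>g\<in>E2. \<psi> (g \<otimes> x \<otimes> inv g) = \<psi> x)"
proof -
  interpret SK: subquotient G E2 K by (rule E2_subquotient)
  have xE: "x \<in> E2" and xH: "x \<in> H" using x H2_E2 H2_facts(3) by auto
  have "(K #> x) \<otimes>\<^bsub>SK.Q\<^esub> (K #> g) = (K #> g) \<otimes>\<^bsub>SK.Q\<^esub> (K #> x) \<longleftrightarrow> \<psi> (g \<otimes> x \<otimes> inv g) = \<psi> x"
    if g: "g \<in> E2" for g
  proof -
    have gx: "g \<otimes> x \<otimes> inv g \<in> H" using g E2_facts(3) E_N xH by (intro conj_closed(1)) auto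
    have c: "g \<in> carrier G" "x \<in> carrier G" using SK.A_mem g xE by auto
    have "(K #> x) \<otimes>\<^bsub>SK.Q\<^esub> (K #> g) = (K #> g) \<otimes>\<^bsub>SK.Q\<^esub> (K #> x) \<longleftrightarrow> K #> (g \<otimes> x) = K #> (x \<otimes> g)"
      using g xE by (auto simp: SK.mult_quot)
    also have "\<dots> \<longleftrightarrow> g \<otimes> x \<otimes> inv (x \<otimes> g) \<in> K" using c by (intro SK.coset_eq_iff) auto
    also have "g \<otimes> x \<otimes> inv (x \<otimes> g) = g \<otimes> x \<otimes> inv g \<otimes> inv x" using c by (simp add: inv_mult_group m_assoc)
    also have "\<dots> \<in> K \<longleftrightarrow> \<psi> (g \<otimes> x \<otimes> inv g) * inverse (\<psi> x) = 1"
      using \<psi>_one_iff[OF H_mult[OF gx H_inv[OF xH]]] unfolding \<psi>_mult[OF gx H_inv[OF xH]] \<psi>_inv[OF xH] by blast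
    also have "\<dots> \<longleftrightarrow> \<psi> (g \<otimes> x \<otimes> inv g) = \<psi> x" using \<psi>_nonzero[OF xH] by (simp add: field_simps)
    finally show ?thesis .
  qed
  thus ?thesis using xE by (auto simp: group_center_def carrier_quot)
qed

text \<open>The value is a primitive fourth root of unity, whose powers depend on the exponent
  modulo 4. This turns the centrality condition in the construction into a congruence on
  \<open>r\<close>.\<close>

lemma quarter_power_iff:
  assumes n: "n \<ge> 2" and e: "e > 0"
  shows "(\<psi> a2 ^ 2 ^ (n - 2)) ^ e = \<psi> a2 ^ 2 ^ (n - 2) \<longleftrightarrow> 4 dvd e - 1"
proof -
  have n4: "2 ^ n = 2 ^ (n - 2) * (4::nat)" using n by (metis le_add_diff_inverse2 power_add power2_eq_square num_double numeral_times_numeral)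
  let ?i = "\<psi> a2 ^ 2 ^ (n - 2)"
  have "?i ^ e = ?i ^ (e - 1) * ?i" using e by (metis Suc_diff_1 power_Suc2)
  moreover have "?i \<noteq> 0" using \<psi>_nonzero[OF a2_H] by simp
  ultimately have "?i ^ e = ?i \<longleftrightarrow> ?i ^ (e - 1) = 1" by auto
  also have "\<dots> \<longleftrightarrow> 2 ^ n dvd 2 ^ (n - 2) * (e - 1)" unfolding power_mult[symmetric] by (rule \<psi>_a2)
  also have "\<dots> \<longleftrightarrow> 4 dvd e - 1" unfolding n4 by simp
  finally show ?thesis .
qed

lemma two_part_complemented:
  fixes k :: nat
  assumes M: "subgroup M2 G" "K \<subseteq> M2"
    and compl: "is_complement (quot G E2 K) (carrier (quot G H2 K)) (carrier (quot G M2 K))"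
    and cyc: "cyclic_group (quot G M2 K)"
    and pres: "has_presentation (quot G E2 K) [K #> a2, K #> b0] (relations_cyclic n k r)" "b0 \<in> E2"
  defines "central \<equiv> n \<le> 1 \<or> K #> (a2 [^] (2 ^ (n - 2) :: nat)) \<in> group_center (quot G E2 K)"
  shows "central \<Longrightarrow> unit_system E2 {a2 [^] i | i::nat. i < 2 ^ k} (\<lambda>x. x) (conv (average M2) * w 1)"
    and "\<not> central \<Longrightarrow> unit_system E2 ({a2 [^] i | i::nat. i < index G E2 H2 div 2} \<union>
      {a2 [^] (2 ^ (n - 2) + i) | i::nat. i < index G E2 H2 div 2}) (\<lambda>x. x) (conv (average M2) * w 1)"
proof -
  obtain b where b: "complemented_part G q H K m C \<chi> Cl E2 H2 a2 b" and V: "M2 \<subseteq> E2" "b \<in> M2"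
    "(\<lambda>x. K #> x) ` M2 \<subseteq> generate (quot G E2 K) {K #> b}"
    by (rule unit_system_complemented[OF M compl cyc])
  interpret P: complemented_part G q f_type H K m C \<chi> Cl E2 H2 a2 b by (rule b)
  have ord: "P.ord_a = 2 ^ n"
    using P.ord_a(1)[of "2 ^ n"] \<psi>_a2[of "2 ^ n"] P.ord_a(1)[of P.ord_a] \<psi>_a2[of P.ord_a] by (intro dvd_antisym) auto
  have a2p: "a2 [^] (j :: nat) \<in> H2" for j
    by (induction j)
      (simp_all add: subgroup.one_closed[OF H2_facts(1)] subgroup.m_closed[OF H2_facts(1)] a2)
  have cent: "central \<longleftrightarrow> n \<le> 1 \<or> 4 dvd P.r - 1"
  proof (cases "n \<le> 1")
    case False
    hence n2: "n \<ge> 2" by simp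
    let ?x = "a2 [^] (2 ^ (n - 2) :: nat)"
    have xH: "?x \<in> H" by (rule HK.A_pow[OF a2_H])
    have \<psi>x: "\<psi> ?x = \<psi> a2 ^ 2 ^ (n - 2)" by (rule \<psi>_pow[OF a2_H])
    have "(\<forall>g\<in>E2. \<psi> (g \<otimes> ?x \<otimes> inv g) = \<psi> ?x) \<longleftrightarrow> 4 dvd P.r - 1"
    proof
      assume "\<forall>g\<in>E2. \<psi> (g \<otimes> ?x \<otimes> inv g) = \<psi> ?x"
      hence "\<psi> (b \<otimes> ?x \<otimes> inv b) = \<psi> ?x" using P.b by blast
      hence "\<psi> ?x ^ P.r = \<psi> ?x" using acts_\<psi>[OF P.acts_b xH] by (simp add: P.r_def)
      thus "4 dvd P.r - 1" unfolding \<psi>x using quarter_power_iff[OF n2 P.r_pos] by blast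
    next
      assume 4: "4 dvd P.r - 1"
      show "\<forall>g\<in>E2. \<psi> (g \<otimes> ?x \<otimes> inv g) = \<psi> ?x"
      proof
        fix g assume "g \<in> E2"
        then obtain h and j :: nat where h: "h \<in> H2" "g = h \<otimes> b [^] j" using P.complement_facts(5) by blast
        have "acts g (0 + j * P.s)" unfolding h(2)
          using h(1) H2_facts(3) by (intro acts_mult acts_H acts_pow P.acts_b) auto
        hence "\<psi> (g \<otimes> ?x \<otimes> inv g) = \<psi> ?x ^ (P.r ^ j)"
          using acts_\<psi>[OF _ xH] by (simp add: P.r_def power_mult[symmetric] mult.commute)
        moreover have "P.r mod 4 = 1" using 4 P.r_pos by presburger
        hence "P.r ^ j mod 4 = 1" by (metis power_mod power_one mod_mod_trivial)
        hence "4 dvd P.r ^ j - 1" by (metis dvd_minus_mod)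
        hence "\<psi> ?x ^ (P.r ^ j) = \<psi> ?x" unfolding \<psi>x using quarter_power_iff[OF n2, of "P.r ^ j"] P.r_pos by simp
        ultimately show "\<psi> (g \<otimes> ?x \<otimes> inv g) = \<psi> ?x" by simp
      qed
    qed
    thus ?thesis using False central_iff[OF a2p] unfolding central_def by simp
  qed (simp add: central_def)
  have d: "P.d = index G E2 H2" by (rule P.complement_facts(6)[symmetric])
  show "unit_system E2 {a2 [^] i | i::nat. i < 2 ^ k} (\<lambda>x. x) (conv (average M2) * w 1)" if central
  proof -
    have "4 dvd P.r - 1" if "4 dvd P.ord_a"
    proof -
      have "\<not> n \<le> 1"
      proof
        assume "n \<le> 1"
        hence "n = 0 \<or> n = 1" by auto
        thus False using that unfolding ord by auto
      qed
      thus ?thesis using \<open>central\<close> cent by blast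
    qed
    hence orth: "conjugate_orthogonal {..<P.d} (\<lambda>j. \<psi> a2 ^ j) P.r P.d" by (rule P.orthogonal_central)
    have "{a2 [^] i | i::nat. i < 2 ^ k} = (\<lambda>j. a2 [^] j) ` {..<P.d}"
      unfolding d index_presentation[OF pres] by auto
    thus ?thesis using P.unit_system_complement[OF M(1) V orth] by simp
  qed
  show "unit_system E2 ({a2 [^] i | i::nat. i < index G E2 H2 div 2} \<union>
      {a2 [^] (2 ^ (n - 2) + i) | i::nat. i < index G E2 H2 div 2}) (\<lambda>x. x) (conv (average M2) * w 1)"
    if "\<not> central"
  proof -
    have n2: "n \<ge> 2" and r4: "\<not> 4 dvd P.r - 1" using that cent by auto
    have "2 dvd P.r - 1" using P.ord_a_rad[of 2] n2 by (simp add: ord)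
    moreover obtain y where "P.r = Suc y" using P.r_pos by (cases P.r) auto
    ultimately have r3: "P.r mod 4 = 3" using r4 by simp presburger
    let ?J = "{..<P.d div 2} \<times> {..<2::nat}" and ?e = "\<lambda>(i, b). i + b * 2 ^ (n - 2) :: nat"
    have "conjugate_orthogonal ?J (\<lambda>(i, b). \<psi> a2 ^ (i + b * 2 ^ (n - 2))) P.r P.d"
      by (rule conjugate_orthogonal_noncentral(2)[OF n2 r3 P.complement_facts(2)])
        (use P.ord_a_dvd P.ord_a_min \<psi>_a2 in \<open>simp_all add: ord\<close>)
    moreover have "(\<lambda>(i, b). \<psi> a2 ^ (i + b * 2 ^ (n - 2))) = (\<lambda>j. \<psi> a2 ^ ?e j)" by (auto simp: fun_eq_iff)
    ultimately have "conjugate_orthogonal ?J (\<lambda>j. \<psi> a2 ^ ?e j) P.r P.d" by simp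
    from P.unit_system_complement[OF M(1) V this]
    have "unit_system E2 ((\<lambda>j. a2 [^] ?e j) ` ?J) (\<lambda>x. x) (conv (average M2) * w 1)" .
    moreover have "(\<lambda>j. a2 [^] ?e j) ` ?J = {a2 [^] i | i::nat. i < P.d div 2} \<union>
        {a2 [^] (2 ^ (n - 2) + i) | i::nat. i < P.d div 2}"
    proof -
      have "{..<2::nat} = {0, 1}" by auto
      hence "?J = (\<lambda>i. (i, 0)) ` {..<P.d div 2} \<union> (\<lambda>i. (i, 1)) ` {..<P.d div 2}" by auto
      hence "(\<lambda>j. a2 [^] ?e j) ` ?J = (\<lambda>i. a2 [^] i) ` {..<P.d div 2} \<union> (\<lambda>i. a2 [^] (2 ^ (n - 2) + i)) ` {..<P.d div 2}"
        by (simp add: image_Un image_image add.commute)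
      thus ?thesis by auto
    qed
    ultimately show ?thesis unfolding d by simp
  qed
qed

text \<open>The group \<open>E/H\<close> is cyclic, so the subcase of a noncyclic complement does not occur.\<close>

lemma complement_cyclic:
  assumes M: "subgroup M2 G" "K \<subseteq> M2"
    and compl: "is_complement (quot G E2 K) (carrier (quot G H2 K)) (carrier (quot G M2 K))"
  shows "cyclic_group (quot G M2 K)"
proof -
  interpret SK: subquotient G E2 K by (rule E2_subquotient)
  have sM: "subgroup ((\<lambda>x. K #> x) ` M2) SK.Q" and dis: "(\<lambda>x. K #> x) ` H2 \<inter> (\<lambda>x. K #> x) ` M2 = {\<one>\<^bsub>SK.Q\<^esub>}"
    using compl by (simp_all add: is_complement_def carrier_quot)
  have ME: "M2 \<subseteq> E2"
    using subgroup.subset[OF sM] SK.mem_image_iff[OF E2_facts(1,2)] subgroup.subset[OF M(1)]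
    by (auto simp: carrier_quot)
  have ME': "M2 \<subseteq> E" using ME E2_facts(3) by blast
  obtain v s where v: "v \<in> M2" "\<And>g. g \<in> M2 \<Longrightarrow> \<exists>h\<in>M2 \<inter> H. \<exists>j<ell div s. g = h \<otimes> v [^] (j::nat)"
    by (rule cyclic_mod_H[OF M(1) ME']) blast
  \<comment> \<open>An element of \<open>M2\<close> in \<open>H\<close> lies in \<open>H2\<close>,
    which meets \<open>M2\<close> in \<open>K\<close> only. So cyclicity modulo \<open>H\<close>
    becomes cyclicity modulo \<open>K\<close>.\<close>
  have MH: "M2 \<inter> H \<subseteq> K"
  proof
    fix h assume h: "h \<in> M2 \<inter> H"
    hence "h \<in> H2" using ME intersect_H(2) by blast
    hence "K #> h \<in> (\<lambda>x. K #> x) ` H2 \<inter> (\<lambda>x. K #> x) ` M2" using h by blast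
    hence "K #> h = K" unfolding dis by (simp add: SK.one_quot)
    thus "h \<in> K" using SK.coset_one_iff[of h] h H_mem by blast
  qed
  interpret MK: subquotient G M2 K
    by (rule subquotient_sub[OF M]) (use ME' E_N in blast)
  interpret Q: group MK.Q by (rule MK.group_quot)
  have Kv: "K #> v \<in> carrier MK.Q" using v(1) by (auto simp: carrier_quot)
  have "carrier MK.Q \<subseteq> generate MK.Q {K #> v}"
  proof
    fix x assume "x \<in> carrier MK.Q"
    then obtain g where g: "g \<in> M2" "x = K #> g" by (auto simp: carrier_quot)
    obtain h and j :: nat where h: "h \<in> M2" "h \<in> H" "g = h \<otimes> v [^] j" using v(2)[OF g(1)] by blast
    have "K #> g = (K #> h) #> v [^] j" unfolding h(3)
      using coset_mult_assoc[OF K_carrier MK.A_mem[OF h(1)] MK.A_mem[OF MK.A_pow[OF v(1)]]] by simp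
    also have "K #> h = K" using MH h MK.coset_one_iff[OF MK.A_mem[OF h(1)]] by blast
    finally have "x = (K #> v) [^]\<^bsub>MK.Q\<^esub> j" by (simp add: g MK.pow_quot[OF v(1)])
    thus "x \<in> generate MK.Q {K #> v}"
      using Q.generate_pow_on_finite_carrier[OF MK.finite_quot[OF finite_G] Kv] by auto
  qed
  moreover have "generate MK.Q {K #> v} \<subseteq> carrier MK.Q" using Kv by (intro Q.generate_incl) simp
  ultimately have "generate MK.Q {K #> v} = carrier MK.Q" by blast
  hence "subgroup_generated MK.Q {K #> v} = MK.Q"
    using Kv by (simp add: subgroup_generated_def)
  thus ?thesis unfolding cyclic_group_def using Kv by blast
qed

end

section \<open>Inclusions implied by the data of the construction\<close>

context nilpotent_shoda
begin

lemma generator_subset: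
  assumes S: "subgroup S G" "K \<subseteq> S" and a: "a \<in> S" "a \<in> H" and S': "S' \<subseteq> carrier G"
    and gen: "generate (quot G E K) {K #> a} = carrier (quot G S' K)"
  shows "S' \<subseteq> S"
proof
  fix h assume h: "h \<in> S'"
  have aE: "a \<in> E" using a H_E by blast
  have Ka: "K #> a \<in> carrier EK.Q" using aE by (auto simp: carrier_quot)
  have "K #> h \<in> generate EK.Q {K #> a}" unfolding gen carrier_quot using h by (rule imageI)
  then obtain i :: nat where "K #> h = (K #> a) [^]\<^bsub>EK.Q\<^esub> i"
    by (auto simp: group.generate_pow_on_finite_carrier[OF EK.group_quot EK.finite_quot[OF finite_G] Ka])
  hence "h \<otimes> inv (a [^] i) \<in> K"
    using EK.coset_eq_iff[of h "a [^] i"] h S' E_mem[OF aE] by (simp add: EK.pow_quot[OF aE] subset_iff)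
  hence 1: "h \<otimes> inv (a [^] i) \<in> S" using S(2) by blast
  have "a [^] i \<in> S" by (induction i) (simp_all add: subgroup.one_closed[OF S(1)] subgroup.m_closed[OF S(1)] a)
  from subgroup.m_closed[OF S(1) 1 this] show "h \<in> S"
    using h S' E_mem[OF aE] by (simp add: m_assoc subset_iff)
qed

text \<open>In every rule the presentation of \<open>E2/K\<close> has the coset of \<open>a2\<close>
  among its generators. This puts \<open>a2\<close> into \<open>E2\<close>, and with it all of
  \<open>H2\<close>.\<close>

lemma two_part_subset:
  assumes E2: "hall_preimage {2} G E K E2" and H2: "hall_preimage {2} G H K H2" and a2: "a2 \<in> H2"
    and gen: "generate (quot G E K) {K #> a2} = carrier (quot G H2 K)"
    and two: "two_part G K E2 H2 a2 n T2 \<beta>2"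
  shows "H2 \<subseteq> E2"
proof -
  note E2 = hall_preimage_facts[OF E2]
  have sH2: "subgroup H2 G" using H2 by (simp add: hall_preimage_def)
  have "(\<lambda>x. K #> x) ` H2 \<subseteq> carrier HK.Q"
    using H2 subgroup.subset unfolding hall_preimage_def hall_subgroup_def carrier_quot[of G H2] by blast
  hence a2H: "a2 \<in> H" using a2 HK.mem_image_iff[OF sub_H K_H] subgroup.mem_carrier[OF sH2] by (auto simp: carrier_quot)
  interpret SK: subquotient G E2 K by (rule subquotient_sub[OF E2(1,2)]) (use E2(3) E_N in blast)
  have "K #> a2 \<in> carrier SK.Q" using two by cases (auto simp: has_presentation_def)
  hence "a2 \<in> E2" using SK.mem_image_iff[OF E2(1,2) H_mem[OF a2H]] by (simp add: carrier_quot)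
  from generator_subset[OF E2(1,2) this a2H subgroup.subset[OF sH2] gen] show ?thesis .
qed

end

section \<open>The 2-part in which \<open>H2/K\<close> has no complement\<close>

lemma dvd_odd_power_plus_one:
  fixes r :: nat
  assumes "odd r" "odd j" "2 ^ n dvd r ^ j + 1"
  shows "2 ^ n dvd r + 1"
proof -
  define s :: int where "s = (\<Sum>i<j. (- int r) ^ i)"
  \<comment> \<open>\<open>s\<close> is the quotient of \<open>r ^ j + 1\<close> by
    \<open>r + 1\<close>. As an alternating sum of an odd number of odd terms it is odd, so the
    power of 2 divides \<open>r + 1\<close>.\<close>
  have "odd s"
  proof -
    have "odd (\<Sum>i<j. (- int r) ^ i) \<longleftrightarrow> odd j" for j :: nat
      by (induction j) (use assms(1) in auto)
    thus ?thesis using assms(2) by (simp add: s_def)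
  qed
  hence "coprime (2 ^ n) s" by simp
  moreover have "1 - (- int r) ^ j = (1 - (- int r)) * s" unfolding s_def by (rule one_diff_power_eq)
  hence "int (r ^ j + 1) = (int r + 1) * s" using assms(2) by (simp add: power_minus_odd)
  moreover have "int (2 ^ n) dvd int (r ^ j + 1)" using assms(3) of_nat_dvd_iff by blast
  hence "2 ^ n dvd int (r ^ j + 1)" by simp
  ultimately have "2 ^ n dvd int r + 1" using coprime_dvd_mult_left_iff by metis
  hence "int (2 ^ n) dvd int (r + 1)" by (simp add: add.commute)
  thus ?thesis unfolding of_nat_dvd_iff .
qed

text \<open>A 2-part that is generated modulo \<open>K\<close> by \<open>a\<close> and an element \<open>c\<close> that inverts \<open>a\<close>.\<close>

locale nonsplit_part = hall_parts G q f_type H K m C \<chi> Cl E2 Eo H2 Ho a2 ao n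
  for G (structure) and q and f_type :: "'f::{field,finite} itself" and H K m C \<chi> Cl
    and E2 Eo H2 Ho :: "'a set" and a2 ao :: 'a and n :: nat +
  fixes c :: 'a
  assumes c: "c \<in> E2" and n2: "n \<ge> 2"
    and cover: "g \<in> E2 \<Longrightarrow> g \<in> H2 \<or> g \<otimes> inv c \<in> H2"
    and inverts: "\<psi> (inv c \<otimes> a2 \<otimes> c) = inverse (\<psi> a2)"
    and c_square: "K #> (c \<otimes> c) = K #> (a2 [^] (2 ^ (n - 1) :: nat))"
begin

definition s where "s = (SOME i. acts c i)"
definition \<iota> where "\<iota> = \<psi> a2 ^ 2 ^ (n - 2)"

lemma c_E: "c \<in> E" using c E2_facts(3) by blast
lemma c_carrier: "c \<in> carrier G" using c_E E_mem by blast
lemma acts_c: "acts c s" unfolding s_def by (rule someI_ex) (use c_E mem_E in blast)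

lemma power_n: "(2::nat) ^ n = 2 ^ (n - 2) * 4" "(2::nat) ^ (n - 1) = 2 ^ (n - 2) * 2" "(2::nat) ^ n = 2 ^ (n - 1) * 2"
proof -
  obtain j where "n = Suc (Suc j)" using n2 by (metis Suc_le_D numeral_2_eq_2 Suc_le_mono le0)
  thus "(2::nat) ^ n = 2 ^ (n - 2) * 4" "(2::nat) ^ (n - 1) = 2 ^ (n - 2) * 2" "(2::nat) ^ n = 2 ^ (n - 1) * 2"
    by simp_all
qed

lemma half_power: "\<psi> a2 ^ 2 ^ (n - 1) = - 1"
proof -
  let ?z = "\<psi> a2 ^ 2 ^ (n - 1)"
  have "?z * ?z = \<psi> a2 ^ 2 ^ n" by (simp add: power_n(3) power_mult power2_eq_square)
  also have "\<dots> = 1" using \<psi>_a2[of "2 ^ n"] by simp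
  finally have "?z = 1 \<or> ?z = - 1" using square_eq_1_iff by blast
  moreover have "?z \<noteq> 1" unfolding \<psi>_a2 power_n(3) using nat_dvd_not_less[of "2 ^ (n - 1)" "2 ^ (n - 1) * 2"] by (auto dest: dvd_imp_le)
  ultimately show ?thesis by blast
qed

text \<open>In characteristic 2 the value -1 found in \<open>half_power\<close> would equal 1,
  contradicting the order of \<open>\<psi> a2\<close>.\<close>

lemma two_nonzero: "(2 :: 'f alg_closure) \<noteq> 0"
proof
  assume 2: "(2 :: 'f alg_closure) = 0"
  have "(- 1 :: 'f alg_closure) = 1 - 2" by simp
  hence "\<psi> a2 ^ 2 ^ (n - 1) = 1" unfolding half_power 2 by simp
  thus False unfolding \<psi>_a2 power_n(3) by (auto dest: dvd_imp_le)
qed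

lemma \<iota>_square: "\<iota> * \<iota> = - 1"
  using half_power unfolding \<iota>_def power_n(2) power_mult power2_eq_square .

lemma inverts_inv: "\<psi> a2 ^ (C ^ s) = inverse (\<psi> a2)"
proof -
  have cN: "inv c \<in> N" using c_E E_closed(3) E_N by blast
  have "inv c \<otimes> a2 \<otimes> inv (inv c) \<in> H" by (rule conj_closed(1)[OF cN a2_H])
  hence h: "inv c \<otimes> a2 \<otimes> c \<in> H" using c_carrier by simp
  have "c \<otimes> (inv c \<otimes> a2 \<otimes> c) \<otimes> inv c = a2"
    using c_carrier H_mem[OF a2_H] by (simp add: m_assoc) (simp add: m_assoc[symmetric])
  hence "\<psi> a2 = inverse (\<psi> a2) ^ (C ^ s)" using acts_\<psi>[OF acts_c h] inverts by simp
  thus ?thesis by (metis inverse_inverse_eq power_inverse)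
qed

lemma \<iota>_twist: "\<iota> ^ (C ^ s) = - \<iota>"
proof -
  have "\<iota> ^ (C ^ s) = inverse \<iota>"
    unfolding \<iota>_def by (metis inverts_inv mult.commute power_inverse power_mult)
  also have "inverse \<iota> = - \<iota>" using \<iota>_square by (intro inverse_unique) simp
  finally show ?thesis .
qed

lemma \<iota>_u: "w \<iota> = u (a2 [^] (2 ^ (n - 2) :: nat))" "\<iota> \<in> FF"
  using u_H[OF HK.A_pow[OF a2_H]] \<psi>_pow[OF a2_H] FF_power[OF \<psi>_FF[OF a2_H]] by (simp_all add: \<iota>_def)

lemma c_notin_H: "c \<notin> H"
proof
  assume "c \<in> H"
  from acts_unique[OF acts_c acts_H[OF this]] have "ell dvd s" by (simp add: cong_0_iff)
  hence "\<iota> ^ (C ^ s) = \<iota>" using fixed_field_power[OF \<iota>_u(2)] by (auto elim!: dvdE)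
  hence "\<iota> + \<iota> = 0" unfolding \<iota>_twist by (metis add.left_inverse)
  hence "2 * \<iota> = 0" by simp
  thus False using two_nonzero \<iota>_square by simp
qed

lemma cc_H: "c \<otimes> c \<in> H" and u_cc: "u c * u c = w (- 1)"
proof -
  let ?x = "a2 [^] (2 ^ (n - 1) :: nat)"
  have xH: "?x \<in> H" by (rule HK.A_pow[OF a2_H])
  have k: "(c \<otimes> c) \<otimes> inv ?x \<in> K" using c_square EK.coset_eq_iff[of "c \<otimes> c" ?x] c_carrier H_mem[OF xH] by simp
  hence "(c \<otimes> c) \<otimes> inv ?x \<otimes> ?x \<in> H" using K_H H_mult[OF _ xH] by blast
  thus "c \<otimes> c \<in> H" using c_carrier H_mem[OF xH] by (simp add: m_assoc)
  have "u c * u c = u (c \<otimes> c)" by (rule u_mult[OF c_E c_E])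
  also have "\<dots> = u ?x" using xH H_E by (intro u_K_eq E_closed c_E k) auto
  also have "\<dots> = w (- 1)" unfolding u_H[OF xH] \<psi>_pow[OF a2_H] half_power ..
  finally show "u c * u c = w (- 1)" .
qed

lemma u_inv_c: "u (inv c) = w (- 1) * u c"
proof -
  have m1: "(- 1) \<in> FF" by (intro uminus_L one_FF)
  have "w (- 1) * u c * u c = w ((- 1) * (- 1))" unfolding mult.assoc u_cc by (rule w_mult[OF m1 m1, symmetric])
  hence "w (- 1) * u c * (u c * u (inv c)) = w 1 * u (inv c)" by (simp add: mult.assoc[symmetric])
  thus ?thesis unfolding u_inv(1)[OF c_E] using u_one[OF c_E] u_one(2)[OF E_closed(3)[OF c_E]]
    by (simp add: mult.assoc)
qed

lemma coset_cases:
  assumes "g \<in> E2"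
  obtains "g \<in> H2" | h where "h \<in> H2" "g = h \<otimes> c"
proof (cases "g \<in> H2")
  case False
  hence "g \<otimes> inv c \<in> H2" using cover[OF assms] by blast
  moreover have "g = g \<otimes> inv c \<otimes> c"
    using E_mem[of g] assms E2_facts(3) c_carrier by (simp add: m_assoc subset_iff)
  ultimately show ?thesis by (rule that(2))
qed (rule that(1))

context
  fixes x y :: 'f
  assumes xy: "x\<^sup>2 + y\<^sup>2 = - 1" "y \<noteq> 0"
begin

text \<open>The quaternion units are the images of \<open>a2 [^] (2 ^ (n - 2))\<close> and of
  \<open>c\<close>; the solution \<open>x\<close>, \<open>y\<close> in the base field splits the
  algebra.\<close>

interpretation Y: twisted_quaternion w FF "u c" "C ^ s" \<iota> "to_ac x" "to_ac y"
proof (unfold_locales)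
  show "u c * w l = w (l ^ C ^ s) * u c" if "l \<in> FF" for l by (rule u_w[OF acts_c that])
  show "u c * w 1 = u c" "w 1 * u c = u c" using u_one[OF c_E] .
  show "u c * u c = w (- 1)" by (rule u_cc)
  show "\<iota> \<in> FF" "\<iota> * \<iota> = - 1" "\<iota> ^ C ^ s = - \<iota>" by (rule \<iota>_u \<iota>_square \<iota>_twist)+
  show "to_ac x \<in> FF" "to_ac y \<in> FF" by (rule fixed_field_closed)+
  show "to_ac x ^ C ^ s = to_ac x" "to_ac y ^ C ^ s = to_ac y" by (rule frobenius_base)+
  have "to_ac (x\<^sup>2 + y\<^sup>2) = to_ac (- 1)" using xy(1) by (rule arg_cong)
  thus "(to_ac x)\<^sup>2 + (to_ac y)\<^sup>2 = - 1" by simp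
  show "to_ac y \<noteq> 0" using xy(2) by simp
  show "(2 :: 'f alg_closure) \<noteq> 0" by (rule two_nonzero)
  show "(a + b) ^ C ^ s = a ^ C ^ s + b ^ C ^ s" for a b :: "'f alg_closure" by (rule frobenius_add)
  show "C ^ s > 0" using C_gt_1 by simp
  show "(l ^ C ^ s) ^ C ^ s = l" if l: "l \<in> FF" for l
  proof -
    have "ell dvd s + s" using acts_unique[OF acts_mult[OF acts_c acts_c] acts_H[OF cc_H]] by (simp add: cong_0_iff)
    hence "l ^ (C ^ (s + s)) = l" using fixed_field_power[OF l] by (auto elim!: dvdE)
    thus ?thesis by (simp add: power_add power_mult)
  qed
qed

text \<open>The idempotent written with base field coefficients and images of group elements. In
  this form it matches \<open>\<beta>2\<close> of the construction, and it commutes with whatever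
  commutes with these ingredients.\<close>

lemma nonsplit_expand:
  "Y.f = w (to_ac (1 / 2)) + w (to_ac (x / 2)) * u (a2 [^] (2 ^ (n - 2) :: nat))
     + w (to_ac (y / 2)) * (u (a2 [^] (2 ^ (n - 2) :: nat)) * u c)"
proof -
  have "Y.A = to_ac (1 / 2) + to_ac (x / 2) * \<iota>" "Y.B = to_ac (y / 2) * \<iota>"
    by (simp_all add: Y.A_def Y.B_def add_divide_distrib)
  thus ?thesis unfolding Y.f_def \<iota>_u(1)[symmetric]
    using w_add[OF fixed_field_closed(7) mult_L[OF fixed_field_closed(7) \<iota>_u(2)], of "1 / 2" "x / 2"]
      w_mult[OF fixed_field_closed(7) \<iota>_u(2), of "x / 2"] w_mult[OF fixed_field_closed(7) \<iota>_u(2), of "y / 2"]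
    by (simp only: mult.assoc)
qed

text \<open>\<open>E2\<close> consists of \<open>H2\<close> and the coset of \<open>c\<close>, so
  the idempotent and its conjugate by \<open>c\<close> make up the whole identity of the
  corner.\<close>

lemma unit_system_nonsplit: "unit_system E2 {\<one>, c} (\<lambda>x. x) Y.f"
  unfolding unit_system_def
proof (intro conjI ballI allI impI)
  have c1: "c \<noteq> \<one>" using c_notin_H HK.A_closed(1) by blast
  show "finite {\<one>, c}" by simp
  show "(\<lambda>x. x) ` {\<one>, c} \<subseteq> E2" using c subgroup.one_closed[OF E2_facts(1)] by simp
  show "Y.f * w 1 = Y.f" "w 1 * Y.f = Y.f" by (rule Y.f_one)+
  have uu: "u \<one> * u (inv \<one>) = w 1" "u c * u (inv c) = w 1" "u c * u (inv \<one>) = u c" "u \<one> * u (inv c) = w (- 1) * u c"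
    using u_inv(1)[OF c_E] u_one[OF c_E] u_one(2)[OF E_closed(3)[OF c_E]] w_one_idem u_inv_c by (simp_all add: u_unit)
  have ff: "Y.f * w 1 * Y.f = Y.f" by (simp add: Y.f_one Y.f_idem)
  fix i j assume "i \<in> {\<one>, c}" "j \<in> {\<one>, c}"
  hence "(i = \<one> \<or> i = c) \<and> (j = \<one> \<or> j = c)" by simp
  thus "Y.f * (u i * u (inv j)) * Y.f = (if i = j then Y.f else 0)"
    using uu ff c1 c1[symmetric] Y.f_y_f Y.f_inv_y_f by (elim conjE disjE) simp_all
next
  have c1: "c \<noteq> \<one>" using c_notin_H HK.A_closed(1) by blast
  have "(\<Sum>j\<in>{\<one>, c}. u (inv j) * Y.f * u j) = u (inv \<one>) * Y.f * u \<one> + u (inv c) * Y.f * u c"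
    using c1 by simp
  also have "\<dots> = Y.f + w (- 1) * u c * Y.f * u c" by (simp add: u_inv_c u_unit Y.f_one)
  finally show "(\<Sum>j\<in>{\<one>, c}. u (inv j) * Y.f * u j) = w 1" by (simp only: Y.f_complete)
next
  fix l assume l: "l \<in> FF"
  let ?t = "Y.A * l + (Y.A * l) ^ C ^ s"
  have tF: "?t \<in> FF" by (intro add_L FF_power mult_L Y.AB_L l)
  have fix_t: "?t ^ (C ^ i) = ?t" if g: "g \<in> E2" "acts g i" for g i
    using g(1)
  proof (cases rule: coset_cases)
    case 1
    hence "g \<in> H" using H2_facts(3) by blast
    hence "ell dvd i" using acts_H_iff[OF g(2)] by blast
    thus ?thesis using fixed_field_power[OF tF] by (auto elim!: dvdE)
  next
    case (2 h)
    have "acts g (0 + s)" unfolding 2(2) using 2(1) H2_facts(3) by (intro acts_mult acts_H acts_c) auto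
    hence "[i = s] (mod ell)" using acts_unique[OF g(2)] by simp
    from FF_frobenius_cong[OF tF this] show ?thesis using Y.f_fixed[OF l] by simp
  qed
  show "\<exists>\<tau>\<in>FF. Y.f * w l * Y.f = w \<tau> * Y.f \<and> (\<forall>g\<in>E2. \<forall>i. acts g i \<longrightarrow> \<tau> ^ C ^ i = \<tau>)"
    using tF Y.f_sandwich[OF l] fix_t by blast
next
  fix g assume g: "g \<in> E2"
  show "\<exists>l\<in>FF. u g * Y.f = w l * Y.f"
    using g
  proof (cases rule: coset_cases)
    case 1
    hence "g \<in> H" using H2_facts(3) by blast
    thus ?thesis using u_H \<psi>_FF by metis
  next
    case (2 h)
    have h: "h \<in> H" using 2 H2_facts(3) by blast
    let ?l = "(1 - Y.A) / Y.B"
    have lF: "?l \<in> FF" by (intro divide_L diff_L one_L Y.AB_L)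
    have "u g * Y.f = u h * (u c * Y.f)" unfolding 2(2) mult.assoc[symmetric] using u_mult[OF _ c_E, of h] h H_E by (simp add: subset_iff)
    also have "\<dots> = w (\<psi> h * ?l) * Y.f" unfolding Y.y_f u_H[OF h] w_mult[OF \<psi>_FF[OF h] lF] by (simp add: mult.assoc)
    finally show ?thesis using mult_L[OF \<psi>_FF[OF h] lF] by blast
  qed
next
  fix Z assume Z: "\<forall>g\<in>E2. Z * u g = u g * Z" "\<forall>c. Z * w (to_ac c) = w (to_ac c) * Z"
  let ?a = "a2 [^] (2 ^ (n - 2) :: nat)"
  have aH: "a2 [^] (j :: nat) \<in> H2" for j
    by (induction j) (simp_all add: subgroup.one_closed[OF H2_facts(1)] subgroup.m_closed[OF H2_facts(1)] a2)
  have za: "Z * u ?a = u ?a * Z" and zc: "Z * u c = u c * Z" using Z(1) aH H2_E2 c by blast+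
  have zw: "Z * w (to_ac e) = w (to_ac e) * Z" for e using Z(2) by blast
  have p: "Z * (X1 * X2) = X1 * X2 * Z" if "Z * X1 = X1 * Z" "Z * X2 = X2 * Z" for X1 X2
    using that by (metis mult.assoc)
  show "Z * Y.f = Y.f * Z" unfolding nonsplit_expand distrib_left distrib_right
    by (intro arg_cong2[where f = plus] zw p za zc)
qed

text \<open>Since \<open>b\<close> lies in \<open>K\<close>, averaging over its powers acts as the
  identity on the corner, and the second factor expands to the quaternion idempotent.\<close>

lemma nonsplit_average:
  assumes b: "b \<in> K"
  shows "conv (average (generate G {b}) \<star> scale (1 / 2) (\<one>\<^bsub>group_algebra G\<^esub> \<oplus>\<^bsub>group_algebra G\<^esub>
      scale x (single (a2 [^] (2 ^ (n - 2) :: nat))) \<oplus>\<^bsub>group_algebra G\<^esub>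
      scale y (single (a2 [^] (2 ^ (n - 2) :: nat) \<otimes> c)))) * w 1 = Y.f"
proof -
  let ?a = "a2 [^] (2 ^ (n - 2) :: nat)" and ?V = "generate G {b}"
  have V: "subgroup ?V G" using b K_carrier by (intro generate_is_subgroup) blast
  have VK: "?V \<subseteq> K" by (rule generate_subgroup_incl[OF _ sub_K]) (use b in blast)
  have "(\<Sum>v\<in>?V. \<psi> v) = (\<Sum>v\<in>?V. 1)" using VK K_H \<psi>_one_iff by (intro sum.cong) auto
  hence sV: "(\<Sum>v\<in>?V. \<psi> v) = to_ac (of_nat (card ?V))" by simp
  have "to_ac (inverse (of_nat (card ?V))) * (\<Sum>v\<in>?V. \<psi> v) = (to_ac (inverse (of_nat (card ?V)) * of_nat (card ?V)) :: 'f alg_closure)"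
    unfolding sV by (rule to_ac_mult[symmetric])
  also have "inverse (of_nat (card ?V)) * of_nat (card ?V) = (1 :: 'f)" using card_nonzero[OF V] by simp
  finally have aV: "conv (average ?V) * w 1 = w 1"
    using w_average(2)[OF V] VK K_H by (simp add: subset_trans[of ?V K H])
  have aH: "?a \<in> H" by (rule HK.A_pow[OF a2_H])
  have aE: "?a \<in> E" and ac: "?a \<in> carrier G" using aH H_E H_mem by auto
  have sc: "scalar e * w 1 = w (to_ac e)" for e using scalar_w[OF one_FF] by simp
  have cl: "scale x (single ?a) \<in> carrier (group_algebra G)" "scale y (single (?a \<otimes> c)) \<in> carrier (group_algebra G)"
    using ac c_carrier by (auto intro!: scale_closed single_closed)
  let ?t = "\<one>\<^bsub>group_algebra G\<^esub> \<oplus>\<^bsub>group_algebra G\<^esub> scale x (single ?a) \<oplus>\<^bsub>group_algebra G\<^esub> scale y (single (?a \<otimes> c))"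
  have t: "?t = single \<one> + scale x (single ?a) + scale y (single (?a \<otimes> c))"
    by (simp add: group_algebra_simps(4) one_single)
  have tc: "?t \<in> carrier (group_algebra G)"
    unfolding t using one_closed cl by (auto simp: group_algebra_simps(1) single_def)
  have ct: "conv ?t = grp \<one> + scalar x * grp ?a + scalar y * grp (?a \<otimes> c)"
    unfolding t conv_add scalar_left[OF single_closed[OF ac], symmetric, folded grp_def]
      scalar_left[OF single_closed[OF m_closed[OF ac c_carrier]], symmetric, folded grp_def] grp_def by (rule HOL.refl)
  have "conv (scale (1 / 2) ?t) * w 1 = scalar (1 / 2) * ((grp \<one> + scalar x * grp ?a + scalar y * grp (?a \<otimes> c)) * w 1)"
    unfolding scalar_left[OF tc, of "1 / 2", symmetric] mult.assoc ct ..
  also have "(grp \<one> + scalar x * grp ?a + scalar y * grp (?a \<otimes> c)) * w 1 = u \<one> + scalar x * u ?a + scalar y * u (?a \<otimes> c)"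
    by (simp add: u_def distrib_right mult.assoc)
  also have "\<dots> = w 1 + scalar x * (w 1 * u ?a) + scalar y * (w 1 * (u ?a * u c))"
  proof -
    have "w 1 * (u ?a * u c) = u (?a \<otimes> c)" using u_mult[OF aE c_E] u_one(2)[OF E_closed(2)[OF aE c_E]] by simp
    thus ?thesis using u_one(2)[OF aE] by (simp add: u_unit)
  qed
  also have "\<dots> = w (to_ac 1) + w (to_ac x) * u ?a + w (to_ac y) * (u ?a * u c)"
    by (simp only: mult.assoc[symmetric] sc) simp
  also have "scalar (1 / 2) * \<dots> = Y.f"
  proof -
    have h: "scalar (1 / 2) * w (to_ac e) = w (to_ac (e / 2))" for e
      using scalar_w[OF fixed_field_closed(7), of "1 / 2" e] by simp
    have h': "scalar (1 / 2) * (w (to_ac e) * X1) = w (to_ac (e / 2)) * X1" for e X1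
      unfolding mult.assoc[symmetric] h ..
    show ?thesis unfolding nonsplit_expand distrib_left h h' ..
  qed
  finally have f: "conv (scale (1 / 2) ?t) * w 1 = Y.f" .
  have "conv (average ?V \<star> scale (1 / 2) ?t) * w 1 = conv (average ?V) * Y.f" unfolding conv_mult mult.assoc f ..
  also have "\<dots> = conv (average ?V) * w 1 * Y.f" unfolding mult.assoc Y.f_one(1) ..
  finally show ?thesis unfolding aV Y.f_one(1) .
qed

lemma unit_system_nonsplit_average:
  assumes "b \<in> K"
  shows "unit_system E2 {\<one>, c} (\<lambda>x. x) (conv (average (generate G {b}) \<star> scale (1 / 2) (\<one>\<^bsub>group_algebra G\<^esub> \<oplus>\<^bsub>group_algebra G\<^esub>
      scale x (single (a2 [^] (2 ^ (n - 2) :: nat))) \<oplus>\<^bsub>group_algebra G\<^esub>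
      scale y (single (a2 [^] (2 ^ (n - 2) :: nat) \<otimes> c)))) * w 1)"
  unfolding nonsplit_average[OF assms] by (rule unit_system_nonsplit)

end

end

section \<open>Reading the presentation in the absence of a complement\<close>

lemma (in group) eval_word_wconj:
  assumes "set gs \<subseteq> carrier G" "i < length gs" "j < length gs"
  shows "eval_word G gs (wconj (gen i) (gen j)) = inv (gs ! j) \<otimes> gs ! i \<otimes> gs ! j"
proof -
  have "gs ! i \<in> carrier G" "gs ! j \<in> carrier G" using assms by auto
  thus ?thesis by (simp add: wconj_def winv_def gen_def eval_word_def eval_letter_def m_assoc)
qed

context hall_parts
begin

text \<open>For smaller \<open>n\<close> the value \<open>\<psi> a2\<close> is 1 or -1 and hence
  fixed by Frobenius. Faithfulness gives \<open>E2 = H2\<close>, and then the trivial subgroup is a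
  complement.\<close>

lemma nonsplit_exponent:
  assumes nc: "\<not> (\<exists>B. is_complement (quot G E2 K) (carrier (quot G H2 K)) B)"
  shows "n \<ge> 2"
proof (rule ccontr)
  assume "\<not> n \<ge> 2"
  hence "n = 0 \<or> n = 1" by auto
  hence "(2::nat) ^ n dvd 2" by auto
  hence "\<psi> a2 * \<psi> a2 = 1" using \<psi>_a2[of 2] by (simp add: power2_eq_square)
  hence pm: "\<psi> a2 = 1 \<or> \<psi> a2 = - 1" using square_eq_1_iff by blast
  interpret SK: subquotient G E2 K by (rule E2_subquotient)
  interpret Q: group SK.Q by (rule SK.group_quot)
  have "g \<in> H2" if g: "g \<in> E2" for g
  proof -
    obtain i where "acts g i" using g E2_facts(3) mem_E by blast
    from acts_\<psi>[OF this a2_H] have "\<psi> (g \<otimes> a2 \<otimes> inv g) = \<psi> a2"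
      using pm frobenius_uminus[of 1 i] by auto
    thus ?thesis by (rule faithful_2[OF g])
  qed
  hence "H2 = E2" using H2_E2 by blast
  moreover have "is_complement SK.Q (carrier SK.Q) {\<one>\<^bsub>SK.Q\<^esub>}"
    unfolding is_complement_def using Q.subgroup_self Q.triv_subgroup by (auto simp: set_mult_def)
  ultimately show False using nc by blast
qed

text \<open>Let a generator of \<open>E2\<close> modulo \<open>H2\<close> act as the
  \<open>R\<close>-th power. Because \<open>c\<close> inverts \<open>a2\<close>, an odd power of
  \<open>R\<close> is -1 modulo \<open>2 ^ n\<close>, which forces \<open>R\<close> itself to be -1,
  so \<open>E2\<close> acts through inversion alone. Since \<open>r\<close> is 1 modulo 4,
  \<open>b\<close> cannot invert; it acts trivially, lies in \<open>H2\<close>, and is a power of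
  \<open>a2\<close> modulo \<open>K\<close>. By the exponent sum this is possible only for
  \<open>k = 0\<close>.\<close>

lemma two_part_nonsplit:
  fixes k :: nat
  assumes nc: "\<not> (\<exists>B. is_complement (quot G E2 K) (carrier (quot G H2 K)) B)"
    and b: "b \<in> E2" and c: "c \<in> E2" and r: "[r = 1] (mod 4)"
    and pres: "has_presentation (quot G E2 K) [K #> a2, K #> b, K #> c] (relations_nonsplit n k r)"
  shows "nonsplit_part G q H K m C \<chi> Cl E2 Eo H2 Ho a2 ao n c" and "k = 0" and "b \<in> K"
proof -
  interpret SK: subquotient G E2 K by (rule E2_subquotient)
  interpret Q: group SK.Q by (rule SK.group_quot)
  let ?gs = "[K #> a2, K #> b, K #> c]" and ?z = "\<psi> a2"
  have gs: "set ?gs \<subseteq> carrier SK.Q" using pres by (simp add: has_presentation_def)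
  have n2: "n \<ge> 2" by (rule nonsplit_exponent[OF nc])
  have n4: "4 dvd (2::nat) ^ n" using le_imp_power_dvd[OF n2, of "2::nat"] by simp
  have z0: "?z \<noteq> 0" by (rule \<psi>_nonzero[OF a2_H])
  have a2E: "a2 \<in> E2" using a2 H2_E2 by blast
  have cc: "a2 \<in> carrier G" "b \<in> carrier G" "c \<in> carrier G" using SK.A_mem a2E b c by auto
  have ia: "inv b \<in> E2" "inv c \<in> E2" using SK.A_closed(3) b c by auto
  have rel: "eval_word SK.Q ?gs v = eval_word SK.Q ?gs v'"
    if "(v, v') \<in> relations_nonsplit n k r" "fst ` set v \<subseteq> {0, 1, 2}" "fst ` set v' \<subseteq> {0, 1, 2}" for v v'
  proof -
    have "{..<length ?gs} = {0, 1, 2}" by auto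
    thus ?thesis using Q.presentation_relation[OF pres that(1)] that(2,3) by simp
  qed
  have lw: "fst ` set (wpow (Defs.gen i) j) \<subseteq> {0, 1, 2}" if "i \<in> {0, 1, 2}" for i j
    by (rule subset_trans[OF letters_wpow]) (use that in simp)
  have lc: "fst ` set (wconj (Defs.gen i) (Defs.gen j)) \<subseteq> {0, 1, 2}" if "i \<in> {0, 1, 2}" "j \<in> {0, 1, 2}" for i j
    using that by (simp add: wconj_def Defs.gen_def winv_def)
  have "eval_word SK.Q ?gs (wpow wb (2 ^ k)) = eval_word SK.Q ?gs []"
    by (rule rel) (use lw in \<open>auto simp: relations_nonsplit_def\<close>)
  hence bk: "(K #> b) [^]\<^bsub>SK.Q\<^esub> (2 ^ k :: nat) = \<one>\<^bsub>SK.Q\<^esub>"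
    using Q.eval_word_wpow[OF gs, of 1 "2 ^ k"] by (simp add: eval_word_def nat_power_eq)
  have "eval_word SK.Q ?gs (wpow wc 2) = eval_word SK.Q ?gs (wpow wa (2 ^ (n - 1)))"
    by (rule rel) (use lw in \<open>auto simp: relations_nonsplit_def\<close>)
  hence "(K #> c) [^]\<^bsub>SK.Q\<^esub> (2::nat) = (K #> a2) [^]\<^bsub>SK.Q\<^esub> (2 ^ (n - 1) :: nat)"
    using Q.eval_word_wpow[OF gs, of 2 2] Q.eval_word_wpow[OF gs, of 0 "2 ^ (n - 1)"] by (simp add: nat_power_eq)
  moreover have "c [^] (2::nat) = c \<otimes> c" using cc by (simp add: numeral_2_eq_2)
  ultimately have c_square: "K #> (c \<otimes> c) = K #> (a2 [^] (2 ^ (n - 1) :: nat))"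
    unfolding SK.pow_quot[OF c] SK.pow_quot[OF a2E] by simp
  have conj: "(inv\<^bsub>SK.Q\<^esub> (K #> g)) \<otimes>\<^bsub>SK.Q\<^esub> (K #> a2) \<otimes>\<^bsub>SK.Q\<^esub> (K #> g) = K #> (inv g \<otimes> a2 \<otimes> g)" if "g \<in> E2" for g
    using that a2E SK.A_closed by (simp add: SK.inv_quot SK.mult_quot)
  have pw: "(K #> a2) [^]\<^bsub>SK.Q\<^esub> j = K #> (a2 [^] j)"
    "(inv\<^bsub>SK.Q\<^esub> (K #> a2)) [^]\<^bsub>SK.Q\<^esub> j = K #> (inv a2 [^] j)" for j :: nat
    using SK.pow_quot[OF a2E] SK.pow_quot[OF SK.A_closed(3)[OF a2E]] by (simp_all add: SK.inv_quot[OF a2E])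
  have \<psi>p: "\<psi> (a2 [^] j) = ?z ^ j" "\<psi> (inv a2 [^] j) = inverse ?z ^ j" for j :: nat
    using \<psi>_pow[OF a2_H] \<psi>_pow[OF H_inv[OF a2_H]] \<psi>_inv[OF a2_H] by simp_all
  have "eval_word SK.Q ?gs (wconj wa wc) = eval_word SK.Q ?gs (wpow wa (- 1))"
    by (rule rel) (use lw lc in \<open>auto simp: relations_nonsplit_def\<close>)
  hence "K #> (inv c \<otimes> a2 \<otimes> c) = K #> (inv a2 [^] (1::nat))"
    unfolding pw[symmetric] conj[OF c, symmetric]
    using Q.eval_word_wconj[OF gs, of 0 2] Q.eval_word_wpow[OF gs, of 0 "- 1"] by simp
  hence inverts: "\<psi> (inv c \<otimes> a2 \<otimes> c) = inverse ?z" using \<psi>p(2)[of 1] unfolding \<psi>_def by simp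
  have i01: "0 < length ?gs" "1 < length ?gs" and nth: "?gs ! 0 = K #> a2" "?gs ! 1 = K #> b" by simp_all
  have "eval_word SK.Q ?gs (wconj wa wb) = eval_word SK.Q ?gs (wpow wa r)"
    by (rule rel) (use lw lc in \<open>auto simp: relations_nonsplit_def\<close>)
  hence "K #> (inv b \<otimes> a2 \<otimes> b) = (if 0 \<le> r then K #> (a2 [^] nat r) else K #> (inv a2 [^] nat (- r)))"
    unfolding Q.eval_word_wconj[OF gs i01] Q.eval_word_wpow[OF gs i01(1)] nth conj[OF b] pw .
  hence b_r: "\<psi> (inv b \<otimes> a2 \<otimes> b) = (if 0 \<le> r then ?z ^ nat r else inverse ?z ^ nat (- r))"
    unfolding \<psi>p[symmetric] unfolding \<psi>_def by (cases "0 \<le> r") (simp_all only: if_True if_False)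
  obtain v s where v: "acts v s" "\<And>g. g \<in> E2 \<Longrightarrow> \<exists>h\<in>E2 \<inter> H. \<exists>j<ell div s. g = h \<otimes> v [^] (j::nat)"
    by (rule cyclic_mod_H[OF E2_facts(1,3)]) blast
  define R where "R = C ^ s"
  have act: "\<exists>j. acts g (j * s)" if g: "g \<in> E2" for g
  proof -
    obtain h and j :: nat where h: "h \<in> H" "g = h \<otimes> v [^] j" using v(2)[OF g] by blast
    have "acts g (0 + j * s)" unfolding h(2) by (intro acts_mult acts_H acts_pow v(1) h(1))
    thus ?thesis by auto
  qed
  have RC: "C ^ (j * s) = R ^ j" for j by (simp add: R_def power_mult[symmetric] mult.commute)
  obtain jc where jc: "acts (inv c) (jc * s)" using act[OF ia(2)] by blast
  have "?z ^ (R ^ jc) = inverse ?z" using acts_\<psi>[OF jc a2_H] inverts cc by (simp add: RC)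
  hence "?z ^ (R ^ jc + 1) = 1" using z0 by simp
  hence d: "2 ^ n dvd R ^ jc + 1" using \<psi>_a2 by blast
  hence d4: "4 dvd R ^ jc + 1" using n4 dvd_trans by blast
  have oddR: "odd R"
  proof
    assume "even R"
    hence "R ^ jc = 1 \<or> even (R ^ jc)" by (cases jc) auto
    thus False using d4 by presburger
  qed
  have "odd jc"
  proof
    assume "even jc"
    then obtain i where i: "jc = 2 * i" by auto
    obtain t where "R ^ i = 2 * t + 1" using oddR by (metis even_power oddE)
    hence "R ^ jc = 4 * (t * t + t) + 1" by (simp add: i mult.commute[of 2] power_mult power2_eq_square algebra_simps)
    thus False using d4 by presburger
  qed
  hence "2 ^ n dvd R + 1" by (rule dvd_odd_power_plus_one[OF oddR _ d])
  hence "?z ^ (R + 1) = 1" using \<psi>_a2 by blast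
  hence "?z ^ R * ?z = 1" by (simp add: mult.commute)
  hence zR: "?z ^ R = inverse ?z" using z0 by (metis inverse_unique mult.commute)
  have zRj: "?z ^ (R ^ j) = (if even j then ?z else inverse ?z)" for j
  proof (induction j)
    case (Suc j)
    have "?z ^ (R ^ Suc j) = (?z ^ R) ^ (R ^ j)" by (simp add: power_mult)
    also have "\<dots> = inverse (?z ^ (R ^ j))" unfolding zR by (rule power_inverse)
    finally show ?case using Suc by simp
  qed simp
  obtain jb where jb: "acts (inv b) (jb * s)" using act[OF ia(1)] by blast
  have b_j: "\<psi> (inv b \<otimes> a2 \<otimes> b) = ?z ^ (R ^ jb)" using acts_\<psi>[OF jb a2_H] cc by (simp add: RC)
  have "even jb"
  proof (rule ccontr)
    assume "odd jb"
    \<comment> \<open>Inversion would make \<open>r\<close> congruent to -1 modulo 4; the two signs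
      of \<open>r\<close> are separated because the relation is evaluated with natural
      exponents.\<close>
    hence e: "inverse ?z = (if 0 \<le> r then ?z ^ nat r else inverse ?z ^ nat (- r))" using b_r b_j zRj by simp
    have r1: "r mod 4 = 1" using r by (simp add: cong_def)
    show False
    proof (cases "0 \<le> r")
      case True
      hence "?z ^ (nat r + 1) = 1" using e z0 by (metis left_inverse power_Suc Suc_eq_plus1 mult.commute)
      hence "4 dvd nat r + 1" using \<psi>_a2 n4 dvd_trans by blast
      moreover obtain t where t: "r = int t" using True nonneg_int_cases by blast
      ultimately have "int 4 dvd int (t + 1)" using int_dvd_int_iff by fastforce
      hence "4 dvd 1 + int t" by simp
      thus False using r1 unfolding t by presburger
    next
      case False
      obtain N' where N': "- r = 1 + int N'" using False zero_less_imp_eq_int[of "- r"] by (metis Suc_diff_1 neg_0_less_iff_less not_le of_nat_Suc add.commute)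
      hence "nat (- r) = Suc N'" by simp
      hence "inverse ?z = inverse ?z ^ Suc N'" using e False by simp
      hence "?z ^ N' = 1" using z0 by (simp add: power_inverse)
      hence "4 dvd N'" using \<psi>_a2 n4 dvd_trans by blast
      hence "4 dvd int N'" by (metis int_dvd_int_iff of_nat_numeral)
      thus False using r1 N' by presburger
    qed
  qed
  hence "\<psi> (inv b \<otimes> a2 \<otimes> inv (inv b)) = ?z" using b_j zRj cc by simp
  hence "inv b \<in> H2" by (rule faithful_2[OF ia(1)])
  hence bH2: "b \<in> H2" using subgroup.m_inv_closed[OF H2_facts(1)] cc by fastforce
  hence bH: "b \<in> H" using H2_facts(3) by blast
  obtain i :: nat where "b \<otimes> inv (a2 [^] i) \<in> K" using power_of_generator[OF a2_H gen2 bH2 bH] by blast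
  hence "K #> b = K #> (a2 [^] i)" using SK.coset_eq_iff[of b "a2 [^] i"] cc by simp
  hence "(?gs ! 1) [^]\<^bsub>SK.Q\<^esub> (1::nat) = (?gs ! 0) [^]\<^bsub>SK.Q\<^esub> i" using gs by (simp add: pw)
  from Q.presentation_second_generator[OF pres _ relations_exponent_sum(2) this] have "2 ^ k dvd (1::nat)" by simp
  thus k0: "k = 0" by simp
  have "K #> b = K" using bk SK.pow_quot[OF b, of 1] cc unfolding k0 by (simp add: SK.one_quot)
  thus "b \<in> K" using SK.coset_one_iff[OF cc(2)] by blast
  have cover: "g \<in> H2 \<or> g \<otimes> inv c \<in> H2" if g: "g \<in> E2" for g
  proof -
    obtain j where j: "acts g (j * s)" using act[OF g] by blast
    have gc: "g \<in> carrier G" using SK.A_mem[OF g] .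
    show ?thesis
    proof (cases "even j")
      case True
      hence "\<psi> (g \<otimes> a2 \<otimes> inv g) = ?z" using acts_\<psi>[OF j a2_H] zRj by (simp add: RC)
      thus ?thesis using faithful_2[OF g] by blast
    next
      case False
      \<comment> \<open>Both factors act by inversion, so their product acts trivially.\<close>
      have "acts (g \<otimes> inv c) ((j + jc) * s)" using acts_mult[OF j jc] by (simp add: distrib_right)
      hence "\<psi> (g \<otimes> inv c \<otimes> a2 \<otimes> inv (g \<otimes> inv c)) = ?z"
        using acts_\<psi>[OF _ a2_H] zRj[of "j + jc"] False \<open>odd jc\<close> by (simp add: RC)
      thus ?thesis using faithful_2[OF SK.A_closed(2)[OF g ia(2)]] by blast
    qed
  qed
  show "nonsplit_part G q H K m C \<chi> Cl E2 Eo H2 Ho a2 ao n c"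
    by (intro nonsplit_part.intro hall_parts_axioms nonsplit_part_axioms.intro c n2 cover inverts c_square)
qed

lemma unit_system_two_part:
  assumes "two_part G K E2 H2 a2 n T2 (\<beta>2 :: 'a \<Rightarrow> 'f)"
  shows "unit_system E2 T2 (\<lambda>x. x) (conv \<beta>2 * w 1)"
  using assms
proof cases
  case (cyclic_central M2 b k r)
  show ?thesis unfolding cyclic_central(1,2)
    using two_part_complemented(1)[OF cyclic_central(3-6) cyclic_central(8,7,9)] .
next
  case (cyclic_noncentral M2 b k r d)
  show ?thesis unfolding cyclic_noncentral(1,2) \<open>d = index G E2 H2\<close>
    using two_part_complemented(2)[OF cyclic_noncentral(3-6) cyclic_noncentral(8,7,9)] .
next
  case (noncyclic M2 b c r k d)
  thus ?thesis using complement_cyclic by blast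
next
  case (no_complement b c r k x y)
  note N = two_part_nonsplit[OF no_complement(3-7)]
  interpret P: nonsplit_part G q f_type H K m C \<chi> Cl E2 Eo H2 Ho a2 ao n c by (rule N(1))
  have "{a2 [^] i | i::nat. i < 2 ^ k} \<union> {c \<otimes> a2 [^] i | i::nat. i < 2 ^ k} = {\<one>, c}"
    using P.c_carrier by (auto simp: N(2))
  thus ?thesis unfolding no_complement(1,2) using P.unit_system_nonsplit_average[OF no_complement(8,9) N(3)] by simp
qed

end

section \<open>Assembling the two parts and the transversal of the stabilizer\<close>

section \<open>Matrix units\<close>

context shoda_class
begin

text \<open>A nonzero difference of scalars would be invertible and annihilate
  \<open>B\<close>.\<close>

lemma w_left_cancel:
  assumes B: "w 1 * B = B" "B \<noteq> 0" and l: "l \<in> FF" "\<mu> \<in> FF" and eq: "w l * B = w \<mu> * B"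
  shows "l = \<mu>"
proof (rule ccontr)
  assume "l \<noteq> \<mu>"
  have d: "l - \<mu> \<in> FF" "inverse (l - \<mu>) \<in> FF" using l by (simp_all add: diff_L inverse_L)
  have "w l = w (l - \<mu>) + w \<mu>" using w_add[OF d(1) l(2)] by simp
  hence "w (l - \<mu>) * B = 0" using eq by (simp add: distrib_right)
  hence "w (inverse (l - \<mu>)) * w (l - \<mu>) * B = 0" by (simp add: mult.assoc)
  also have "w (inverse (l - \<mu>)) * w (l - \<mu>) = w 1" using w_mult[OF d(2,1)] \<open>l \<noteq> \<mu>\<close> by simp
  finally show False using B by simp
qed

lemma unit_systemD:
  assumes "unit_system S J t B"
  shows "finite J" "t ` J \<subseteq> S" "B * w 1 = B" "w 1 * B = B"
    "i \<in> J \<Longrightarrow> j \<in> J \<Longrightarrow> B * (u (t i) * u (inv (t j))) * B = (if i = j then B else 0)"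
    "(\<Sum>j\<in>J. u (inv (t j)) * B * u (t j)) = w 1"
    "l \<in> FF \<Longrightarrow> \<exists>\<tau>\<in>FF. B * w l * B = w \<tau> * B \<and> (\<forall>g\<in>S. \<forall>i. acts g i \<longrightarrow> \<tau> ^ (C ^ i) = \<tau>)"
    "g \<in> S \<Longrightarrow> \<exists>l\<in>FF. u g * B = w l * B"
    "(\<And>g. g \<in> S \<Longrightarrow> Z * u g = u g * Z) \<Longrightarrow> (\<And>a. Z * w (to_ac a) = w (to_ac a) * Z) \<Longrightarrow> Z * B = B * Z"
  using assms unfolding unit_system_def by blast+

lemma unit_system_idem:
  assumes U: "unit_system S J t B" and S: "S \<subseteq> E"
  shows "B * B = B"
proof -
  have "J \<noteq> {}" using U w_one_nonzero by (auto simp: unit_system_def)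
  then obtain j where j: "j \<in> J" by blast
  have tE: "t j \<in> E" using unit_systemD(2)[OF U] S j by blast
  have "B * w 1 * B = B" using unit_systemD(5)[OF U j j] unfolding u_inv(1)[OF tE] by simp
  thus ?thesis unfolding unit_systemD(3)[OF U] .
qed

end

context hall_parts
begin

text \<open>The Hall parts commute modulo \<open>K\<close>, and the double centralizer clause
  carries this over to \<open>Bo\<close> and \<open>B2\<close>. The sandwich is evaluated in both
  orders: each order yields a scalar invariant under one part, cancellation identifies the two
  scalars, and so the result is invariant under all of \<open>E\<close>.\<close>

lemma unit_system_product:
  assumes Uo: "unit_system Eo To (\<lambda>x. x) Bo" and U2: "unit_system E2 T2 (\<lambda>x. x) B2"
  shows "unit_system E (To <#> T2) (\<lambda>x. x) (Bo * B2)"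
proof -
  let ?B = "Bo * B2"
  note Do = unit_systemD[OF Uo] and D2 = unit_systemD[OF U2]
  note EoE = Eo_facts(3) and E2E = E2_facts(3)
  have To: "To \<subseteq> Eo" "finite To" and T2: "T2 \<subseteq> E2" "finite T2" using Do(1,2) D2(1,2) by auto
  have cE: "u x * u y = u y * u x" if x: "x \<in> Eo" and y: "y \<in> E2" for x y
    using x y EoE E2E u_mult u_K_eq[OF _ _ hall_commute(2)[OF hEo hE2 x y]] E_closed(2) by (simp add: subset_iff)
  have wc: "w (to_ac a) * w (to_ac b) = w (to_ac b) * w (to_ac a)" for a b
    by (simp add: w_mult[OF fixed_field_closed(7) fixed_field_closed(7), symmetric] mult.commute)
  have ub: "u g * w (to_ac a) = w (to_ac a) * u g" if "g \<in> E" for g a by (rule u_base[OF that])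
  have c1: "u g * Bo = Bo * u g" if "g \<in> E2" for g
    by (rule Do(9)) (use cE[OF _ that] ub that E2E in auto)
  have c2: "u g * B2 = B2 * u g" if "g \<in> Eo" for g
    by (rule D2(9)) (use cE[OF that] ub that EoE in auto)
  have c3: "w (to_ac a) * Bo = Bo * w (to_ac a)" for a
    by (rule Do(9)) (use ub wc EoE in auto)
  have c4: "Bo * B2 = B2 * Bo" by (rule D2(9)) (use c1 c3 in auto)
  have io: "inv x \<in> Eo" if "x \<in> Eo" for x by (rule subgroup.m_inv_closed[OF Eo_facts(1) that])
  have i2: "inv x \<in> E2" if "x \<in> E2" for x by (rule subgroup.m_inv_closed[OF E2_facts(1) that])
  note Eo_mem = subsetD[OF To(1)] and E2_mem = subsetD[OF T2(1)]
  have k1: "y \<in> T2 \<Longrightarrow> Bo * u y = u y * Bo" "y \<in> T2 \<Longrightarrow> Bo * u (inv y) = u (inv y) * Bo" for y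
    using c1[OF E2_mem, of y] c1[OF i2[OF E2_mem], of y] by simp_all
  have k2: "x \<in> To \<Longrightarrow> B2 * u x = u x * B2" "x \<in> To \<Longrightarrow> B2 * u (inv x) = u (inv x) * B2" for x
    using c2[OF Eo_mem, of x] c2[OF io[OF Eo_mem], of x] by simp_all
  have k3: "x \<in> To \<Longrightarrow> y \<in> T2 \<Longrightarrow> u (inv x) * u y = u y * u (inv x)"
    "x \<in> To \<Longrightarrow> y \<in> T2 \<Longrightarrow> u (inv x) * u (inv y) = u (inv y) * u (inv x)" for x y
    by (rule cE[OF io[OF Eo_mem] E2_mem], assumption+) (rule cE[OF io[OF Eo_mem] i2[OF E2_mem]], assumption+)
  note M = product_matrix_units[where \<epsilon> = "w 1" and I = To and J = T2 and s = u and t = u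
      and s' = "\<lambda>x. u (inv x)" and t' = "\<lambda>x. u (inv x)",
      OF Do(5) D2(5) Do(6) D2(6) c4 D2(4) k1 k2 k3]
  have P: "?B * ((u x * u y) * (u (inv y') * u (inv x'))) * ?B = (if x = x' \<and> y = y' then ?B else 0)"
    if "x \<in> To" "x' \<in> To" "y \<in> T2" "y' \<in> T2" for x y x' y'
    using that by - (rule M(1), assumption+)
  have Q: "(\<Sum>(x, y)\<in>To \<times> T2. (u (inv y) * u (inv x)) * ?B * (u x * u y)) = w 1"
    by (rule M(2)) assumption+
  have B0: "?B \<noteq> 0" using Q w_one_nonzero by auto
  have B1: "?B * w 1 = ?B" "w 1 * ?B = ?B" by (simp add: mult.assoc D2(3)) (simp add: mult.assoc[symmetric] Do(4))
  have xyE: "x \<in> E" "y \<in> E" "x \<otimes> y \<in> E" if "x \<in> To" "y \<in> T2" for x y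
    using that To T2 EoE E2E by (auto intro!: E_closed(2))
  have uxy: "u x * u y = u (x \<otimes> y)" "u (inv y) * u (inv x) = u (inv (x \<otimes> y))" if "x \<in> To" "y \<in> T2" for x y
    using xyE[OF that] u_mult E_closed(3) E_mem by (simp_all add: inv_mult_group)
  have inj: "inj_on (\<lambda>(x, y). x \<otimes> y) (To \<times> T2)"
  proof (rule inj_onI, clarify)
    fix x y x' y' assume m: "x \<in> To" "y \<in> T2" "x' \<in> To" "y' \<in> T2" and eq: "x \<otimes> y = x' \<otimes> y'"
    have "(u x * u y) * (u (inv y') * u (inv x')) = w 1"
      unfolding uxy[OF m(1,2)] uxy[OF m(3,4)] eq using u_inv(1) xyE(3)[OF m(3,4)] by simp
    hence "?B * w 1 * ?B = (if x = x' \<and> y = y' then ?B else 0)" using P[OF m(1,3,2,4)] by simp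
    moreover have "x = x' \<and> y = y' \<Longrightarrow> x = x'" by simp
    moreover obtain j where "j \<in> To \<times> T2" using m by blast
    hence "?B * w 1 * ?B = ?B" using P[OF m(1,1,2,2)] uxy[OF m(1,2)] u_inv(1)[OF xyE(3)[OF m(1,2)]] by simp
    ultimately show "x = x' \<and> y = y'" using B0 by argo
  qed
  have S: "To <#> T2 = (\<lambda>(x, y). x \<otimes> y) ` (To \<times> T2)" by (auto simp: set_mult_def)
  show ?thesis unfolding unit_system_def
  proof (intro conjI ballI allI impI)
    show "finite (To <#> T2)" unfolding S using To T2 by simp
    show "(\<lambda>x. x) ` (To <#> T2) \<subseteq> E" unfolding S using xyE by auto
    show "?B * w 1 = ?B" "w 1 * ?B = ?B" by (rule B1)+
    fix i j assume "i \<in> To <#> T2" "j \<in> To <#> T2"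
    then obtain x y x' y' where m: "x \<in> To" "y \<in> T2" "i = x \<otimes> y" "x' \<in> To" "y' \<in> T2" "j = x' \<otimes> y'"
      by (auto simp: S)
    have "i = j \<longleftrightarrow> x = x' \<and> y = y'" unfolding m(3,6)
      using inj_onD[OF inj, of "(x, y)" "(x', y')"] m by auto
    thus "?B * (u i * u (inv j)) * ?B = (if i = j then ?B else 0)"
      using P[OF m(1,4,2,5)] unfolding uxy[OF m(1,2)] uxy[OF m(4,5)] m(3)[symmetric] m(6)[symmetric] by simp
  next
    have "(\<Sum>j\<in>To <#> T2. u (inv j) * ?B * u j) = (\<Sum>(x, y)\<in>To \<times> T2. (u (inv y) * u (inv x)) * ?B * (u x * u y))"
      unfolding S sum.reindex[OF inj] by (rule sum.cong) (auto simp: uxy)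
    thus "(\<Sum>j\<in>To <#> T2. u (inv j) * ?B * u j) = w 1" unfolding Q .
  next
    fix l assume l: "l \<in> FF"
    have sand: "\<exists>\<tau>\<in>FF. X2 * X1 * w l * X1 * X2 = w \<tau> * (X1 * X2) \<and> (\<forall>g\<in>A. \<forall>i. acts g i \<longrightarrow> \<tau> ^ C ^ i = \<tau>)"
      if 1: "\<And>l. l \<in> FF \<Longrightarrow> \<exists>\<tau>\<in>FF. X1 * w l * X1 = w \<tau> * X1"
        and 2: "\<And>l. l \<in> FF \<Longrightarrow> \<exists>\<tau>\<in>FF. X2 * w l * X2 = w \<tau> * X2 \<and> (\<forall>g\<in>A. \<forall>i. acts g i \<longrightarrow> \<tau> ^ C ^ i = \<tau>)"
        and X12: "X1 * X2 = X2 * X1" for X1 X2 A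
    proof -
      obtain \<sigma> where s: "\<sigma> \<in> FF" "X1 * w l * X1 = w \<sigma> * X1" using 1[OF l] by blast
      obtain \<tau> where t: "\<tau> \<in> FF" "X2 * w \<sigma> * X2 = w \<tau> * X2" "\<forall>g\<in>A. \<forall>i. acts g i \<longrightarrow> \<tau> ^ C ^ i = \<tau>"
        using 2[OF s(1)] by blast
      have "X2 * X1 * w l * X1 * X2 = X2 * (X1 * w l * X1) * X2" by (simp add: mult.assoc)
      also have "\<dots> = X2 * w \<sigma> * (X1 * X2)" unfolding s(2) by (simp only: mult.assoc)
      also have "\<dots> = w \<tau> * (X2 * X1)" unfolding X12 by (simp add: mult.assoc[symmetric] t)
      finally show ?thesis using t X12 by auto
    qed
    have s2: "\<exists>\<tau>\<in>FF. B2 * Bo * w l * Bo * B2 = w \<tau> * (Bo * B2) \<and> (\<forall>g\<in>E2. \<forall>i. acts g i \<longrightarrow> \<tau> ^ C ^ i = \<tau>)"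
      by (rule sand[OF _ D2(7) c4]) (use Do(7) in blast)
    have so: "\<exists>\<tau>\<in>FF. Bo * B2 * w l * B2 * Bo = w \<tau> * (B2 * Bo) \<and> (\<forall>g\<in>Eo. \<forall>i. acts g i \<longrightarrow> \<tau> ^ C ^ i = \<tau>)"
      by (rule sand[OF _ Do(7) c4[symmetric]]) (use D2(7) in blast)
    have c: "?B * w l * ?B = (B2 * Bo) * w l * ?B" "?B * w l * ?B = ?B * w l * (B2 * Bo)"
      by (simp_all only: c4)
    have e: "?B * w l * ?B = B2 * Bo * w l * Bo * B2" "?B * w l * ?B = Bo * B2 * w l * B2 * Bo"
    proof -
      show "?B * w l * ?B = B2 * Bo * w l * Bo * B2" unfolding c(1) by (simp only: mult.assoc)
      show "?B * w l * ?B = Bo * B2 * w l * B2 * Bo" unfolding c(2) by (simp only: mult.assoc)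
    qed
    obtain \<tau> where t: "\<tau> \<in> FF" "B2 * Bo * w l * Bo * B2 = w \<tau> * ?B" "\<forall>g\<in>E2. \<forall>i. acts g i \<longrightarrow> \<tau> ^ C ^ i = \<tau>"
      using s2 by (elim bexE conjE) (rule that)
    obtain \<tau>' where t': "\<tau>' \<in> FF" "Bo * B2 * w l * B2 * Bo = w \<tau>' * (B2 * Bo)" "\<forall>g\<in>Eo. \<forall>i. acts g i \<longrightarrow> \<tau>' ^ C ^ i = \<tau>'"
      using so by (elim bexE conjE) (rule that)
    note t = t(1) t(2)[folded e(1)] t(3) and t' = t'(1) t'(2)[folded e(2) c4] t'(3)
    have "\<tau>' = \<tau>" by (rule w_left_cancel[OF B1(2) B0 t'(1) t(1)]) (simp add: t(2) t'(2)[symmetric])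
    hence tt: "\<forall>g\<in>Eo. \<forall>i. acts g i \<longrightarrow> \<tau> ^ C ^ i = \<tau>" using t'(3) by simp
    have "\<tau> ^ C ^ i = \<tau>" if g: "g \<in> E" "acts g i" for g i
    proof -
      obtain x y where xy: "x \<in> Eo" "y \<in> E2" "g = x \<otimes> y" using hall_cover[OF hEo hE2 g(1)] by blast
      obtain i1 i2 where i: "acts x i1" "acts y i2" using xy EoE E2E mem_E by blast
      have "[i = i1 + i2] (mod ell)" using acts_unique[OF g(2)] acts_mult[OF i] xy(3) by simp
      hence "\<tau> ^ C ^ i = (\<tau> ^ C ^ i1) ^ C ^ i2"
        using FF_frobenius_cong[OF t(1)] by (simp add: power_add power_mult)
      thus ?thesis using tt t(3) xy i by simp
    qed
    thus "\<exists>\<tau>\<in>FF. ?B * w l * ?B = w \<tau> * ?B \<and> (\<forall>g\<in>E. \<forall>i. acts g i \<longrightarrow> \<tau> ^ C ^ i = \<tau>)"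
      using t(1,2) by blast
  next
    fix g assume "g \<in> E"
    then obtain x y where xy: "x \<in> Eo" "y \<in> E2" "g = x \<otimes> y" using hall_cover[OF hEo hE2] by blast
    have xyE: "x \<in> E" "y \<in> E" using xy EoE E2E by auto
    obtain i where i: "acts x i" using xyE mem_E by blast
    obtain l where l: "l \<in> FF" "u y * B2 = w l * B2" using D2(8)[OF xy(2)] by blast
    obtain \<mu> where \<mu>: "\<mu> \<in> FF" "u x * Bo = w \<mu> * Bo" using Do(8)[OF xy(1)] by blast
    have "u g * ?B = u x * (u y * B2) * Bo" unfolding xy(3) u_mult[OF xyE, symmetric] c4 by (simp add: mult.assoc)
    also have "\<dots> = (u x * w l) * (B2 * Bo)" by (simp add: l(2) mult.assoc)
    also have "\<dots> = w (l ^ C ^ i) * ((u x * Bo) * B2)" unfolding u_w[OF i l(1)] c4[symmetric] by (simp add: mult.assoc)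
    also have "\<dots> = w (l ^ C ^ i * \<mu>) * ?B" unfolding \<mu>(2) w_mult[OF FF_power[OF l(1)] \<mu>(1)] by (simp add: mult.assoc)
    finally show "\<exists>l\<in>FF. u g * ?B = w l * ?B" using mult_L[OF FF_power[OF l(1)] \<mu>(1)] by blast
  next
    fix Z assume Z: "\<forall>g\<in>E. Z * u g = u g * Z" "\<forall>a. Z * w (to_ac a) = w (to_ac a) * Z"
    have "Z * Bo = Bo * Z" by (rule Do(9)) (use Z EoE in auto)
    moreover have "Z * B2 = B2 * Z" by (rule D2(9)) (use Z E2E in auto)
    ultimately show "Z * ?B = ?B * Z" by (metis mult.assoc)
  qed
qed

end

context shoda_class
begin

lemma index_HK: "index G H K = k"
  by (simp add: index_def k_def Coset.order_def quot_def FactGroup_def)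

lemma fixed_field_commute:
  assumes U: "unit_system E S (\<lambda>x. x) B" and l: "l \<in> FF" "\<And>g i. g \<in> E \<Longrightarrow> acts g i \<Longrightarrow> l ^ C ^ i = l"
  shows "w l * B = B * w l"
proof -
  have "w l * u g = u g * w l" if "g \<in> E" for g
    using that mem_E u_w[OF _ l(1)] l(2) by metis
  moreover have "w l * w (to_ac a) = w (to_ac a) * w l" for a
    by (simp add: w_mult[OF fixed_field_closed(7) l(1), symmetric] w_mult[OF l(1) fixed_field_closed(7), symmetric] mult.commute)
  ultimately show ?thesis by (rule unit_systemD(9)[OF U])
qed

lemma scalar_w_one: "w 1 * scalar a = w (to_ac a)" "scalar a * w 1 = w (to_ac a)"
proof -
  show 1: "scalar a * w 1 = w (to_ac a)" using scalar_w[OF one_FF] by simp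
  show "w 1 * scalar a = w (to_ac a)"
    using 1 scalar_left[OF W_closed] scalar_right[OF W_closed] by (simp add: w_def)
qed

text \<open>By linearity group elements suffice. Those outside \<open>E\<close> contribute 0 by
  orthogonality of conjugates; for \<open>g\<close> in \<open>E\<close>, \<open>u g\<close> acts on
  \<open>B\<close> as a scalar, and the sandwich clause applies.\<close>

lemma corner_span:
  assumes U: "unit_system E S (\<lambda>x. x) B" and \<alpha>: "\<alpha> \<in> carrier (group_algebra G)"
  shows "\<exists>\<tau>\<in>FF. B * conv \<alpha> * B = w \<tau> * B \<and> (\<forall>g\<in>E. \<forall>i. acts g i \<longrightarrow> \<tau> ^ C ^ i = \<tau>)"
proof -
  note U' = unit_systemD[OF U]
  let ?P = "\<lambda>\<tau> :: 'f alg_closure. \<forall>g\<in>E. \<forall>i. acts g i \<longrightarrow> \<tau> ^ C ^ i = \<tau>"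
  note B1 = U'(3,4)
  have 0: "\<exists>\<tau>\<in>FF. B * grp g * B = w \<tau> * B \<and> ?P \<tau>" if g: "g \<in> carrier G" for g
  proof (cases "g \<in> E")
    case True
    obtain l where l: "l \<in> FF" "u g * B = w l * B" using U'(8)[OF True] by blast
    have "B * grp g * B = B * (grp g * (w 1 * B))" by (simp add: B1 mult.assoc)
    also have "\<dots> = B * (u g * B)" by (simp add: u_def mult.assoc)
    also have "\<dots> = B * w l * B" by (simp add: l mult.assoc)
    finally show ?thesis using U'(7)[OF l(1)] by metis
  next
    case False
    have "B * grp g * B = B * (w 1 * grp g * w 1) * B" using B1 by (metis mult.assoc)
    hence "B * grp g * B = w 0 * B" by (simp add: orthogonal_conjugates[OF g False] w_zero)
    moreover have "?P 0" using C_gt_1 by (simp add: power_0_left)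
    ultimately show ?thesis using zero_L by blast
  qed
  have 1: "\<exists>\<tau>\<in>FF. B * (scalar a * grp g) * B = w \<tau> * B \<and> ?P \<tau>" if g: "g \<in> carrier G" for g a
  proof -
    obtain \<tau> where t: "\<tau> \<in> FF" "B * grp g * B = w \<tau> * B" "?P \<tau>" using 0[OF g] by blast
    have "w (to_ac a) * B = B * w (to_ac a)"
      by (rule fixed_field_commute[OF U fixed_field_closed(7)]) (rule frobenius_base)
    moreover have "B * scalar a = B * w (to_ac a)" using B1(1) scalar_w_one(1)[of a] by (metis mult.assoc)
    ultimately have "B * (scalar a * grp g) * B = w (to_ac a) * (B * grp g * B)" by (metis mult.assoc)
    also have "\<dots> = w (to_ac a * \<tau>) * B" unfolding t w_mult[OF fixed_field_closed(7) t(1)] by (simp add: mult.assoc)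
    finally have "B * (scalar a * grp g) * B = w (to_ac a * \<tau>) * B" .
    moreover have "?P (to_ac a * \<tau>)" using t(3) by (simp add: power_mult_distrib frobenius_base)
    ultimately show ?thesis using mult_L[OF fixed_field_closed(7) t(1)] by blast
  qed
  have "\<forall>g\<in>carrier G. \<exists>\<tau>. \<tau> \<in> FF \<and> B * (scalar (\<alpha> g) * grp g) * B = w \<tau> * B \<and> ?P \<tau>"
  proof
    fix g assume g: "g \<in> carrier G"
    show "\<exists>\<tau>. \<tau> \<in> FF \<and> B * (scalar (\<alpha> g) * grp g) * B = w \<tau> * B \<and> ?P \<tau>"
      using 1[OF g, of "\<alpha> g"] unfolding Bex_def .
  qed
  from bchoice[OF this] obtain \<tau> where
    t: "\<forall>g\<in>carrier G. \<tau> g \<in> FF \<and> B * (scalar (\<alpha> g) * grp g) * B = w (\<tau> g) * B \<and> ?P (\<tau> g)" ..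
  have tF: "\<tau> g \<in> FF" and tB: "B * (scalar (\<alpha> g) * grp g) * B = w (\<tau> g) * B"
    and tP: "x \<in> E \<Longrightarrow> acts x i \<Longrightarrow> \<tau> g ^ C ^ i = \<tau> g" if "g \<in> carrier G" for g x i
    using bspec[OF t that] by simp_all
  have "B * conv \<alpha> * B = (\<Sum>g\<in>carrier G. B * (scalar (\<alpha> g) * grp g) * B)"
    unfolding conv_expand[OF \<alpha>] by (simp add: sum_distrib_left sum_distrib_right)
  also have "\<dots> = (\<Sum>g\<in>carrier G. w (\<tau> g) * B)" by (intro sum.cong HOL.refl tB)
  also have "\<dots> = w (\<Sum>g\<in>carrier G. \<tau> g) * B" by (simp add: w_sum tF sum_distrib_right)
  finally have "B * conv \<alpha> * B = w (\<Sum>g\<in>carrier G. \<tau> g) * B" .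
  moreover have "?P (\<Sum>g\<in>carrier G. \<tau> g)" by (simp add: frobenius_sum tP)
  moreover have "(\<Sum>g\<in>carrier G. \<tau> g) \<in> FF" by (intro FF_sum tF)
  ultimately show ?thesis by blast
qed

lemma conv_sandwich: "conv (sandwich G \<beta> s t) = grp (inv s) * conv \<beta> * grp t"
  by (simp add: sandwich_def conv_mult grp_def)

lemma sandwich_closed: "sandwich G \<beta> s t \<in> carrier (group_algebra G)"
  unfolding sandwich_def by (rule convolve_closed)

text \<open>
  Conjugation by \<open>t\<close> identifies the corner of \<open>\<beta>\<close> with that of \<open>\<beta>\<^sup>t\<close>. The former consists of the
  multiples of \<open>\<beta>\<close> by elements of the field fixed by the stabilizer.
\<close>

lemma corner_iso:
  assumes U: "unit_system E S (\<lambda>x. x) (conv \<beta>)" and \<beta>: "\<beta> \<in> carrier (group_algebra G)" and t: "t \<in> carrier G"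
    and s: "s dvd ell" "acts v s" "\<And>g i. g \<in> E \<Longrightarrow> acts g i \<Longrightarrow> s dvd i"
  shows "corner (group_algebra G) (sandwich G \<beta> t t) \<simeq> (GF (C ^ s) :: 'f alg_closure ring)"
proof -
  let ?B = "conv \<beta>" and ?A = "group_algebra G :: ('a \<Rightarrow> 'f) ring"
  let ?e = "sandwich G \<beta> t t"
  have B1: "?B * w 1 = ?B" "w 1 * ?B = ?B" and BB: "?B * ?B = ?B" and B0: "?B \<noteq> 0"
    using unit_systemD(3,4)[OF U] unit_system_idem[OF U] unit_system_nonzero[OF U] by auto
  define \<phi> where "\<phi> l = sandwich G (W \<psi> l \<star> \<beta>) t t" for l
  have Fs: "carrier (GF (C ^ s) :: 'f alg_closure ring) = fixed_field s" by (simp add: GF_def fixed_field_def)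
  have sF: "l \<in> FF" if "l \<in> fixed_field s" for l using fixed_field_dvd[OF s(1)] that by blast
  have inv_fix: "l ^ C ^ i = l" if "l \<in> fixed_field s" "g \<in> E" "acts g i" for l g i
    using s(3)[OF that(2,3)] fixed_field_power[OF that(1)] by (auto elim!: dvdE)
  have comm: "w l * ?B = ?B * w l" if "l \<in> fixed_field s" for l
    using fixed_field_commute[OF U sF[OF that]] inv_fix[OF that] by blast
  have c\<phi>: "conv (\<phi> l) = grp (inv t) * (w l * ?B) * grp t" for l
    by (simp add: \<phi>_def conv_sandwich conv_mult w_def)
  have ce: "conv ?e = grp (inv t) * ?B * grp t" by (rule conv_sandwich)
  have gg: "grp t * grp (inv t) = grp \<one>" "grp (inv t) * grp t = grp \<one>" using t by (simp_all add: grp_mult)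
  have Bg: "X1 * ?B * grp \<one> = X1 * ?B" for X1 by (simp add: mult.assoc grp_one_right[OF \<beta>])
  have wg: "grp \<one> * w l = w l" for l unfolding w_def by (rule grp_one_left[OF W_closed])
  have cancel: "(grp (inv t) * (X1 * ?B) * grp t) * (grp (inv t) * (X2 * ?B) * grp t) = grp (inv t) * (X1 * ?B * X2 * ?B) * grp t" for X1 X2
  proof -
    have "(grp (inv t) * (X1 * ?B) * grp t) * (grp (inv t) * (X2 * ?B) * grp t) =
        grp (inv t) * (X1 * ?B * (grp t * grp (inv t))) * (X2 * ?B) * grp t" by (simp add: mult.assoc)
    thus ?thesis unfolding gg Bg by (simp add: mult.assoc)
  qed
  have mult: "\<phi> (l * l') = \<phi> l \<star> \<phi> l'" if l: "l \<in> fixed_field s" "l' \<in> fixed_field s" for l l'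
  proof -
    have "w l * ?B * w l' * ?B = w l * (?B * w l') * ?B" by (simp only: mult.assoc)
    also have "\<dots> = w l * w l' * (?B * ?B)" unfolding comm[OF l(2), symmetric] by (simp only: mult.assoc)
    finally have "w l * ?B * w l' * ?B = w l * w l' * (?B * ?B)" .
    hence "conv (\<phi> l \<star> \<phi> l') = conv (\<phi> (l * l'))"
      unfolding conv_mult c\<phi> cancel w_mult[OF sF[OF l(1)] sF[OF l(2)]] BB by (simp add: mult.assoc)
    thus ?thesis using conv_inject[OF convolve_closed, of "\<phi> (l * l')"] by (simp add: \<phi>_def sandwich_closed)
  qed
  have add: "\<phi> (l + l') = \<phi> l + \<phi> l'" if l: "l \<in> fixed_field s" "l' \<in> fixed_field s" for l l'
  proof -
    have cl: "\<phi> l + \<phi> l' \<in> carrier ?A"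
      using sandwich_closed[of "W \<psi> l \<star> \<beta>" t t] sandwich_closed[of "W \<psi> l' \<star> \<beta>" t t]
      by (simp add: \<phi>_def group_algebra_simps(1))
    have "conv (\<phi> (l + l')) = conv (\<phi> l + \<phi> l')"
      unfolding conv_add c\<phi> w_add[OF sF[OF l(1)] sF[OF l(2)]] by (simp add: distrib_left distrib_right)
    thus ?thesis using conv_inject[OF _ cl] by (simp add: \<phi>_def sandwich_closed)
  qed
  have one: "\<phi> 1 = ?e"
    using conv_inject[OF sandwich_closed sandwich_closed] c\<phi>[of 1] unfolding ce[symmetric] B1 \<phi>_def by blast
  have conv_corner: "conv ((?e \<star> x) \<star> ?e) = grp (inv t) * (?B * (grp t * conv x * grp (inv t)) * ?B) * grp t" for x
    unfolding conv_mult ce by (simp add: mult.assoc)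
  have inj: "inj_on \<phi> (fixed_field s)"
  proof (rule inj_onI)
    fix l l' assume l: "l \<in> fixed_field s" "l' \<in> fixed_field s" and eq: "\<phi> l = \<phi> l'"
    have x: "grp t * conv (\<phi> l) * grp (inv t) = w l * ?B" for l
    proof -
      have "grp t * conv (\<phi> l) * grp (inv t) = (grp t * grp (inv t)) * (w l * ?B * (grp t * grp (inv t)))"
        by (simp add: c\<phi> mult.assoc)
      also have "\<dots> = grp \<one> * w l * ?B" unfolding gg Bg by (simp add: mult.assoc)
      finally show ?thesis unfolding wg .
    qed
    have "w l * ?B = w l' * ?B" unfolding x[symmetric] eq ..
    thus "l = l'" by (rule w_left_cancel[OF B1(2) B0 sF[OF l(1)] sF[OF l(2)]])
  qed
  have in_corner: "\<phi> l \<in> (\<lambda>x. (?e \<star> x) \<star> ?e) ` carrier ?A" if l: "l \<in> fixed_field s" for l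
  proof (rule image_eqI)
    show cl: "\<phi> l \<in> carrier ?A" by (simp add: \<phi>_def sandwich_closed)
    have o: "1 \<in> fixed_field s" by (rule fixed_field_closed)
    have "\<phi> 1 \<star> \<phi> l = \<phi> l" "\<phi> l \<star> \<phi> 1 = \<phi> l" using mult[OF o l, symmetric] mult[OF l o, symmetric] by simp_all
    thus "\<phi> l = (?e \<star> \<phi> l) \<star> ?e" unfolding one[symmetric] by (simp only:)
  qed
  have surj: "y \<in> \<phi> ` fixed_field s" if y: "y \<in> (\<lambda>x. (?e \<star> x) \<star> ?e) ` carrier ?A" for y
  proof -
    obtain x where x: "y = (?e \<star> x) \<star> ?e" using y by blast
    have mid: "grp t * conv x * grp (inv t) = conv ((single t \<star> x) \<star> single (inv t))"
      by (simp add: conv_mult grp_def mult.assoc)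
    obtain \<tau> where \<tau>: "\<tau> \<in> FF" "?B * conv ((single t \<star> x) \<star> single (inv t)) * ?B = w \<tau> * ?B"
      "\<forall>g\<in>E. \<forall>i. acts g i \<longrightarrow> \<tau> ^ C ^ i = \<tau>"
      using corner_span[OF U convolve_closed, of "single t \<star> x" "single (inv t)"] by (elim bexE conjE) (rule that)
    have "v \<in> E" using s(2) mem_E by blast
    hence "\<tau> ^ C ^ s = \<tau>" using \<tau>(3) s(2) by blast
    hence f: "\<tau> \<in> fixed_field s" by (simp add: fixed_field_def)
    have "conv y = conv (\<phi> \<tau>)" unfolding x conv_corner mid \<tau>(2) c\<phi> ..
    moreover have "y \<in> carrier ?A" unfolding x by (rule convolve_closed)
    moreover have "\<phi> \<tau> \<in> carrier ?A" by (simp add: \<phi>_def sandwich_closed)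
    ultimately have "y = \<phi> \<tau>" using conv_inject by blast
    thus ?thesis using f by blast
  qed
  let ?F = "GF (C ^ s) :: 'f alg_closure ring" and ?C = "corner ?A ?e"
  have Cc: "carrier ?C = (\<lambda>x. (?e \<star> x) \<star> ?e) ` carrier ?A" by (simp add: corner_def)
  have ops: "a \<otimes>\<^bsub>?F\<^esub> b = a * b" "a \<oplus>\<^bsub>?F\<^esub> b = a + b" "\<one>\<^bsub>?F\<^esub> = 1" for a b by (simp_all add: GF_def)
  have ops': "a \<otimes>\<^bsub>?C\<^esub> b = a \<star> b" "a \<oplus>\<^bsub>?C\<^esub> b = a + b" "\<one>\<^bsub>?C\<^esub> = ?e" for a b
    by (simp_all add: corner_def group_algebra_simps(4))
  have "\<phi> \<in> ring_iso ?F ?C"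
  proof (rule ring_iso_memI)
    fix l l' assume l: "l \<in> carrier ?F" "l' \<in> carrier ?F"
    show "\<phi> (l \<otimes>\<^bsub>?F\<^esub> l') = \<phi> l \<otimes>\<^bsub>?C\<^esub> \<phi> l'" using l unfolding ops ops' Fs by (rule mult)
    show "\<phi> (l \<oplus>\<^bsub>?F\<^esub> l') = \<phi> l \<oplus>\<^bsub>?C\<^esub> \<phi> l'" using l unfolding ops ops' Fs by (rule add)
    show "\<phi> l \<in> carrier ?C" using l(1) unfolding Fs Cc by (rule in_corner)
  next
    show "\<phi> \<one>\<^bsub>?F\<^esub> = \<one>\<^bsub>?C\<^esub>" unfolding ops ops' by (rule one)
    show "bij_betw \<phi> (carrier ?F) (carrier ?C)"
      unfolding Fs Cc bij_betw_def
    proof (intro conjI inj equalityI subsetI)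
      fix y assume "y \<in> \<phi> ` fixed_field s"
      then obtain l where "l \<in> fixed_field s" "y = \<phi> l" by blast
      thus "y \<in> (\<lambda>x. (?e \<star> x) \<star> ?e) ` carrier ?A" using in_corner[of l] by simp
    qed (rule surj)
  qed
  hence iso: "?F \<simeq> ?C" unfolding is_ring_iso_def by blast
  \<comment> \<open>The isomorphism was built from the field to the corner; reversing it requires
    its source to be a ring.\<close>
  have "ring ?F"
  proof -
    interpret R: field "ring_of_type_algebra :: 'f alg_closure ring" by (rule field_from_type_algebra)
    have "subring (fixed_field s) (ring_of_type_algebra :: 'f alg_closure ring)"
      by (rule R.subringI) (simp_all add: fixed_field_closed)
    from R.subring_is_ring[OF this] show ?thesis by (simp add: GF_def fixed_field_def)
  qed
  from ring_iso_sym[OF this iso] show ?thesis .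
qed

lemma transversalD:
  assumes "right_transversal G E TE"
  shows "TE \<subseteq> carrier G" "finite TE" "g \<in> carrier G \<Longrightarrow> \<exists>x\<in>E. \<exists>t\<in>TE. g = x \<otimes> t"
    "t \<in> TE \<Longrightarrow> t' \<in> TE \<Longrightarrow> t \<otimes> inv t' \<in> E \<Longrightarrow> t = t'"
proof -
  have Ec: "E \<subseteq> carrier G" by (rule subgroup.subset[OF sub_E])
  show T: "TE \<subseteq> carrier G" using assms by (simp add: right_transversal_def)
  show "finite TE" using finite_subset[OF T finite_G] .
  have ex1: "\<exists>!t. t \<in> TE \<and> t \<in> E #> g" if "g \<in> carrier G" for g
    using assms rcosetsI[OF Ec that] unfolding right_transversal_def by blast
  show "\<exists>x\<in>E. \<exists>t\<in>TE. g = x \<otimes> t" if g: "g \<in> carrier G"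
  proof -
    obtain t where t: "t \<in> TE" "t \<in> E #> g" using ex1[OF g] by blast
    then obtain x where x: "x \<in> E" "t = x \<otimes> g" by (auto simp: r_coset_def)
    have "g = inv x \<otimes> t" using E_mem[OF x(1)] g by (simp add: x(2) m_assoc[symmetric])
    thus ?thesis using E_closed(3)[OF x(1)] t(1) by blast
  qed
  show "t = t'" if t: "t \<in> TE" "t' \<in> TE" "t \<otimes> inv t' \<in> E"
  proof -
    have c: "t \<in> carrier G" "t' \<in> carrier G" using t T by auto
    have "t = (t \<otimes> inv t') \<otimes> t'" using c by (simp add: m_assoc)
    hence "t \<in> E #> t'" using t(3) by (auto simp: r_coset_def)
    moreover have "t' \<in> E #> t'" by (rule rcos_self[OF c(2) sub_E])
    ultimately show ?thesis using ex1[OF c(2)] t by blast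
  qed
qed

lemma group_algebra_monoid: "abelian_monoid (group_algebra G :: ('a \<Rightarrow> 'f) ring)"
  by (rule abelian_group.axioms(1)[OF ring.is_abelian_group[OF group_algebra_ring]])

text \<open>\<open>E\<close> fixes the class idempotent, so a transversal produces all conjugates.
  Different representatives give different conjugates, because equal ones would be orthogonal to
  themselves.\<close>

lemma conv_class_e:
  assumes TE: "right_transversal G E TE" and eps: "class_eps G H K Cl = W \<psi> 1"
  shows "conv (class_e G H K Cl) = (\<Sum>t\<in>TE. grp (inv t) * w 1 * grp t)"
    and "class_e G H K Cl \<in> carrier (group_algebra G)"
proof -
  note T = transversalD[OF TE]
  let ?s = "\<lambda>g. sandwich G (W \<psi> 1) g g"
  have cs: "conv (?s g) = grp (inv g) * w 1 * grp g" for g by (simp add: conv_sandwich w_def)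
  have w1: "w 1 * grp \<one> = w 1" unfolding w_def by (rule grp_one_right[OF W_closed])
  have "?s g \<in> ?s ` TE" if g: "g \<in> carrier G" for g
  proof -
    obtain x t where x: "x \<in> E" "t \<in> TE" "g = x \<otimes> t" using T(3)[OF g] by blast
    have c: "x \<in> carrier G" "t \<in> carrier G" using x T(1) E_mem by auto
    have "conv (?s g) = grp (inv t) * (grp (inv x) * w 1 * grp x) * grp t"
      using c by (simp add: cs x(3) inv_mult_group grp_mult[symmetric] mult.assoc)
    also have "grp (inv x) * w 1 * grp x = w 1 * (grp (inv x) * grp x)"
      unfolding grp_w_one[OF E_closed(3)[OF x(1)]] by (rule mult.assoc)
    also have "\<dots> = w 1" using c by (simp add: grp_mult w1)
    finally have "conv (?s g) = conv (?s t)" by (simp add: cs)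
    hence "?s g = ?s t" using conv_inject[OF sandwich_closed sandwich_closed] by blast
    thus ?thesis using x(2) by blast
  qed
  hence img: "?s ` carrier G = ?s ` TE" using T(1) by auto
  have inj: "inj_on ?s TE"
  proof (rule inj_onI, rule ccontr)
    fix t t' assume t: "t \<in> TE" "t' \<in> TE" "?s t = ?s t'" "t \<noteq> t'"
    have c: "t \<in> carrier G" "t' \<in> carrier G" using t T(1) by auto
    have "t \<otimes> inv t' \<notin> E" using T(4) t by blast
    hence o: "w 1 * grp (t \<otimes> inv t') * w 1 = 0" using c by (intro orthogonal_conjugates) auto
    have "w 1 = w 1 * (grp t * grp (inv t)) * w 1 * (grp t * grp (inv t))"
      using c by (simp add: grp_mult w1 w_one_idem)
    also have "\<dots> = w 1 * grp t * conv (?s t) * grp (inv t)" unfolding cs by (simp add: mult.assoc)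
    also have "\<dots> = (w 1 * (grp t * grp (inv t')) * w 1) * grp t' * grp (inv t)" unfolding t(3) cs by (simp add: mult.assoc)
    also have "\<dots> = 0" using c o by (simp add: grp_mult)
    finally show False using w_one_nonzero by simp
  qed
  have e: "class_e G H K Cl = (\<Sum>\<alpha>\<in>?s ` TE. \<alpha>)"
    unfolding class_e_def eps img by (rule finsum_eq_sum) (auto intro: sandwich_closed)
  have "class_e G H K Cl = (\<Sum>t\<in>TE. ?s t)" unfolding e by (simp add: sum.reindex[OF inj])
  thus "conv (class_e G H K Cl) = (\<Sum>t\<in>TE. grp (inv t) * w 1 * grp t)" by (simp add: conv_sum cs)
  have "(\<lambda>\<alpha>. \<alpha>) \<in> ?s ` carrier G \<rightarrow> carrier (group_algebra G)" by (auto intro: sandwich_closed)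
  thus "class_e G H K Cl \<in> carrier (group_algebra G)"
    unfolding class_e_def eps by (rule abelian_monoid.finsum_closed[OF group_algebra_monoid])
qed

text \<open>If both elements lie in the same coset of \<open>E\<close>, the transversal part cancels
  and the relation of the unit system remains. Otherwise their quotient lies outside
  \<open>E\<close>, where conjugates are orthogonal.\<close>

lemma transversal_orthogonal:
  assumes U: "unit_system E S (\<lambda>x. x) B" and TE: "right_transversal G E TE"
    and t: "t \<in> S <#> TE" "t' \<in> S <#> TE"
  shows "B * grp (t \<otimes> inv t') * B = (if t = t' then B else 0)"
proof -
  note D = unit_systemD[OF U] and T = transversalD[OF TE]
  obtain x g x' g' where m: "x \<in> S" "g \<in> TE" "t = x \<otimes> g" "x' \<in> S" "g' \<in> TE" "t' = x' \<otimes> g'"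
    using t by (auto simp: set_mult_def)
  have xE: "x \<in> E" "x' \<in> E" using D(2) m by auto
  have c: "x \<in> carrier G" "x' \<in> carrier G" "g \<in> carrier G" "g' \<in> carrier G" using xE E_mem m T(1) by auto
  show ?thesis
  proof (cases "g = g'")
    case True
    have "t \<otimes> inv t' = x \<otimes> inv x'"
    proof -
      have "t \<otimes> inv t' = x \<otimes> (g \<otimes> inv g) \<otimes> inv x'" using c by (simp only: m True inv_mult_group m_assoc m_closed inv_closed)
      thus ?thesis using c by simp
    qed
    hence "B * grp (t \<otimes> inv t') * B = B * (grp (x \<otimes> inv x') * (w 1 * B))" by (simp add: D(4) mult.assoc)
    also have "\<dots> = B * (u x * u (inv x')) * B"
      unfolding u_mult[OF xE(1) E_closed(3)[OF xE(2)]] by (simp add: u_def mult.assoc)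
    also have "\<dots> = (if x = x' then B else 0)" by (rule D(5)[OF m(1,4)])
    finally show ?thesis using c by (simp add: m(3,6) True)
  next
    case False
    have "t \<otimes> inv t' \<notin> E"
    proof
      assume tE: "t \<otimes> inv t' \<in> E"
      have "inv x \<otimes> (t \<otimes> inv t') \<otimes> x' \<in> E" by (rule E_closed(2)[OF E_closed(2)[OF E_closed(3)[OF xE(1)] tE] xE(2)])
      moreover have "inv x \<otimes> (t \<otimes> inv t') \<otimes> x' = inv x \<otimes> x \<otimes> g \<otimes> inv g' \<otimes> (inv x' \<otimes> x')"
        using c by (simp only: m inv_mult_group m_assoc m_closed inv_closed)
      ultimately have "g \<otimes> inv g' \<in> E" using c by simp
      thus False using T(4)[OF m(2,5)] False by blast
    qed
    moreover from this have "t \<noteq> t'" using E_closed(1) c by (auto simp: m)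
    moreover have "B * grp (t \<otimes> inv t') * B = B * (w 1 * grp (t \<otimes> inv t') * w 1) * B" using D(3,4) by (metis mult.assoc)
    ultimately show ?thesis using orthogonal_conjugates[of "t \<otimes> inv t'"] c by (simp add: m)
  qed
qed

lemma transversal_complete:
  assumes U: "unit_system E S (\<lambda>x. x) B" and TE: "right_transversal G E TE"
  shows "(\<Sum>t\<in>S <#> TE. grp (inv t) * B * grp t) = (\<Sum>t\<in>TE. grp (inv t) * w 1 * grp t)"
proof -
  note D = unit_systemD[OF U] and T = transversalD[OF TE]
  have SE: "x \<in> E" if "x \<in> S" for x using D(2) that by auto
  have inj: "inj_on (\<lambda>(g, x). x \<otimes> g) (TE \<times> S)"
  proof (rule inj_onI, clarify)
    fix g x g' x' assume m: "g \<in> TE" "x \<in> S" "g' \<in> TE" "x' \<in> S" and eq: "x \<otimes> g = x' \<otimes> g'"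
    have c: "x \<in> carrier G" "x' \<in> carrier G" "g \<in> carrier G" "g' \<in> carrier G" using SE E_mem m T(1) by auto
    have "g \<otimes> inv g' = inv x \<otimes> (x \<otimes> g) \<otimes> inv g'" using c by (simp add: m_assoc[symmetric])
    also have "\<dots> = inv x \<otimes> x'" unfolding eq using c by (simp add: m_assoc)
    also have "\<dots> \<in> E" using SE m by (intro E_closed) auto
    finally have "g = g'" by (rule T(4)[OF m(1,3)])
    thus "g = g' \<and> x = x'" using eq c by simp
  qed
  have img: "S <#> TE = (\<lambda>(g, x). x \<otimes> g) ` (TE \<times> S)" by (auto simp: set_mult_def)
  have "(\<Sum>t\<in>S <#> TE. grp (inv t) * B * grp t) = (\<Sum>g\<in>TE. \<Sum>x\<in>S. grp (inv (x \<otimes> g)) * B * grp (x \<otimes> g))"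
    unfolding img sum.reindex[OF inj] sum.cartesian_product by (simp add: split_beta)
  also have "\<dots> = (\<Sum>g\<in>TE. grp (inv g) * (\<Sum>x\<in>S. u (inv x) * B * u x) * grp g)"
    unfolding sum_distrib_left sum_distrib_right
  proof (intro sum.cong HOL.refl)
    fix g x assume m: "g \<in> TE" "x \<in> S"
    have c: "x \<in> carrier G" "g \<in> carrier G" using SE[OF m(2)] E_mem m T(1) by auto
    have 1: "u (inv x) * B = grp (inv x) * B" by (simp add: u_def mult.assoc D(4))
    have 2: "B * u x = B * grp x" unfolding u_def grp_w_one[OF SE[OF m(2)]] by (simp add: D(3) mult.assoc[symmetric])
    have "u (inv x) * B * u x = grp (inv x) * B * grp x" unfolding 1 unfolding mult.assoc 2 ..
    thus "grp (inv (x \<otimes> g)) * B * grp (x \<otimes> g) = grp (inv g) * (u (inv x) * B * u x) * grp g"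
      using c by (simp add: inv_mult_group grp_mult[symmetric] mult.assoc)
  qed
  finally show ?thesis by (simp only: D(6))
qed

lemma stabilizer_index:
  obtains v s where "s dvd ell" "acts v s" "\<And>g i. g \<in> E \<Longrightarrow> acts g i \<Longrightarrow> s dvd i" "s > 0" "index G E H = ell div s"
proof -
  obtain v s where v: "v \<in> E" "acts v s" "s > 0" "s dvd ell"
    and cov: "\<And>g. g \<in> E \<Longrightarrow> \<exists>h\<in>E \<inter> H. \<exists>j<ell div s. g = h \<otimes> v [^] (j::nat)"
    and mem: "\<And>j. v [^] (j::nat) \<in> H \<longleftrightarrow> ell div s dvd j" and min: "\<And>g i. g \<in> E \<Longrightarrow> acts g i \<Longrightarrow> s dvd i"
    by (rule cyclic_mod_H[OF sub_E subset_refl]) blast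
  have "index G E H = ell div s"
    by (rule index_cyclic_transversal[OF sub_H sub_E H_E v(1) _ mem]) (use cov in blast)
  from that[OF v(4,2) min v(3) this] show thesis .
qed

text \<open>Since the index is \<open>ell div s\<close>, the exponent in the order of the field
  equals \<open>m * s\<close>. The divisibility claim records that the truncated division is
  exact.\<close>

lemma complete_matrix_units:
  assumes U: "unit_system E S (\<lambda>x. x) (conv \<beta>)" and \<beta>: "\<beta> \<in> carrier (group_algebra G)"
    and TE: "right_transversal G E TE" and eps: "class_eps G H K Cl = W \<psi> 1"
  defines "T \<equiv> S <#> TE"
  shows "class_e G H K Cl = finsum (group_algebra G) (\<lambda>t. sandwich G \<beta> t t) T"
    and "\<lbrakk>t1 \<in> T; t2 \<in> T; t3 \<in> T; t4 \<in> T\<rbrakk> \<Longrightarrow> sandwich G \<beta> t1 t2 \<star> sandwich G \<beta> t3 t4 =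
      (if t2 = t3 then sandwich G \<beta> t1 t4 else \<zero>\<^bsub>group_algebra G\<^esub>)"
    and "index G E H dvd m * ell"
    and "t \<in> T \<Longrightarrow> corner (group_algebra G) (sandwich G \<beta> t t) \<simeq>
      (GF (q ^ (m * ell div index G E H)) :: 'f alg_closure ring)"
proof -
  have SE: "S \<subseteq> E" using unit_systemD(2)[OF U] by simp
  have Tc: "T \<subseteq> carrier G" unfolding T_def set_mult_def using SE E_mem transversalD(1)[OF TE] by auto
  have f: "finsum (group_algebra G) (\<lambda>t. sandwich G \<beta> t t) T = (\<Sum>t\<in>T. sandwich G \<beta> t t)"
    by (rule finsum_eq_sum) (simp add: sandwich_closed)
  have "(\<lambda>t. sandwich G \<beta> t t) \<in> T \<rightarrow> carrier (group_algebra G)" by (simp add: sandwich_closed)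
  hence fc: "finsum (group_algebra G) (\<lambda>t. sandwich G \<beta> t t) T \<in> carrier (group_algebra G)"
    by (rule abelian_monoid.finsum_closed[OF group_algebra_monoid])
  have "conv (finsum (group_algebra G) (\<lambda>t. sandwich G \<beta> t t) T) = conv (class_e G H K Cl)"
    unfolding f unfolding conv_class_e(1)[OF TE eps] transversal_complete[OF U TE, symmetric] T_def
    by (simp only: conv_sum conv_sandwich)
  thus "class_e G H K Cl = finsum (group_algebra G) (\<lambda>t. sandwich G \<beta> t t) T"
    using conv_inject[OF fc conv_class_e(2)[OF TE eps]] by simp
  show "sandwich G \<beta> t1 t2 \<star> sandwich G \<beta> t3 t4 =
      (if t2 = t3 then sandwich G \<beta> t1 t4 else \<zero>\<^bsub>group_algebra G\<^esub>)"
    if t: "t1 \<in> T" "t2 \<in> T" "t3 \<in> T" "t4 \<in> T"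
  proof -
    have c: "t2 \<in> carrier G" "t3 \<in> carrier G" using t Tc by auto
    have "conv (sandwich G \<beta> t1 t2 \<star> sandwich G \<beta> t3 t4) =
        grp (inv t1) * (conv \<beta> * (grp t2 * grp (inv t3)) * conv \<beta>) * grp t4"
      by (simp add: conv_mult conv_sandwich mult.assoc)
    also have "grp t2 * grp (inv t3) = grp (t2 \<otimes> inv t3)" using c by (simp add: grp_mult)
    also have "conv \<beta> * grp (t2 \<otimes> inv t3) * conv \<beta> = (if t2 = t3 then conv \<beta> else 0)"
      using transversal_orthogonal[OF U TE] t unfolding T_def by blast
    finally have "conv (sandwich G \<beta> t1 t2 \<star> sandwich G \<beta> t3 t4) = conv (if t2 = t3 then sandwich G \<beta> t1 t4 else \<zero>\<^bsub>group_algebra G\<^esub>)"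
      by (simp add: conv_sandwich group_algebra_simps(3) conv_zero)
    moreover have "(if t2 = t3 then sandwich G \<beta> t1 t4 else \<zero>\<^bsub>group_algebra G\<^esub>) \<in> carrier (group_algebra G)"
      by (simp add: sandwich_closed abelian_monoid.zero_closed[OF group_algebra_monoid])
    ultimately show ?thesis using conv_inject[OF convolve_closed] by blast
  qed
  obtain v s where s: "s dvd ell" "acts v s" "\<And>g i. g \<in> E \<Longrightarrow> acts g i \<Longrightarrow> s dvd i" "s > 0" "index G E H = ell div s"
    by (rule stabilizer_index) blast
  obtain r where r: "ell = s * r" using s(1) by auto
  have r0: "r > 0" using ell_pos r by (cases r) auto
  have i: "index G E H = r" using s(4,5) by (simp add: r)
  show "index G E H dvd m * ell" unfolding i r by simp
  show "corner (group_algebra G) (sandwich G \<beta> t t) \<simeq> (GF (q ^ (m * ell div index G E H)) :: 'f alg_closure ring)"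
    if "t \<in> T"
  proof -
    have "m * ell div index G E H = m * s" unfolding i r using r0 by (simp add: mult.assoc[symmetric])
    hence "q ^ (m * ell div index G E H) = C ^ s" by (simp add: C_CARD CARD_f power_mult)
    thus ?thesis using corner_iso[OF U \<beta> _ s(1-3)] that Tc by auto
  qed
qed

text \<open>Any member of the class can serve as its base character. This freedom reconciles the
  given \<open>\<chi>\<close> with the representative chosen inside
  \<open>class_eps\<close>.\<close>

lemma power_faithful:
  shows "\<chi>_power i \<in> faithful_characters G H K" and "Cl = cyclotomic_class G H K (\<chi>_power i)"
proof -
  let ?A = "carrier (quot G H K)"
  have \<chi>': "\<chi> \<in> hom (quot G H K) (units_of ring_of_type_algebra)" "inj_on \<chi> ?A"
    using \<chi> by (simp_all add: faithful_characters_def linear_characters_def)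
  interpret Q: group "quot G H K" by (rule HK.group_quot)
  have nz: "\<chi> y \<noteq> 0" if "y \<in> ?A" for y using that \<psi>_nonzero by (auto simp: carrier_quot \<psi>_def)
  have Un: "x \<in> Units (ring_of_type_algebra :: 'f alg_closure ring)" if "x \<noteq> 0" for x
    unfolding Units_def using that by (auto intro!: exI[of _ "inverse x"])
  have mult: "\<chi> (y \<otimes>\<^bsub>quot G H K\<^esub> y') = \<chi> y * \<chi> y'" if "y \<in> ?A" "y' \<in> ?A" for y y'
    using \<chi>'(1) that by (auto simp: hom_def units_of_def)
  have "\<chi>_power i \<in> hom (quot G H K) (units_of ring_of_type_algebra)"
    by (rule homI) (use nz Un mult in \<open>simp_all add: \<chi>_power_def units_of_def power_mult_distrib\<close>)
  moreover have "inj_on (\<chi>_power i) ?A"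
    using \<chi>'(2) by (auto simp: inj_on_def \<chi>_power_def frobenius_inj)
  moreover have "\<chi>_power i \<in> extensional ?A" by (simp add: \<chi>_power_def)
  ultimately show "\<chi>_power i \<in> faithful_characters G H K"
    by (simp add: faithful_characters_def linear_characters_def)
  have p: "(\<lambda>y \<in> ?A. \<chi>_power i y ^ (C ^ j)) = \<chi>_power (i + j)" for j
    by (auto simp: \<chi>_power_def power_add power_mult restrict_def fun_eq_iff)
  have per: "\<chi>_power j = \<chi>_power (i + (j + i * (ell - 1)))" for j
  proof (rule \<chi>_power_eqI)
    show "\<chi>_power j \<in> extensional ?A" by (simp add: \<chi>_power_def)
    fix h assume h: "h \<in> H"
    have eq: "i + (j + i * (ell - 1)) = j + ell * i" using ell_pos by (cases ell) auto
    have "[j = i + (j + i * (ell - 1))] (mod ell)" unfolding eq by (simp add: cong_def)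
    from FF_frobenius_cong[OF \<psi>_FF[OF h] this]
    show "\<chi>_power j (K #> h) = \<psi> h ^ (C ^ (i + (j + i * (ell - 1))))" by (simp add: \<chi>_power_apply[OF h])
  qed
  have "range \<chi>_power = range (\<lambda>j. \<chi>_power (i + j))" using per by blast
  thus "Cl = cyclotomic_class G H K (\<chi>_power i)"
    unfolding Cl_eq by (simp add: cyclotomic_class_def C_CARD[symmetric] p)
qed

end

lemma (in nilpotent_shoda) complement_subset:
  assumes Eo: "hall_preimage \<pi> G E K Eo" and Ho: "subgroup Ho G"
    and compl: "is_complement (quot G Eo K) (carrier (quot G Ho K)) A"
  shows "Ho \<subseteq> Eo"
proof -
  note Eo = hall_preimage_facts[OF Eo]
  have sub: "subgroup ((\<lambda>x. K #> x) ` Ho) (quot G Eo K)" using compl by (simp add: is_complement_def carrier_quot)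
  have img: "(\<lambda>x. K #> x) ` Ho \<subseteq> (\<lambda>x. K #> x) ` Eo" using subgroup.subset[OF sub] by (simp add: carrier_quot)
  show ?thesis
  proof
    fix h assume h: "h \<in> Ho"
    hence "K #> h \<in> (\<lambda>x. K #> x) ` Eo" using img by blast
    thus "h \<in> Eo" using EK.mem_image_iff[OF Eo(1,2) subgroup.mem_carrier[OF Ho h]] by simp
  qed
qed

theorem corollary3p5:
  fixes G :: "('a, 'b) monoid_scheme"
    and q m :: nat
    and H K T :: "'a set"
    and C :: "('a set \<Rightarrow> 'f::{field,finite} alg_closure) set"
    and \<beta> :: "'a \<Rightarrow> 'f"
  assumes "group G" and "finite (carrier G)" and "nilpotent_group G"
    and "Factorial_Ring.prime q" and "m \<ge> 1" and "CARD('f) = q ^ m"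
    and "\<not> q dvd Coset.order G"
    and "strong_shoda_pair G H K"
    and "C \<in> cyclotomic_classes G H K"
    and "primitive_central_idempotent (group_algebra G) (class_e G H K C)"
    and "matrix_unit_data G H K C T \<beta>"
  shows "class_e G H K C = finsum (group_algebra G) (\<lambda>t. sandwich G \<beta> t t) T \<and>
    (\<forall>t1 \<in> T. \<forall>t2 \<in> T. \<forall>t3 \<in> T. \<forall>t4 \<in> T.
       sandwich G \<beta> t1 t2 \<otimes>\<^bsub>group_algebra G\<^esub> sandwich G \<beta> t3 t4 =
         (if t2 = t3 then sandwich G \<beta> t1 t4 else \<zero>\<^bsub>group_algebra G\<^esub>)) \<and>
    index G (class_stabilizer G H K C) H dvd m * ord (index G H K) (q ^ m) \<and>
    (\<forall>t \<in> T.
       corner (group_algebra G) (sandwich G \<beta> t t) \<simeq>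
       (GF (q ^ (m * ord (index G H K) (q ^ m) div index G (class_stabilizer G H K C) H))
          :: 'f alg_closure ring))"
proof -
  interpret F: frobenius "CARD('f)" q m "TYPE('f)" by (intro frobenius.intro assms HOL.refl)
  interpret R: reduction q "TYPE('f)" by (intro reduction.intro assms F.CHAR_eq)
  interpret S: shoda G q "TYPE('f)" H K
    by (intro shoda.intro modular_group.intro finite_group.intro finite_group_axioms.intro
        modular_group_axioms.intro shoda_axioms.intro R.reduction_axioms assms)
  obtain \<chi>0 where \<chi>0: "\<chi>0 \<in> faithful_characters G H K" "C = cyclotomic_class G H K \<chi>0"
    using assms(9) by (auto simp: cyclotomic_classes_def)
  interpret A: shoda_class G q "TYPE('f)" H K m "CARD('f)" \<chi>0 C
    by (intro shoda_class.intro shoda_class_axioms.intro S.shoda_axioms assms HOL.refl \<chi>0)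
  \<comment> \<open>The setting is instantiated a second time with the representative that
    \<open>class_eps\<close> picks, so that \<open>class_eps\<close> becomes
    \<open>W \<psi> 1\<close>.\<close>
  define \<chi> where "\<chi> = (SOME \<chi>. \<chi> \<in> C)"
  have "\<exists>\<chi>. \<chi> \<in> C" unfolding A.Cl_eq by blast
  hence "\<chi> \<in> C" unfolding \<chi>_def by (rule someI_ex)
  then obtain i where "\<chi> = A.\<chi>_power i" unfolding A.Cl_eq by blast
  hence \<chi>: "\<chi> \<in> faithful_characters G H K" "C = cyclotomic_class G H K \<chi>" using A.power_faithful by simp_all
  interpret B: nilpotent_shoda G q "TYPE('f)" H K m "CARD('f)" \<chi> C
    by (intro nilpotent_shoda.intro shoda_class.intro shoda_class_axioms.intro nilpotent_shoda_axioms.intro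
        S.shoda_axioms assms HOL.refl \<chi>)
  obtain Es E2 Eo H2 Ho a2 ao bo n T2 \<beta>2 TE where
    Es: "Es = class_stabilizer G H K C" and
    hE2: "hall_preimage {2} G Es K E2" and hEo: "hall_preimage (- {2}) G Es K Eo" and
    hH2: "hall_preimage {2} G H K H2" and hHo: "hall_preimage (- {2}) G H K Ho" and
    a2: "a2 \<in> H2" "generate (quot G Es K) {K #>\<^bsub>G\<^esub> a2} = carrier (quot G H2 K)"
      "group.ord (quot G Es K) (K #>\<^bsub>G\<^esub> a2) = 2 ^ n" and
    ao: "ao \<in> Ho" "generate (quot G Es K) {K #>\<^bsub>G\<^esub> ao} = carrier (quot G Ho K)" and
    bo: "bo \<in> Eo"
      "is_complement (quot G Eo K) (carrier (quot G Ho K)) (generate (quot G Eo K) {K #>\<^bsub>G\<^esub> bo})" and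
    two: "two_part G K E2 H2 a2 n T2 \<beta>2" and TE: "right_transversal G Es TE" and
    T: "T = {ao [^]\<^bsub>G\<^esub> i | i::nat. i < index G Eo Ho} <#>\<^bsub>G\<^esub> T2 <#>\<^bsub>G\<^esub> TE" and
    \<beta>: "\<beta> = average (generate G {bo}) \<otimes>\<^bsub>group_algebra G\<^esub> \<beta>2 \<otimes>\<^bsub>group_algebra G\<^esub> class_eps G H K C"
    using assms(11) unfolding matrix_unit_data_def by (elim exE conjE) (rule that, assumption+)
  have Es': "Es = B.E" by (simp only: Es B.E_def)
  note hE2 = hE2[unfolded Es'] and hEo = hEo[unfolded Es'] and a2 = a2[unfolded Es'] and ao = ao[unfolded Es']
    and TE = TE[unfolded Es']
  have H2E2: "H2 \<subseteq> E2" by (rule B.two_part_subset[OF hE2 hH2 a2(1,2) two])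
  have HoEo: "Ho \<subseteq> Eo"
    by (rule B.complement_subset[OF hEo _ bo(2)]) (use hHo in \<open>simp add: hall_preimage_def\<close>)
  interpret P: hall_parts G q "TYPE('f)" H K m "CARD('f)" \<chi> C E2 Eo H2 Ho a2 ao n
    by (intro hall_parts.intro hall_parts_axioms.intro B.nilpotent_shoda_axioms hE2 hEo hH2 hHo a2 ao H2E2 HoEo)
  have eps: "class_eps G H K C = B.W B.\<psi> 1" by (rule B.class_eps_W[OF \<chi>_def])
  let ?Bo = "S.conv (average (generate G {bo})) * B.w 1" and ?B2 = "S.conv \<beta>2 * B.w 1"
  note U2 = P.unit_system_two_part[OF two]
  \<comment> \<open>An extra copy of \<open>w 1\<close> is inserted between the two averages, which
    splits \<open>\<beta>\<close> into the idempotents of the odd part and of the 2-part.\<close>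
  have "S.conv \<beta> = S.conv (average (generate G {bo})) * (B.w 1 * ?B2)"
    unfolding \<beta> eps B.unit_systemD(4)[OF U2] by (simp add: S.conv_mult B.w_def mult.assoc)
  hence "S.conv \<beta> = ?Bo * ?B2" by (simp add: mult.assoc)
  hence U: "B.unit_system B.E ({ao [^]\<^bsub>G\<^esub> i | i::nat. i < index G Eo Ho} <#>\<^bsub>G\<^esub> T2) (\<lambda>x. x) (S.conv \<beta>)"
    using P.unit_system_product[OF P.unit_system_odd[OF bo] U2] by simp
  have \<beta>c: "\<beta> \<in> carrier (group_algebra G)" unfolding \<beta> by (rule S.convolve_closed)
  note M = B.complete_matrix_units[OF U \<beta>c TE eps, folded T]
  have ell: "Pocklington.ord (index G H K) (q ^ m) = B.ell"
    unfolding B.index_HK assms(6)[symmetric] by (rule B.ell_eq[symmetric])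
  show ?thesis
  proof (intro conjI ballI)
    show "class_e G H K C = finsum (group_algebra G) (\<lambda>t. sandwich G \<beta> t t) T" by (rule M(1))
    show "index G (class_stabilizer G H K C) H dvd m * Pocklington.ord (index G H K) (q ^ m)"
      using M(3) unfolding ell B.E_def .
  next
    fix t1 t2 t3 t4 assume "t1 \<in> T" "t2 \<in> T" "t3 \<in> T" "t4 \<in> T"
    thus "sandwich G \<beta> t1 t2 \<otimes>\<^bsub>group_algebra G\<^esub> sandwich G \<beta> t3 t4 =
        (if t2 = t3 then sandwich G \<beta> t1 t4 else \<zero>\<^bsub>group_algebra G\<^esub>)" by (rule M(2))
  next
    fix t assume "t \<in> T"
    from M(4)[OF this] show "corner (group_algebra G) (sandwich G \<beta> t t) \<simeq>
       (GF (q ^ (m * Pocklington.ord (index G H K) (q ^ m) div index G (class_stabilizer G H K C) H)) :: 'f alg_closure ring)"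
      unfolding ell B.E_def .
  qed
qed

end
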